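(* Let $\lambda\in\mathcal I$ be $k$-quasiregular, and set $\ell:=\ell_\lambda:=\lambda_2-\lambda_1+k$, so $0\le \ell\le k$. Then the eigenvalue polynomial $f_\lambda$ of the Capelli operator $D_\lambda$ is $$f_\lambda=\frac{(\ell+1)!}{(\lambda_1-k-1)!\,(\lambda_1+\ell-k)!}\left(\frac{1}{(2k+2-\lambda_1+\lambda_2)!}\,R^{(k)}_{\lambda^\dagger}+\sum_{\mu\in\mathcal I(k-\ell)}M_{\lambda,\mu}\,R^{(k)}_{\nu(\lambda,\mu)}\right),$$ where $\mathcal I(d):=\{\mu\in\mathcal I:|\mu|\le d\}$, $\nu(\lambda,\mu):=(\lambda_1-\mu_1,\lambda_2+\mu_2)$, and $$M_{\lambda,\mu}:=\frac{(-1)^{\ell+\mu_1+\mu_2}\binom{\mu_1}{\mu_2}(\ell+\mu_1)!}{(k-\ell-\mu_1-\mu_2)!\;\ell!\;(\ell+\mu_2+1)!\;(\ell+\mu_1+\mu_2)!\;\mu_1}\quad\text{if }|\mu|>0,$$ $$M_{\lambda,(0,0)}:=\frac{(-1)^{\ell+1}}{(k-\ell)!\,((\ell+1)!)^2}\left(1-\sum_{j=\lambda_1-k}^{\lambda_1+\ell-k}\frac{\ell+1}{j}\right).$$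
   Context: Setting. Let $V=V_{\bar 0}\oplus V_{\bar 1}$ be a complex vector superspace with $\dim V_{\bar 0}=2m$, $\dim V_{\bar 1}=2n$, where $m,n$ are positive integers and $k:=n-m\ge 0$, equipped with a non-degenerate even supersymmetric bilinear form $\omega$. Let $\mathfrak g:=\mathfrak{gosp}(V,\omega):=\mathfrak{osp}(V,\omega)\oplus\mathbb C z$, with $z$ central and acting on $V$ by $-\mathrm{id}_V$. Let $\mathcal P(V)=\bigoplus_{d\ge0}\mathcal P^d(V)\cong \mathcal S(V^* )$ be the superalgebra of superpolynomials on $V$ graded by degree, $\mathcal D(V)=\bigoplus_{d\ge 0}\mathcal D^d(V)\cong\mathcal S(V)$ the superalgebra of constant-coefficient superdifferential operators graded by order, and $\mathcal{PD}(V)\cong\mathcal P(V)\otimes\mathcal D(V)$ the superalgebra of superdifferential operators with superpolynomial coefficients, with $\mathfrak g$ acting by supercommutator; $\mathcal{PD}(V)^{\mathfrak g}$ is the algebra of $\mathfrak g$-invariants. Partitions. $\mathcal I:=\{(\lambda_1,\lambda_2)\in\mathbb Z^2:\lambda_1\ge\lambda_2\ge0\}$, $|\lambda|:=\lambda_1+\lambda_2$. An element $\lambda\in\mathcal I$ is $k$-regular if $\lambda_1\le k$ or $\lambda_1-\lambda_2=k+1$ or $\lambda_1-\lambda_2\ge 2k+3$; it is $k$-quasiregular if $\lambda_1\ge k+1$ and $\lambda_1-\lambda_2\le k$; it is $k$-singular if $k+2\le\lambda_1-\lambda_2\le 2k+2$. $\mathcal I'_k$ is the set of all $k$-regular and $k$-quasiregular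 elements. The involution $\lambda^\dagger:=(\lambda_2+k+1,\lambda_1-k-1)$ interchanges $k$-quasiregular and $k$-singular elements. Modules $V_\lambda$. Let $C$ be the Casimir operator of $\mathfrak g$ acting on $\mathcal P(V)$, normalized so that it acts on the irreducible $\mathfrak{osp}(V,\omega)$-module of highest weight $a\varepsilon_1$ by $a(a-2k-2)$ (here the Borel subalgebra has simple roots $\varepsilon_1-\varepsilon_2,\dots,\varepsilon_{m-1}-\varepsilon_m,\varepsilon_m-\delta_1,\dots,\delta_{n-1}-\delta_n,2\delta_n$). For $\lambda\in\mathcal I'_k$ put $c_\lambda:=(\lambda_1-\lambda_2)(\lambda_1-\lambda_2-2k-2)$ and let $V_\lambda$ be the generalized $c_\lambda$-eigenspace of $C$ on $\mathcal P^{|\lambda|}(V)$. Each $V_\lambda$ is an indecomposable $\mathfrak g$-module, $\mathcal P^d(V)=\bigoplus_{\lambda\in\mathcal I'_k,|\lambda|=d}V_\lambda$, and distinct $V_\lambda$ share no composition factors. The pairing $\mathcal D^d(V)\otimes\mathcal P^d(V)\to\mathbb C$, $(D,p)\mapsto Dp$, identifies $\mathcal D^d(V)\cong\mathcal P^d(V)^*$ and hence $\mathcal{PD}(V)^{\mathfrak g}\cong\bigoplus_{\lambda\in\mathcal I'_k}\mathrm{Hom}_{\mathfrak g}(V_\lambda,V_\lambda)$. Capelli operators. For $\lambda\in\mathcal I'_k$, $D_\lambda\in\mathcal{PD}(V)^{\mathfrak g}$ is the element corresponding to $\mathrm{id}_{V_\lambda}$ under this isomorphism. Every $D\in\mathcal{PD}(V)^{\mathfrak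 g}$ preserves each $V_\mu$ and has a single eigenvalue there; the eigenvalue polynomial of $D$ is the unique symmetric polynomial $f_D\in\mathbb C[x,y]$ such that the eigenvalue of $D$ on $V_\mu$ is $f_D(\mu_1-k-1,\mu_2)$ for all $\mu\in\mathcal I'_k$. Write $f_\lambda:=f_{D_\lambda}$. Knop–Sahi polynomials and regular parts. With $a^{\underline r}:=a(a-1)\cdots(a-r+1)$, for $\lambda\in\mathcal I$ let $P_\lambda^\kappa\in\mathbb Q(\kappa)[x,y]$ be $$P_\lambda^\kappa(x,y):=\sum_{i+j\le\lambda_1-\lambda_2}\frac{(\lambda_1-\lambda_2)!\,(\kappa+1)^{\underline{\lambda_1-\lambda_2-i}}(\kappa+1)^{\underline{\lambda_1-\lambda_2-j}}}{i!\,j!\,(\lambda_1-\lambda_2-i-j)!\,(\kappa+1)^{\underline{\lambda_1-\lambda_2}}}\,x^{\underline{\lambda_2+i}}y^{\underline{\lambda_2+j}}$$ (sum over $i,j\ge0$). The coefficients have at most simple poles at $\kappa=k$. Set $\mathrm{Sing}_k(P_\lambda^\kappa):=\lim_{\kappa\to k}(\kappa-k)P^\kappa_\lambda$ and $$R^{(k)}_\lambda:=\mathrm{Reg}_k(P_\lambda^\kappa):=\lim_{\kappa\to k}\Big(P_\lambda^\kappa-\tfrac{1}{\kappa-k}\mathrm{Sing}_k(P_\lambda^\kappa)\Big),$$ limits taken coefficientwise. *)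

theory Defs
  imports
    "HOL-Analysis.Analysis"
    "HOL-Library.Poly_Mapping"
    "HOL-Computational_Algebra.Polynomial"
begin

(* Coordinates with respect to a homogeneous basis: V = complex ^ ('a + 'b), where the basis
   vectors with index Inl i are even and those with index Inr j are odd.  A parity is a bool,
   True meaning odd. *)

definition odd_index :: "'a + 'b \<Rightarrow> bool" where
  "odd_index i \<longleftrightarrow> (\<exists>j. i = Inr j)"

(* (-1)^(|x||y|) *)
definition super_sign :: "bool \<Rightarrow> bool \<Rightarrow> complex" where
  "super_sign e f = (if e \<and> f then -1 else 1)"

definition hom_vec :: "bool \<Rightarrow> complex ^ ('a::finite + 'b::finite) \<Rightarrow> bool" where
  "hom_vec e v \<longleftrightarrow> (\<forall>i. v $ i \<noteq> 0 \<longrightarrow> odd_index i = e)"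

definition hom_mat :: "bool \<Rightarrow> complex ^ ('a::finite + 'b::finite) ^ ('a + 'b) \<Rightarrow> bool" where
  "hom_mat e X \<longleftrightarrow> (\<forall>i j. X $ i $ j \<noteq> 0 \<longrightarrow> (odd_index i \<noteq> odd_index j) = e)"

definition supersymmetric_form ::
  "(complex ^ ('a::finite + 'b::finite) \<Rightarrow> complex ^ ('a + 'b) \<Rightarrow> complex) \<Rightarrow> bool" where
  "supersymmetric_form \<omega> \<longleftrightarrow>
     (\<forall>v. Vector_Spaces.linear (*s) (*) (\<omega> v)) \<and>
     (\<forall>w. Vector_Spaces.linear (*s) (*) (\<lambda>v. \<omega> v w)) \<and>
     (\<forall>e f v w. hom_vec e v \<and> hom_vec f w \<longrightarrow> \<omega> v w = super_sign e f * \<omega> w v)"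

definition even_form ::
  "(complex ^ ('a::finite + 'b::finite) \<Rightarrow> complex ^ ('a + 'b) \<Rightarrow> complex) \<Rightarrow> bool" where
  "even_form \<omega> \<longleftrightarrow> (\<forall>e f v w. hom_vec e v \<and> hom_vec f w \<and> e \<noteq> f \<longrightarrow> \<omega> v w = 0)"

definition nondegenerate_form ::
  "(complex ^ ('a::finite + 'b::finite) \<Rightarrow> complex ^ ('a + 'b) \<Rightarrow> complex) \<Rightarrow> bool" where
  "nondegenerate_form \<omega> \<longleftrightarrow> (\<forall>v. (\<forall>w. \<omega> v w = 0) \<longrightarrow> v = 0)"


(* The homogeneous component of parity e of osp(V, omega), as matrices acting by *v. *)

definition osp_part ::
  "(complex ^ ('a::finite + 'b::finite) \<Rightarrow> complex ^ ('a + 'b) \<Rightarrow> complex) \<Rightarrow> bool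
     \<Rightarrow> (complex ^ ('a + 'b) ^ ('a + 'b)) set" where
  "osp_part \<omega> e = {X. hom_mat e X \<and>
     (\<forall>f v w. hom_vec f v \<longrightarrow> \<omega> (X *v v) w + super_sign e f * \<omega> v (X *v w) = 0)}"

(* gosp = osp + C z.  Its action on V, with z acting by -id = - mat 1, is faithful, so gosp is
   identified with a space of matrices: Y + c z is Y - mat c.  The centre is even. *)

definition gosp_part ::
  "(complex ^ ('a::finite + 'b::finite) \<Rightarrow> complex ^ ('a + 'b) \<Rightarrow> complex) \<Rightarrow> bool
     \<Rightarrow> (complex ^ ('a + 'b) ^ ('a + 'b)) set" where
  "gosp_part \<omega> e = {Y - mat c | Y c. Y \<in> osp_part \<omega> e \<and> (e \<longrightarrow> c = 0)}"

definition supertrace :: "complex ^ ('a::finite + 'b::finite) ^ ('a + 'b) \<Rightarrow> complex" where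
  "supertrace X = (\<Sum>i\<in>UNIV. (if odd_index i then -1 else 1) * X $ i $ i)"


(* Superpolynomials.  The key (alpha, S) stands for the monomial
   x^alpha * xi_{s_1} * ... * xi_{s_r}  with  S = {s_1 < ... < s_r},
   where x_i, xi_j are the coordinate functions dual to the basis of V.  The product of the
   library type poly_mapping is not used: the super product is sprod below. *)

type_synonym ('a, 'b) smonom = "('a \<Rightarrow> nat) \<times> 'b set"
type_synonym ('a, 'b) superpoly = "('a, 'b) smonom \<Rightarrow>\<^sub>0 complex"
type_synonym ('a, 'b) superop = "('a, 'b) superpoly \<Rightarrow> ('a, 'b) superpoly"

definition cscale :: "complex \<Rightarrow> ('x \<Rightarrow>\<^sub>0 complex) \<Rightarrow> ('x \<Rightarrow>\<^sub>0 complex)" where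
  "cscale c p = Poly_Mapping.map (\<lambda>a. c * a) p"

definition sone :: "('a, 'b) superpoly" where
  "sone = Poly_Mapping.single (\<lambda>_. 0, {}) 1"

fun monom_prod :: "('a, 'b::linorder) smonom \<Rightarrow> ('a, 'b) smonom \<Rightarrow> ('a, 'b) superpoly" where
  "monom_prod (\<alpha>, S) (\<beta>, T) =
     (if S \<inter> T = {}
      then Poly_Mapping.single (\<lambda>i. \<alpha> i + \<beta> i, S \<union> T) ((-1) ^ card {(s, t). s \<in> S \<and> t \<in> T \<and> t < s})
      else 0)"

definition sprod :: "('a, 'b::linorder) superpoly \<Rightarrow> ('a, 'b) superpoly \<Rightarrow> ('a, 'b) superpoly" where
  "sprod p q = (\<Sum>a\<in>Poly_Mapping.keys p. \<Sum>b\<in>Poly_Mapping.keys q.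
     cscale (Poly_Mapping.lookup p a * Poly_Mapping.lookup q b) (monom_prod a b))"

fun coord :: "'a + 'b \<Rightarrow> ('a, 'b) superpoly" where
  "coord (Inl i) = Poly_Mapping.single (\<lambda>j. if j = i then 1 else 0, {}) 1"
| "coord (Inr j) = Poly_Mapping.single (\<lambda>_. 0, {j}) 1"

fun monom_deriv :: "'a + 'b::linorder \<Rightarrow> ('a, 'b) smonom \<Rightarrow> ('a, 'b) superpoly" where
  "monom_deriv (Inl i) (\<alpha>, S) = Poly_Mapping.single (\<alpha>(i := \<alpha> i - 1), S) (of_nat (\<alpha> i))"
| "monom_deriv (Inr j) (\<alpha>, S) =
     (if j \<in> S then Poly_Mapping.single (\<alpha>, S - {j}) ((-1) ^ card {s \<in> S. s < j}) else 0)"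

(* the left superderivation d/dx_i, resp. d/dxi_j *)
definition sderiv :: "'a + 'b::linorder \<Rightarrow> ('a, 'b) superop" where
  "sderiv i p = (\<Sum>a\<in>Poly_Mapping.keys p. cscale (Poly_Mapping.lookup p a) (monom_deriv i a))"

definition parity_inv :: "('a, 'b) superop" where
  "parity_inv p = Poly_Mapping.mapp (\<lambda>(\<alpha>, S) c. (-1) ^ card S * c) p"

definition sdeg :: "('a::finite, 'b) smonom \<Rightarrow> nat" where
  "sdeg a = (\<Sum>i\<in>UNIV. fst a i) + card (snd a)"

definition Pol :: "nat \<Rightarrow> ('a::finite, 'b) superpoly set" where
  "Pol d = {p. \<forall>a\<in>Poly_Mapping.keys p. sdeg a = d}"

inductive_set op_span :: "('a, 'b) superop set \<Rightarrow> ('a, 'b) superop set"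
  for S :: "('a, 'b) superop set" where
  op_span_zero: "(\<lambda>p. 0) \<in> op_span S"
| op_span_add: "F \<in> S \<Longrightarrow> G \<in> op_span S \<Longrightarrow> (\<lambda>p. cscale c (F p) + G p) \<in> op_span S"

definition Diff :: "nat \<Rightarrow> ('a, 'b::linorder) superop set" where
  "Diff d = op_span {foldr (\<lambda>j F. sderiv j \<circ> F) js id | js. length js = d}"

(* PD(V) is realized by its (faithful) action on P(V); the tensor p (x) D in P(V) (x) D(V)
   becomes the operator q |-> p * (D q). *)

definition PolDiff :: "nat \<Rightarrow> nat \<Rightarrow> ('a::finite, 'b::linorder) superop set" where
  "PolDiff d d' = op_span {(\<lambda>q. sprod p (D q)) | p D. p \<in> Pol d \<and> D \<in> Diff d'}"

definition PD :: "('a::finite, 'b::linorder) superop set" where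
  "PD = op_span (\<Union>d d'. PolDiff d d')"


(* The action on P(V), the symmetric superalgebra of V*, by superderivations extending the contragredient of V.
   For homogeneous X:  X . x_i = - (-1)^(|X||i|) x_i o X = - (-1)^(|X||i|) sum_j X_ij x_j,
   so X acts by  sum_i (X . x_i) d/dx_i.  The sign is read off from the matrix entry, since
   |X| = |i| + |j| whenever X_ij is nonzero. *)

definition act :: "complex ^ ('a::finite + 'b::{finite,linorder}) ^ ('a + 'b) \<Rightarrow> ('a, 'b) superop" where
  "act X p = - (\<Sum>i\<in>UNIV. \<Sum>j\<in>UNIV.
     cscale (super_sign (odd_index i \<noteq> odd_index j) (odd_index i) * X $ i $ j)
       (sprod (coord j) (sderiv i p)))"

(* A D - (-1)^(|A||D|) D A for A of parity e, extended linearly to inhomogeneous D: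
   conjugation by parity_inv is the parity involution D_0 + D_1 |-> D_0 - D_1. *)

definition supercommutator :: "bool \<Rightarrow> ('a, 'b) superop \<Rightarrow> ('a, 'b) superop \<Rightarrow> ('a, 'b) superop" where
  "supercommutator e A D =
     (\<lambda>p. A (D p) - (if e then parity_inv (D (parity_inv (A p))) else D (A p)))"

definition PD_inv ::
  "(complex ^ ('a::finite + 'b::{finite,linorder}) \<Rightarrow> complex ^ ('a + 'b) \<Rightarrow> complex)
     \<Rightarrow> ('a, 'b) superop set" where
  "PD_inv \<omega> = {D \<in> PD. \<forall>e. \<forall>X\<in>gosp_part \<omega> e. supercommutator e (act X) D = (\<lambda>p. 0)}"


(* C is the Casimir operator on P(V) attached to the invariant form  c * str(XY)  on osp:
   C = sum_i b'_i b_i for a homogeneous basis b and the dual family b', (b_i, b'_j) = delta_ij.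
   Linear independence of b follows from duality. *)

definition casimir_wrt ::
  "(complex ^ ('a::finite + 'b::{finite,linorder}) \<Rightarrow> complex ^ ('a + 'b) \<Rightarrow> complex)
     \<Rightarrow> complex \<Rightarrow> ('a, 'b) superop \<Rightarrow> bool" where
  "casimir_wrt \<omega> c C \<longleftrightarrow> (\<exists>(N::nat) e b b'.
     (\<forall>i<N. b i \<in> osp_part \<omega> (e i) \<and> b' i \<in> osp_part \<omega> (e i)) \<and>
     (\<forall>f. \<forall>X\<in>osp_part \<omega> f. \<exists>a. \<forall>r s. X $ r $ s = (\<Sum>i<N. a i * b i $ r $ s)) \<and>
     (\<forall>i<N. \<forall>j<N. c * supertrace (b i ** b' j) = (if i = j then 1 else 0)) \<and>
     C = (\<lambda>p. \<Sum>i<N. act (b' i) (act (b i) p)))"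

definition form_as_poly ::
  "(complex ^ ('a::finite + 'b::finite) \<Rightarrow> complex ^ ('a + 'b) \<Rightarrow> complex)
     \<Rightarrow> complex ^ ('a + 'b) \<Rightarrow> ('a, 'b) superpoly" where
  "form_as_poly \<omega> v = (\<Sum>j\<in>UNIV. cscale (\<omega> v (axis j 1)) (coord j))"

(* Normalization: a nonzero even isotropic v spans the epsilon_1-weight space of V for a suitable
   Borel subalgebra with simple roots epsilon_1 - epsilon_2, ..., epsilon_m - delta_1, ...,
   2 delta_n, and omega(v, _)^a in P^a(V) is then a highest weight vector of weight a epsilon_1.
   Hence its C-eigenvalue is the scalar by which C acts on the irreducible module of that highest
   weight.  The condition amounts to c = 1/2. *)

definition casimir ::
  "nat \<Rightarrow> (complex ^ ('a::finite + 'b::{finite,linorder}) \<Rightarrow> complex ^ ('a + 'b) \<Rightarrow> complex)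
     \<Rightarrow> ('a, 'b) superop" where
  "casimir k \<omega> = (THE C.
     (\<exists>c. c \<noteq> 0 \<and> casimir_wrt \<omega> c C) \<and>
     (\<forall>a v. hom_vec False v \<and> \<omega> v v = 0 \<longrightarrow>
        (let u = (sprod (form_as_poly \<omega> v) ^^ a) sone
         in C u = cscale (of_nat a * (of_nat a - 2 * of_nat k - 2)) u)))"


definition partitions :: "(nat \<times> nat) set" where
  "partitions = {(l1, l2). l2 \<le> l1}"

definition regular :: "nat \<Rightarrow> nat \<times> nat \<Rightarrow> bool" where
  "regular k = (\<lambda>(l1, l2). (l1, l2) \<in> partitions \<and>
     (l1 \<le> k \<or> l1 - l2 = k + 1 \<or> l1 - l2 \<ge> 2 * k + 3))"

definition quasiregular :: "nat \<Rightarrow> nat \<times> nat \<Rightarrow> bool" where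
  "quasiregular k = (\<lambda>(l1, l2). (l1, l2) \<in> partitions \<and> k + 1 \<le> l1 \<and> l1 - l2 \<le> k)"

definition reg_or_quasi :: "nat \<Rightarrow> (nat \<times> nat) set" where
  "reg_or_quasi k = {l. regular k l \<or> quasiregular k l}"

(* meant for quasiregular arguments, where the subtraction on nat is exact *)
definition dagger :: "nat \<Rightarrow> nat \<times> nat \<Rightarrow> nat \<times> nat" where
  "dagger k = (\<lambda>(l1, l2). (l2 + k + 1, l1 - k - 1))"

definition c_val :: "nat \<Rightarrow> nat \<times> nat \<Rightarrow> complex" where
  "c_val k = (\<lambda>(l1, l2). (of_nat l1 - of_nat l2) * (of_nat l1 - of_nat l2 - 2 * of_nat k - 2))"

definition V_mod ::
  "nat \<Rightarrow> (complex ^ ('a::finite + 'b::{finite,linorder}) \<Rightarrow> complex ^ ('a + 'b) \<Rightarrow> complex)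
     \<Rightarrow> nat \<times> nat \<Rightarrow> ('a, 'b) superpoly set" where
  "V_mod k \<omega> l = {p \<in> Pol (fst l + snd l).
     \<exists>N. ((\<lambda>q. casimir k \<omega> q - cscale (c_val k l) q) ^^ N) p = 0}"

(* Under the identification D^d(V) = P^d(V)* given by (D, p) |-> D p, the tensor p (x) D in
   P^d(V) (x) D^d(V) is the endomorphism q |-> p * (D q) of P^d(V), that is, the restriction to
   P^d(V) of the corresponding operator.  So the element corresponding to the identity of V_l
   is the invariant operator in P^d(V) D^d(V), d = |l|, which restricts to the projection of
   P^d(V) onto V_l along the other summands V_mu. *)

definition capelli ::
  "nat \<Rightarrow> (complex ^ ('a::finite + 'b::{finite,linorder}) \<Rightarrow> complex ^ ('a + 'b) \<Rightarrow> complex)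
     \<Rightarrow> nat \<times> nat \<Rightarrow> ('a, 'b) superop" where
  "capelli k \<omega> l = (THE D.
     D \<in> PD_inv \<omega> \<and> D \<in> PolDiff (fst l + snd l) (fst l + snd l) \<and>
     (\<forall>p\<in>V_mod k \<omega> l. D p = p) \<and>
     (\<forall>\<mu>\<in>reg_or_quasi k. fst \<mu> + snd \<mu> = fst l + snd l \<and> \<mu> \<noteq> l \<longrightarrow>
        (\<forall>p\<in>V_mod k \<omega> \<mu>. D p = 0)))"


(* Elements of C[x,y] are complex poly poly: the coefficients are polynomials in x and the
   outer variable is y. *)

type_synonym poly2 = "complex poly poly"

definition X_var :: poly2 where "X_var = [:[:0, 1:]:]"
definition Y_var :: poly2 where "Y_var = [:0, 1:]"

definition coeff2 :: "poly2 \<Rightarrow> nat \<Rightarrow> nat \<Rightarrow> complex" where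
  "coeff2 f i j = coeff (coeff f j) i"

definition eval2 :: "poly2 \<Rightarrow> complex \<Rightarrow> complex \<Rightarrow> complex" where
  "eval2 f x y = poly (poly f [:y:]) x"

definition cmult2 :: "complex \<Rightarrow> poly2 \<Rightarrow> poly2" where
  "cmult2 c f = smult [:c:] f"

definition symmetric2 :: "poly2 \<Rightarrow> bool" where
  "symmetric2 f \<longleftrightarrow> (\<forall>i j. coeff2 f i j = coeff2 f j i)"

definition single_eigenvalue :: "('a, 'b) superop \<Rightarrow> ('a, 'b) superpoly set \<Rightarrow> complex \<Rightarrow> bool" where
  "single_eigenvalue D W c \<longleftrightarrow> D ` W \<subseteq> W \<and> {c'. \<exists>p\<in>W. p \<noteq> 0 \<and> D p = cscale c' p} = {c}"

definition eigenvalue_poly ::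
  "nat \<Rightarrow> (complex ^ ('a::finite + 'b::{finite,linorder}) \<Rightarrow> complex ^ ('a + 'b) \<Rightarrow> complex)
     \<Rightarrow> ('a, 'b) superop \<Rightarrow> poly2" where
  "eigenvalue_poly k \<omega> D = (THE f. symmetric2 f \<and>
     (\<forall>(\<mu>1, \<mu>2)\<in>reg_or_quasi k.
        single_eigenvalue D (V_mod k \<omega> (\<mu>1, \<mu>2)) (eval2 f (of_nat \<mu>1 - of_nat k - 1) (of_nat \<mu>2))))"


definition ffact :: "'c::comm_ring_1 \<Rightarrow> nat \<Rightarrow> 'c" where
  "ffact a r = (\<Prod>i<r. a - of_nat i)"

(* The specialization at a complex number kappa outside the poles of the coefficients. *)
definition knop_sahi :: "complex \<Rightarrow> nat \<times> nat \<Rightarrow> poly2" where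
  "knop_sahi \<kappa> = (\<lambda>(l1, l2). let d = l1 - l2 in
     \<Sum>(i, j)\<in>{(i, j). i + j \<le> d}.
       cmult2 (fact d * ffact (\<kappa> + 1) (d - i) * ffact (\<kappa> + 1) (d - j)
                 / (fact i * fact j * fact (d - i - j) * ffact (\<kappa> + 1) d))
              (ffact X_var (l2 + i) * ffact Y_var (l2 + j)))"

definition coeffwise_lim :: "complex \<Rightarrow> (complex \<Rightarrow> poly2) \<Rightarrow> poly2" where
  "coeffwise_lim a F = (THE f. \<forall>i j. ((\<lambda>\<kappa>. coeff2 (F \<kappa>) i j) \<longlongrightarrow> coeff2 f i j) (at a))"

definition Sing_part :: "nat \<Rightarrow> nat \<times> nat \<Rightarrow> poly2" where
  "Sing_part k l = coeffwise_lim (of_nat k) (\<lambda>\<kappa>. cmult2 (\<kappa> - of_nat k) (knop_sahi \<kappa> l))"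

definition R_poly :: "nat \<Rightarrow> nat \<times> nat \<Rightarrow> poly2" where
  "R_poly k l = coeffwise_lim (of_nat k)
     (\<lambda>\<kappa>. knop_sahi \<kappa> l - cmult2 (1 / (\<kappa> - of_nat k)) (Sing_part k l))"


definition partitions_upto :: "nat \<Rightarrow> (nat \<times> nat) set" where
  "partitions_upto d = {(\<mu>1, \<mu>2) \<in> partitions. \<mu>1 + \<mu>2 \<le> d}"

(* In M_coeff, L is the number lambda_2 - lambda_1 + k, and all subtractions on nat are exact
   when lambda is quasiregular and mu lies in partitions_upto (k - L). *)

definition M_coeff :: "nat \<Rightarrow> nat \<times> nat \<Rightarrow> nat \<times> nat \<Rightarrow> complex" where
  "M_coeff k = (\<lambda>(l1, l2) (\<mu>1, \<mu>2). let L = l2 + k - l1 in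
     if \<mu>1 + \<mu>2 > 0 then
       (-1) ^ (L + \<mu>1 + \<mu>2) * of_nat (\<mu>1 choose \<mu>2) * fact (L + \<mu>1)
         / (fact (k - L - \<mu>1 - \<mu>2) * fact L * fact (L + \<mu>2 + 1) * fact (L + \<mu>1 + \<mu>2) * of_nat \<mu>1)
     else
       (-1) ^ (L + 1) / (fact (k - L) * (fact (L + 1))\<^sup>2)
         * (1 - (\<Sum>j = l1 - k..l1 + L - k. of_nat (L + 1) / of_nat j)))"

definition nu :: "nat \<times> nat \<Rightarrow> nat \<times> nat \<Rightarrow> nat \<times> nat" where
  "nu = (\<lambda>(l1, l2) (\<mu>1, \<mu>2). (l1 - \<mu>1, l2 + \<mu>2))"

end

theory Submission
  imports Defs
begin

text \<open>
  By Howe duality the invariants \<open>normal_order (d - 2 * j) (R2 ^^ j \<circ> Lap ^^ j)\<close> act on polynomials of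
  fixed degree through polynomials in the Casimir operator, and their eigenvalues are
  \<open>ffact x j * ffact y j * ffact (x + y + k + 1 - 2 * j) (d - 2 * j)\<close> up to scaling. The Capelli operator
  of a quasiregular weight has to be \<open>1\<close> on a generalized eigenspace whose eigenvalue belongs to two
  indices \<open>j\<close>, and \<open>0\<close> on the others. This is Hermite interpolation with one double node; the Newton
  form of the interpolating polynomial gives the coefficients of the operator. Expanding in products of
  falling factorials turns the theorem into an identity for each coefficient, which follows from the
  Chu--Vandermonde formula, its derivative, and a well-poised summation of Dougall type.
\<close>

section \<open>Superpolynomials\<close>

text \<open>The difficulty comes from the reflection of a to 2k + 2 - a, which preserves the Casimir
  value a(a - 2k - 2). In degree d the operator \<open>R2 ^^ j \<circ> Lap ^^ j\<close> is the
  product over i < j of (node i - Casimir). These products are the Newton basis for the nodes taken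
  in the order i = 0, 1, 2, ..., so Newton coefficients are operator coefficients without any change
  of basis. Prescribing the operator in degree d suffices because an operator of order d with the
  required shape is determined by its action there (\<open>PolDiff_determined\<close>). Harmonic
  numbers enter from two sides: through the vanishing derivative at the double node, and through the
  derivative in \<kappa> contained in the regular part at a pole. The two do not match, and the
  coefficients M together with the pole-free polynomials at the weights \<nu> account for the
  difference.\<close>

lemma lookup_cscale [simp]: "Poly_Mapping.lookup (cscale c p) a = c * Poly_Mapping.lookup p a"
  by (simp add: cscale_def Poly_Mapping.map.rep_eq when_def)

interpretation cs: vector_space "cscale :: complex \<Rightarrow> ('x \<Rightarrow>\<^sub>0 complex) \<Rightarrow> ('x \<Rightarrow>\<^sub>0 complex)"
  by unfold_locales (auto intro!: poly_mapping_eqI simp: lookup_add algebra_simps)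

lemma cscale_single [simp]: "cscale c (Poly_Mapping.single a d) = Poly_Mapping.single a (c * d)"
  by (intro poly_mapping_eqI) (simp add: lookup_single when_def)

definition lin :: "(('x \<Rightarrow>\<^sub>0 complex) \<Rightarrow> ('y \<Rightarrow>\<^sub>0 complex)) \<Rightarrow> bool" where
  "lin F \<longleftrightarrow> (\<forall>p q. F (p + q) = F p + F q) \<and> (\<forall>c p. F (cscale c p) = cscale c (F p))"

lemma linI: "(\<And>p q. F (p + q) = F p + F q) \<Longrightarrow> (\<And>c p. F (cscale c p) = cscale c (F p)) \<Longrightarrow> lin F"
  by (simp add: lin_def)

lemma lin_add: "lin F \<Longrightarrow> F (p + q) = F p + F q"
  and lin_scale: "lin F \<Longrightarrow> F (cscale c p) = cscale c (F p)"
  by (simp_all add: lin_def)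

lemma lin_zero: "lin F \<Longrightarrow> F 0 = 0"
  using lin_scale[of F 0 0] by simp

lemma lin_uminus: "lin F \<Longrightarrow> F (- p) = - F p"
  using lin_scale[of F "-1" p] by simp

lemma lin_diff: "lin F \<Longrightarrow> F (p - q) = F p - F q"
  using lin_add[of F p "- q"] lin_uminus[of F q] by simp

lemma lin_sum: "lin F \<Longrightarrow> F (sum f A) = (\<Sum>a\<in>A. F (f a))"
  by (induction A rule: infinite_finite_induct) (auto simp: lin_add lin_zero)

lemmas lin_simps = lin_add lin_scale lin_zero lin_uminus lin_diff lin_sum

lemma lin_id [intro, simp]: "lin (\<lambda>p. p)" "lin id"
  by (simp_all add: lin_def)

lemma lin_0 [intro, simp]: "lin (\<lambda>p. 0)"
  by (simp add: lin_def)

lemma lin_compose: "lin F \<Longrightarrow> lin G \<Longrightarrow> lin (\<lambda>p. F (G p))"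
  by (simp add: lin_def)

lemma lin_plus: "lin F \<Longrightarrow> lin G \<Longrightarrow> lin (\<lambda>p. F p + G p)"
  by (simp add: lin_def algebra_simps)

lemma lin_minus: "lin F \<Longrightarrow> lin G \<Longrightarrow> lin (\<lambda>p. F p - G p)"
  by (simp add: lin_def algebra_simps)

lemma lin_neg: "lin F \<Longrightarrow> lin (\<lambda>p. - F p)"
  by (simp add: lin_def algebra_simps)

lemma lin_cscale: "lin F \<Longrightarrow> lin (\<lambda>p. cscale c (F p))"
  by (simp add: lin_def algebra_simps)

lemma lin_summation: "(\<And>a. a \<in> A \<Longrightarrow> lin (F a)) \<Longrightarrow> lin (\<lambda>p. \<Sum>a\<in>A. F a p)"
  by (simp add: lin_def sum.distrib cs.scale_sum_right)

lemma lin_funpow: "lin (F :: ('x \<Rightarrow>\<^sub>0 complex) \<Rightarrow> ('x \<Rightarrow>\<^sub>0 complex)) \<Longrightarrow> lin (F ^^ n)"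
  unfolding lin_def by (induction n) simp_all

lemmas lin_intros = lin_plus lin_minus lin_neg lin_cscale lin_summation lin_funpow

lemma sum_monomials:
  "p = (\<Sum>a\<in>Poly_Mapping.keys p. cscale (Poly_Mapping.lookup p a) (Poly_Mapping.single a 1))"
  by (intro poly_mapping_eqI)
     (auto simp: lookup_sum lookup_single when_def in_keys_iff sum.delta' if_distrib cong: if_cong)

lemma lin_ext:
  assumes "lin F" "lin G" "\<And>a. F (Poly_Mapping.single a 1) = G (Poly_Mapping.single a 1)"
  shows "F p = G p"
proof -
  have p: "p = (\<Sum>a\<in>Poly_Mapping.keys p. cscale (Poly_Mapping.lookup p a) (Poly_Mapping.single a 1))"
    by (rule sum_monomials)
  show ?thesis
    by (subst (1 2) p) (simp add: lin_sum lin_scale assms del: cscale_single)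
qed

text \<open>Linear extension of a map given on monomials. Both \<open>sprod\<close> and
  \<open>sderiv\<close> have this form, which makes their linearity immediate.\<close>

definition lext :: "('x \<Rightarrow> ('y \<Rightarrow>\<^sub>0 complex)) \<Rightarrow> ('x \<Rightarrow>\<^sub>0 complex) \<Rightarrow> ('y \<Rightarrow>\<^sub>0 complex)" where
  "lext g p = (\<Sum>a\<in>Poly_Mapping.keys p. cscale (Poly_Mapping.lookup p a) (g a))"

lemma lext_superset:
  assumes "finite A" "Poly_Mapping.keys p \<subseteq> A"
  shows "lext g p = (\<Sum>a\<in>A. cscale (Poly_Mapping.lookup p a) (g a))"
  unfolding lext_def using assms
  by (intro sum.mono_neutral_left) (auto simp: in_keys_iff)

lemma lin_lext [intro, simp]: "lin (lext g)"
proof (rule linI)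
  fix p q :: "'a \<Rightarrow>\<^sub>0 complex" and c
  let ?A = "Poly_Mapping.keys p \<union> Poly_Mapping.keys q"
  show "lext g (p + q) = lext g p + lext g q"
    using Poly_Mapping.keys_add[of p q]
    by (simp add: lext_superset[of ?A] lookup_add cs.scale_left_distrib sum.distrib)
  have "Poly_Mapping.keys (cscale c p) \<subseteq> Poly_Mapping.keys p"
    by (auto simp: in_keys_iff)
  then show "lext g (cscale c p) = cscale c (lext g p)"
    by (simp add: lext_superset[of "Poly_Mapping.keys p"] cs.scale_sum_right)
qed

lemma lext_single [simp]: "lext g (Poly_Mapping.single a c) = cscale c (g a)"
  by (simp add: lext_def)

lemma lext_lin: "(\<And>a. lin (\<lambda>q. g q a)) \<Longrightarrow> lin (\<lambda>q. lext (g q) p)"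
  unfolding lext_def by (intro lin_intros)

lemma sprod_lext: "sprod p q = lext (\<lambda>a. lext (monom_prod a) q) p"
  by (simp add: sprod_def lext_def cs.scale_sum_right)

lemma lin_sprod [intro, simp]: "lin (sprod p)" "lin (\<lambda>p. sprod p q)"
  unfolding sprod_lext by (auto intro!: lext_lin)

lemma lin_sderiv [intro, simp]: "lin (sderiv i)"
proof -
  have "sderiv i = lext (monom_deriv i)"
    by (simp add: fun_eq_iff sderiv_def lext_def)
  then show ?thesis by simp
qed

lemma sderiv_single: "sderiv i (Poly_Mapping.single a c) = cscale c (monom_deriv i a)"
  by (simp add: sderiv_def)

lemma sprod_single: "sprod (Poly_Mapping.single a c) (Poly_Mapping.single b d) = cscale (c * d) (monom_prod a b)"
  by (simp add: sprod_lext)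

declare coord.simps [simp del] monom_deriv.simps [simp del]

section \<open>Coordinates and derivations: the super Weyl algebra\<close>

abbreviation mul :: "'a + 'b::linorder \<Rightarrow> ('a, 'b) superop" where
  "mul i \<equiv> sprod (coord i)"

text \<open>The sign picked up when the odd variable \<open>j\<close> is moved to its place in the
  ordered product over \<open>S\<close>.\<close>

definition lsgn :: "'b::linorder \<Rightarrow> 'b set \<Rightarrow> complex" where
  "lsgn j S = (-1) ^ card {s \<in> S. s < j}"

lemma lsgn_insert:
  fixes S :: "'b::{finite,linorder} set"
  assumes "k \<notin> S"
  shows "lsgn j (insert k S) = (if k < j then - lsgn j S else lsgn j S)"
proof -
  have "{s \<in> insert k S. s < j} = (if k < j then insert k {s \<in> S. s < j} else {s \<in> S. s < j})"
    by auto
  then show ?thesis using assms by (simp add: lsgn_def)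
qed

lemma lsgn_remove:
  fixes S :: "'b::{finite,linorder} set"
  assumes "k \<in> S"
  shows "lsgn j (S - {k}) = (if k < j then - lsgn j S else lsgn j S)"
  using lsgn_insert[of k "S - {k}" j] assms by (simp add: insert_absorb split: if_splits)

lemmas lin_op_intros = lin_compose[OF lin_sprod(1)] lin_compose[OF lin_sprod(2)] lin_compose[OF lin_sderiv] lin_intros

lemma lsgn_square [simp]: "lsgn j S * lsgn j S = 1" "lsgn j S * (lsgn j S * c) = c"
  by (simp_all add: lsgn_def flip: power_add mult.assoc)

lemma lsgn_Un:
  fixes S T :: "'b::{finite,linorder} set"
  assumes "S \<inter> T = {}"
  shows "lsgn j (S \<union> T) = lsgn j S * lsgn j T"
proof -
  have "{s \<in> S \<union> T. s < j} = {s \<in> S. s < j} \<union> {s \<in> T. s < j}" by auto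
  moreover have "card \<dots> = card {s \<in> S. s < j} + card {s \<in> T. s < j}"
    using assms by (intro card_Un_disjoint) auto
  ultimately show ?thesis by (simp add: lsgn_def power_add)
qed

lemma mul_even_single:
  "mul (Inl i) (Poly_Mapping.single (\<alpha>, S) c) = Poly_Mapping.single (\<alpha>(i := Suc (\<alpha> i)), S) c"
proof -
  have "(\<lambda>k. (if k = i then 1 else 0) + \<alpha> k) = \<alpha>(i := Suc (\<alpha> i))" by auto
  then show ?thesis by (simp add: sprod_single coord.simps)
qed

lemma mul_odd_single:
  "mul (Inr j) (Poly_Mapping.single (\<alpha>, S) c) =
     (if j \<in> S then 0 else Poly_Mapping.single (\<alpha>, insert j S) (c * lsgn j S))"
proof -
  have "{(s, t). s \<in> {j} \<and> t \<in> S \<and> t < s} = Pair j ` {t \<in> S. t < j}" by auto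
  then have "card {(s, t). s \<in> {j} \<and> t \<in> S \<and> t < s} = card {t \<in> S. t < j}"
    by (simp add: card_image inj_on_def)
  then show ?thesis by (simp add: sprod_single lsgn_def coord.simps)
qed

lemma sderiv_even_single:
  "sderiv (Inl i) (Poly_Mapping.single (\<alpha>, S) c) =
     Poly_Mapping.single (\<alpha>(i := \<alpha> i - 1), S) (of_nat (\<alpha> i) * c)"
  by (simp add: sderiv_single mult.commute monom_deriv.simps)

lemma sderiv_odd_single:
  "sderiv (Inr j) (Poly_Mapping.single (\<alpha>, S) c) =
     (if j \<in> S then Poly_Mapping.single (\<alpha>, S - {j}) (c * lsgn j S) else 0)"
  by (simp add: sderiv_single lsgn_def monom_deriv.simps)

lemmas mul_sderiv_single = mul_even_single mul_odd_single sderiv_even_single sderiv_odd_single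

text \<open>The Koszul sign for exchanging two objects with the parities of the indices.\<close>

definition sg :: "'a + 'b \<Rightarrow> 'a + 'b \<Rightarrow> complex" where
  "sg i j = super_sign (odd_index i) (odd_index j)"

lemma odd_index_simps [simp]: "\<not> odd_index (Inl i)" "odd_index (Inr j)"
  by (auto simp: odd_index_def)

lemma mul_mul:
  fixes p :: "('a, 'b::{finite,linorder}) superpoly"
  shows "mul i (mul j p) = cscale (sg i j) (mul j (mul i p))"
proof (rule lin_ext[where p = p])
  fix a :: "('a, 'b) smonom"
  obtain \<alpha> S where a: "a = (\<alpha>, S)" by (cases a)
  show "mul i (mul j (Poly_Mapping.single a 1)) = cscale (sg i j) (mul j (mul i (Poly_Mapping.single a 1)))"
    by (cases i; cases j)
       (auto simp: a mul_sderiv_single sg_def super_sign_def lsgn_insert fun_upd_twist insert_commute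
             lin_zero[OF lin_sprod(1)] single_uminus mult.commute)
qed (auto intro!: lin_op_intros)

lemma sderiv_sderiv:
  fixes p :: "('a, 'b::{finite,linorder}) superpoly"
  shows "sderiv i (sderiv j p) = cscale (sg i j) (sderiv j (sderiv i p))"
proof (rule lin_ext[where p = p])
  fix a :: "('a, 'b) smonom"
  obtain \<alpha> S where a: "a = (\<alpha>, S)" by (cases a)
  have [simp]: "S - {i} - {j} = S - {j} - {i}" for i j by auto
  show "sderiv i (sderiv j (Poly_Mapping.single a 1)) = cscale (sg i j) (sderiv j (sderiv i (Poly_Mapping.single a 1)))"
    by (cases i; cases j)
       (auto simp: a mul_sderiv_single sg_def super_sign_def lsgn_remove fun_upd_twist
             lin_zero[OF lin_sderiv] single_uminus mult.commute)
qed (auto intro!: lin_op_intros)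

text \<open>The super Weyl relation. With \<open>mul_mul\<close> and \<open>sderiv_sderiv\<close> it
  reduces the later operator identities to a comparison of signs.\<close>

lemma sderiv_mul:
  fixes p :: "('a, 'b::{finite,linorder}) superpoly"
  shows "sderiv i (mul j p) = cscale (if i = j then 1 else 0) p + cscale (sg i j) (mul j (sderiv i p))"
proof (rule lin_ext[where p = p])
  fix a :: "('a, 'b) smonom"
  obtain \<alpha> S where a: "a = (\<alpha>, S)" by (cases a)
  have [simp]: "insert i S - {j} = insert i (S - {j})" if "i \<noteq> j" for i j using that by auto
  have [simp]: "insert i (S - {i}) = S" if "i \<in> S" for i using that by auto
  have [simp]: "insert i S = S" if "i \<in> S" for i using that by auto
  have [simp]: "Poly_Mapping.single (\<alpha>(i := Suc (\<alpha> i - Suc 0)), S) (of_nat (\<alpha> i)) =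
      Poly_Mapping.single (\<alpha>, S) (complex_of_nat (\<alpha> i))" for i
    by (cases "\<alpha> i = 0") auto
  show "sderiv i (mul j (Poly_Mapping.single a 1)) = cscale (if i = j then 1 else 0) (Poly_Mapping.single a 1) +
          cscale (sg i j) (mul j (sderiv i (Poly_Mapping.single a 1)))"
    by (cases i; cases j)
       (auto simp: a mul_sderiv_single sg_def super_sign_def lsgn_remove lsgn_insert fun_upd_twist
             lin_zero[OF lin_sderiv] lin_zero[OF lin_sprod(1)] single_uminus single_add algebra_simps)
qed (auto intro!: lin_op_intros)

lemma sg_commute: "sg i j = sg j i"
  by (auto simp: sg_def super_sign_def)

lemma sg_square [simp]: "sg i j * sg i j = 1" "sg i j * (sg i j * c) = c"
  by (auto simp: sg_def super_sign_def)

text \<open>Every monomial arises from \<open>sone\<close> by multiplying with coordinates from the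
  left, so identities of linear operators can be checked along such products.\<close>

lemma superpoly_induct [consumes 0, case_names one add scale mul]:
  fixes p :: "('a::finite, 'b::{finite,linorder}) superpoly"
  assumes one: "P sone" and add: "\<And>p q. P p \<Longrightarrow> P q \<Longrightarrow> P (p + q)"
    and scale: "\<And>c p. P p \<Longrightarrow> P (cscale c p)" and mul: "\<And>i p. P p \<Longrightarrow> P (mul i p)"
  shows "P p"
proof -
  have mono: "P (Poly_Mapping.single (\<alpha>, S) 1)" for \<alpha> :: "'a \<Rightarrow> nat" and S :: "'b set"
  proof (induction "sdeg (\<alpha>, S)" arbitrary: \<alpha> S rule: less_induct)
    case less
    consider "\<alpha> = (\<lambda>_. 0)" "S = {}" | i where "\<alpha> i > 0" | "S \<noteq> {}" by fastforce
    then show ?case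
    proof cases
      case 1
      then show ?thesis using one by (simp add: sone_def)
    next
      case 2
      have "(\<Sum>j\<in>UNIV. (\<alpha>(i := \<alpha> i - 1)) j) < (\<Sum>j\<in>UNIV. \<alpha> j)"
        using 2 by (intro sum_strict_mono_ex1) auto
      then have "P (Poly_Mapping.single (\<alpha>(i := \<alpha> i - 1), S) 1)"
        by (intro less) (simp add: sdeg_def)
      then have "P (mul (Inl i) (Poly_Mapping.single (\<alpha>(i := \<alpha> i - 1), S) 1))" by (rule mul)
      then show ?thesis using 2 by (simp add: mul_even_single)
    next
      case 3
      \<comment> \<open>With the smallest index as leftmost factor, the sign
        \<open>lsgn j (S - {j})\<close> is trivial.\<close>
      define j where "j = Min S"
      have j: "j \<in> S" "{s \<in> S - {j}. s < j} = {}" using 3 by (auto simp: j_def)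
      have "P (Poly_Mapping.single (\<alpha>, S - {j}) 1)"
        using j(1) card_Diff1_less[of S j] by (intro less) (auto simp: sdeg_def simp del: card_Diff_insert)
      then have "P (mul (Inr j) (Poly_Mapping.single (\<alpha>, S - {j}) 1))" by (rule mul)
      moreover have "lsgn j (S - {j}) = 1" unfolding lsgn_def j(2) by simp
      ultimately show ?thesis using j(1) by (simp add: mul_odd_single insert_absorb)
    qed
  qed
  have zero: "P 0" using scale[OF one, of 0] by simp
  have p: "p = (\<Sum>a\<in>Poly_Mapping.keys p. cscale (Poly_Mapping.lookup p a) (Poly_Mapping.single a 1))"
    by (rule sum_monomials)
  have "P (\<Sum>a\<in>A. cscale (Poly_Mapping.lookup p a) (Poly_Mapping.single a 1))" if "finite A" for A
    using that
  proof (induction A rule: finite_induct)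
    case (insert a A)
    then show ?case using mono[of "fst a" "snd a"] by (auto intro!: add scale simp del: cscale_single)
  qed (simp add: zero)
  then show ?thesis by (subst p) simp
qed

lemma superpoly_eqI [consumes 2, case_names one mul]:
  fixes p :: "('a::finite, 'b::{finite,linorder}) superpoly"
  assumes "lin F" "lin G" "F sone = G sone" "\<And>i p. F p = G p \<Longrightarrow> F (mul i p) = G (mul i p)"
  shows "F p = G p"
  by (induction p rule: superpoly_induct) (use assms in \<open>auto simp: lin_add lin_scale\<close>)

lemma sprod_sone_left [simp]: "sprod sone p = (p :: ('a::finite, 'b::{finite,linorder}) superpoly)"
proof (rule lin_ext[where p = p])
  fix a :: "('a, 'b) smonom"
  show "sprod sone (Poly_Mapping.single a 1) = Poly_Mapping.single a 1"
    by (cases a) (simp add: sone_def sprod_single)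
qed (auto intro!: lin_op_intros)

lemma card_inversions_insert:
  fixes S T :: "'b::{finite,linorder} set"
  assumes "j \<notin> S"
  shows "card {(s, t). s \<in> insert j S \<and> t \<in> T \<and> t < s} =
    card {t \<in> T. t < j} + card {(s, t). s \<in> S \<and> t \<in> T \<and> t < s}"
proof -
  have "{(s, t). s \<in> insert j S \<and> t \<in> T \<and> t < s} =
      Pair j ` {t \<in> T. t < j} \<union> {(s, t). s \<in> S \<and> t \<in> T \<and> t < s}" by auto
  moreover have "card \<dots> = card (Pair j ` {t \<in> T. t < j}) + card {(s, t). s \<in> S \<and> t \<in> T \<and> t < s}"
    using assms by (intro card_Un_disjoint) (auto intro: finite_subset[OF subset_UNIV])
  ultimately show ?thesis by (simp add: card_image inj_on_def)
qed

text \<open>Associativity for a coordinate as leftmost factor. Since \<open>superpoly_induct\<close>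
  adds coordinates on the left, this case takes the place of general associativity.\<close>

lemma mul_sprod:
  fixes p q :: "('a::finite, 'b::{finite,linorder}) superpoly"
  shows "sprod (mul i p) q = mul i (sprod p q)"
proof (rule lin_ext[where p = p])
  fix a :: "('a, 'b) smonom"
  show "sprod (mul i (Poly_Mapping.single a 1)) q = mul i (sprod (Poly_Mapping.single a 1) q)"
  proof (rule lin_ext[where p = q])
    fix b :: "('a, 'b) smonom"
    obtain \<alpha> S where a: "a = (\<alpha>, S)" by (cases a)
    obtain \<beta> T where b: "b = (\<beta>, T)" by (cases b)
    have 1: "(\<lambda>k. (if k = i then Suc (\<alpha> i) else \<alpha> k) + \<beta> k) = (\<lambda>k. \<alpha> k + \<beta> k)(i := Suc (\<alpha> i + \<beta> i))" for i
      by auto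
    show "sprod (mul i (Poly_Mapping.single a 1)) (Poly_Mapping.single b 1) =
        mul i (sprod (Poly_Mapping.single a 1) (Poly_Mapping.single b 1))"
    proof (cases i)
      case (Inl i')
      then show ?thesis
        by (auto simp: a b mul_even_single sprod_single 1 lin_zero[OF lin_sprod(1)])
    next
      case (Inr j)
      have 2: "(-1) ^ card {(s, t). s \<in> insert j S \<and> t \<in> T \<and> t < s} =
          lsgn j T * (-1) ^ card {(s, t). s \<in> S \<and> t \<in> T \<and> t < s}" if "j \<notin> S"
        using that by (subst card_inversions_insert) (auto simp: lsgn_def power_add)
      have 3: "lsgn j (S \<union> T) = lsgn j S * lsgn j T" if "S \<inter> T = {}"
        using that by (rule lsgn_Un)
      have 4: "sprod 0 q = 0" for q :: "('a, 'b) superpoly"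
        by (rule lin_zero[OF lin_sprod(2)])
      show ?thesis unfolding Inr
        by (cases "j \<in> S"; cases "j \<in> T"; cases "S \<inter> T = {}")
          (auto simp: a b mul_odd_single sprod_single 2 3 4 lin_zero[OF lin_sprod(1)] algebra_simps
             simp del: insert_iff)
    qed
  qed (auto intro!: lin_op_intros)
qed (auto intro!: lin_op_intros)

text \<open>For odd \<open>i\<close> the parity involution encodes the sign of passing coordinate
  \<open>i\<close> across a superpolynomial that need not be homogeneous; for even \<open>i\<close>
  there is no sign.\<close>

definition mixed :: "'a + 'b::linorder \<Rightarrow> ('a, 'b) superop" where
  "mixed i = (if odd_index i then parity_inv else (\<lambda>p. p))"

lemma lookup_parity_inv: "Poly_Mapping.lookup (parity_inv p) a = (-1) ^ card (snd a) * Poly_Mapping.lookup p a"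
  by (cases a) (simp add: parity_inv_def mapp.rep_eq when_def in_keys_iff)

lemma lin_parity_inv [intro, simp]: "lin parity_inv"
  by (auto intro!: linI poly_mapping_eqI simp: lookup_parity_inv lookup_add algebra_simps)

lemma parity_inv_single: "parity_inv (Poly_Mapping.single a c) = Poly_Mapping.single a ((-1) ^ card (snd a) * c)"
  by (intro poly_mapping_eqI) (auto simp: lookup_parity_inv lookup_single when_def)

lemma parity_inv_parity_inv [simp]: "parity_inv (parity_inv p) = p"
  by (intro poly_mapping_eqI) (auto simp: lookup_parity_inv simp flip: power_add mult.assoc)

abbreviation psgn :: "'a + 'b \<Rightarrow> complex" where
  "psgn i \<equiv> sg i i"

lemma parity_inv_mul:
  fixes p :: "('a::finite, 'b::{finite,linorder}) superpoly"
  shows "parity_inv (mul i p) = cscale (psgn i) (mul i (parity_inv p))"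
proof (rule lin_ext[where p = p])
  fix a :: "('a, 'b) smonom"
  obtain \<alpha> S where a: "a = (\<alpha>, S)" by (cases a)
  show "parity_inv (mul i (Poly_Mapping.single a 1)) = cscale (psgn i) (mul i (parity_inv (Poly_Mapping.single a 1)))"
    by (cases i) (auto simp: a mul_sderiv_single parity_inv_single sg_def super_sign_def
      lin_zero[OF lin_parity_inv] mult.commute single_uminus)
qed (auto intro!: lin_op_intros lin_compose[OF lin_parity_inv])

lemma parity_inv_sderiv:
  fixes p :: "('a::finite, 'b::{finite,linorder}) superpoly"
  shows "parity_inv (sderiv i p) = cscale (psgn i) (sderiv i (parity_inv p))"
proof (rule lin_ext[where p = p])
  fix a :: "('a, 'b) smonom"
  obtain \<alpha> S where a: "a = (\<alpha>, S)" by (cases a)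
  have "(-1) ^ (card S - Suc 0) = - ((-1) ^ card S :: complex)" if "j \<in> S" for j
  proof -
    have "card S \<noteq> 0" using that by auto
    then obtain m where "card S = Suc m" using not0_implies_Suc by blast
    then show ?thesis by simp
  qed
  then show "parity_inv (sderiv i (Poly_Mapping.single a 1)) = cscale (psgn i) (sderiv i (parity_inv (Poly_Mapping.single a 1)))"
    by (cases i) (auto simp: a mul_sderiv_single parity_inv_single sg_def super_sign_def
      lin_zero[OF lin_parity_inv] mult.commute single_uminus)
qed (auto intro!: lin_op_intros lin_compose[OF lin_parity_inv])

lemma parity_inv_sone [simp]: "parity_inv sone = sone"
  by (simp add: sone_def parity_inv_single)

lemma parity_inv_sprod:
  fixes p q :: "('a::finite, 'b::{finite,linorder}) superpoly"
  shows "parity_inv (sprod p q) = sprod (parity_inv p) (parity_inv q)"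
proof (rule superpoly_eqI[where p = p])
  fix i and p :: "('a, 'b) superpoly"
  assume "parity_inv (sprod p q) = sprod (parity_inv p) (parity_inv q)"
  then show "parity_inv (sprod (mul i p) q) = sprod (parity_inv (mul i p)) (parity_inv q)"
    by (simp add: mul_sprod parity_inv_mul lin_scale[OF lin_sprod(2)])
qed (auto intro!: lin_op_intros lin_compose[OF lin_parity_inv])

text \<open>Coordinates pass from the right factor to the left at the cost of the parity involution.\<close>

lemma sprod_mul:
  fixes p q :: "('a::finite, 'b::{finite,linorder}) superpoly"
  shows "sprod p (mul i q) = mul i (sprod (mixed i p) q)"
proof (rule superpoly_eqI[where p = p])
  show "lin (\<lambda>p. mul i (sprod (mixed i p) q))"
    by (auto simp: mixed_def intro!: lin_op_intros lin_compose[OF lin_parity_inv])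
  fix j and p :: "('a, 'b) superpoly"
  assume IH: "sprod p (mul i q) = mul i (sprod (mixed i p) q)"
  have "mixed i (mul j p) = cscale (sg i j) (mul j (mixed i p))"
    by (auto simp: mixed_def parity_inv_mul sg_def super_sign_def)
  then show "sprod (mul j p) (mul i q) = mul i (sprod (mixed i (mul j p)) q)"
    by (simp add: mul_sprod IH lin_scale[OF lin_sprod(2)] lin_scale[OF lin_sprod(1)] mul_mul[of j i]
        sg_commute[of j i])
qed (auto simp: mixed_def intro!: lin_op_intros)

section \<open>Degrees and the Euler operator\<close>

lemma single_Pol: "Poly_Mapping.single a c \<in> Pol d \<longleftrightarrow> c = 0 \<or> sdeg a = d"
  by (auto simp: Pol_def)

lemma Pol_0 [simp]: "0 \<in> Pol d"
  by (simp add: Pol_def)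

lemma Pol_add: "p \<in> Pol d \<Longrightarrow> q \<in> Pol d \<Longrightarrow> p + q \<in> Pol d"
  using Poly_Mapping.keys_add[of p q] by (auto simp: Pol_def)

lemma Pol_cscale: "p \<in> Pol d \<Longrightarrow> cscale c p \<in> Pol d"
  by (auto simp: Pol_def in_keys_iff)

lemma Pol_uminus: "p \<in> Pol d \<Longrightarrow> - p \<in> Pol d"
  using Pol_cscale[of p d "-1"] by simp

lemma Pol_diff: "p \<in> Pol d \<Longrightarrow> q \<in> Pol d \<Longrightarrow> p - q \<in> Pol d"
  using Pol_add[of p d "- q"] by (simp add: Pol_uminus)

lemma Pol_sum: "(\<And>a. a \<in> A \<Longrightarrow> f a \<in> Pol d) \<Longrightarrow> (\<Sum>a\<in>A. f a) \<in> Pol d"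
  by (induction A rule: infinite_finite_induct) (auto intro: Pol_add)

lemmas Pol_intros = Pol_add Pol_cscale Pol_uminus Pol_diff Pol_sum

lemma Pol_lin_image:
  assumes "lin F" "p \<in> Pol d" "\<And>a. sdeg a = d \<Longrightarrow> F (Poly_Mapping.single a 1) \<in> Pol e"
  shows "F p \<in> Pol e"
proof -
  have p: "p = (\<Sum>a\<in>Poly_Mapping.keys p. cscale (Poly_Mapping.lookup p a) (Poly_Mapping.single a 1))"
    by (rule sum_monomials)
  show ?thesis
    by (subst p) (use assms(2) in \<open>auto simp: lin_sum[OF assms(1)] lin_scale[OF assms(1)] Pol_def[of d]
      simp del: cscale_single intro!: Pol_sum Pol_cscale assms(3)\<close>)
qed

lemma sdeg_upd: "sdeg (\<alpha>(i := n), S) = sdeg (\<alpha>, S) - \<alpha> i + n"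
proof -
  have "(\<Sum>j\<in>UNIV. (\<alpha>(i := n)) j) = n + (\<Sum>j\<in>UNIV - {i}. \<alpha> j)"
    by (simp add: sum.remove[of UNIV i])
  moreover have "(\<Sum>j\<in>UNIV. \<alpha> j) = \<alpha> i + (\<Sum>j\<in>UNIV - {i}. \<alpha> j)"
    by (simp add: sum.remove[of UNIV i])
  ultimately show ?thesis by (simp add: sdeg_def)
qed

lemma le_sdeg: "\<alpha> i \<le> sdeg (\<alpha>, S)"
  unfolding sdeg_def by (simp add: member_le_sum trans_le_add1)

lemma Pol_mul:
  fixes p :: "('a::finite, 'b::{finite,linorder}) superpoly"
  assumes "p \<in> Pol d"
  shows "mul i p \<in> Pol (Suc d)"
proof (rule Pol_lin_image[OF lin_sprod(1) assms])
  fix a :: "('a, 'b) smonom" assume d: "sdeg a = d"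
  obtain \<alpha> S where a: "a = (\<alpha>, S)" by (cases a)
  show "mul i (Poly_Mapping.single a 1) \<in> Pol (Suc d)"
    using d le_sdeg[of \<alpha> _ S] unfolding a
    by (cases i) (auto simp: mul_sderiv_single single_Pol sdeg_upd, auto simp: sdeg_def)
qed

lemma Pol_sderiv:
  fixes p :: "('a::finite, 'b::{finite,linorder}) superpoly"
  assumes "p \<in> Pol d"
  shows "sderiv i p \<in> Pol (d - 1)"
proof (rule Pol_lin_image[OF lin_sderiv assms])
  fix a :: "('a, 'b) smonom" assume d: "sdeg a = d"
  obtain \<alpha> S where a: "a = (\<alpha>, S)" by (cases a)
  show "sderiv i (Poly_Mapping.single a 1) \<in> Pol (d - 1)"
  proof (cases i)
    case (Inl i')
    then show ?thesis using d le_sdeg[of \<alpha> i' S]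
      by (cases "\<alpha> i'") (auto simp: a mul_sderiv_single single_Pol sdeg_upd)
  next
    case (Inr j)
    have "card S > 0" if "j \<in> S" using that by (auto simp: card_gt_0_iff)
    then show ?thesis using d Inr
      by (auto simp: a mul_sderiv_single single_Pol sdeg_def)
  qed
qed

lemma sderiv_Pol_0:
  fixes p :: "('a::finite, 'b::{finite,linorder}) superpoly"
  assumes "p \<in> Pol 0"
  shows "sderiv i p = 0"
proof -
  have p: "p = (\<Sum>a\<in>Poly_Mapping.keys p. cscale (Poly_Mapping.lookup p a) (Poly_Mapping.single a 1))"
    by (rule sum_monomials)
  have "sderiv i (Poly_Mapping.single a 1) = 0" if "a \<in> Poly_Mapping.keys p" for a
    using that assms by (cases i; cases a) (auto simp: Pol_def sdeg_def mul_sderiv_single)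
  then show ?thesis
    by (subst p) (auto simp: lin_sum[OF lin_sderiv] lin_scale[OF lin_sderiv] simp del: cscale_single intro!: sum.neutral)
qed

definition euler :: "('a::finite, 'b::{finite,linorder}) superop" where
  "euler p = (\<Sum>i\<in>UNIV. mul i (sderiv i p))"

lemma lin_euler [intro, simp]: "lin euler"
  unfolding euler_def by (auto intro!: lin_op_intros)

lemma euler_single: "euler (Poly_Mapping.single a c) = cscale (of_nat (sdeg a)) (Poly_Mapping.single a c)"
proof -
  obtain \<alpha> S where a: "a = (\<alpha>, S)" by (cases a)
  have 1: "mul (Inl i) (sderiv (Inl i) (Poly_Mapping.single a c)) = Poly_Mapping.single a (of_nat (\<alpha> i) * c)" for i
    by (cases "\<alpha> i = 0") (auto simp: a mul_sderiv_single lin_zero[OF lin_sprod(1)] fun_upd_idem_iff)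
  have 2: "mul (Inr j) (sderiv (Inr j) (Poly_Mapping.single a c)) = Poly_Mapping.single a ((if j \<in> S then 1 else 0) * c)" for j
    by (auto simp: a mul_sderiv_single lin_zero[OF lin_sprod(1)] lsgn_remove insert_absorb mult.assoc)
  have "euler (Poly_Mapping.single a c) = (\<Sum>i\<in>UNIV. Poly_Mapping.single a (of_nat (\<alpha> i) * c)) +
      (\<Sum>j\<in>UNIV. Poly_Mapping.single a ((if j \<in> S then 1 else 0) * c))"
    unfolding euler_def UNIV_Plus_UNIV[symmetric]
    by (subst sum.Plus) (auto simp: 1 2)
  also have "\<dots> = Poly_Mapping.single a ((\<Sum>i\<in>UNIV. of_nat (\<alpha> i) * c) + (\<Sum>j\<in>UNIV. (if j \<in> S then 1 else 0) * c))"
    by (intro poly_mapping_eqI) (auto simp: lookup_add lookup_sum lookup_single when_def)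
  also have "(\<Sum>i\<in>UNIV. of_nat (\<alpha> i) * c) + (\<Sum>j\<in>UNIV. (if j \<in> S then 1 else 0) * c) = of_nat (sdeg a) * c"
    by (simp add: a sdeg_def sum_distrib_right[symmetric] distrib_right sum.If_cases)
  finally show ?thesis by simp
qed

lemma euler_Pol:
  assumes "p \<in> Pol d"
  shows "euler p = cscale (of_nat d) p"
proof -
  have p: "p = (\<Sum>a\<in>Poly_Mapping.keys p. Poly_Mapping.single a (Poly_Mapping.lookup p a))"
    using sum_monomials[of p] by simp
  show ?thesis
    by (subst (1 2) p) (use assms in \<open>auto simp: lin_sum[OF lin_euler] euler_single cs.scale_sum_right Pol_def\<close>)
qed

lemma lin_ext_Pol:
  assumes "lin F" "lin G" "\<And>d p. p \<in> Pol d \<Longrightarrow> F p = G p"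
  shows "F p = G (p :: ('a::finite, 'b) superpoly)"
  by (rule lin_ext[OF assms(1,2)], rule assms(3)) (auto simp: single_Pol)

section \<open>The Casimir operator\<close>

lemma sum_cscale_cscale:
  "(\<Sum>q\<in>A. cscale (a q) (\<Sum>s\<in>B. cscale (b q s) (f s))) = (\<Sum>s\<in>B. cscale (\<Sum>q\<in>A. a q * b q s) (f s))"
  by (simp add: cs.scale_sum_right cs.scale_sum_left) (rule sum.swap)

lemma sum_cscale_delta:
  fixes v :: "'a::finite"
  shows "(\<Sum>s\<in>UNIV. cscale (if s = v then c else 0) (f s)) = cscale c (f v)"
    "(\<Sum>s\<in>UNIV. cscale (if v = s then c else 0) (f s)) = cscale c (f v)"
  by (simp_all add: if_distrib[of "\<lambda>c. cscale c _"] cong: if_cong)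

lemma sum_mult_delta:
  fixes k :: "'a::finite"
  shows "(\<Sum>j\<in>UNIV. f j * (if j = k then 1 else 0)) = (f k :: 'c::semiring_1)"
    "(\<Sum>j\<in>UNIV. f j * (if k = j then 1 else 0)) = f k"
    "(\<Sum>j\<in>UNIV. (if j = k then 1 else 0) * f j) = f k"
    "(\<Sum>j\<in>UNIV. (if k = j then 1 else 0) * f j) = f k"
  by (simp_all add: if_distrib[of "\<lambda>c. c * _"] if_distrib[of "\<lambda>c. _ * c"] cong: if_cong)

lemma eq_uminus_iff_zero: "p = - p \<longleftrightarrow> p = (0 :: 'x \<Rightarrow>\<^sub>0 complex)"
proof
  assume "p = - p"
  then have "Poly_Mapping.lookup p a = - Poly_Mapping.lookup p a" for a
    by (metis lookup_uminus)
  then show "p = 0" by (intro poly_mapping_eqI) simp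
qed simp

lemma add_self_cscale: "p + p = cscale 2 p"
  using cs.scale_left_distrib[of 1 1 p] by simp

lemma sum_antisym_zero:
  fixes f :: "'i \<Rightarrow> 'i \<Rightarrow> ('x \<Rightarrow>\<^sub>0 complex)"
  assumes "\<And>i j. f i j = - f j i"
  shows "(\<Sum>i\<in>A. \<Sum>j\<in>A. f i j) = 0"
proof -
  have "(\<Sum>i\<in>A. \<Sum>j\<in>A. f i j) = (\<Sum>i\<in>A. \<Sum>j\<in>A. f j i)" by (rule sum.swap)
  also have "\<dots> = (\<Sum>i\<in>A. \<Sum>j\<in>A. - f i j)" by (intro sum.cong refl assms)
  also have "\<dots> = - (\<Sum>i\<in>A. \<Sum>j\<in>A. f i j)" by (simp add: sum_negf)
  finally show ?thesis by (simp add: eq_uminus_iff_zero)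
qed

definition asg :: "'a + 'b \<Rightarrow> 'a + 'b \<Rightarrow> complex" where
  "asg i j = super_sign (odd_index i \<noteq> odd_index j) (odd_index i)"

lemmas sign_defs = asg_def sg_def super_sign_def

lemma act_alt:
  "act X p = - (\<Sum>i\<in>UNIV. \<Sum>j\<in>UNIV. cscale (asg i j * X $ i $ j) (mul j (sderiv i p)))"
  by (simp add: act_def asg_def)

lemma lin_act [intro, simp]: "lin (act X)"
  unfolding act_def by (auto intro!: lin_op_intros)

section \<open>The form, its inverse matrix and the Howe dual sl(2)\<close>

locale osp_form =
  fixes \<omega> :: "complex ^ ('a::finite + 'b::{finite,linorder}) \<Rightarrow> complex ^ ('a + 'b) \<Rightarrow> complex"
  assumes even: "even_form \<omega>" and supersymmetric: "supersymmetric_form \<omega>"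
    and nondegenerate: "nondegenerate_form \<omega>"
begin

definition G :: "'a + 'b \<Rightarrow> 'a + 'b \<Rightarrow> complex" where
  "G i j = \<omega> (axis i 1) (axis j 1)"

lemma form_sum: "\<omega> v w = (\<Sum>i\<in>UNIV. \<Sum>j\<in>UNIV. v $ i * G i j * w $ j)"
proof -
  have l: "Vector_Spaces.linear (*s) (*) (\<omega> v)" "Vector_Spaces.linear (*s) (*) (\<lambda>v. \<omega> v w)" for v w
    using supersymmetric by (auto simp: supersymmetric_form_def)
  have r: "\<omega> v w = (\<Sum>j\<in>UNIV. w $ j * \<omega> v (axis j 1))" for v w
  proof -
    interpret Vector_Spaces.linear "(*s)" "(*)" "\<omega> v" by (rule l)
    show ?thesis by (subst (1) basis_expansion[symmetric]) (simp add: sum scale)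
  qed
  have "\<omega> v (axis j 1) = (\<Sum>i\<in>UNIV. v $ i * G i j)" for j
  proof -
    interpret Vector_Spaces.linear "(*s)" "(*)" "\<lambda>v. \<omega> v (axis j 1)" by (rule l)
    show ?thesis unfolding G_def by (subst (1) basis_expansion[symmetric]) (simp add: sum scale)
  qed
  then have "\<omega> v w = (\<Sum>j\<in>UNIV. \<Sum>i\<in>UNIV. v $ i * G i j * w $ j)"
    by (subst r) (simp add: sum_distrib_left mult_ac)
  then show ?thesis by (subst sum.swap) simp
qed

lemma hom_axis: "hom_vec (odd_index i) (axis i c)"
  by (auto simp: hom_vec_def axis_def)

lemma G_even: "odd_index i \<noteq> odd_index j \<Longrightarrow> G i j = 0"
  using even hom_axis unfolding even_form_def G_def by blast

lemma G_sym: "G i j = psgn i * G j i"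
proof (cases "odd_index i = odd_index j")
  case True
  have "\<omega> (axis i 1) (axis j 1) = super_sign (odd_index i) (odd_index j) * \<omega> (axis j 1) (axis i 1)"
    using supersymmetric hom_axis unfolding supersymmetric_form_def by blast
  then show ?thesis using True by (simp add: G_def sg_def)
qed (simp add: G_even)

lemma G_sym': "G i j = psgn j * G j i"
  by (subst G_sym[of j i]) simp

lemma exists_inverse: "\<exists>H. (\<forall>i k. (\<Sum>j\<in>UNIV. G i j * H j k) = (if i = k then 1 else 0)) \<and>
    (\<forall>i k. (\<Sum>j\<in>UNIV. H i j * G j k) = (if i = k then 1 else 0))"
proof -
  \<comment> \<open>The transposed Gram matrix: its kernel is the radical in the left argument,
    which is what \<open>nondegenerate_form\<close> speaks about.\<close>
  define M :: "complex ^ ('a + 'b) ^ ('a + 'b)" where "M = (\<chi> i j. G j i)"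
  have "x = 0" if "M *v x = 0" for x
  proof -
    have "(\<Sum>i\<in>UNIV. x $ i * G i j) = 0" for j
      using that by (auto simp: M_def matrix_vector_mult_def vec_eq_iff mult.commute)
    then have "(\<Sum>j\<in>UNIV. (\<Sum>i\<in>UNIV. x $ i * G i j) * w $ j) = 0" for w by simp
    then have "(\<Sum>i\<in>UNIV. \<Sum>j\<in>UNIV. x $ i * G i j * w $ j) = 0" for w
      by (subst sum.swap) (simp add: sum_distrib_right)
    then have "\<omega> x w = 0" for w by (simp add: form_sum)
    then show ?thesis using nondegenerate by (auto simp: nondegenerate_form_def)
  qed
  then obtain B where B: "B ** M = mat 1" using matrix_left_invertible_ker by metis
  then have B': "M ** B = mat 1" using matrix_left_right_inverse by metis
  show ?thesis
    using B B'
    by (intro exI[of _ "\<lambda>i j. B $ j $ i"])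
       (auto simp: matrix_matrix_mult_def mat_def M_def vec_eq_iff mult.commute)
qed

definition H :: "'a + 'b \<Rightarrow> 'a + 'b \<Rightarrow> complex" where
  "H = (SOME H. (\<forall>i k. (\<Sum>j\<in>UNIV. G i j * H j k) = (if i = k then 1 else 0)) \<and>
    (\<forall>i k. (\<Sum>j\<in>UNIV. H i j * G j k) = (if i = k then 1 else 0)))"

lemma GH: "(\<Sum>j\<in>UNIV. G i j * H j k) = (if i = k then 1 else 0)"
  and HG: "(\<Sum>j\<in>UNIV. H i j * G j k) = (if i = k then 1 else 0)"
  using someI_ex[OF exists_inverse, folded H_def] by auto

text \<open>The diagonal matrix of the signs \<open>psgn\<close> commutes with \<open>G\<close> by
  \<open>G_even\<close>, hence also with the inverse \<open>H\<close>.\<close>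

lemma H_even:
  assumes "odd_index i \<noteq> odd_index k"
  shows "H i k = 0"
proof -
  have "(\<Sum>j\<in>UNIV. \<Sum>l\<in>UNIV. H i j * psgn j * (G j l * H l k)) = H i k * psgn k"
    by (simp add: GH sum_mult_delta flip: sum_distrib_left)
  moreover have "(\<Sum>j\<in>UNIV. \<Sum>l\<in>UNIV. H i j * psgn j * (G j l * H l k)) =
      (\<Sum>l\<in>UNIV. \<Sum>j\<in>UNIV. (H i j * G j l) * (psgn l * H l k))"
  proof (subst sum.swap, intro sum.cong refl)
    fix j l
    show "H i j * psgn j * (G j l * H l k) = (H i j * G j l) * (psgn l * H l k)"
      using G_even[of j l] by (cases "odd_index j = odd_index l") (auto simp: sign_defs)
  qed
  moreover have "\<dots> = psgn i * H i k"
    by (simp add: HG sum_mult_delta flip: sum_distrib_right)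
  ultimately show ?thesis using assms by (auto simp: sign_defs split: if_splits)
qed

lemma H_sym: "H i k = psgn i * H k i"
proof -
  have "(\<Sum>j\<in>UNIV. \<Sum>l\<in>UNIV. H k j * (G j l * H i l)) = (\<Sum>j\<in>UNIV. psgn i * H k j * (\<Sum>l\<in>UNIV. H i l * G l j))"
    unfolding sum_distrib_left
  proof (intro sum.cong refl)
    fix j l
    show "H k j * (G j l * H i l) = psgn i * H k j * (H i l * G l j)"
      using H_even[of i l] G_sym'[of j l] by (cases "odd_index i = odd_index l") (auto simp: sign_defs)
  qed
  also have "\<dots> = psgn i * H k i"
    by (simp add: HG sum_mult_delta)
  finally have 1: "(\<Sum>j\<in>UNIV. \<Sum>l\<in>UNIV. H k j * (G j l * H i l)) = psgn i * H k i" .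
  have "(\<Sum>j\<in>UNIV. \<Sum>l\<in>UNIV. H k j * (G j l * H i l)) = (\<Sum>l\<in>UNIV. (\<Sum>j\<in>UNIV. H k j * G j l) * H i l)"
    by (subst sum.swap) (simp add: sum_distrib_right mult.assoc)
  also have "\<dots> = H i k"
    by (simp add: HG sum_mult_delta)
  finally show ?thesis by (rule trans[OF sym 1])
qed

text \<open>\<open>X q\<close> is multiplication by the linear form \<open>\<omega> (axis q 1)\<close>. The multiplication \<open>R2\<close> by the
  quadratic form and the dual Laplacian \<open>Lap\<close> generate the copy of \<open>sl(2)\<close> that commutes with the
  orthosymplectic Lie superalgebra (Howe duality); \<open>Lap_R2\<close> is its main relation.\<close>

definition X :: "'a + 'b \<Rightarrow> ('a, 'b) superop" where
  "X q p = (\<Sum>s\<in>UNIV. cscale (G q s) (mul s p))"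

definition R2 :: "('a, 'b) superop" where
  "R2 p = (\<Sum>v\<in>UNIV. cscale (psgn v) (mul v (X v p)))"

definition Lap :: "('a, 'b) superop" where
  "Lap p = (\<Sum>i\<in>UNIV. \<Sum>j\<in>UNIV. cscale (H i j) (sderiv i (sderiv j p)))"

lemma lin_X [intro, simp]: "lin (X q)"
  unfolding X_def by (auto intro!: lin_op_intros)

lemmas lin_X_comp = lin_compose[OF lin_X]

lemma lin_R2 [intro, simp]: "lin R2"
  unfolding R2_def by (auto intro!: lin_op_intros lin_X_comp)

lemma lin_Lap [intro, simp]: "lin Lap"
  unfolding Lap_def by (auto intro!: lin_op_intros)

lemmas op_simps = lin_simps[OF lin_sprod(1)] lin_simps[OF lin_sderiv] lin_simps[OF lin_X] lin_simps[OF lin_R2]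
  lin_simps[OF lin_Lap] lin_simps[OF lin_euler] cs.scale_right_distrib cs.scale_sum_right
  cs.scale_right_diff_distrib

lemma sum_H_X: "(\<Sum>q\<in>UNIV. cscale (H v q) (X q p)) = mul v p"
  unfolding X_def by (simp add: sum_cscale_cscale HG sum_cscale_delta)

lemma mul_X: "mul i (X q p) = cscale (sg i q) (X q (mul i p))"
  unfolding X_def op_simps
proof (intro sum.cong refl)
  fix s
  show "cscale (G q s) (mul i (mul s p)) = cscale (sg i q) (cscale (G q s) (mul s (mul i p)))"
    using G_even[of q s] mul_mul[of i s p]
    by (cases "odd_index q = odd_index s") (auto simp: sign_defs)
qed

lemma sderiv_X: "sderiv i (X q p) = cscale (G q i) p + cscale (sg i q) (X q (sderiv i p))"
proof -
  have "sderiv i (X q p) = (\<Sum>s\<in>UNIV. cscale (if s = i then G q i else 0) p +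
      cscale (sg i q) (cscale (G q s) (mul s (sderiv i p))))"
    unfolding X_def op_simps
  proof (intro sum.cong refl)
    fix s
    show "cscale (G q s) (sderiv i (mul s p)) = cscale (if s = i then G q i else 0) p +
      cscale (sg i q) (cscale (G q s) (mul s (sderiv i p)))"
      using G_even[of q s] sderiv_mul[of i s p]
      by (cases "odd_index q = odd_index s") (auto simp: sign_defs cs.scale_right_distrib)
  qed
  then show ?thesis
    by (simp add: sum.distrib sum_cscale_delta(1)[where f = "\<lambda>_. p"] X_def cs.scale_sum_right)
qed

text \<open>The form in which \<open>X p\<close> appears when \<open>sderiv p\<close> hits the
  second factor of \<open>R2\<close>. By supersymmetry it agrees with the contribution of the first
  factor, whence the factor 2 in \<open>sderiv_R2\<close>.\<close>

lemma X_alt: "X p f = (\<Sum>v\<in>UNIV. cscale (psgn v * (sg p v * (psgn p * G v p))) (mul v f))"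
  unfolding X_def
proof (intro sum.cong refl)
  fix v
  show "cscale (G p v) (mul v f) = cscale (psgn v * (sg p v * (psgn p * G v p))) (mul v f)"
    using G_even[of v p] G_sym[of p v] G_even[of p v]
    by (cases "odd_index p = odd_index v") (auto simp: sign_defs)
qed

lemma sderiv_R2: "sderiv i (R2 p) = R2 (sderiv i p) + cscale (2 * psgn i) (X i p)"
proof -
  have "sderiv i (R2 p) = (\<Sum>v\<in>UNIV. cscale (if v = i then psgn i else 0) (X v p) +
      cscale (psgn i) (cscale (psgn v * (sg i v * (psgn i * G v i))) (mul v p)) + cscale (psgn v) (mul v (X v (sderiv i p))))"
    unfolding R2_def op_simps
  proof (intro sum.cong refl)
    fix v
    show "cscale (psgn v) (sderiv i (mul v (X v p))) = cscale (if v = i then psgn i else 0) (X v p) +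
      cscale (psgn i) (cscale (psgn v * (sg i v * (psgn i * G v i))) (mul v p)) + cscale (psgn v) (mul v (X v (sderiv i p)))"
      by (simp add: sderiv_mul sderiv_X op_simps)
  qed
  also have "\<dots> = cscale (psgn i) (X i p) + cscale (psgn i) (X i p) + R2 (sderiv i p)"
    unfolding sum.distrib sum_cscale_delta cs.scale_sum_right[symmetric] X_alt[symmetric] R2_def ..
  finally show ?thesis
    by (simp add: algebra_simps cs.scale_left_distrib[symmetric])
qed

lemma mul_R2: "mul i (R2 p) = R2 (mul i p)"
  unfolding R2_def op_simps
  by (intro sum.cong refl) (simp add: mul_mul[of i] mul_X op_simps)

lemma sum_H_sderiv: "(\<Sum>i\<in>UNIV. cscale (H j i) (sderiv i p)) = cscale (psgn j) (\<Sum>i\<in>UNIV. cscale (H i j) (sderiv i p))"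
  by (simp add: cs.scale_sum_right flip: H_sym)

lemma Lap_mul: "Lap (mul j p) = mul j (Lap p) + cscale 2 (\<Sum>i\<in>UNIV. cscale (H i j) (sderiv i p))"
proof -
  have 1: "(\<Sum>i\<in>UNIV. \<Sum>u\<in>UNIV. cscale (if i = j then psgn j * H j u else 0) (sderiv u p)) =
      (\<Sum>u\<in>UNIV. cscale (psgn j * H j u) (sderiv u p))"
  proof (subst sum.swap, intro sum.cong refl)
    fix u
    show "(\<Sum>i\<in>UNIV. cscale (if i = j then psgn j * H j u else 0) (sderiv u p)) = cscale (psgn j * H j u) (sderiv u p)"
      by (rule sum_cscale_delta)
  qed
  have "Lap (mul j p) = (\<Sum>i\<in>UNIV. \<Sum>u\<in>UNIV. cscale (if u = j then H i j else 0) (sderiv i p) +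
      cscale (if i = j then psgn j * H j u else 0) (sderiv u p) + mul j (cscale (H i u) (sderiv i (sderiv u p))))"
    unfolding Lap_def
  proof (intro sum.cong refl)
    fix i u
    show "cscale (H i u) (sderiv i (sderiv u (mul j p))) = cscale (if u = j then H i j else 0) (sderiv i p) +
      cscale (if i = j then psgn j * H j u else 0) (sderiv u p) + mul j (cscale (H i u) (sderiv i (sderiv u p)))"
      using H_even[of i u]
      by (cases "odd_index i = odd_index u") (auto simp: sderiv_mul op_simps sign_defs)
  qed
  also have "\<dots> = (\<Sum>i\<in>UNIV. cscale (H i j) (sderiv i p)) + cscale (psgn j) (\<Sum>u\<in>UNIV. cscale (H j u) (sderiv u p)) + mul j (Lap p)"
    unfolding sum.distrib sum_cscale_delta Lap_def op_simps 1 by simp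
  finally show ?thesis
    by (simp add: sum_H_sderiv add_ac add_self_cscale)
qed

lemma sderiv_Lap: "sderiv i (Lap p) = Lap (sderiv i p)"
  unfolding Lap_def op_simps
proof (intro sum.cong refl)
  fix u v
  show "cscale (H u v) (sderiv i (sderiv u (sderiv v p))) = cscale (H u v) (sderiv u (sderiv v (sderiv i p)))"
    using H_even[of u v]
    by (cases "odd_index u = odd_index v") (auto simp: sderiv_sderiv[of i] op_simps sign_defs)
qed

definition sdim :: complex where
  "sdim = (\<Sum>i\<in>(UNIV :: ('a + 'b) set). psgn i)"

lemma sdim_eq: "sdim = of_nat CARD('a) - of_nat CARD('b)"
  unfolding sdim_def UNIV_Plus_UNIV[symmetric]
  by (subst sum.Plus) (auto simp: sign_defs)

text \<open>Move both derivatives of \<open>Lap\<close> past \<open>R2\<close>. The two kinds of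
  terms in which exactly one of them hits \<open>R2\<close> give \<open>2 * euler\<close> each
  (facts 1 and 3); where both hit it, \<open>H\<close> is contracted with \<open>G\<close> and the
  signs add up to the superdimension (fact 2).\<close>

lemma Lap_R2: "Lap (R2 p) = R2 (Lap p) + cscale 4 (euler p) + cscale (2 * sdim) p"
proof -
  have 1: "(\<Sum>i\<in>UNIV. \<Sum>u\<in>UNIV. cscale (H i u) (cscale (2 * psgn i) (X i (sderiv u p)))) = cscale 2 (euler p)"
  proof -
    have "(\<Sum>i\<in>UNIV. \<Sum>u\<in>UNIV. cscale (H i u) (cscale (2 * psgn i) (X i (sderiv u p)))) =
        cscale 2 (\<Sum>u\<in>UNIV. \<Sum>i\<in>UNIV. cscale (H u i) (X i (sderiv u p)))"
      unfolding cs.scale_sum_right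
    proof (subst sum.swap, intro sum.cong refl)
      fix u i
      show "cscale (H i u) (cscale (2 * psgn i) (X i (sderiv u p))) = cscale 2 (cscale (H u i) (X i (sderiv u p)))"
        by (subst H_sym[of i u]) (simp add: mult_ac)
    qed
    then show ?thesis by (simp add: sum_H_X euler_def)
  qed
  have 2: "(\<Sum>i\<in>UNIV. \<Sum>u\<in>UNIV. cscale (H i u) (cscale (2 * psgn u) (cscale (G u i) p))) = cscale (2 * sdim) p"
  proof -
    have "(\<Sum>i\<in>UNIV. \<Sum>u\<in>UNIV. H i u * (2 * psgn u * G u i)) = (\<Sum>i\<in>UNIV. 2 * psgn i * (\<Sum>u\<in>UNIV. H i u * G u i))"
      unfolding sum_distrib_left
    proof (intro sum.cong refl)
      fix i u
      show "H i u * (2 * psgn u * G u i) = 2 * psgn i * (H i u * G u i)"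
        using H_even[of i u] by (cases "odd_index i = odd_index u") (auto simp: sign_defs)
    qed
    also have "\<dots> = 2 * sdim"
      by (simp add: HG sdim_def sum_distrib_left)
    finally have "cscale (\<Sum>i\<in>UNIV. \<Sum>u\<in>UNIV. H i u * (2 * psgn u * G u i)) p = cscale (2 * sdim) p"
      by (rule arg_cong)
    then show ?thesis
      by (simp add: cs.scale_sum_left mult.assoc)
  qed
  have 3: "(\<Sum>i\<in>UNIV. \<Sum>u\<in>UNIV. cscale (H i u) (cscale (2 * psgn u) (cscale (sg i u) (X u (sderiv i p))))) = cscale 2 (euler p)"
  proof -
    have "(\<Sum>i\<in>UNIV. \<Sum>u\<in>UNIV. cscale (H i u) (cscale (2 * psgn u) (cscale (sg i u) (X u (sderiv i p))))) =
        cscale 2 (\<Sum>i\<in>UNIV. \<Sum>u\<in>UNIV. cscale (H i u) (X u (sderiv i p)))"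
      unfolding cs.scale_sum_right
    proof (intro sum.cong refl)
      fix i u
      show "cscale (H i u) (cscale (2 * psgn u) (cscale (sg i u) (X u (sderiv i p)))) = cscale 2 (cscale (H i u) (X u (sderiv i p)))"
        using H_even[of i u] by (cases "odd_index i = odd_index u") (auto simp: sign_defs)
    qed
    then show ?thesis by (simp add: sum_H_X euler_def)
  qed
  have "Lap (R2 p) = (\<Sum>i\<in>UNIV. \<Sum>u\<in>UNIV. cscale (H i u) (R2 (sderiv i (sderiv u p))) +
      cscale (H i u) (cscale (2 * psgn i) (X i (sderiv u p))) +
      (cscale (H i u) (cscale (2 * psgn u) (cscale (G u i) p)) +
      cscale (H i u) (cscale (2 * psgn u) (cscale (sg i u) (X u (sderiv i p))))))"
    unfolding Lap_def by (intro sum.cong refl) (simp add: sderiv_R2 sderiv_X op_simps add.assoc)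
  also have "\<dots> = (\<Sum>i\<in>UNIV. \<Sum>u\<in>UNIV. cscale (H i u) (R2 (sderiv i (sderiv u p)))) +
      cscale 2 (euler p) + (cscale (2 * sdim) p + cscale 2 (euler p))"
    unfolding sum.distrib 1 2 3 ..
  also have "(\<Sum>i\<in>UNIV. \<Sum>u\<in>UNIV. cscale (H i u) (R2 (sderiv i (sderiv u p)))) = R2 (Lap p)"
    by (simp only: Lap_def op_simps)
  also have "R2 (Lap p) + cscale 2 (euler p) + (cscale (2 * sdim) p + cscale 2 (euler p)) =
      R2 (Lap p) + (cscale 2 (euler p) + cscale 2 (euler p)) + cscale (2 * sdim) p"
    by (simp only: add_ac)
  also have "cscale 2 (euler p) + cscale 2 (euler p) = cscale 4 (euler p)"
    by (simp add: add_self_cscale)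
  finally show ?thesis .
qed

end

lemma sum_psgn_if: "supertrace Y = (\<Sum>i\<in>UNIV. psgn i * Y $ i $ i)"
  unfolding supertrace_def by (intro sum.cong) (auto simp: sign_defs)

lemma act_linear:
  assumes "\<And>r s. M $ r $ s = (\<Sum>i\<in>I. a i * b i $ r $ s)"
  shows "act M p = (\<Sum>i\<in>I. cscale (a i) (act (b i) p))"
proof -
  have "act M p = - (\<Sum>r\<in>UNIV. \<Sum>s\<in>UNIV. \<Sum>i\<in>I. cscale (a i) (cscale (asg r s * b i $ r $ s) (mul s (sderiv r p))))"
    unfolding act_alt assms
    by (simp add: sum_distrib_left cs.scale_sum_left mult_ac)
  also have "(\<Sum>r\<in>UNIV. \<Sum>s\<in>UNIV. \<Sum>i\<in>I. cscale (a i) (cscale (asg r s * b i $ r $ s) (mul s (sderiv r p)))) =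
      (\<Sum>r\<in>UNIV. \<Sum>i\<in>I. \<Sum>s\<in>UNIV. cscale (a i) (cscale (asg r s * b i $ r $ s) (mul s (sderiv r p))))"
    by (intro sum.cong refl sum.swap)
  also have "\<dots> = (\<Sum>i\<in>I. \<Sum>r\<in>UNIV. \<Sum>s\<in>UNIV. cscale (a i) (cscale (asg r s * b i $ r $ s) (mul s (sderiv r p))))"
    by (rule sum.swap)
  also have "- \<dots> = (\<Sum>i\<in>I. cscale (a i) (act (b i) p))"
    by (simp only: act_alt cs.scale_sum_right cs.scale_minus_right sum_negf)
  finally show ?thesis .
qed

lemma Pol_act: "p \<in> Pol d \<Longrightarrow> act M p \<in> Pol d"
  unfolding act_alt
  using Pol_mul[OF Pol_sderiv[of p d]] sderiv_Pol_0[of p] 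
  by (cases d) (auto intro!: Pol_intros simp: lin_zero[OF lin_sprod(1)])

lemma act_euler: "act M (euler p) = euler (act M p)"
proof (rule lin_ext_Pol[where p = p])
  fix d and p :: "('a, 'b) superpoly" assume "p \<in> Pol d"
  then show "act M (euler p) = euler (act M p)"
    by (simp add: euler_Pol[OF Pol_act] euler_Pol lin_scale[OF lin_act])
qed (auto intro: lin_compose[OF lin_act] lin_compose[OF lin_euler])

lemma euler_sderiv: "euler (sderiv i p) = sderiv i (euler p) - sderiv i p"
proof (rule lin_ext_Pol[where p = p])
  fix d and p :: "('a, 'b) superpoly" assume d: "p \<in> Pol d"
  show "euler (sderiv i p) = sderiv i (euler p) - sderiv i p"
  proof (cases d)
    case 0
    then show ?thesis using d by (simp add: sderiv_Pol_0 euler_Pol lin_zero[OF lin_euler] lin_scale[OF lin_sderiv])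
  next
    case (Suc d')
    then have "sderiv i p \<in> Pol d'" using Pol_sderiv[OF d] by simp
    then have "euler (sderiv i p) = cscale (of_nat d') (sderiv i p)" by (rule euler_Pol)
    then show ?thesis using d Suc by (simp add: euler_Pol lin_scale[OF lin_sderiv] lin_add[OF lin_sderiv] cs.scale_left_distrib)
  qed
qed (auto intro!: lin_op_intros lin_compose[OF lin_euler])

lemma act_mat: "act (mat c) p = - cscale c (euler p)"
proof -
  have "act (mat c) p = - (\<Sum>i\<in>UNIV. \<Sum>j\<in>UNIV. cscale (if j = i then c else 0) (mul j (sderiv i p)))"
    unfolding act_alt by (intro arg_cong[where f = uminus] sum.cong refl) (auto simp: mat_def sign_defs)
  then show ?thesis by (simp add: sum_cscale_delta euler_def cs.scale_sum_right)
qed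

lemma act_diff: "act (M - M') p = act M p - act M' p"
  unfolding act_alt by (simp add: algebra_simps cs.scale_left_diff_distrib sum_subtractf)

section \<open>Orthosymplectic matrices and the computation of the Casimir operator\<close>

context osp_form
begin

text \<open>The Gram matrix of the form twisted by \<open>M\<close>: by \<open>osp_iff\<close>, \<open>M\<close> is orthosymplectic
  exactly if \<open>W M\<close> is antisymmetric up to the signs \<open>eta\<close>.\<close>

definition W :: "complex ^ ('a + 'b) ^ ('a + 'b) \<Rightarrow> 'a + 'b \<Rightarrow> 'a + 'b \<Rightarrow> complex" where
  "W M j s = (\<Sum>i\<in>UNIV. G j i * M $ i $ s)"

definition eta :: "'a + 'b \<Rightarrow> 'a + 'b \<Rightarrow> complex" where
  "eta j s = - (psgn s * psgn j * sg s j)"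

lemma W_inverse: "(\<Sum>j\<in>UNIV. H i j * W M j s) = M $ i $ s"
proof -
  have "(\<Sum>j\<in>UNIV. H i j * W M j s) = (\<Sum>j\<in>UNIV. \<Sum>l\<in>UNIV. (H i j * G j l) * M $ l $ s)"
    by (simp add: W_def sum_distrib_left mult.assoc)
  also have "\<dots> = (\<Sum>l\<in>UNIV. (\<Sum>j\<in>UNIV. H i j * G j l) * M $ l $ s)"
    by (subst sum.swap) (simp add: sum_distrib_right)
  finally show ?thesis by (simp add: HG sum_mult_delta)
qed

lemma W_of_H:
  assumes "\<And>r s. M $ r $ s = (\<Sum>j\<in>UNIV. H r j * w j s)"
  shows "W M j s = w j s"
proof -
  have "W M j s = (\<Sum>i\<in>UNIV. \<Sum>l\<in>UNIV. (G j i * H i l) * w l s)"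
    by (simp add: W_def assms sum_distrib_left mult.assoc)
  also have "\<dots> = (\<Sum>l\<in>UNIV. (\<Sum>i\<in>UNIV. G j i * H i l) * w l s)"
    by (subst sum.swap) (simp add: sum_distrib_right)
  finally show ?thesis by (simp add: GH sum_mult_delta)
qed

lemma sum_G_right: "(\<Sum>i\<in>UNIV. M $ i $ j * G i s) = psgn s * W M s j"
  unfolding W_def sum_distrib_left by (intro sum.cong refl) (subst G_sym', simp)

lemma form_left: "\<omega> (M *v v) w = (\<Sum>j\<in>UNIV. \<Sum>s\<in>UNIV. v $ j * w $ s * (psgn s * W M s j))"
proof -
  have "\<omega> (M *v v) w = (\<Sum>i\<in>UNIV. \<Sum>s\<in>UNIV. \<Sum>j\<in>UNIV. v $ j * w $ s * (M $ i $ j * G i s))"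
    by (simp add: form_sum matrix_vector_mult_def sum_distrib_right sum_distrib_left mult_ac)
  also have "\<dots> = (\<Sum>i\<in>UNIV. \<Sum>j\<in>UNIV. \<Sum>s\<in>UNIV. v $ j * w $ s * (M $ i $ j * G i s))"
    by (intro sum.cong refl sum.swap)
  also have "\<dots> = (\<Sum>j\<in>UNIV. \<Sum>i\<in>UNIV. \<Sum>s\<in>UNIV. v $ j * w $ s * (M $ i $ j * G i s))"
    by (rule sum.swap)
  also have "\<dots> = (\<Sum>j\<in>UNIV. \<Sum>s\<in>UNIV. \<Sum>i\<in>UNIV. v $ j * w $ s * (M $ i $ j * G i s))"
    by (intro sum.cong refl sum.swap)
  finally show ?thesis by (simp only: sum_G_right flip: sum_distrib_left)
qed

lemma form_right: "\<omega> v (M *v w) = (\<Sum>j\<in>UNIV. \<Sum>s\<in>UNIV. v $ j * w $ s * W M j s)"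
proof -
  have "\<omega> v (M *v w) = (\<Sum>j\<in>UNIV. \<Sum>i\<in>UNIV. \<Sum>s\<in>UNIV. v $ j * w $ s * (G j i * M $ i $ s))"
    by (simp add: form_sum matrix_vector_mult_def sum_distrib_right sum_distrib_left mult_ac)
  also have "\<dots> = (\<Sum>j\<in>UNIV. \<Sum>s\<in>UNIV. \<Sum>i\<in>UNIV. v $ j * w $ s * (G j i * M $ i $ s))"
    by (intro sum.cong refl sum.swap)
  finally show ?thesis by (simp only: W_def flip: sum_distrib_left)
qed

lemma W_hom:
  assumes "hom_mat e M" "(odd_index j \<noteq> odd_index s) \<noteq> e"
  shows "W M j s = 0"
  unfolding W_def
proof (rule sum.neutral, rule ballI)
  fix i
  have "odd_index i = odd_index j \<Longrightarrow> M $ i $ s = 0" using assms by (auto simp: hom_mat_def)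
  then show "G j i * M $ i $ s = 0" using G_even[of j i] by auto
qed

lemma osp_iff:
  "M \<in> osp_part \<omega> e \<longleftrightarrow> hom_mat e M \<and> (\<forall>j s. W M j s = eta j s * W M s j)"
proof (cases "hom_mat e M")
  case True
  have key: "psgn s * W M s j + super_sign e (odd_index j) * W M j s = 0 \<longleftrightarrow> W M j s = eta j s * W M s j" for j s
  proof (cases "(odd_index j \<noteq> odd_index s) = e")
    case e: True
    have *: "psgn s * x + super_sign e (odd_index j) * y = 0 \<longleftrightarrow> y = eta j s * x" for x y
      unfolding e[symmetric]
      by (cases "odd_index j"; cases "odd_index s")
         (auto simp: eta_def sign_defs add_eq_0_iff neg_eq_iff_add_eq_0 add.commute)
    show ?thesis by (rule *)
  next
    case False
    then show ?thesis using W_hom[OF True, of j s] W_hom[OF True, of s j] by auto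
  qed
  have "M \<in> osp_part \<omega> e \<longleftrightarrow> (\<forall>j s. psgn s * W M s j + super_sign e (odd_index j) * W M j s = 0)"
  proof
    assume M: "M \<in> osp_part \<omega> e"
    show "\<forall>j s. psgn s * W M s j + super_sign e (odd_index j) * W M j s = 0"
    proof (intro allI)
      fix j s
      have "\<omega> (M *v axis j 1) (axis s 1) + super_sign e (odd_index j) * \<omega> (axis j 1) (M *v axis s 1) = 0"
        using M hom_axis[of j 1] unfolding osp_part_def by blast
      moreover have "\<omega> (M *v axis j 1) (axis s 1) = psgn s * W M s j"
        unfolding form_left
        by (simp add: axis_def if_distrib[of "\<lambda>c. c * _"] if_distrib[of "\<lambda>c. _ * c"] cong: if_cong)
      moreover have "\<omega> (axis j 1) (M *v axis s 1) = W M j s"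
        unfolding form_right
        by (simp add: axis_def if_distrib[of "\<lambda>c. c * _"] if_distrib[of "\<lambda>c. _ * c"] cong: if_cong)
      ultimately show "psgn s * W M s j + super_sign e (odd_index j) * W M j s = 0" by simp
    qed
  next
    assume *: "\<forall>j s. psgn s * W M s j + super_sign e (odd_index j) * W M j s = 0"
    have "\<omega> (M *v v) w + super_sign e f * \<omega> v (M *v w) = 0" if v: "hom_vec f v" for f v w
    proof -
      have "\<omega> (M *v v) w + super_sign e f * \<omega> v (M *v w) =
          (\<Sum>j\<in>UNIV. \<Sum>s\<in>UNIV. v $ j * w $ s * (psgn s * W M s j + super_sign e f * W M j s))"
        by (simp add: form_left form_right sum_distrib_left sum.distrib algebra_simps)
      also have "\<dots> = 0"
      proof (intro sum.neutral ballI)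
        fix j s
        show "v $ j * w $ s * (psgn s * W M s j + super_sign e f * W M j s) = 0"
          using v * by (cases "v $ j = 0") (auto simp: hom_vec_def)
      qed
      finally show ?thesis .
    qed
    then show "M \<in> osp_part \<omega> e" using True by (simp add: osp_part_def)
  qed
  then show ?thesis using True key by simp
qed (simp add: osp_part_def)

lemma osp_W: "M \<in> osp_part \<omega> e \<Longrightarrow> W M j s = eta j s * W M s j"
  using osp_iff by blast

text \<open>The commutator is multiplication by a quadratic polynomial whose coefficients are, up to
  signs, the entries of \<open>W M\<close>. These are super-antisymmetric by \<open>osp_W\<close>,
  whereas the coordinates supercommute, so the terms cancel in pairs.\<close>

lemma act_R2:
  assumes "M \<in> osp_part \<omega> e"
  shows "act M (R2 p) = R2 (act M p)"
proof -
  have "(\<Sum>i\<in>UNIV. \<Sum>j\<in>UNIV. cscale (asg i j * M $ i $ j) (mul j (cscale (2 * psgn i) (X i p)))) =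
      (\<Sum>i\<in>UNIV. \<Sum>j\<in>UNIV. \<Sum>s\<in>UNIV. cscale (2 * (asg s j * psgn s) * (M $ i $ j * G i s)) (mul j (mul s p)))"
    unfolding X_def op_simps
  proof (intro sum.cong refl)
    fix i j s
    show "cscale (asg i j * M $ i $ j) (cscale (2 * psgn i) (cscale (G i s) (mul j (mul s p)))) =
        cscale (2 * (asg s j * psgn s) * (M $ i $ j * G i s)) (mul j (mul s p))"
      using G_even[of i s] by (cases "odd_index i = odd_index s") (auto simp: sign_defs)
  qed
  also have "\<dots> = (\<Sum>j\<in>UNIV. \<Sum>i\<in>UNIV. \<Sum>s\<in>UNIV. cscale (2 * (asg s j * psgn s) * (M $ i $ j * G i s)) (mul j (mul s p)))"
    by (rule sum.swap)
  also have "\<dots> = (\<Sum>j\<in>UNIV. \<Sum>s\<in>UNIV. \<Sum>i\<in>UNIV. cscale (2 * (asg s j * psgn s) * (M $ i $ j * G i s)) (mul j (mul s p)))"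
    by (intro sum.cong refl sum.swap)
  also have "\<dots> = (\<Sum>j\<in>UNIV. \<Sum>s\<in>UNIV. cscale (2 * (asg s j * psgn s) * (psgn s * W M s j)) (mul j (mul s p)))"
    by (simp only: sum_G_right flip: cs.scale_sum_left sum_distrib_left)
  also have "\<dots> = 0"
  proof (rule sum_antisym_zero)
    fix j s
    show "cscale (2 * (asg s j * psgn s) * (psgn s * W M s j)) (mul j (mul s p)) =
        - cscale (2 * (asg j s * psgn j) * (psgn j * W M j s)) (mul s (mul j p))"
      by (subst osp_W[OF assms, of s j], subst mul_mul[of j s]) (auto simp: eta_def sign_defs)
  qed
  finally have *: "(\<Sum>i\<in>UNIV. \<Sum>j\<in>UNIV. cscale (asg i j * M $ i $ j) (mul j (cscale (2 * psgn i) (X i p)))) = 0" .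
  have "act M (R2 p) = - (\<Sum>i\<in>UNIV. \<Sum>j\<in>UNIV. R2 (cscale (asg i j * M $ i $ j) (mul j (sderiv i p)))) -
      (\<Sum>i\<in>UNIV. \<Sum>j\<in>UNIV. cscale (asg i j * M $ i $ j) (mul j (cscale (2 * psgn i) (X i p))))"
    by (simp add: act_alt sderiv_R2 lin_add[OF lin_sprod(1)] mul_R2 cs.scale_right_distrib sum.distrib lin_scale[OF lin_R2])
  then show ?thesis unfolding * by (simp add: act_alt lin_simps[OF lin_R2])
qed

lemma act_Lap:
  assumes "M \<in> osp_part \<omega> e"
  shows "act M (Lap p) = Lap (act M p)"
proof -
  \<comment> \<open>The analogue of \<open>W M\<close> for the dual form: writing \<open>M\<close>
    through \<open>W M\<close> gives \<open>Z\<close> as \<open>W M\<close> between two copies of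
    \<open>H\<close>, so the antisymmetry carries over and the second derivatives cancel in pairs as
    in \<open>act_R2\<close>.\<close>
  define Z where "Z i l = (\<Sum>j\<in>UNIV. M $ i $ j * H j l)" for i l
  have Z: "Z i l = (\<Sum>r\<in>UNIV. \<Sum>j\<in>UNIV. H i r * W M r j * H j l)" for i l
  proof -
    have "Z i l = (\<Sum>j\<in>UNIV. \<Sum>r\<in>UNIV. H i r * W M r j * H j l)"
      by (simp add: Z_def sum_distrib_right flip: W_inverse[of i M])
    then show ?thesis by (subst sum.swap)
  qed
  have Z_sym: "Z i l = - (sg i l * Z l i)" for i l
  proof -
    have "Z i l = (\<Sum>r\<in>UNIV. \<Sum>j\<in>UNIV. - (sg i l) * (H l j * W M j r * H r i))"
      unfolding Z
    proof (intro sum.cong refl)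
      fix r j
      show "H i r * W M r j * H j l = - (sg i l) * (H l j * W M j r * H r i)"
        using H_even[of i r] H_even[of j l]
        by (cases "odd_index i = odd_index r \<and> odd_index j = odd_index l")
           (auto simp: osp_W[OF assms, of r j] H_sym[of i r] H_sym[of j l] eta_def sign_defs)
    qed
    also have "\<dots> = - (sg i l) * Z l i"
      unfolding Z sum_distrib_left by (rule sum.swap)
    finally show ?thesis by simp
  qed
  have "(\<Sum>i\<in>UNIV. \<Sum>j\<in>UNIV. cscale (asg i j * M $ i $ j) (\<Sum>l\<in>UNIV. cscale (H l j) (sderiv l (sderiv i p)))) =
      (\<Sum>i\<in>UNIV. \<Sum>j\<in>UNIV. \<Sum>l\<in>UNIV. cscale (asg i l * psgn l * (M $ i $ j * H j l)) (sderiv l (sderiv i p)))"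
    unfolding op_simps
  proof (intro sum.cong refl)
    fix i j l
    show "cscale (asg i j * M $ i $ j) (cscale (H l j) (sderiv l (sderiv i p))) =
        cscale (asg i l * psgn l * (M $ i $ j * H j l)) (sderiv l (sderiv i p))"
      using H_even[of l j] by (cases "odd_index l = odd_index j") (auto simp: sign_defs H_sym[of l j])
  qed
  also have "\<dots> = (\<Sum>i\<in>UNIV. \<Sum>l\<in>UNIV. \<Sum>j\<in>UNIV. cscale (asg i l * psgn l * (M $ i $ j * H j l)) (sderiv l (sderiv i p)))"
    by (intro sum.cong refl sum.swap)
  also have "\<dots> = (\<Sum>i\<in>UNIV. \<Sum>l\<in>UNIV. cscale (asg i l * psgn l * Z i l) (sderiv l (sderiv i p)))"
    by (simp only: Z_def flip: cs.scale_sum_left sum_distrib_left)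
  also have "\<dots> = 0"
  proof (rule sum_antisym_zero)
    fix i l
    show "cscale (asg i l * psgn l * Z i l) (sderiv l (sderiv i p)) = - cscale (asg l i * psgn i * Z l i) (sderiv i (sderiv l p))"
      by (subst Z_sym[of i l], subst sderiv_sderiv[of l i]) (auto simp: sign_defs)
  qed
  finally have *: "(\<Sum>i\<in>UNIV. \<Sum>j\<in>UNIV. cscale (asg i j * M $ i $ j) (\<Sum>l\<in>UNIV. cscale (H l j) (sderiv l (sderiv i p)))) = 0" .
  have "Lap (act M p) = - (\<Sum>i\<in>UNIV. \<Sum>j\<in>UNIV. cscale (asg i j * M $ i $ j) (mul j (sderiv i (Lap p)))) -
      cscale 2 (\<Sum>i\<in>UNIV. \<Sum>j\<in>UNIV. cscale (asg i j * M $ i $ j) (\<Sum>l\<in>UNIV. cscale (H l j) (sderiv l (sderiv i p))))"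
    by (simp add: act_alt lin_simps[OF lin_Lap] Lap_mul sderiv_Lap cs.scale_right_distrib sum.distrib cs.scale_sum_right mult_ac)
  then show ?thesis unfolding * by (simp add: act_alt)
qed

text \<open>The orthosymplectic matrix corresponding to the super exterior product of two basis vectors.\<close>

definition B :: "'a + 'b \<Rightarrow> 'a + 'b \<Rightarrow> complex ^ ('a + 'b) ^ ('a + 'b)" where
  "B p q = (\<chi> r s. (if r = p then 1 else 0) * G q s - sg p q * ((if r = q then 1 else 0) * G p s))"

lemma W_B: "W (B p q) j s = G j p * G q s - sg p q * G j q * G p s"
proof -
  have "W (B p q) j s = (\<Sum>i\<in>UNIV. (G j i * G q s) * (if i = p then 1 else 0)) -
      (\<Sum>i\<in>UNIV. (sg p q * G j i * G p s) * (if i = q then 1 else 0))"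
    by (simp add: W_def B_def algebra_simps sum_subtractf)
  then show ?thesis by (simp only: sum_mult_delta)
qed

lemma B_osp: "B p q \<in> osp_part \<omega> (odd_index p \<noteq> odd_index q)"
  unfolding osp_iff
proof (intro conjI allI)
  show "hom_mat (odd_index p \<noteq> odd_index q) (B p q)"
    using G_even[of q] G_even[of p] by (fastforce simp: hom_mat_def B_def split: if_splits)
  fix j s
  show "W (B p q) j s = eta j s * W (B p q) s j"
    unfolding W_B
    using G_even[of j p] G_even[of j q] G_even[of q s] G_even[of p s]
    by (cases "odd_index j"; cases "odd_index s"; cases "odd_index p"; cases "odd_index q")
       (auto simp: G_sym[of s p] G_sym[of q j] G_sym[of s q] G_sym[of p j] eta_def sign_defs)
qed

text \<open>Pairing with \<open>B p q\<close> under the supertrace reads off an entry of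
  \<open>W Y\<close>. The two terms of \<open>B p q\<close> contribute equally by
  \<open>osp_W\<close>, whence the factor 2.\<close>

lemma supertrace_B_right:
  assumes "Y \<in> osp_part \<omega> e"
  shows "supertrace (Y ** B p q) = 2 * psgn q * W Y q p"
proof -
  have "supertrace (Y ** B p q) = (\<Sum>r\<in>UNIV. \<Sum>s\<in>UNIV. (psgn r * Y $ r $ s * G q r) * (if s = p then 1 else 0)) -
      (\<Sum>r\<in>UNIV. \<Sum>s\<in>UNIV. (sg p q * psgn r * Y $ r $ s * G p r) * (if s = q then 1 else 0))"
    by (simp add: sum_psgn_if matrix_matrix_mult_def B_def algebra_simps sum_subtractf sum_distrib_left)
  also have "\<dots> = (\<Sum>r\<in>UNIV. psgn r * Y $ r $ p * G q r) - (\<Sum>r\<in>UNIV. sg p q * psgn r * Y $ r $ q * G p r)"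
    by (simp only: sum_mult_delta)
  also have "(\<Sum>r\<in>UNIV. psgn r * Y $ r $ p * G q r) = psgn q * W Y q p"
    unfolding W_def sum_distrib_left
  proof (intro sum.cong refl)
    fix r
    show "psgn r * Y $ r $ p * G q r = psgn q * (G q r * Y $ r $ p)"
      using G_even[of q r] by (cases "odd_index q = odd_index r") (auto simp: sign_defs)
  qed
  also have "(\<Sum>r\<in>UNIV. sg p q * psgn r * Y $ r $ q * G p r) = sg p q * psgn p * W Y p q"
    unfolding W_def sum_distrib_left
  proof (intro sum.cong refl)
    fix r
    show "sg p q * psgn r * Y $ r $ q * G p r = sg p q * psgn p * (G p r * Y $ r $ q)"
      using G_even[of p r] by (cases "odd_index p = odd_index r") (auto simp: sign_defs)
  qed
  finally show ?thesis
    by (subst (asm) osp_W[OF assms, of p q]) (auto simp: eta_def sign_defs)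
qed

lemma supertrace_B_left:
  assumes "Y \<in> osp_part \<omega> e"
  shows "supertrace (B p q ** Y) = 2 * psgn p * W Y q p"
proof -
  have "supertrace (B p q ** Y) = (\<Sum>s\<in>UNIV. \<Sum>r\<in>UNIV. (psgn r * (G q s * Y $ s $ r)) * (if r = p then 1 else 0)) -
      (\<Sum>s\<in>UNIV. \<Sum>r\<in>UNIV. (sg p q * psgn r * (G p s * Y $ s $ r)) * (if r = q then 1 else 0))"
    by (subst (1 2) sum.swap) (simp add: sum_psgn_if matrix_matrix_mult_def B_def algebra_simps sum_subtractf sum_distrib_left)
  also have "\<dots> = psgn p * W Y q p - sg p q * psgn q * W Y p q"
    by (simp only: sum_mult_delta W_def sum_distrib_left)
  finally show ?thesis
    by (subst (asm) osp_W[OF assms, of p q]) (auto simp: eta_def sign_defs)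
qed

lemma act_B: "act (B s t) p = cscale (sg s t * asg t s) (X s (sderiv t p)) - cscale (asg s t) (X t (sderiv s p))"
proof -
  have "act (B s t) p = - (\<Sum>j\<in>UNIV. \<Sum>i\<in>UNIV. cscale (if i = s then asg s j * G t j else 0) (mul j (sderiv i p)) -
      cscale (if i = t then sg s t * asg t j * G s j else 0) (mul j (sderiv i p)))"
    unfolding act_alt
    by (subst sum.swap, intro arg_cong[where f = uminus] sum.cong refl)
       (auto simp: B_def algebra_simps cs.scale_left_diff_distrib)
  also have "\<dots> = - ((\<Sum>j\<in>UNIV. cscale (asg s j * G t j) (mul j (sderiv s p))) -
      (\<Sum>j\<in>UNIV. cscale (sg s t * asg t j * G s j) (mul j (sderiv t p))))"
    by (simp only: sum_subtractf sum_cscale_delta)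
  also have "(\<Sum>j\<in>UNIV. cscale (asg s j * G t j) (mul j (sderiv s p))) = cscale (asg s t) (X t (sderiv s p))"
    unfolding X_def cs.scale_sum_right
  proof (intro sum.cong refl)
    fix j
    show "cscale (asg s j * G t j) (mul j (sderiv s p)) = cscale (asg s t) (cscale (G t j) (mul j (sderiv s p)))"
      using G_even[of t j] by (cases "odd_index t = odd_index j") (auto simp: sign_defs)
  qed
  also have "(\<Sum>j\<in>UNIV. cscale (sg s t * asg t j * G s j) (mul j (sderiv t p))) = cscale (sg s t * asg t s) (X s (sderiv t p))"
    unfolding X_def cs.scale_sum_right
  proof (intro sum.cong refl)
    fix j
    show "cscale (sg s t * asg t j * G s j) (mul j (sderiv t p)) = cscale (sg s t * asg t s) (cscale (G s j) (mul j (sderiv t p)))"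
      using G_even[of s j] by (cases "odd_index s = odd_index j") (auto simp: sign_defs)
  qed
  finally show ?thesis by simp
qed

text \<open>Howe duality predicts this form. On harmonics of degree d it is
  \<open>d * (d + sdim - 2)\<close>, as for the spherical Laplacian, and for
  \<open>sdim = - 2 * k\<close> this is the prescribed d(d - 2k - 2).\<close>

definition cas :: "('a, 'b) superop" where
  "cas p = euler (euler p) + cscale (sdim - 2) (euler p) - R2 (Lap p)"

text \<open>The Casimir operator written with the redundant family \<open>B s t\<close> instead of a
  basis. T1 and T2 are the two terms of \<open>act_B\<close>: T1 yields the square of the Euler
  operator, T2 the product \<open>R2 \<circ> Lap\<close>.\<close>

lemma sum_act_B:
  "(\<Sum>r\<in>UNIV. \<Sum>s\<in>UNIV. \<Sum>t\<in>UNIV. cscale (asg r s * H r t * psgn s) (mul s (sderiv r (act (B s t) p)))) = - cas p"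
proof -
  have T1: "(\<Sum>r\<in>UNIV. \<Sum>s\<in>UNIV. \<Sum>t\<in>UNIV. cscale (asg r s * H r t * psgn s) (mul s (sderiv r (cscale (asg s t) (X t (sderiv s p)))))) =
      euler (euler p) + cscale (sdim - 1) (euler p)"
  proof -
    have "(\<Sum>r\<in>UNIV. \<Sum>s\<in>UNIV. \<Sum>t\<in>UNIV. cscale (asg r s * H r t * psgn s) (mul s (sderiv r (cscale (asg s t) (X t (sderiv s p)))))) =
      (\<Sum>r\<in>UNIV. \<Sum>s\<in>UNIV. \<Sum>t\<in>UNIV. cscale (psgn r) (mul s (sderiv r (cscale (H r t) (X t (sderiv s p))))))"
    proof (intro sum.cong refl)
      fix r s t
      show "cscale (asg r s * H r t * psgn s) (mul s (sderiv r (cscale (asg s t) (X t (sderiv s p))))) =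
          cscale (psgn r) (mul s (sderiv r (cscale (H r t) (X t (sderiv s p)))))"
        using H_even[of r t] by (cases "odd_index r = odd_index t") (auto simp: op_simps sign_defs)
    qed
    also have "\<dots> = (\<Sum>r\<in>UNIV. \<Sum>s\<in>UNIV. cscale (psgn r) (mul s (sderiv r (mul r (sderiv s p)))))"
      by (simp only: sum_H_X flip: lin_sum[OF lin_sprod(1)] lin_sum[OF lin_sderiv] cs.scale_sum_right)
    also have "\<dots> = (\<Sum>s\<in>UNIV. \<Sum>r\<in>UNIV. cscale (psgn r) (mul s (sderiv s p)) + mul s (mul r (sderiv r (sderiv s p))))"
      by (subst sum.swap) (simp add: sderiv_mul op_simps)
    also have "\<dots> = (\<Sum>s\<in>UNIV. cscale sdim (mul s (sderiv s p)) + mul s (euler (sderiv s p)))"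
      by (simp only: sum.distrib sdim_def euler_def flip: cs.scale_sum_left lin_sum[OF lin_sprod(1)])
    also have "\<dots> = cscale sdim (euler p) + (euler (euler p) - euler p)"
      by (simp only: euler_sderiv lin_diff[OF lin_sprod(1)] sum.distrib sum_subtractf
        euler_def[of p, symmetric] euler_def[of "euler p", symmetric] flip: cs.scale_sum_right)
    finally show ?thesis by (simp add: cs.scale_left_diff_distrib)
  qed
  have T2: "(\<Sum>r\<in>UNIV. \<Sum>s\<in>UNIV. \<Sum>t\<in>UNIV. cscale (asg r s * H r t * psgn s) (mul s (sderiv r (cscale (sg s t * asg t s) (X s (sderiv t p)))))) =
      euler p + R2 (Lap p)"
  proof -
    have "(\<Sum>r\<in>UNIV. \<Sum>s\<in>UNIV. \<Sum>t\<in>UNIV. cscale (asg r s * H r t * psgn s) (mul s (sderiv r (cscale (sg s t * asg t s) (X s (sderiv t p)))))) =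
      (\<Sum>r\<in>UNIV. \<Sum>s\<in>UNIV. \<Sum>t\<in>UNIV. cscale (G s r * H r t) (mul s (sderiv t p)) + cscale (psgn s) (mul s (X s (cscale (H r t) (sderiv r (sderiv t p))))))"
    proof (intro sum.cong refl)
      fix r s t
      show "cscale (asg r s * H r t * psgn s) (mul s (sderiv r (cscale (sg s t * asg t s) (X s (sderiv t p))))) =
          cscale (G s r * H r t) (mul s (sderiv t p)) + cscale (psgn s) (mul s (X s (cscale (H r t) (sderiv r (sderiv t p)))))"
        using H_even[of r t] G_even[of s r]
        by (cases "odd_index r = odd_index t"; cases "odd_index s = odd_index r")
           (auto simp: sderiv_X op_simps sign_defs)
    qed
    also have "\<dots> = (\<Sum>s\<in>UNIV. \<Sum>r\<in>UNIV. \<Sum>t\<in>UNIV. cscale (G s r * H r t) (mul s (sderiv t p)) + cscale (psgn s) (mul s (X s (cscale (H r t) (sderiv r (sderiv t p))))))"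
      by (rule sum.swap)
    also have "\<dots> = (\<Sum>s\<in>UNIV. (\<Sum>r\<in>UNIV. \<Sum>t\<in>UNIV. cscale (G s r * H r t) (mul s (sderiv t p)))) + R2 (Lap p)"
      by (simp only: sum.distrib Lap_def R2_def flip: lin_sum[OF lin_sprod(1)] lin_sum[OF lin_X] cs.scale_sum_right)
    also have "(\<Sum>s\<in>UNIV. (\<Sum>r\<in>UNIV. \<Sum>t\<in>UNIV. cscale (G s r * H r t) (mul s (sderiv t p)))) =
        (\<Sum>s\<in>UNIV. (\<Sum>t\<in>UNIV. cscale (\<Sum>r\<in>UNIV. G s r * H r t) (mul s (sderiv t p))))"
      unfolding cs.scale_sum_left by (intro sum.cong refl sum.swap)
    also have "\<dots> = euler p"
      by (simp only: GH sum_cscale_delta euler_def cs.scale_one)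
    finally show ?thesis .
  qed
  have "(\<Sum>r\<in>UNIV. \<Sum>s\<in>UNIV. \<Sum>t\<in>UNIV. cscale (asg r s * H r t * psgn s) (mul s (sderiv r (act (B s t) p)))) =
     (euler p + R2 (Lap p)) - (euler (euler p) + cscale (sdim - 1) (euler p))"
    unfolding T1[symmetric] T2[symmetric] act_B
    by (simp only: lin_diff[OF lin_sderiv] lin_diff[OF lin_sprod(1)] cs.scale_right_diff_distrib sum_subtractf)
  also have "\<dots> = - cas p"
    by (simp add: cas_def cs.scale_left_diff_distrib algebra_simps add_self_cscale[symmetric])
  finally show ?thesis .
qed

text \<open>The entries of \<open>b' i\<close> are supertraces against the matrices
  \<open>B s t\<close>, and by duality these supertraces are, up to the factor \<open>c\<close>, the
  coefficients of \<open>B s t\<close> in the basis \<open>b\<close>. Summing over \<open>i\<close>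
  thus eliminates the bases and leaves \<open>sum_act_B\<close>.\<close>

lemma casimir_wrt_eq:
  assumes "casimir_wrt \<omega> c C" "c \<noteq> 0"
  shows "C p = cscale (1 / (2 * c)) (cas p)"
proof -
  obtain N :: nat and e b b' where
    b: "\<And>i. i < N \<Longrightarrow> b i \<in> osp_part \<omega> (e i)" "\<And>i. i < N \<Longrightarrow> b' i \<in> osp_part \<omega> (e i)"
    and span: "\<And>f X. X \<in> osp_part \<omega> f \<Longrightarrow> \<exists>a. \<forall>r s. X $ r $ s = (\<Sum>i<N. a i * b i $ r $ s)"
    and dual: "\<And>i j. i < N \<Longrightarrow> j < N \<Longrightarrow> c * supertrace (b i ** b' j) = (if i = j then 1 else 0)"
    and C: "C = (\<lambda>p. \<Sum>i<N. act (b' i) (act (b i) p))"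
    using assms(1) unfolding casimir_wrt_def by blast
  have expand: "act (B s t) p = cscale c (\<Sum>i<N. cscale (supertrace (B s t ** b' i)) (act (b i) p))" for s t p
  proof -
    obtain a where a: "\<And>r u. B s t $ r $ u = (\<Sum>i<N. a i * b i $ r $ u)"
      using span[OF B_osp] by blast
    have "a j = c * supertrace (B s t ** b' j)" if j: "j < N" for j
    proof -
      have "supertrace (B s t ** b' j) = (\<Sum>r\<in>UNIV. \<Sum>u\<in>UNIV. \<Sum>i<N. a i * (psgn r * (b i $ r $ u * b' j $ u $ r)))"
        by (simp add: sum_psgn_if matrix_matrix_mult_def a sum_distrib_left sum_distrib_right mult_ac)
      also have "\<dots> = (\<Sum>r\<in>UNIV. \<Sum>i<N. \<Sum>u\<in>UNIV. a i * (psgn r * (b i $ r $ u * b' j $ u $ r)))"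
        by (intro sum.cong refl sum.swap)
      also have "\<dots> = (\<Sum>i<N. \<Sum>r\<in>UNIV. \<Sum>u\<in>UNIV. a i * (psgn r * (b i $ r $ u * b' j $ u $ r)))"
        by (rule sum.swap)
      also have "\<dots> = (\<Sum>i<N. a i * supertrace (b i ** b' j))"
        by (simp add: sum_psgn_if matrix_matrix_mult_def sum_distrib_left)
      finally have "c * supertrace (B s t ** b' j) = (\<Sum>i<N. a i * (c * supertrace (b i ** b' j)))"
        by (simp add: sum_distrib_left mult_ac)
      also have "\<dots> = (\<Sum>i<N. if i = j then a i else 0)"
        using dual j by (intro sum.cong refl) auto
      finally show ?thesis using j by simp
    qed
    then show ?thesis
      by (subst act_linear[OF a]) (simp add: cs.scale_sum_right)
  qed
  have W': "W (b' i) t s = psgn s / 2 * supertrace (B s t ** b' i)" if "i < N" for i s t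
    by (simp add: supertrace_B_left[OF b(2)[OF that]])
  have "act (b' i) q = - (\<Sum>r\<in>UNIV. \<Sum>s\<in>UNIV. \<Sum>t\<in>UNIV.
      cscale (1/2 * (asg r s * H r t * psgn s) * supertrace (B s t ** b' i)) (mul s (sderiv r q)))" if "i < N" for i q
    unfolding act_alt W_inverse[of _ "b' i", symmetric]
    by (simp add: W'[OF that] sum_distrib_left cs.scale_sum_left mult_ac)
  then have "C p = (\<Sum>i<N. - (\<Sum>r\<in>UNIV. \<Sum>s\<in>UNIV. \<Sum>t\<in>UNIV.
      cscale (1/2 * (asg r s * H r t * psgn s) * supertrace (B s t ** b' i)) (mul s (sderiv r (act (b i) p)))))"
    unfolding C by (intro sum.cong refl) auto
  also have "\<dots> = - (\<Sum>r\<in>UNIV. \<Sum>i<N. \<Sum>s\<in>UNIV. \<Sum>t\<in>UNIV.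
      cscale (1/2 * (asg r s * H r t * psgn s) * supertrace (B s t ** b' i)) (mul s (sderiv r (act (b i) p))))"
    unfolding sum_negf by (intro arg_cong[where f = uminus] sum.swap)
  also have "\<dots> = - (\<Sum>r\<in>UNIV. \<Sum>s\<in>UNIV. \<Sum>i<N. \<Sum>t\<in>UNIV.
      cscale (1/2 * (asg r s * H r t * psgn s) * supertrace (B s t ** b' i)) (mul s (sderiv r (act (b i) p))))"
    by (intro arg_cong[where f = uminus] sum.cong refl sum.swap)
  also have "\<dots> = - (\<Sum>r\<in>UNIV. \<Sum>s\<in>UNIV. \<Sum>t\<in>UNIV. \<Sum>i<N.
      cscale (1/2 * (asg r s * H r t * psgn s) * supertrace (B s t ** b' i)) (mul s (sderiv r (act (b i) p))))"
    by (intro arg_cong[where f = uminus] sum.cong refl sum.swap)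
  also have "\<dots> = - (\<Sum>r\<in>UNIV. \<Sum>s\<in>UNIV. \<Sum>t\<in>UNIV.
      cscale (1 / (2 * c)) (cscale (asg r s * H r t * psgn s) (mul s (sderiv r (act (B s t) p)))))"
    unfolding expand using assms(2)
    by (simp add: op_simps mult_ac)
  also have "\<dots> = cscale (1 / (2 * c)) (cas p)"
    by (simp only: sum_act_B cs.scale_minus_right minus_minus flip: cs.scale_sum_right)
  finally show ?thesis .
qed

end

section \<open>Highest weight vectors\<close>

text \<open>\<open>eval_even x\<close> sets the odd variables to \<open>0\<close> and the even ones to \<open>x\<close>; it is used to see that
  superpolynomials do not vanish. Its values are polynomials in no variables, so that \<open>lin\<close> applies.\<close>

definition coord_val :: "('a \<Rightarrow> complex) \<Rightarrow> 'a + 'b \<Rightarrow> complex" where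
  "coord_val x i = (case i of Inl j \<Rightarrow> x j | Inr _ \<Rightarrow> 0)"

definition eval_even :: "('a::finite \<Rightarrow> complex) \<Rightarrow> ('a, 'b) superpoly \<Rightarrow> (unit \<Rightarrow>\<^sub>0 complex)" where
  "eval_even x = lext (\<lambda>a. Poly_Mapping.single () (if snd a = {} then \<Prod>i\<in>UNIV. x i ^ fst a i else 0))"

lemma lin_eval_even [intro, simp]: "lin (eval_even x)"
  by (simp add: eval_even_def)

lemma eval_even_sone [simp]: "eval_even x sone = Poly_Mapping.single () 1"
  by (simp add: eval_even_def sone_def)

lemma eval_even_mul:
  fixes p :: "('a::finite, 'b::{finite,linorder}) superpoly"
  shows "eval_even x (mul i p) = cscale (coord_val x i) (eval_even x p)"
proof (rule lin_ext[where p = p])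
  fix a :: "('a, 'b) smonom"
  obtain \<alpha> S where a: "a = (\<alpha>, S)" by (cases a)
  have "(\<Prod>j\<in>UNIV. x j ^ (\<alpha>(i := Suc (\<alpha> i))) j) = x i * (\<Prod>j\<in>UNIV. x j ^ \<alpha> j)" for i
    by (simp add: prod.remove[of UNIV i])
  then show "eval_even x (mul i (Poly_Mapping.single a 1)) = cscale (coord_val x i) (eval_even x (Poly_Mapping.single a 1))"
    by (cases i) (auto simp: a mul_sderiv_single eval_even_def coord_val_def lin_zero[OF lin_lext] simp del: fun_upd_apply)
qed (auto intro!: lin_op_intros lin_compose[OF lin_eval_even])

lemma sderiv_sone [simp]: "sderiv i sone = (0 :: ('a::finite, 'b::{finite,linorder}) superpoly)"
  by (cases i) (auto simp: sone_def mul_sderiv_single)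

lemma sone_Pol [simp]: "sone \<in> Pol 0"
  by (simp add: sone_def single_Pol sdeg_def)

context osp_form
begin

text \<open>\<open>casimir\<close> is a definite description, so dual bases have to be exhibited.
  \<open>W\<close> maps each \<open>b i\<close> to an elementary super-antisymmetric matrix, and
  \<open>b' i\<close> is a signed \<open>B p q\<close>, which reads off the matching entry; the
  constant \<open>1 / 2\<close> cancels the factor 2 of \<open>supertrace_B_right\<close>.\<close>

lemma casimir_exists: "casimir_wrt \<omega> (1 / 2) cas"
proof -
  obtain rk :: "'a + 'b \<Rightarrow> nat" where rk: "inj rk"
    using finite_imp_inj_to_nat_seg[of "UNIV :: ('a + 'b) set"] by auto
  \<comment> \<open>One index pair for each independent entry of \<open>W\<close>, selected by an
    arbitrary ordering \<open>rk\<close> of the basis. Diagonal entries occur only at odd indices: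
    at even ones \<open>eta p p = - 1\<close> forces them to vanish.\<close>
  define I where "I = {(p, q). rk p < rk q \<or> (p = q \<and> odd_index p)}"
  define Wb where "Wb = (\<lambda>(p, q) j s. if j = q \<and> s = p then 1 else if j = p \<and> s = q then eta p q else 0)"
  define b :: "('a + 'b) \<times> ('a + 'b) \<Rightarrow> complex ^ ('a + 'b) ^ ('a + 'b)"
    where "b = (\<lambda>i. \<chi> r s. \<Sum>j\<in>UNIV. H r j * Wb i j s)"
  define b' where "b' = (\<lambda>(p, q). \<chi> r s. psgn q * B p q $ r $ s)"
  define par where "par = (\<lambda>(p :: 'a + 'b, q :: 'a + 'b). odd_index p \<noteq> odd_index q)"
  have W_b: "W (b i) j s = Wb i j s" for i j s
    by (rule W_of_H) (simp add: b_def)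
  have eta_eta: "eta p q * eta q p = 1" for p q
    by (auto simp: eta_def sign_defs)
  have b_osp: "b i \<in> osp_part \<omega> (par i)" if i: "i \<in> I" for i
    unfolding osp_iff
  proof (intro conjI allI)
    obtain p q where pq: "i = (p, q)" by (cases i)
    show "hom_mat (par i) (b i)"
      unfolding hom_mat_def
    proof (intro allI impI)
      fix r s assume "b i $ r $ s \<noteq> 0"
      then have "(\<Sum>j\<in>UNIV. H r j * Wb i j s) \<noteq> 0"
        by (simp add: b_def)
      then obtain j where "H r j * Wb i j s \<noteq> 0"
        by (rule sum.not_neutral_contains_not_neutral)
      then have "odd_index r = odd_index j" "Wb i j s \<noteq> 0" using H_even[of r j] by auto
      then show "(odd_index r \<noteq> odd_index s) = par i"
        by (auto simp: Wb_def pq par_def split: if_splits)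
    qed
    fix j s
    have e: "eta q q = 1" if "p = q" using i that by (auto simp: pq I_def eta_def sign_defs)
    consider "j = q" "s = p" "p \<noteq> q" | "j = p" "s = q" "p \<noteq> q" | "j = q" "s = q" "p = q"
      | "\<not> (j = q \<and> s = p)" "\<not> (j = p \<and> s = q)" by blast
    then show "W (b i) j s = eta j s * W (b i) s j"
      unfolding W_b pq Wb_def prod.case
    proof cases
      case 4
      then have "\<not> (s = q \<and> j = p)" "\<not> (s = p \<and> j = q)" by blast+
      then show "(if j = q \<and> s = p then 1 else if j = p \<and> s = q then eta p q else 0) =
          eta j s * (if s = q \<and> j = p then 1 else if s = p \<and> j = q then eta p q else 0)"
        using 4 by (simp only: if_False) simp
    qed (simp_all add: eta_eta e)
  qed
  have W_b': "W (b' (p, q)) j s = psgn q * W (B p q) j s" for p q j s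
    by (simp add: W_def b'_def sum_distrib_left mult_ac)
  have b'_osp: "b' i \<in> osp_part \<omega> (par i)" for i
  proof -
    obtain p q where pq: "i = (p, q)" by (cases i)
    have "hom_mat (par i) (b' i)"
      using B_osp[of p q] by (auto simp: osp_iff hom_mat_def pq par_def b'_def)
    moreover have "W (b' i) j s = eta j s * W (b' i) s j" for j s
      unfolding pq W_b' by (subst osp_W[OF B_osp, of p q j s]) (simp add: mult_ac)
    ultimately show ?thesis unfolding osp_iff by blast
  qed
  have dual: "1 / 2 * supertrace (b i ** b' i') = (if i = i' then 1 else 0)" if "i \<in> I" "i' \<in> I" for i i'
  proof -
    obtain p q where pq: "i' = (p, q)" by (cases i')
    obtain p' q' where pq': "i = (p', q')" by (cases i)
    have "supertrace (b i ** b' i') = psgn q * supertrace (b i ** B p q)"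
      by (simp add: sum_psgn_if matrix_matrix_mult_def b'_def pq sum_distrib_left mult_ac)
    also have "\<dots> = 2 * Wb i q p"
      by (simp add: supertrace_B_right[OF b_osp[OF that(1)]] W_b)
    also have "Wb i q p = (if i = i' then 1 else 0)"
      using that unfolding Wb_def pq pq' I_def by auto
    finally show ?thesis by simp
  qed
  have span: "M $ r $ s = (\<Sum>(p, q)\<in>I. W M q p * b (p, q) $ r $ s)" if M: "M \<in> osp_part \<omega> f" for M f r s
  proof -
    have *: "(\<Sum>(p, q)\<in>I. W M q p * Wb (p, q) j s) = W M j s" for j s
    proof -
      consider "rk s < rk j" | "rk j < rk s" | "j = s" "odd_index j" | "j = s" "\<not> odd_index j"
        using rk by (metis injD linorder_neqE_nat)
      then show ?thesis
      proof cases
        case 1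
        have "(\<Sum>(p, q)\<in>I. W M q p * Wb (p, q) j s) = (\<Sum>i\<in>I. if i = (s, j) then W M j s else 0)"
          using 1 by (intro sum.cong refl) (auto simp: I_def Wb_def split: if_splits)
        then show ?thesis using 1 by (simp add: I_def)
      next
        case 2
        have "(\<Sum>(p, q)\<in>I. W M q p * Wb (p, q) j s) = (\<Sum>i\<in>I. if i = (j, s) then W M s j * eta j s else 0)"
        proof (intro sum.cong refl)
          fix i assume i: "i \<in> I"
          obtain p q where pq: "i = (p, q)" by (cases i)
          have "\<not> (j = q \<and> s = p)" using 2 i by (auto simp: I_def pq)
          then show "(case i of (p, q) \<Rightarrow> W M q p * Wb (p, q) j s) = (if i = (j, s) then W M s j * eta j s else 0)"
            unfolding pq Wb_def prod.case by (simp only: if_False) auto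
        qed
        then show ?thesis using 2 osp_W[OF M, of j s] by (simp add: I_def)
      next
        case 3
        have "(\<Sum>(p, q)\<in>I. W M q p * Wb (p, q) j s) = (\<Sum>i\<in>I. if i = (j, j) then W M j j else 0)"
          using 3 by (intro sum.cong refl) (auto simp: I_def Wb_def split: if_splits)
        then show ?thesis using 3 by (simp add: I_def)
      next
        case 4
        have "(\<Sum>(p, q)\<in>I. W M q p * Wb (p, q) j s) = 0"
          using 4 by (intro sum.neutral) (auto simp: I_def Wb_def split: if_splits)
        then show ?thesis using 4 osp_W[OF M, of j j] by (simp add: eta_def sign_defs)
      qed
    qed
    have "(\<Sum>(p, q)\<in>I. W M q p * b (p, q) $ r $ s) = (\<Sum>i\<in>I. \<Sum>j\<in>UNIV. H r j * (W M (snd i) (fst i) * Wb i j s))"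
      by (simp add: b_def sum_distrib_left case_prod_beta mult_ac)
    also have "\<dots> = (\<Sum>j\<in>UNIV. H r j * (\<Sum>(p, q)\<in>I. W M q p * Wb (p, q) j s))"
      by (subst sum.swap) (simp add: sum_distrib_left case_prod_beta)
    finally show ?thesis by (simp only: * W_inverse)
  qed
  obtain h where h: "bij_betw h {..<card I} I"
    using ex_bij_betw_nat_finite[of I] by (auto simp: atLeast0LessThan)
  have hI: "h i \<in> I" if "i < card I" for i
    using h that by (auto simp: bij_betw_def)
  have span': "\<exists>a. \<forall>r s. M $ r $ s = (\<Sum>i<card I. a i * b (h i) $ r $ s)" if M: "M \<in> osp_part \<omega> f" for M f
  proof (intro exI allI)
    fix r s
    have "M $ r $ s = (\<Sum>i\<in>I. W M (snd i) (fst i) * b i $ r $ s)"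
      using span[OF M, of r s] by (simp add: case_prod_beta)
    also have "\<dots> = (\<Sum>i<card I. W M (snd (h i)) (fst (h i)) * b (h i) $ r $ s)"
      by (rule sum.reindex_bij_betw[OF h, symmetric])
    finally show "M $ r $ s = (\<Sum>i<card I. W M (snd (h i)) (fst (h i)) * b (h i) $ r $ s)" .
  qed
  have dual': "1 / 2 * supertrace (b (h i) ** b' (h j)) = (if i = j then 1 else 0)"
    if "i < card I" "j < card I" for i j
    using dual[OF hI[OF that(1)] hI[OF that(2)]] h that by (auto simp: bij_betw_def inj_on_def)
  let ?C = "\<lambda>p. \<Sum>i<card I. act (b' (h i)) (act (b (h i)) p)"
  have C: "casimir_wrt \<omega> (1 / 2) ?C"
    unfolding casimir_wrt_def
    by (rule exI[of _ "card I"], rule exI[of _ "\<lambda>i. par (h i)"], rule exI[of _ "\<lambda>i. b (h i)"], rule exI[of _ "\<lambda>i. b' (h i)"],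
        intro conjI allI impI ballI refl)
       (simp_all only: b_osp b'_osp hI span' dual')
  have "?C p = cas p" for p
    using casimir_wrt_eq[OF C, of p] by simp
  then have "?C = cas" by (rule ext)
  then show ?thesis using C by (simp only:)
qed

definition form_mul :: "complex ^ ('a + 'b) \<Rightarrow> ('a, 'b) superop" where
  "form_mul v = sprod (form_as_poly \<omega> v)"

lemma form_mul_sum: "form_mul v p = (\<Sum>j\<in>UNIV. cscale (\<omega> v (axis j 1)) (mul j p))"
  by (simp add: form_mul_def form_as_poly_def lin_simps[OF lin_sprod(2)])

lemma form_axis: "\<omega> v (axis j 1) = (\<Sum>i\<in>UNIV. v $ i * G i j)"
  by (simp add: form_sum axis_def if_distrib[of "\<lambda>c. _ * c"] cong: if_cong)

lemma form_axis_odd: "hom_vec False v \<Longrightarrow> odd_index j \<Longrightarrow> \<omega> v (axis j 1) = 0"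
  unfolding form_axis by (rule sum.neutral) (auto simp: hom_vec_def G_even)

lemma sderiv_form_mul:
  assumes "hom_vec False v"
  shows "sderiv i (form_mul v p) = cscale (\<omega> v (axis i 1)) p + form_mul v (sderiv i p)"
proof -
  have "sderiv i (form_mul v p) = (\<Sum>j\<in>UNIV. cscale (if j = i then \<omega> v (axis i 1) else 0) p + cscale (\<omega> v (axis j 1)) (mul j (sderiv i p)))"
    unfolding form_mul_sum op_simps
    using form_axis_odd[OF assms] by (intro sum.cong refl) (auto simp: sderiv_mul cs.scale_right_distrib sign_defs)
  then show ?thesis by (simp add: sum.distrib sum_cscale_delta[where f = "\<lambda>_. p"] form_mul_sum)
qed

lemma lin_form_mul [intro, simp]: "lin (form_mul v)"
  by (simp add: form_mul_def)

lemma sderiv_form_mul_pow: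
  assumes "hom_vec False v"
  shows "sderiv i ((form_mul v ^^ a) sone) = cscale (of_nat a * \<omega> v (axis i 1)) ((form_mul v ^^ (a - 1)) sone)"
proof (induction a)
  case (Suc a)
  show ?case
  proof (cases a)
    case 0
    then show ?thesis using Suc by (simp add: sderiv_form_mul[OF assms] lin_zero[OF lin_form_mul])
  next
    case (Suc a')
    then show ?thesis using Suc.IH
      by (simp add: sderiv_form_mul[OF assms] lin_scale[OF lin_form_mul] algebra_simps flip: cs.scale_left_distrib)
  qed
qed simp

lemma sum_H_form_axis:
  assumes "hom_vec False v"
  shows "(\<Sum>j\<in>UNIV. H i j * \<omega> v (axis j 1)) = v $ i"
proof -
  have "(\<Sum>j\<in>UNIV. H i j * \<omega> v (axis j 1)) = (\<Sum>j\<in>UNIV. \<Sum>l\<in>UNIV. v $ l * (H i j * G j l))"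
    unfolding form_axis sum_distrib_left
  proof (intro sum.cong refl)
    fix j l
    show "H i j * (v $ l * G l j) = v $ l * (H i j * G j l)"
      using assms G_sym[of l j] by (cases "v $ l = 0") (auto simp: hom_vec_def sign_defs)
  qed
  also have "\<dots> = (\<Sum>l\<in>UNIV. v $ l * (\<Sum>j\<in>UNIV. H i j * G j l))"
    by (subst sum.swap) (simp add: sum_distrib_left)
  finally show ?thesis by (simp add: HG sum_mult_delta)
qed

text \<open>The second derivatives of a power of the linear form, contracted with \<open>H\<close>,
  carry the factor \<open>\<omega> v v\<close>.\<close>

lemma Lap_form_mul_pow:
  assumes "hom_vec False v" "\<omega> v v = 0"
  shows "Lap ((form_mul v ^^ a) sone) = 0"
proof -
  have "Lap ((form_mul v ^^ a) sone) = (\<Sum>i\<in>UNIV. \<Sum>j\<in>UNIV.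
      cscale (H i j * \<omega> v (axis j 1) * (of_nat a * of_nat (a - 1) * \<omega> v (axis i 1))) ((form_mul v ^^ (a - 1 - 1)) sone))"
    by (simp add: Lap_def sderiv_form_mul_pow[OF assms(1)] lin_scale[OF lin_sderiv] mult_ac)
  also have "\<dots> = cscale (\<Sum>i\<in>UNIV. (\<Sum>j\<in>UNIV. H i j * \<omega> v (axis j 1)) * (of_nat a * of_nat (a - 1) * \<omega> v (axis i 1))) ((form_mul v ^^ (a - 1 - 1)) sone)"
    by (simp only: cs.scale_sum_left sum_distrib_right)
  also have "(\<Sum>i\<in>UNIV. (\<Sum>j\<in>UNIV. H i j * \<omega> v (axis j 1)) * (of_nat a * of_nat (a - 1) * \<omega> v (axis i 1))) =
      of_nat a * of_nat (a - 1) * (\<Sum>i\<in>UNIV. \<omega> v (axis i 1) * v $ i)"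
    by (simp add: sum_H_form_axis[OF assms(1)] sum_distrib_left mult_ac)
  also have "(\<Sum>i\<in>UNIV. \<omega> v (axis i 1) * v $ i) = \<omega> v v"
    by (subst form_sum, subst sum.swap) (simp add: form_axis sum_distrib_right)
  finally show ?thesis using assms(2) by simp
qed

lemma Pol_form_mul: "p \<in> Pol d \<Longrightarrow> form_mul v p \<in> Pol (Suc d)"
  unfolding form_mul_sum by (intro Pol_intros Pol_mul)

lemma Pol_form_mul_pow: "(form_mul v ^^ a) sone \<in> Pol a"
  by (induction a) (auto intro: Pol_form_mul)

lemma Pol_X: "p \<in> Pol d \<Longrightarrow> X q p \<in> Pol (Suc d)"
  unfolding X_def by (intro Pol_intros Pol_mul)

lemma Pol_R2: "p \<in> Pol d \<Longrightarrow> R2 p \<in> Pol (d + 2)"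
  unfolding R2_def using Pol_mul[OF Pol_X[of p d]] by (auto intro!: Pol_intros)

lemma Pol_Lap: "p \<in> Pol d \<Longrightarrow> Lap p \<in> Pol (d - 2)"
  unfolding Lap_def using Pol_sderiv[OF Pol_sderiv[of p d]] by (auto intro!: Pol_intros simp: numeral_2_eq_2)

lemma Lap_low:
  assumes "p \<in> Pol d" "d < 2"
  shows "Lap p = 0"
proof -
  have "sderiv i (sderiv j p) = 0" for i j
    using Pol_sderiv[OF assms(1), of j] assms(2) by (intro sderiv_Pol_0) auto
  then show ?thesis by (simp add: Lap_def)
qed

lemma cas_Pol:
  assumes "p \<in> Pol d"
  shows "cas p = cscale (of_nat d * (of_nat d + sdim - 2)) p - R2 (Lap p)"
  by (simp add: cas_def euler_Pol[OF assms] lin_scale[OF lin_euler] algebra_simps flip: cs.scale_left_distrib)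

lemma lin_cas [intro, simp]: "lin cas"
  unfolding cas_def by (auto intro!: lin_op_intros lin_compose[OF lin_euler] lin_compose[OF lin_R2])

lemma Pol_cas: 
  assumes "p \<in> Pol d"
  shows "cas p \<in> Pol d"
proof (cases "d < 2")
  case True
  then show ?thesis using assms by (simp add: cas_Pol[OF assms] Lap_low[OF assms] lin_zero[OF lin_R2] Pol_cscale)
next
  case False
  then have "d - 2 + 2 = d" by simp
  then have "R2 (Lap p) \<in> Pol d" using Pol_R2[OF Pol_Lap[OF assms]] by (simp only:)
  then show ?thesis using assms by (simp add: cas_Pol[OF assms] Pol_intros)
qed

text \<open>The scalar part of \<open>cas\<close> grows by \<open>4 * d + 2 * sdim\<close> when the
  degree rises from \<open>d\<close> to \<open>d + 2\<close>; this is exactly the scalar in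
  \<open>Lap_R2\<close>.\<close>

lemma cas_R2: "cas (R2 p) = R2 (cas p)"
proof (rule lin_ext_Pol[where p = p])
  fix d and p :: "('a, 'b) superpoly" assume p: "p \<in> Pol d"
  have "cas (R2 p) = cscale (of_nat (d + 2) * (of_nat (d + 2) + sdim - 2) - 4 * of_nat d - 2 * sdim) (R2 p) - R2 (R2 (Lap p))"
    by (simp only: cas_Pol[OF Pol_R2[OF p]] Lap_R2 euler_Pol[OF p] lin_add[OF lin_R2] lin_scale[OF lin_R2]
        cs.scale_left_diff_distrib cs.scale_left_distrib cs.scale_scale diff_diff_eq add_ac)
  also have "of_nat (d + 2) * (of_nat (d + 2) + sdim - 2) - 4 * of_nat d - 2 * sdim = of_nat d * (of_nat d + sdim - 2)"
    by (simp add: algebra_simps)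
  also have "cscale (of_nat d * (of_nat d + sdim - 2)) (R2 p) - R2 (R2 (Lap p)) = R2 (cas p)"
    by (simp only: cas_Pol[OF p] lin_diff[OF lin_R2] lin_scale[OF lin_R2])
  finally show "cas (R2 p) = R2 (cas p)" .
qed (auto intro: lin_compose[OF lin_cas] lin_compose[OF lin_R2])

lemma cas_R2_pow: "cas ((R2 ^^ j) p) = (R2 ^^ j) (cas p)"
  by (induction j) (auto simp: cas_R2)

lemma cas_form_mul_pow:
  assumes "hom_vec False v" "\<omega> v v = 0"
  shows "cas ((form_mul v ^^ a) sone) = cscale (of_nat a * (of_nat a + sdim - 2)) ((form_mul v ^^ a) sone)"
  by (simp add: cas_Pol[OF Pol_form_mul_pow] Lap_form_mul_pow[OF assms] lin_zero[OF lin_R2])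

lemma exists_isotropic:
  assumes "CARD('a) \<ge> 2"
  shows "\<exists>v. v \<noteq> 0 \<and> hom_vec False v \<and> \<omega> v v = 0"
proof -
  obtain i1 i2 :: 'a where ne: "i1 \<noteq> i2"
  proof -
    have "\<not> (\<forall>i1 i2 :: 'a. i1 = i2)"
    proof
      assume "\<forall>i1 i2 :: 'a. i1 = i2"
      then have "card (UNIV :: 'a set) \<le> Suc 0" by (subst card_le_Suc0_iff_eq) auto
      then show False using assms by simp
    qed
    then show thesis using that by blast
  qed
  let ?e = "\<lambda>i. axis (Inl i) 1 :: complex ^ ('a + 'b)"
  show ?thesis
  proof (cases "G (Inl i2) (Inl i2) = 0")
    case True
    then show ?thesis
      using hom_axis[of "Inl i2" 1] by (intro exI[of _ "?e i2"]) (auto simp: G_def axis_eq_0_iff)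
  next
    case False
    define g11 g12 g22 where g: "g11 = G (Inl i1) (Inl i1)" "g12 = G (Inl i1) (Inl i2)" "g22 = G (Inl i2) (Inl i2)"
    \<comment> \<open>A root of \<open>g22 * t^2 + 2 * g12 * t + g11\<close>, the value of the form
      on the first basis vector plus \<open>t\<close> times the second.\<close>
    define t where "t = (- g12 + csqrt (g12\<^sup>2 - g11 * g22)) / g22"
    define v :: "complex ^ ('a + 'b)" where "v = (\<chi> i. if i = Inl i1 then 1 else if i = Inl i2 then t else 0)"
    have "\<omega> v v = (\<Sum>i\<in>{Inl i1, Inl i2}. \<Sum>j\<in>{Inl i1, Inl i2}. v $ i * G i j * v $ j)"
    proof -
      have "(\<Sum>j\<in>UNIV. v $ i * G i j * v $ j) = (\<Sum>j\<in>{Inl i1, Inl i2}. v $ i * G i j * v $ j)" for i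
        by (intro sum.mono_neutral_right) (auto simp: v_def)
      then have "\<omega> v v = (\<Sum>i\<in>UNIV. \<Sum>j\<in>{Inl i1, Inl i2}. v $ i * G i j * v $ j)"
        by (simp only: form_sum)
      also have "\<dots> = (\<Sum>i\<in>{Inl i1, Inl i2}. \<Sum>j\<in>{Inl i1, Inl i2}. v $ i * G i j * v $ j)"
        by (rule sum.mono_neutral_right) (auto simp: v_def)
      finally show ?thesis .
    qed
    also have "\<dots> = g11 + 2 * g12 * t + g22 * t\<^sup>2"
      using ne G_sym[of "Inl i2" "Inl i1"] by (simp add: v_def g sign_defs algebra_simps power2_eq_square)
    also have "\<dots> = 0"
    proof -
      have "g22 * t = - g12 + csqrt (g12\<^sup>2 - g11 * g22)" using False by (simp add: t_def g)
      then have "(g22 * t + g12)\<^sup>2 = g12\<^sup>2 - g11 * g22" by simp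
      then have "g22 * (g11 + 2 * g12 * t + g22 * t\<^sup>2) = 0" by (simp add: algebra_simps power2_eq_square)
      then show ?thesis using False by (simp add: g)
    qed
    finally have "\<omega> v v = 0" .
    moreover have "v $ Inl i1 \<noteq> 0" by (simp add: v_def)
    then have "v \<noteq> 0" by auto
    moreover have "hom_vec False v" by (auto simp: hom_vec_def v_def)
    ultimately show ?thesis by blast
  qed
qed

text \<open>Such an \<open>x\<close> is an even point at which both the quadratic form and the
  linear form of \<open>v\<close> are nonzero. If the first candidate is isotropic, adding
  \<open>v\<close> gives it the square \<open>2 * \<omega> v x0\<close>.\<close>

lemma exists_nonvanishing:
  assumes "v \<noteq> 0" "hom_vec False v" "\<omega> v v = 0"
  shows "\<exists>x. hom_vec False x \<and> \<omega> v x \<noteq> 0 \<and> \<omega> x x \<noteq> 0"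
proof -
  obtain w where w: "\<omega> v w \<noteq> 0"
    using nondegenerate assms(1) by (auto simp: nondegenerate_form_def)
  define x0 :: "complex ^ ('a + 'b)" where "x0 = (\<chi> i. if odd_index i then 0 else w $ i)"
  have hx0: "hom_vec False x0" by (auto simp: hom_vec_def x0_def)
  have "v $ i * G i j * x0 $ j = v $ i * G i j * w $ j" for i j
    using assms(2) G_even[of i j] by (cases "v $ i = 0") (auto simp: hom_vec_def x0_def)
  then have "\<omega> v x0 = \<omega> v w"
    by (simp only: form_sum)
  then have x0: "\<omega> v x0 \<noteq> 0" using w by simp
  show ?thesis
  proof (cases "\<omega> x0 x0 = 0")
    case False
    then show ?thesis using hx0 x0 by blast
  next
    case True
    have "\<omega> x0 v = super_sign False False * \<omega> v x0"
      using supersymmetric assms(2) hx0 unfolding supersymmetric_form_def by blast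
    then have "\<omega> x0 v = \<omega> v x0" by (simp add: super_sign_def)
    moreover have "\<omega> (x0 + v) y = \<omega> x0 y + \<omega> v y" "\<omega> y (x0 + v) = \<omega> y x0 + \<omega> y v" for y
      by (simp_all add: form_sum sum.distrib algebra_simps)
    ultimately have "\<omega> (x0 + v) (x0 + v) = 2 * \<omega> v x0" "\<omega> v (x0 + v) = \<omega> v x0"
      using True assms(3) by simp_all
    moreover have "hom_vec False (x0 + v)" using hx0 assms(2) by (simp add: hom_vec_def) (metis add_0)
    ultimately show ?thesis using x0 by (intro exI[of _ "x0 + v"]) auto
  qed
qed

text \<open>Evaluation at a point from \<open>exists_nonvanishing\<close> turns \<open>R2\<close>
  and \<open>form_mul v\<close> into multiplication by nonzero numbers.\<close>

lemma R2_form_mul_pow_nonzero: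
  assumes "v \<noteq> 0" "hom_vec False v" "\<omega> v v = 0"
  shows "(R2 ^^ j) ((form_mul v ^^ a) sone) \<noteq> 0"
proof -
  obtain x where x: "hom_vec False x" "\<omega> v x \<noteq> 0" "\<omega> x x \<noteq> 0"
    using exists_nonvanishing[OF assms] by blast
  define y where "y i = x $ Inl i" for i
  have y: "coord_val y i = x $ i" for i
    using x(1) by (cases i) (auto simp: coord_val_def y_def hom_vec_def odd_index_def)
  have ev_form_mul: "eval_even y (form_mul v p) = cscale (\<omega> v x) (eval_even y p)" for p
  proof -
    have "\<omega> v x = (\<Sum>j\<in>UNIV. \<omega> v (axis j 1) * x $ j)"
      by (subst form_sum, subst sum.swap) (simp add: form_axis sum_distrib_right)
    then show ?thesis by (simp add: form_mul_sum lin_simps[OF lin_eval_even] eval_even_mul y cs.scale_sum_left)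
  qed
  have ev_R2: "eval_even y (R2 p) = cscale (\<omega> x x) (eval_even y p)" for p
  proof -
    have "eval_even y (R2 p) = cscale (\<Sum>i\<in>UNIV. psgn i * (x $ i * (\<Sum>j\<in>UNIV. G i j * x $ j))) (eval_even y p)"
      by (simp add: R2_def X_def lin_simps[OF lin_eval_even] lin_simps[OF lin_sprod(1)] eval_even_mul y
          cs.scale_sum_left cs.scale_sum_right sum_distrib_left mult_ac)
    also have "(\<Sum>i\<in>UNIV. psgn i * (x $ i * (\<Sum>j\<in>UNIV. G i j * x $ j))) = \<omega> x x"
    proof -
      have "psgn i * (x $ i * (G i j * x $ j)) = x $ i * G i j * x $ j" for i j
        using x(1) by (cases "x $ i = 0") (auto simp: hom_vec_def sign_defs)
      then show ?thesis by (simp only: form_sum sum_distrib_left)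
    qed
    finally show ?thesis .
  qed
  have "eval_even y ((R2 ^^ j) p) = cscale (\<omega> x x ^ j) (eval_even y p)" for p
    by (induction j) (auto simp: ev_R2)
  moreover have "eval_even y ((form_mul v ^^ a) p) = cscale (\<omega> v x ^ a) (eval_even y p)" for p
    by (induction a) (auto simp: ev_form_mul)
  ultimately have "eval_even y ((R2 ^^ j) ((form_mul v ^^ a) sone)) = Poly_Mapping.single () (\<omega> x x ^ j * \<omega> v x ^ a)"
    by simp
  moreover have "\<omega> x x ^ j * \<omega> v x ^ a \<noteq> 0" using x by simp
  ultimately show ?thesis by (metis lin_zero[OF lin_eval_even] lookup_single_eq lookup_zero)
qed

text \<open>By \<open>casimir_wrt_eq\<close> two candidates differ only by a scalar. The
  normalization with exponent 1 fixes this scalar, because the prescribed eigenvalue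
  \<open>- 1 - 2 * k\<close> is nonzero.\<close>

lemma casimir_eq_cas:
  assumes "CARD('a) \<ge> 2" "sdim = - 2 * of_nat k"
  shows "casimir k \<omega> = cas"
  unfolding casimir_def
proof (rule the_equality)
  show "(\<exists>c. c \<noteq> 0 \<and> casimir_wrt \<omega> c cas) \<and>
    (\<forall>a v. hom_vec False v \<and> \<omega> v v = 0 \<longrightarrow>
       (let u = (sprod (form_as_poly \<omega> v) ^^ a) sone
        in cas u = cscale (of_nat a * (of_nat a - 2 * of_nat k - 2)) u))"
    using casimir_exists cas_form_mul_pow unfolding Let_def form_mul_def
    by (auto intro!: exI[of _ "1 / 2 :: complex"] simp: assms(2))
next
  fix C
  assume C: "(\<exists>c. c \<noteq> 0 \<and> casimir_wrt \<omega> c C) \<and>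
    (\<forall>a v. hom_vec False v \<and> \<omega> v v = 0 \<longrightarrow>
       (let u = (sprod (form_as_poly \<omega> v) ^^ a) sone
        in C u = cscale (of_nat a * (of_nat a - 2 * of_nat k - 2)) u))"
  then obtain c where c: "c \<noteq> 0" "casimir_wrt \<omega> c C" by blast
  obtain v where v: "v \<noteq> 0" "hom_vec False v" "\<omega> v v = 0" using exists_isotropic[OF assms(1)] by blast
  define u where "u = (form_mul v ^^ 1) sone"
  have u0: "u \<noteq> 0" using R2_form_mul_pow_nonzero[OF v, of 0 1] by (simp add: u_def)
  have "C u = cscale (of_nat 1 * (of_nat 1 - 2 * of_nat k - 2)) u"
    using C v unfolding u_def form_mul_def Let_def by blast
  moreover have "C u = cscale (1 / (2 * c)) (cas u)"
    by (rule casimir_wrt_eq[OF c(2,1)])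
  moreover have "cas u = cscale (of_nat 1 * (of_nat 1 + sdim - 2)) u"
    unfolding u_def by (rule cas_form_mul_pow[OF v(2,3)])
  ultimately have "cscale (1 / (2 * c) * (- 1 - 2 * of_nat k)) u = cscale (- 1 - 2 * of_nat k) u"
    by (simp add: assms(2))
  then have "1 / (2 * c) * (- 1 - 2 * of_nat k) = (- 1 - 2 * of_nat k :: complex)"
    using u0 by (simp only: cs.scale_cancel_right) simp
  moreover have "(- 1 - 2 * of_nat k :: complex) \<noteq> 0"
  proof
    assume "(- 1 - 2 * of_nat k :: complex) = 0"
    moreover have "complex_of_nat (2 * k + 1) = - (- 1 - 2 * of_nat k)" by simp
    ultimately have "complex_of_nat (2 * k + 1) = 0" by (simp only: minus_zero)
    then show False by (simp only: of_nat_eq_0_iff)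
  qed
  ultimately have "1 / (2 * c) = 1" by (metis mult_cancel_right mult_1)
  then show "C = cas" using casimir_wrt_eq[OF c(2,1)] by (auto simp: fun_eq_iff)
qed

end

section \<open>Functional calculus and differential operators\<close>

definition poly_act :: "(('x \<Rightarrow>\<^sub>0 complex) \<Rightarrow> ('x \<Rightarrow>\<^sub>0 complex)) \<Rightarrow> complex poly \<Rightarrow> ('x \<Rightarrow>\<^sub>0 complex) \<Rightarrow> ('x \<Rightarrow>\<^sub>0 complex)" where
  "poly_act F q p = (\<Sum>i\<le>degree q. cscale (coeff q i) ((F ^^ i) p))"

lemma poly_act_upto: "degree q \<le> n \<Longrightarrow> poly_act F q p = (\<Sum>i\<le>n. cscale (coeff q i) ((F ^^ i) p))"
  unfolding poly_act_def by (rule sum.mono_neutral_left) (auto simp: coeff_eq_0)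

lemma poly_act_add: "poly_act F (q + r) p = poly_act F q p + poly_act F r p"
proof -
  let ?n = "max (degree q) (degree r)"
  show ?thesis
    by (simp add: poly_act_upto[of _ ?n] degree_add_le_max cs.scale_left_distrib sum.distrib)
qed

lemma poly_act_smult: "poly_act F (smult c q) p = cscale c (poly_act F q p)"
  by (simp add: poly_act_upto[of "smult c q" "degree q"] degree_smult_le poly_act_def cs.scale_sum_right)

lemma poly_act_0 [simp]: "poly_act F 0 p = 0" and poly_act_1 [simp]: "poly_act F 1 p = p"
  by (simp_all add: poly_act_def)

lemma poly_act_diff: "poly_act F (q - r) p = poly_act F q p - poly_act F r p"
proof -
  have "q - r = q + smult (-1) r" by simp
  then show ?thesis by (simp only: poly_act_add poly_act_smult) simp
qed

lemma poly_act_sum: "poly_act F (sum q A) p = (\<Sum>a\<in>A. poly_act F (q a) p)"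
  by (induction A rule: infinite_finite_induct) (auto simp: poly_act_add)

lemma lin_poly_act: "lin F \<Longrightarrow> lin (poly_act F q)"
  unfolding poly_act_def by (intro lin_intros)

context
  fixes F :: "('x \<Rightarrow>\<^sub>0 complex) \<Rightarrow> ('x \<Rightarrow>\<^sub>0 complex)"
  assumes F: "lin F"
begin

lemma poly_act_pCons: "poly_act F (pCons a q) p = cscale a p + F (poly_act F q p)"
proof -
  have "poly_act F (pCons a q) p = (\<Sum>i\<le>Suc (degree q). cscale (coeff (pCons a q) i) ((F ^^ i) p))"
    by (rule poly_act_upto) (simp add: degree_pCons_le)
  also have "\<dots> = cscale a p + F (poly_act F q p)"
    by (subst sum.atMost_Suc_shift) (simp add: poly_act_def lin_sum[OF F] lin_scale[OF F])
  finally show ?thesis .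
qed

lemma poly_act_linear: "poly_act F [:a, b:] p = cscale a p + cscale b (F p)"
  by (simp add: poly_act_pCons lin_scale[OF F] lin_zero[OF F])

lemma poly_act_mult: "poly_act F (q * r) p = poly_act F q (poly_act F r p)"
  by (induction q) (simp_all add: poly_act_pCons poly_act_add poly_act_smult)

lemma poly_act_commute: "poly_act F q (poly_act F r p) = poly_act F r (poly_act F q p)"
  by (simp add: mult.commute flip: poly_act_mult)

lemma poly_act_eigen: "F p = cscale c p \<Longrightarrow> poly_act F q p = cscale (poly q c) p"
  by (induction q) (auto simp: poly_act_pCons lin_scale[OF F] algebra_simps cs.scale_left_distrib)

lemma poly_act_intertwine:
  assumes "lin T" "\<And>p. T (F p) = F (T p)"
  shows "T (poly_act F q p) = poly_act F q (T p)"
  by (induction q) (auto simp: poly_act_pCons lin_simps[OF assms(1)] assms(2))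

lemma poly_act_shift: "poly_act F ([:- c, 1:] * q) p = poly_act F q (F p - cscale c p)"
  by (subst poly_act_mult, subst poly_act_commute) (simp add: poly_act_linear)

lemma poly_act_shift': "poly_act F ([:- c, 1:] * q) p = F (poly_act F q p) - cscale c (poly_act F q p)"
  by (subst poly_act_mult) (simp add: poly_act_linear)

lemma poly_act_funpow: "((\<lambda>q. F q - cscale c q) ^^ N) p = poly_act F ([:- c, 1:] ^ N) p"
  by (induction N) (simp_all add: poly_act_shift' del: mult_pCons_left)

text \<open>This plays the role of a coprimality argument: the last nonzero vector among the images
  of \<open>w\<close> under powers of \<open>F - c\<close> would be an eigenvector, on which
  \<open>r\<close> acts by the nonzero scalar \<open>poly r c\<close>.\<close>

lemma gen_eigen_kill:
  assumes "poly_act F ([:- c, 1:] ^ n) w = 0" "poly_act F r w = 0" "poly r c \<noteq> 0"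
  shows "w = 0"
  using assms(1)
proof (induction n)
  case (Suc n)
  define u where "u = poly_act F ([:- c, 1:] ^ n) w"
  have "F u = cscale c u" using Suc.prems by (simp add: u_def poly_act_shift' del: mult_pCons_left)
  then have "poly_act F r u = cscale (poly r c) u" by (rule poly_act_eigen)
  moreover have "poly_act F r u = 0"
    unfolding u_def by (subst poly_act_commute) (simp add: assms(2) lin_zero[OF lin_poly_act[OF F]])
  ultimately have "u = 0" using assms(3) by simp
  then show ?case using Suc.IH by (simp add: u_def)
qed simp

text \<open>\<open>F - c\<close> is the nonzero scalar \<open>a - c\<close> plus
  \<open>F - a\<close>, which is nilpotent on the generalized eigenspace of \<open>a\<close>. The
  induction on \<open>n\<close> inverts it there without leaving \<open>S\<close>.\<close>

lemma shift_surj_gen_eigen: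
  assumes S: "\<And>p q. p \<in> S \<Longrightarrow> q \<in> S \<Longrightarrow> p - q \<in> S" "\<And>c p. p \<in> S \<Longrightarrow> cscale c p \<in> S" "\<And>p. p \<in> S \<Longrightarrow> F p \<in> S"
    and "a \<noteq> c" "q \<in> S" "poly_act F ([:- a, 1:] ^ n) q = 0"
  shows "\<exists>u\<in>S. poly_act F ([:- a, 1:] ^ n) u = 0 \<and> F u - cscale c u = q"
  using assms(5,6)
proof (induction n arbitrary: q)
  case 0
  have "(0 :: 'x \<Rightarrow>\<^sub>0 complex) \<in> S" using S(2)[OF 0(1), of 0] by simp
  then show ?case using 0 by (intro bexI[of _ 0]) (auto simp: lin_zero[OF F])
next
  case (Suc n)
  define q' where "q' = F q - cscale a q"
  have "poly_act F ([:- a, 1:] ^ n) q' = 0"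
    using Suc.prems by (simp add: q'_def poly_act_shift del: mult_pCons_left)
  moreover have "q' \<in> S" using Suc.prems S by (simp add: q'_def)
  ultimately obtain u' where u': "u' \<in> S" "poly_act F ([:- a, 1:] ^ n) u' = 0" "F u' - cscale c u' = q'"
    using Suc.IH by blast
  define u where "u = cscale (1 / (a - c)) (q - u')"
  have "poly_act F ([:- a, 1:] ^ Suc n) u' = 0"
    using u'(2) by (simp add: poly_act_shift' lin_zero[OF F] del: mult_pCons_left)
  then have "poly_act F ([:- a, 1:] ^ Suc n) u = 0"
    using Suc.prems(2) unfolding u_def by (simp only: lin_scale[OF lin_poly_act[OF F]] lin_diff[OF lin_poly_act[OF F]]) simp
  moreover have "u \<in> S" using Suc.prems(1) u'(1) S by (simp add: u_def)
  moreover have "F u - cscale c u = q"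
  proof -
    have "F u - cscale c u = cscale (1 / (a - c)) (F q - cscale c q - (F u' - cscale c u'))"
      by (simp add: u_def lin_scale[OF F] lin_diff[OF F] cs.scale_right_diff_distrib mult.commute algebra_simps)
    also have "F q - cscale c q - (F u' - cscale c u') = cscale (a - c) q"
      by (simp add: u'(3) q'_def cs.scale_left_diff_distrib)
    finally show ?thesis using assms(4) by simp
  qed
  ultimately show ?case by blast
qed

text \<open>Primary decomposition, proved by peeling off one linear factor, with repeated factors
  allowed. The components of \<open>(F - c) p\<close> at the values other than \<open>c\<close> are
  lifted through \<open>F - c\<close> by \<open>shift_surj_gen_eigen\<close>; what remains of
  \<open>p\<close> belongs to \<open>c\<close>.\<close>

lemma gen_eigen_decomposition:
  assumes S: "\<And>p q. p \<in> S \<Longrightarrow> q \<in> S \<Longrightarrow> p - q \<in> S" "\<And>c p. p \<in> S \<Longrightarrow> cscale c p \<in> S" "\<And>p. p \<in> S \<Longrightarrow> F p \<in> S"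
    and "p \<in> S" "poly_act F (\<Prod>c\<leftarrow>cs. [:- c, 1:]) p = 0"
  shows "\<exists>f. (\<forall>c\<in>set cs. f c \<in> S \<and> (\<exists>n. poly_act F ([:- c, 1:] ^ n) (f c) = 0)) \<and> p = (\<Sum>c\<in>set cs. f c)"
  using assms(4,5)
proof (induction cs arbitrary: p)
  case (Cons c cs)
  define q where "q = F p - cscale c p"
  have sumS: "sum f A \<in> S" if "\<And>a. a \<in> A \<Longrightarrow> f a \<in> S" for f :: "complex \<Rightarrow> 'x \<Rightarrow>\<^sub>0 complex" and A
  proof -
    have 0: "0 \<in> S" using S(2)[OF Cons.prems(1), of 0] by simp
    have add: "p + q \<in> S" if "p \<in> S" "q \<in> S" for p q
      using S(1)[OF that(1) S(1)[OF 0 that(2)]] by simp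
    show ?thesis using that
      by (induction A rule: infinite_finite_induct) (auto simp: 0 add)
  qed
  have "q \<in> S" using S Cons.prems by (simp add: q_def)
  moreover have "poly_act F (\<Prod>c\<leftarrow>cs. [:- c, 1:]) q = 0"
    using Cons.prems(2) by (simp add: poly_act_shift q_def del: mult_pCons_left)
  ultimately obtain f where f: "\<And>c. c \<in> set cs \<Longrightarrow> f c \<in> S \<and> (\<exists>n. poly_act F ([:- c, 1:] ^ n) (f c) = 0)"
      "q = (\<Sum>c\<in>set cs. f c)"
    using Cons.IH by blast
  have "\<exists>u. u \<in> S \<and> (\<exists>n. poly_act F ([:- a, 1:] ^ n) u = 0) \<and> F u - cscale c u = f a" if a: "a \<in> set cs - {c}" for a
  proof -
    obtain n where n: "poly_act F ([:- a, 1:] ^ n) (f a) = 0" using f(1) a by blast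
    from shift_surj_gen_eigen[OF S _ _ n, of c] f(1)[of a] a show ?thesis by blast
  qed
  then obtain u where u: "\<And>a. a \<in> set cs - {c} \<Longrightarrow> u a \<in> S \<and> (\<exists>n. poly_act F ([:- a, 1:] ^ n) (u a) = 0) \<and> F (u a) - cscale c (u a) = f a"
    by metis
  \<comment> \<open>\<open>F - c\<close> maps this remainder to the component of \<open>q\<close> at
    \<open>c\<close>, or to 0 if \<open>c\<close> does not occur in \<open>cs\<close>.\<close>
  define v where "v = p - (\<Sum>a\<in>set cs - {c}. u a)"
  have vS: "v \<in> S" unfolding v_def using u Cons.prems(1) S(1) sumS by blast
  have "poly_act F [:- c, 1:] v = q - (\<Sum>a\<in>set cs - {c}. F (u a) - cscale c (u a))"
    by (simp add: poly_act_linear v_def q_def lin_diff[OF F] lin_sum[OF F] cs.scale_right_diff_distrib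
        cs.scale_sum_right sum_subtractf sum_negf algebra_simps)
  also have "(\<Sum>a\<in>set cs - {c}. F (u a) - cscale c (u a)) = (\<Sum>a\<in>set cs - {c}. f a)"
    using u by (intro sum.cong refl) blast
  also have "q - \<dots> = (if c \<in> set cs then f c else 0)"
    by (simp add: f(2) sum.remove[of _ c])
  finally have "\<exists>n. poly_act F ([:- c, 1:] ^ n) (poly_act F [:- c, 1:] v) = 0"
    using f(1)[of c] by (auto simp: lin_zero[OF lin_poly_act[OF F]])
  then obtain n where "poly_act F ([:- c, 1:] ^ n) (poly_act F [:- c, 1:] v) = 0" by blast
  then have "poly_act F ([:- c, 1:] ^ Suc n) v = 0"
    by (simp only: power_Suc2 poly_act_mult)
  then have v: "\<exists>n. poly_act F ([:- c, 1:] ^ n) v = 0" by blast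
  have "p = (\<Sum>a\<in>set (c # cs). (u(c := v)) a)"
  proof -
    have "(\<Sum>a\<in>set (c # cs). (u(c := v)) a) = v + (\<Sum>a\<in>set cs - {c}. (u(c := v)) a)"
      by (simp add: sum.insert_remove)
    also have "(\<Sum>a\<in>set cs - {c}. (u(c := v)) a) = (\<Sum>a\<in>set cs - {c}. u a)"
      by (intro sum.cong) auto
    finally show ?thesis by (simp add: v_def)
  qed
  moreover have "\<forall>a\<in>set (c # cs). (u(c := v)) a \<in> S \<and> (\<exists>n. poly_act F ([:- a, 1:] ^ n) ((u(c := v)) a) = 0)"
    using u v vS by auto
  ultimately show ?case by blast
qed auto

end

section \<open>Constant-coefficient and polynomial differential operators\<close>

lemma op_span_base: "F \<in> S \<Longrightarrow> F \<in> op_span S"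
  using op_span_add[OF _ op_span_zero, of F S 1] by simp

lemma op_span_plus: "F \<in> op_span S \<Longrightarrow> G \<in> op_span S \<Longrightarrow> (\<lambda>p. F p + G p) \<in> op_span S"
proof (induction rule: op_span.induct)
  case (op_span_add F G' c)
  have "(\<lambda>p. cscale c (F p) + (G' p + G p)) \<in> op_span S"
    using op_span_add by (intro op_span.op_span_add) auto
  then show ?case by (simp add: add.assoc)
qed simp

lemma op_span_scale: "F \<in> op_span S \<Longrightarrow> (\<lambda>p. cscale c (F p)) \<in> op_span S"
proof (induction rule: op_span.induct)
  case (op_span_add F G c')
  then have "(\<lambda>p. cscale (c * c') (F p) + cscale c (G p)) \<in> op_span S"
    by (intro op_span.op_span_add) auto
  then show ?case by (simp add: cs.scale_right_distrib)
qed (simp add: op_span_zero)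

lemma op_span_minus: "F \<in> op_span S \<Longrightarrow> G \<in> op_span S \<Longrightarrow> (\<lambda>p. F p - G p) \<in> op_span S"
  using op_span_plus[OF _ op_span_scale[of G S "-1"], of F] by simp

lemma op_span_sum: "(\<And>a. a \<in> A \<Longrightarrow> F a \<in> op_span S) \<Longrightarrow> (\<lambda>p. \<Sum>a\<in>A. F a p) \<in> op_span S"
  by (induction A rule: infinite_finite_induct) (auto intro: op_span_zero op_span_plus)

lemma op_span_map:
  assumes "F \<in> op_span S" "T (\<lambda>p. 0) = (\<lambda>p. 0)"
    "\<And>c F G. F \<in> S \<Longrightarrow> G \<in> op_span S \<Longrightarrow> T (\<lambda>p. cscale c (F p) + G p) = (\<lambda>p. cscale c (T F p) + T G p)"
    "\<And>F. F \<in> S \<Longrightarrow> T F \<in> op_span S'"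
  shows "T F \<in> op_span S'"
  using assms(1)
proof (induction rule: op_span.induct)
  case (op_span_add F G c)
  then show ?case
    by (simp add: assms(3) op_span_plus op_span_scale assms(4))
qed (simp add: assms(2) op_span_zero)

lemma lin_op_span: "F \<in> op_span S \<Longrightarrow> (\<And>G. G \<in> S \<Longrightarrow> lin G) \<Longrightarrow> lin F"
  by (induction rule: op_span.induct) (auto intro!: lin_intros)

primrec derivs :: "('a + 'b::linorder) list \<Rightarrow> ('a, 'b) superop" where
  "derivs [] = (\<lambda>p. p)"
| "derivs (j # js) = (\<lambda>p. sderiv j (derivs js p))"

lemma Diff_alt: "Diff d = op_span {derivs js | js. length js = d}"
proof -
  have "foldr (\<lambda>j F. sderiv j \<circ> F) js id = derivs js" for js :: "('a + 'b::linorder) list"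
    by (induction js) (auto simp: fun_eq_iff)
  then show ?thesis by (simp add: Diff_def)
qed

lemma lin_derivs: "lin (derivs js)"
  by (induction js) (auto intro: lin_compose[OF lin_sderiv])

lemma lin_Diff: "D \<in> Diff d \<Longrightarrow> lin D"
  unfolding Diff_alt by (rule lin_op_span) (auto intro: lin_derivs)

lemma lin_PolDiff: "D \<in> PolDiff d d' \<Longrightarrow> lin D"
  unfolding PolDiff_def by (rule lin_op_span) (auto intro!: lin_compose[OF lin_sprod(1)] intro: lin_Diff)

lemma derivs_snoc: "derivs (js @ [k]) p = derivs js (sderiv k p)"
  by (induction js) auto

lemma Diff_sderiv_right:
  fixes D :: "('a, 'b::linorder) superop"
  assumes "D \<in> Diff d"
  shows "(\<lambda>p. D (sderiv k p)) \<in> Diff (Suc d)"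
  using assms unfolding Diff_alt
proof (rule op_span_map)
  fix F :: "('a, 'b) superop" assume "F \<in> {derivs js |js. length js = d}"
  then obtain js where js: "length js = d" "F = derivs js" by blast
  then show "(\<lambda>p. F (sderiv k p)) \<in> op_span {derivs js |js. length js = Suc d}"
    by (intro op_span_base CollectI exI[of _ "js @ [k]"]) (auto simp: derivs_snoc)
qed auto

lemma Diff_sderiv_left:
  fixes D :: "('a, 'b::linorder) superop"
  assumes "D \<in> Diff d"
  shows "(\<lambda>p. sderiv k (D p)) \<in> Diff (Suc d)"
  using assms unfolding Diff_alt
proof (rule op_span_map)
  fix F :: "('a, 'b) superop" assume "F \<in> {derivs js |js. length js = d}"
  then obtain js where js: "length js = d" "F = derivs js" by blast
  then show "(\<lambda>p. sderiv k (F p)) \<in> op_span {derivs js |js. length js = Suc d}"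
    by (intro op_span_base CollectI exI[of _ "k # js"]) auto
qed (auto simp: lin_zero[OF lin_sderiv] lin_add[OF lin_sderiv] lin_scale[OF lin_sderiv])

lemma id_Diff: "(\<lambda>p. p) \<in> Diff 0"
  unfolding Diff_alt by (rule op_span_base) (auto intro: exI[of _ "[]"])

lemma PolDiff_base: "p \<in> Pol d \<Longrightarrow> D \<in> Diff d' \<Longrightarrow> (\<lambda>q. sprod p (D q)) \<in> PolDiff d d'"
  unfolding PolDiff_def by (rule op_span_base) blast

lemma PolDiff_sandwich:
  fixes D :: "('a::finite, 'b::{finite,linorder}) superop"
  assumes "D \<in> PolDiff d d'"
  shows "(\<lambda>p. mul i (D (sderiv k p))) \<in> PolDiff (Suc d) (Suc d')"
  using assms unfolding PolDiff_def[of d d']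
proof (subst PolDiff_def, rule op_span_map)
  fix F assume "F \<in> {(\<lambda>q. sprod p (D q)) |p D. p \<in> (Pol d :: ('a, 'b) superpoly set) \<and> D \<in> Diff d'}"
  then obtain p D where pD: "F = (\<lambda>q. sprod p (D q))" "p \<in> Pol d" "D \<in> Diff d'" by blast
  have "(\<lambda>q. sprod (mul i p) (D (sderiv k q))) \<in> PolDiff (Suc d) (Suc d')"
    using pD by (intro PolDiff_base Pol_mul Diff_sderiv_right)
  then show "(\<lambda>p. mul i (F (sderiv k p))) \<in> op_span {(\<lambda>q. sprod p (D q)) |p D. p \<in> Pol (Suc d) \<and> D \<in> Diff (Suc d')}"
    by (simp add: pD mul_sprod PolDiff_def)
qed (auto simp: lin_zero[OF lin_sprod(1)] lin_add[OF lin_sprod(1)] lin_scale[OF lin_sprod(1)])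

lemma PolDiff_sum: "(\<And>a. a \<in> A \<Longrightarrow> F a \<in> PolDiff d d') \<Longrightarrow> (\<lambda>p. \<Sum>a\<in>A. F a p) \<in> PolDiff d d'"
  unfolding PolDiff_def by (rule op_span_sum)

lemma PolDiff_scale: "F \<in> PolDiff d d' \<Longrightarrow> (\<lambda>p. cscale c (F p)) \<in> PolDiff d d'"
  unfolding PolDiff_def by (rule op_span_scale)

lemma PolDiff_minus: "F \<in> PolDiff d d' \<Longrightarrow> G \<in> PolDiff d d' \<Longrightarrow> (\<lambda>p. F p - G p) \<in> PolDiff d d'"
  unfolding PolDiff_def by (rule op_span_minus)

lemma id_PolDiff: "(\<lambda>p :: ('a::finite, 'b::{finite,linorder}) superpoly. p) \<in> PolDiff 0 0"
proof -
  have "(\<lambda>p :: ('a, 'b) superpoly. sprod sone p) = (\<lambda>p. p)" by (rule ext) simp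
  then show ?thesis using PolDiff_base[OF sone_Pol id_Diff] by metis
qed

lemma mixed_mixed [simp]: "mixed i (mixed i p) = p"
  by (simp add: mixed_def)

lemma lin_mixed [intro, simp]: "lin (mixed i)"
  by (auto simp: mixed_def)

lemma mixed_sderiv:
  fixes p :: "('a::finite, 'b::{finite,linorder}) superpoly"
  shows "mixed i (sderiv j p) = cscale (sg i j) (sderiv j (mixed i p))"
  by (auto simp: mixed_def parity_inv_sderiv sign_defs)

lemma mixed_sprod:
  fixes p q :: "('a::finite, 'b::{finite,linorder}) superpoly"
  shows "mixed i (sprod p q) = sprod (mixed i p) (mixed i q)"
  by (auto simp: mixed_def parity_inv_sprod)

lemma parity_inv_Pol: "p \<in> Pol d \<Longrightarrow> parity_inv p \<in> Pol d"
  by (auto simp: Pol_def in_keys_iff lookup_parity_inv)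

lemma mixed_Pol: "p \<in> Pol d \<Longrightarrow> mixed i p \<in> Pol d"
  by (auto simp: mixed_def parity_inv_Pol)

text \<open>Conjugation by \<open>mixed i\<close> produces the Koszul sign, so \<open>D\<close> is
  the supercommutator with coordinate \<open>i\<close>. One derivative is used up in it, which
  lowers the order by one.\<close>

lemma derivs_mul:
  fixes i :: "'a::finite + 'b::{finite,linorder}"
  shows "\<exists>D\<in>Diff (length js - 1). \<forall>q. derivs js (mul i q) = mul i (mixed i (derivs js (mixed i q))) + D q"
proof (induction js)
  case Nil
  have "(\<lambda>p. 0) \<in> Diff 0" by (simp add: Diff_alt op_span_zero)
  then show ?case by (intro bexI[of _ "\<lambda>p. 0"]) auto
next
  case (Cons j js)
  then obtain D where D: "D \<in> Diff (length js - 1)"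
      "\<And>q. derivs js (mul i q) = mul i (mixed i (derivs js (mixed i q))) + D q" by blast
  define D' where "D' q = cscale (if j = i then 1 else 0) (mixed i (derivs js (mixed i q))) + sderiv j (D q)" for q
  have "(\<lambda>q. mixed i (derivs js (mixed i q))) \<in> Diff (length js)"
  proof -
    have "\<exists>c. \<forall>q. mixed i (derivs js (mixed i q)) = cscale c (derivs js q)"
    proof (induction js)
      case Nil
      show ?case by (auto intro!: exI[of _ 1])
    next
      case (Cons j js)
      then obtain c where "\<And>q. mixed i (derivs js (mixed i q)) = cscale c (derivs js q)" by blast
      then show ?case
        by (auto simp: mixed_sderiv lin_scale[OF lin_sderiv] intro!: exI[of _ "sg i j * c"])
    qed
    then obtain c where "\<And>q. mixed i (derivs js (mixed i q)) = cscale c (derivs js q)" by blast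
    moreover have "derivs js \<in> Diff (length js)" unfolding Diff_alt by (rule op_span_base) blast
    ultimately show ?thesis by (simp add: Diff_alt op_span_scale)
  qed
  moreover have "(\<lambda>q. sderiv j (D q)) \<in> Diff (length js)"
  \<comment> \<open>For the empty list the truncated \<open>length js - 1\<close> would give an
    order too high by one; there \<open>D\<close> vanishes.\<close>
  proof (cases js)
    case Nil
    then have "D q = 0" for q using D(2)[of q] by simp
    then show ?thesis by (simp add: lin_zero[OF lin_sderiv] Diff_alt op_span_zero)
  next
    case (Cons a list)
    then show ?thesis using Diff_sderiv_left[OF D(1), of j] by simp
  qed
  ultimately have "D' \<in> Diff (length (j # js) - 1)"
    unfolding D'_def[abs_def] Diff_alt using op_span_plus op_span_scale by auto
  moreover have "derivs (j # js) (mul i q) = mul i (mixed i (derivs (j # js) (mixed i q))) + D' q" for q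
    by (simp add: D(2) lin_add[OF lin_sderiv] sderiv_mul D'_def mixed_sderiv lin_scale[OF lin_sprod(1)] sg_commute[of j i])
  ultimately show ?case by blast
qed

lemma PolDiff_mul:
  fixes F :: "('a::finite, 'b::{finite,linorder}) superop"
  assumes "F \<in> PolDiff r (Suc s)"
  shows "(\<lambda>q. F (mul i q) - mul i (mixed i (F (mixed i q)))) \<in> PolDiff r s"
  using assms unfolding PolDiff_def[of r "Suc s"]
proof (subst PolDiff_def, rule op_span_map)
  fix F assume "F \<in> {(\<lambda>q. sprod p (D q)) |p D. p \<in> (Pol r :: ('a, 'b) superpoly set) \<and> D \<in> Diff (Suc s)}"
  then obtain p D where pD: "F = (\<lambda>q. sprod p (D q))" "p \<in> Pol r" "D \<in> Diff (Suc s)" by blast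
  have "(\<lambda>q. D (mul i q) - mul i (mixed i (D (mixed i q)))) \<in> Diff s"
    using pD(3) unfolding Diff_alt
  proof (rule op_span_map)
    fix D :: "('a, 'b) superop" assume "D \<in> {derivs js |js. length js = Suc s}"
    then obtain js where js: "D = derivs js" "length js = Suc s" by blast
    obtain D' where D': "D' \<in> Diff s" "\<And>q. D (mul i q) = mul i (mixed i (D (mixed i q))) + D' q"
      using derivs_mul[of js i] js by auto
    have "(\<lambda>q. D (mul i q) - mul i (mixed i (D (mixed i q)))) = D'" using D'(2) by (simp add: fun_eq_iff)
    then show "(\<lambda>q. D (mul i q) - mul i (mixed i (D (mixed i q)))) \<in> op_span {derivs js |js. length js = s}"
      using D'(1) by (simp add: Diff_alt)
  qed (auto simp: fun_eq_iff lin_simps[OF lin_sprod(1)] lin_simps[OF lin_mixed] cs.scale_right_diff_distrib)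
  from PolDiff_base[OF pD(2) this]
  have "(\<lambda>q. sprod p (D (mul i q)) - sprod p (mul i (mixed i (D (mixed i q))))) \<in> PolDiff r s"
    by (simp add: lin_diff[OF lin_sprod(1)])
  moreover have "sprod p (mul i (mixed i (D (mixed i q)))) = mul i (mixed i (sprod p (D (mixed i q))))" for q
    by (simp add: sprod_mul mixed_sprod)
  ultimately show "(\<lambda>q. F (mul i q) - mul i (mixed i (F (mixed i q))))
       \<in> op_span {(\<lambda>q. sprod p (D q)) |p D. p \<in> Pol r \<and> D \<in> Diff s}"
    by (simp add: pD(1) PolDiff_def)
qed (auto simp: fun_eq_iff lin_simps[OF lin_sprod(1)] lin_simps[OF lin_mixed] cs.scale_right_diff_distrib)

lemma Diff_low:
  fixes D :: "('a::finite, 'b::{finite,linorder}) superop"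
  assumes "D \<in> Diff (Suc s)"
  shows "D sone = 0"
  using assms unfolding Diff_alt
proof (induction rule: op_span.induct)
  case (op_span_add F G c)
  then obtain js where js: "F = derivs js" "length js = Suc s" by blast
  then obtain js' k where "js = js' @ [k]" by (cases js rule: rev_cases) auto
  then have "F sone = 0" by (simp add: js derivs_snoc lin_zero[OF lin_derivs])
  then show ?case using op_span_add by simp
qed simp

text \<open>An operator of order at most \<open>s\<close> that annihilates degree \<open>s\<close> has supercommutators with
  the coordinates of the same kind and of lower order; by induction these vanish, so the operator
  is determined by its value at \<open>1\<close>.\<close>

lemma PolDiff_determined:
  fixes F :: "('a::finite, 'b::{finite,linorder}) superop"
  assumes "F \<in> PolDiff r s" "\<And>p. p \<in> Pol s \<Longrightarrow> F p = 0"
  shows "F p = 0"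
  using assms
proof (induction s arbitrary: F p)
  case 0
  have lin: "lin F" using 0(1) by (rule lin_PolDiff)
  have F: "F q = sprod (F sone) q" for q
    using 0(1) unfolding PolDiff_def
  proof (induction rule: op_span.induct)
    case (op_span_add F G c)
    then obtain p D where pD: "F = (\<lambda>q. sprod p (D q))" "D \<in> Diff 0" by blast
    have "\<exists>c. \<forall>q. D q = cscale c q"
      using pD(2) unfolding Diff_alt
    proof (induction rule: op_span.induct)
      case op_span_zero
      show ?case by (auto intro!: exI[of _ 0])
    next
      case (op_span_add F G c)
      then obtain c' where "\<And>q. G q = cscale c' q" by blast
      then show ?case using op_span_add(1) by (intro exI[of _ "c + c'"]) (auto simp: cs.scale_left_distrib)
    qed
    then obtain c' where c': "\<And>q. D q = cscale c' q" by blast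
    have "sprod p q = sprod (sprod p sone) q" for q
    proof (rule superpoly_eqI[where p = p])
      show "lin (\<lambda>p. sprod (sprod p sone) q)" by (auto intro!: lin_op_intros)
      fix i and p :: "('a, 'b) superpoly" assume "sprod p q = sprod (sprod p sone) q"
      then show "sprod (mul i p) q = sprod (sprod (mul i p) sone) q" by (simp add: mul_sprod)
    qed auto
    then have "F q = sprod (F sone) q"
      unfolding pD c' lin_scale[OF lin_sprod(1)] lin_scale[OF lin_sprod(2)] by (rule arg_cong)
    then show ?case using op_span_add.IH by (simp only: lin_add[OF lin_sprod(2)] lin_scale[OF lin_sprod(2)])
  qed (simp add: lin_zero[OF lin_sprod(2)])
  show ?case using F[of p] 0(2)[OF sone_Pol] by (simp add: lin_zero[OF lin_sprod(2)])
next
  case (Suc s)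
  have lin: "lin F" using Suc.prems(1) by (rule lin_PolDiff)
  have comm: "F (mul i q) = mul i (mixed i (F (mixed i q)))" for i q
  proof -
    have "F (mul i q) - mul i (mixed i (F (mixed i q))) = 0" for q
    proof (rule Suc.IH[OF PolDiff_mul[OF Suc.prems(1)]])
      fix q :: "('a, 'b) superpoly" assume q: "q \<in> Pol s"
      have "F (mixed i q) = 0" if "s < Suc s" for i
      proof -
        have kill: "D q = 0" if "D \<in> Diff (Suc s)" "q \<in> Pol s" for D and q :: "('a, 'b) superpoly"
          using that(1) unfolding Diff_alt
        proof (induction rule: op_span.induct)
          case (op_span_add F G c)
          then obtain js where js: "F = derivs js" "length js = Suc s" by blast
          have "derivs js q = 0" if "length js = Suc t" "q \<in> Pol t" for js t and q :: "('a, 'b) superpoly"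
            using that
          proof (induction t arbitrary: js q)
            case 0
            then obtain k where "js = [k]" by (cases js) auto
            then show ?case using 0 by (simp add: sderiv_Pol_0)
          next
            case (Suc t)
            then obtain js' k where "js = js' @ [k]" by (cases js rule: rev_cases) auto
            then show ?case using Suc Pol_sderiv[OF Suc.prems(2), of k] by (simp add: derivs_snoc)
          qed
          then show ?case using op_span_add js that(2) by simp
        qed simp
        show ?thesis
          using Suc.prems(1) unfolding PolDiff_def
        proof (induction rule: op_span.induct)
          case (op_span_add F G c)
          then show ?case by (auto simp: lin_zero[OF lin_sprod(1)] kill[OF _ mixed_Pol[OF q]])
        qed simp
      qed
      then show "F (mul i q) - mul i (mixed i (F (mixed i q))) = 0"
        using Suc.prems(2)[OF Pol_mul[OF q]] by (simp add: lin_zero[OF lin_mixed] lin_zero[OF lin_sprod(1)])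
    qed
    then show ?thesis by simp
  qed
  have F1: "F sone = 0"
    using Suc.prems(1) unfolding PolDiff_def
  proof (induction rule: op_span.induct)
    case (op_span_add F G c)
    then show ?case by (auto simp: Diff_low lin_zero[OF lin_sprod(1)])
  qed simp
  \<comment> \<open>The claim includes \<open>parity_inv p\<close> because \<open>comm\<close> puts
    \<open>mixed i\<close> in front of the argument.\<close>
  have "F p = 0 \<and> F (parity_inv p) = 0"
  proof (induction p rule: superpoly_induct)
    case (mul i p)
    then have "F (mixed i p) = 0" "F (mixed i (parity_inv p)) = 0" by (auto simp: mixed_def)
    then show ?case
      by (simp add: comm parity_inv_mul lin_scale[OF lin] lin_zero[OF lin_mixed] lin_zero[OF lin_sprod(1)])
  qed (auto simp: F1 lin_add[OF lin] lin_scale[OF lin] lin_add[OF lin_parity_inv] lin_scale[OF lin_parity_inv])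
  then show ?case by simp
qed

section \<open>Invariant operators\<close>

text \<open>The normally ordered product with a power of the Euler operator: coordinates stay on the
  left of \<open>F\<close> and derivatives on its right, so that the polynomial degree and the order
  both rise by exactly \<open>r\<close>. For the identity it is the falling factorial of the Euler
  operator.\<close>

primrec normal_order :: "nat \<Rightarrow> ('a::finite, 'b::{finite,linorder}) superop \<Rightarrow> ('a, 'b) superop" where
  "normal_order 0 F = F"
| "normal_order (Suc r) F = (\<lambda>p. \<Sum>i\<in>UNIV. mul i (normal_order r F (sderiv i p)))"

lemma normal_order_PolDiff: "F \<in> PolDiff d d' \<Longrightarrow> normal_order r F \<in> PolDiff (d + r) (d' + r)"
  by (induction r) (auto intro!: PolDiff_sum PolDiff_sandwich)

lemma normal_order_id:
  fixes p :: "('a::finite, 'b::{finite,linorder}) superpoly"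
  assumes "p \<in> Pol e"
  shows "normal_order r (\<lambda>p. p) p = cscale (ffact (of_nat e) r) p"
  using assms
proof (induction r arbitrary: p e)
  case (Suc r)
  show ?case
  proof (cases e)
    case 0
    have "ffact (0 :: complex) (Suc r) = 0" by (auto simp: ffact_def intro!: bexI[of _ 0])
    moreover have "normal_order r (\<lambda>p. p) (0 :: ('a, 'b) superpoly) = 0" using Suc.IH[of 0 0] by simp
    ultimately show ?thesis using Suc.prems 0 by (simp add: sderiv_Pol_0 lin_zero[OF lin_sprod(1)])
  next
    case e: (Suc e')
    have "normal_order r (\<lambda>p. p) (sderiv i p) = cscale (ffact (of_nat e') r) (sderiv i p)" for i
      using Suc.IH Pol_sderiv[OF Suc.prems, of i] by (simp add: e)
    then have "normal_order (Suc r) (\<lambda>p. p) p = cscale (ffact (of_nat e') r) (euler p)"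
      by (simp add: lin_scale[OF lin_sprod(1)] euler_def cs.scale_sum_right)
    also have "\<dots> = cscale (ffact (of_nat e') r * of_nat e) p"
      by (simp add: euler_Pol[OF Suc.prems])
    also have "ffact (of_nat e') r * of_nat e = (ffact (of_nat e) (Suc r) :: complex)"
      unfolding ffact_def prod.lessThan_Suc_shift by (simp add: e mult.commute)
    finally show ?thesis .
  qed
qed (simp add: ffact_def)

context osp_form
begin

lemma PolDiff_R2_Lap:
  assumes "F \<in> PolDiff d d'"
  shows "(\<lambda>p. R2 (F (Lap p))) \<in> PolDiff (d + 2) (d' + 2)"
proof -
  have lin: "lin F" by (rule lin_PolDiff[OF assms])
  have *: "(\<lambda>p. mul v (mul s (F (sderiv i (sderiv j p))))) \<in> PolDiff (d + 2) (d' + 2)" for v s i j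
    using PolDiff_sandwich[OF PolDiff_sandwich[OF assms, of s i], of v j] by (simp add: numeral_2_eq_2)
  have "(\<lambda>p. R2 (F (Lap p))) = (\<lambda>p. \<Sum>v\<in>UNIV. cscale (psgn v) (\<Sum>s\<in>UNIV. cscale (G v s)
      (\<Sum>i\<in>UNIV. \<Sum>j\<in>UNIV. cscale (H i j) (mul v (mul s (F (sderiv i (sderiv j p))))))))"
    by (simp add: R2_def X_def Lap_def lin_simps[OF lin] lin_simps[OF lin_sprod(1)])
  then show ?thesis by (simp only:) (intro PolDiff_sum PolDiff_scale *)
qed

lemma PolDiff_R2_Lap_pow: "(\<lambda>p. (R2 ^^ j) ((Lap ^^ j) p)) \<in> PolDiff (2 * j) (2 * j)"
proof (induction j)
  case (Suc j)
  have "(\<lambda>p. R2 ((R2 ^^ j) ((Lap ^^ j) (Lap p)))) \<in> PolDiff (2 * j + 2) (2 * j + 2)"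
    by (rule PolDiff_R2_Lap[OF Suc])
  then show ?case by (simp add: funpow_swap1)
qed (simp add: id_PolDiff)

lemma lin_R2_pow: "lin (R2 ^^ j)" and lin_Lap_pow: "lin (Lap ^^ j)"
  by (auto intro: lin_funpow)

lemma normal_order_R2_Lap_pow:
  "normal_order r (\<lambda>p. (R2 ^^ j) ((Lap ^^ j) p)) p = (R2 ^^ j) (normal_order r (\<lambda>p. p) ((Lap ^^ j) p))"
proof (induction r arbitrary: p)
  case (Suc r)
  have 1: "(Lap ^^ j) (sderiv i p) = sderiv i ((Lap ^^ j) p)" for i p
    by (induction j) (auto simp: sderiv_Lap)
  have 2: "mul i ((R2 ^^ j) p) = (R2 ^^ j) (mul i p)" for i p
    by (induction j) (auto simp: mul_R2)
  show ?case by (simp add: Suc.IH 1 2 lin_sum[OF lin_R2_pow])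
qed simp

lemma Pol_Lap_pow: "p \<in> Pol e \<Longrightarrow> (Lap ^^ j) p \<in> Pol (e - 2 * j)"
proof (induction j)
  case (Suc j)
  then show ?case using Pol_Lap[of "(Lap ^^ j) p" "e - 2 * j"] by simp
qed simp

lemma Lap_pow_low:
  assumes "p \<in> Pol e" "e < 2 * j"
  shows "(Lap ^^ j) p = 0"
  using assms(2)
proof (induction j)
  case (Suc j)
  show ?case
  proof (cases "e < 2 * j")
    case True
    then show ?thesis using Suc.IH by (simp add: lin_zero[OF lin_Lap])
  next
    case False
    then show ?thesis using Suc.prems Lap_low[OF Pol_Lap_pow[OF assms(1), of j]] by simp
  qed
qed simp

lemma parity_inv_cas: "parity_inv (cas p) = cas (parity_inv p)"
proof -
  have 1: "parity_inv (euler p) = euler (parity_inv p)" for p :: "('a, 'b) superpoly"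
    by (simp add: euler_def lin_sum[OF lin_parity_inv] parity_inv_mul parity_inv_sderiv lin_scale[OF lin_sprod(1)])
  have 2: "parity_inv (X i p) = cscale (psgn i) (X i (parity_inv p))" for i p
    unfolding X_def lin_sum[OF lin_parity_inv] lin_scale[OF lin_parity_inv] cs.scale_sum_right
  proof (intro sum.cong refl)
    fix s
    show "cscale (G i s) (parity_inv (mul s p)) = cscale (psgn i) (cscale (G i s) (mul s (parity_inv p)))"
      using G_even[of i s] by (cases "odd_index i = odd_index s") (auto simp: parity_inv_mul sign_defs)
  qed
  have 3: "parity_inv (R2 p) = R2 (parity_inv p)" for p
    by (simp add: R2_def lin_simps[OF lin_parity_inv] parity_inv_mul 2 lin_scale[OF lin_sprod(1)])
  have 4: "parity_inv (Lap p) = Lap (parity_inv p)" for p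
    unfolding Lap_def lin_sum[OF lin_parity_inv] lin_scale[OF lin_parity_inv]
  proof (intro sum.cong refl)
    fix i j
    show "cscale (H i j) (parity_inv (sderiv i (sderiv j p))) = cscale (H i j) (sderiv i (sderiv j (parity_inv p)))"
      using H_even[of i j] by (cases "odd_index i = odd_index j")
        (auto simp: parity_inv_sderiv lin_scale[OF lin_sderiv] sign_defs)
  qed
  show ?thesis by (simp add: cas_def lin_simps[OF lin_parity_inv] 1 3 4)
qed

lemma gosp_cas:
  assumes "M \<in> gosp_part \<omega> e"
  shows "act M (cas p) = cas (act M p)"
proof -
  obtain Y c where M: "M = Y - mat c" "Y \<in> osp_part \<omega> e"
    using assms by (auto simp: gosp_part_def)
  have act: "act M p = act Y p + cscale c (euler p)" for p
    by (simp add: M(1) act_diff act_mat)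
  have 1: "act Y (cas p) = cas (act Y p)"
    by (simp add: cas_def lin_simps[OF lin_act] act_euler act_R2[OF M(2)] act_Lap[OF M(2)])
  have "euler (cas p) = cas (euler p)"
  proof (rule lin_ext_Pol[where p = p])
    fix d and p :: "('a, 'b) superpoly" assume "p \<in> Pol d"
    then show "euler (cas p) = cas (euler p)"
      by (simp add: euler_Pol Pol_cas lin_scale[OF lin_cas])
  qed (auto intro: lin_compose[OF lin_cas] lin_compose[OF lin_euler])
  then show ?thesis by (simp add: act 1 lin_simps[OF lin_cas])
qed

end

section \<open>Radial operators and the characterization of Capelli operators\<close>

locale gosp_form = osp_form \<omega>
  for \<omega> :: "complex ^ ('a::finite + 'b::{finite,linorder}) \<Rightarrow> complex ^ ('a + 'b) \<Rightarrow> complex" +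
  fixes k :: nat
  assumes card2: "CARD('a) \<ge> 2" and sdim: "sdim = - 2 * of_nat k"
begin

lemma casimir_cas: "casimir k \<omega> = cas"
  by (rule casimir_eq_cas[OF card2 sdim])

lemma V_mod_eq: "V_mod k \<omega> l = {p \<in> Pol (fst l + snd l). \<exists>N. poly_act cas ([:- c_val k l, 1:] ^ N) p = 0}"
  unfolding V_mod_def casimir_cas poly_act_funpow[OF lin_cas] ..

text \<open>The value of the Casimir operator on \<open>R2 ^^ i\<close> applied to harmonics of degree \<open>e - 2 * i\<close>.\<close>

definition cas_node :: "nat \<Rightarrow> nat \<Rightarrow> complex" where
  "cas_node e i = (of_nat e - 2 * of_nat i) * (of_nat e - 2 * of_nat i - 2 * of_nat k - 2)"

text \<open>On degree \<open>e - 2 * j\<close> the operator \<open>R2 \<circ> Lap\<close> equals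
  \<open>cas_node e j - cas\<close>, and \<open>cas\<close> commutes with the outer
  \<open>R2 ^^ j\<close>. Each further pair therefore contributes one linear factor in
  \<open>cas\<close>, a new member of the Newton basis.\<close>

lemma R2_Lap_pow:
  assumes "p \<in> Pol e"
  shows "(R2 ^^ j) ((Lap ^^ j) p) = poly_act cas (\<Prod>i<j. [:cas_node e i, -1:]) p"
proof (induction j)
  case (Suc j)
  define q where "q = (Lap ^^ j) p"
  have "R2 (Lap q) = cscale (cas_node e j) q - cas q"
  proof (cases "2 * j \<le> e")
    case True
    have "of_nat (e - 2 * j) = (of_nat e - 2 * of_nat j :: complex)" using True by (simp add: of_nat_diff)
    then have "of_nat (e - 2 * j) * (of_nat (e - 2 * j) + sdim - 2) = cas_node e j"
      by (simp only: cas_node_def sdim) (simp add: algebra_simps)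
    then show ?thesis
      using cas_Pol[OF Pol_Lap_pow[OF assms, of j]] by (simp add: q_def)
  next
    case False
    then have "q = 0" using Lap_pow_low[OF assms] by (simp add: q_def)
    then show ?thesis by (simp add: lin_simps[OF lin_Lap] lin_simps[OF lin_R2] lin_simps[OF lin_cas])
  qed
  then have "(R2 ^^ Suc j) ((Lap ^^ Suc j) p) = (R2 ^^ j) (cscale (cas_node e j) q - cas q)"
    by (simp add: q_def funpow_swap1)
  also have "\<dots> = cscale (cas_node e j) ((R2 ^^ j) q) - cas ((R2 ^^ j) q)"
    by (simp add: lin_simps[OF lin_R2_pow] cas_R2_pow)
  also have "\<dots> = poly_act cas [:cas_node e j, -1:] ((R2 ^^ j) q)"
    by (simp add: poly_act_linear[OF lin_cas])
  also have "\<dots> = poly_act cas (\<Prod>i<Suc j. [:cas_node e i, -1:]) p"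
    unfolding prod.lessThan_Suc mult.commute[of _ "[:cas_node e j, -1:]"] poly_act_mult[OF lin_cas] q_def Suc ..
  finally show ?case .
qed simp

text \<open>Normal ordering of \<open>R2 ^^ j \<circ> Lap ^^ j\<close> with \<open>d - 2 * j\<close> Euler operators makes the sum an
  operator of order \<open>d\<close> with coefficients of degree \<open>d\<close>. The scaling is chosen so that its
  eigenvalues have the form \<open>poly_radial_poly\<close>.\<close>

definition radial_op :: "(nat \<Rightarrow> complex) \<Rightarrow> nat \<Rightarrow> ('a, 'b) superop" where
  "radial_op b d p = (\<Sum>j\<le>d div 2. cscale (b j / (4 ^ j * fact (d - 2 * j))) (normal_order (d - 2 * j) (\<lambda>p. (R2 ^^ j) ((Lap ^^ j) p)) p))"

definition radial_poly :: "(nat \<Rightarrow> complex) \<Rightarrow> nat \<Rightarrow> nat \<Rightarrow> complex poly" where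
  "radial_poly b d e = (\<Sum>j\<le>d div 2. smult (b j / (4 ^ j * fact (d - 2 * j)) * ffact (of_nat e - 2 * of_nat j) (d - 2 * j))
     (\<Prod>i<j. [:cas_node e i, -1:]))"

lemma radial_op_PolDiff: "radial_op b d \<in> PolDiff d d"
  unfolding radial_op_def[abs_def]
proof (intro PolDiff_sum PolDiff_scale)
  fix j assume "j \<in> {..d div 2}"
  then show "normal_order (d - 2 * j) (\<lambda>p. (R2 ^^ j) ((Lap ^^ j) p)) \<in> PolDiff d d"
    using normal_order_PolDiff[OF PolDiff_R2_Lap_pow, of "d - 2 * j" j] by simp
qed

lemma radial_op_poly_act:
  assumes "p \<in> Pol e"
  shows "radial_op b d p = poly_act cas (radial_poly b d e) p"
  unfolding radial_op_def radial_poly_def poly_act_sum poly_act_smult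
proof (intro sum.cong refl)
  fix j assume j: "j \<in> {..d div 2}"
  have "normal_order (d - 2 * j) (\<lambda>p. (R2 ^^ j) ((Lap ^^ j) p)) p = cscale (ffact (of_nat e - 2 * of_nat j) (d - 2 * j)) ((R2 ^^ j) ((Lap ^^ j) p))"
  proof (cases "2 * j \<le> e")
    case True
    then show ?thesis
      unfolding normal_order_R2_Lap_pow normal_order_id[OF Pol_Lap_pow[OF assms]]
      by (simp add: lin_scale[OF lin_R2_pow] of_nat_diff)
  next
    case False
    then have "(Lap ^^ j) p = 0" using Lap_pow_low[OF assms] by simp
    moreover have "normal_order r (\<lambda>p. p) (0 :: ('a, 'b) superpoly) = 0" for r using normal_order_id[of 0 0] by simp
    ultimately show ?thesis
      unfolding normal_order_R2_Lap_pow by (simp add: lin_zero[OF lin_R2_pow])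
  qed
  then show "cscale (b j / (4 ^ j * fact (d - 2 * j))) (normal_order (d - 2 * j) (\<lambda>p. (R2 ^^ j) ((Lap ^^ j) p)) p) =
      cscale (b j / (4 ^ j * fact (d - 2 * j)) * ffact (of_nat e - 2 * of_nat j) (d - 2 * j)) (poly_act cas (\<Prod>i<j. [:cas_node e i, -1:]) p)"
    by (simp only: R2_Lap_pow[OF assms] cs.scale_scale)
qed

lemma lin_radial_op: "lin (radial_op b d)"
  by (rule lin_PolDiff[OF radial_op_PolDiff])

text \<open>In each degree a radial operator is a polynomial in \<open>cas\<close>. The lemma is
  applied to the action of the Lie superalgebra and to the parity involution, which together give
  the vanishing of the supercommutators.\<close>

lemma radial_op_commute:
  assumes "lin T" "\<And>e p. p \<in> Pol e \<Longrightarrow> T p \<in> Pol e" "\<And>p. T (cas p) = cas (T p)"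
  shows "T (radial_op b d p) = radial_op b d (T p)"
proof (rule lin_ext_Pol[where p = p])
  fix e and p :: "('a, 'b) superpoly" assume p: "p \<in> Pol e"
  show "T (radial_op b d p) = radial_op b d (T p)"
    unfolding radial_op_poly_act[OF p] radial_op_poly_act[OF assms(2)[OF p]] by (rule poly_act_intertwine[OF lin_cas assms(1,3)])
qed (auto intro: lin_compose[OF lin_radial_op] lin_compose[OF assms(1)] lin_radial_op assms(1))

lemma radial_op_inv: "radial_op b d \<in> PD_inv \<omega>"
  unfolding PD_inv_def
proof (intro CollectI conjI allI ballI)
  show "radial_op b d \<in> PD"
    unfolding PD_def by (rule op_span_base) (use radial_op_PolDiff in blast)
  fix e M assume M: "M \<in> gosp_part \<omega> e"
  have "act M (radial_op b d p) = radial_op b d (act M p)" for p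
    by (rule radial_op_commute) (auto intro: Pol_act gosp_cas[OF M])
  moreover have "parity_inv (radial_op b d p) = radial_op b d (parity_inv p)" for p
    by (rule radial_op_commute) (auto intro: parity_inv_Pol parity_inv_cas)
  ultimately show "supercommutator e (act M) (radial_op b d) = (\<lambda>p. 0)"
    by (simp add: supercommutator_def fun_eq_iff)
qed

text \<open>The difference of a node and the Casimir value factors as
  \<open>4 * (m1 - k - 1 - i) * (m2 - i)\<close>. This is the origin of the shifted argument
  \<open>m1 - k - 1\<close>, of the symmetry in the two arguments, and of the powers of 4 in
  \<open>radial_op\<close>.\<close>

lemma poly_radial_poly:
  assumes "m2 \<le> m1"
  shows "poly (radial_poly b d (m1 + m2)) (c_val k (m1, m2)) =
    (\<Sum>j\<le>d div 2. b j * ffact (of_nat m1 - of_nat k - 1) j * ffact (of_nat m2) j *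
       ffact (of_nat m1 + of_nat m2 - 2 * of_nat j) (d - 2 * j) / fact (d - 2 * j))"
  unfolding radial_poly_def poly_sum poly_smult poly_prod
proof (intro sum.cong refl)
  fix j assume "j \<in> {..d div 2}"
  have "poly [:cas_node (m1 + m2) i, -1:] (c_val k (m1, m2)) = 4 * ((of_nat m1 - of_nat k - 1 - of_nat i) * (of_nat m2 - of_nat i))" for i
    by (simp add: cas_node_def c_val_def algebra_simps)
  then have "(\<Prod>i<j. poly [:cas_node (m1 + m2) i, -1:] (c_val k (m1, m2))) = 4 ^ j * (ffact (of_nat m1 - of_nat k - 1) j * ffact (of_nat m2) j)"
    by (simp add: prod.distrib ffact_def)
  then show "b j / (4 ^ j * fact (d - 2 * j)) * ffact (of_nat (m1 + m2) - 2 * of_nat j) (d - 2 * j) *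
      (\<Prod>i<j. poly [:cas_node (m1 + m2) i, -1:] (c_val k (m1, m2))) =
      b j * ffact (of_nat m1 - of_nat k - 1) j * ffact (of_nat m2) j * ffact (of_nat m1 + of_nat m2 - 2 * of_nat j) (d - 2 * j) / fact (d - 2 * j)"
    by simp
qed

text \<open>\<open>single_eigenvalue\<close> asks for a genuine eigenvector. A power of
  \<open>R2\<close> times a highest weight vector is one, even where the Casimir operator is not
  semisimple.\<close>

lemma V_mod_eigenvector:
  assumes "m2 \<le> m1"
  shows "\<exists>p\<in>V_mod k \<omega> (m1, m2). p \<noteq> 0 \<and> cas p = cscale (c_val k (m1, m2)) p"
proof -
  obtain v where v: "v \<noteq> 0" "hom_vec False v" "\<omega> v v = 0" using exists_isotropic[OF card2] by blast
  define p where "p = (R2 ^^ m2) ((form_mul v ^^ (m1 - m2)) sone)"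
  have "(R2 ^^ j) q \<in> Pol (a + 2 * j)" if "q \<in> Pol a" for q j a
  proof (induction j)
    case (Suc j)
    then show ?case using Pol_R2 by fastforce
  qed (use that in simp)
  from this[OF Pol_form_mul_pow[where v = v and a = "m1 - m2"], of m2] have P: "p \<in> Pol (m1 + m2)" using assms by (simp add: p_def add.commute)
  have "cas p = cscale (c_val k (m1, m2)) p"
    using assms unfolding p_def cas_R2_pow cas_form_mul_pow[OF v(2,3)] lin_scale[OF lin_R2_pow]
    by (simp add: c_val_def sdim of_nat_diff algebra_simps)
  moreover from this have "poly_act cas ([:- c_val k (m1, m2), 1:] ^ 1) p = 0"
    by (simp add: poly_act_linear[OF lin_cas])
  then have "p \<in> V_mod k \<omega> (m1, m2)" unfolding V_mod_eq using P by (metis (mono_tags, lifting) fst_conv mem_Collect_eq snd_conv)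
  moreover have "p \<noteq> 0" unfolding p_def by (rule R2_form_mul_pow_nonzero[OF v])
  ultimately show ?thesis by blast
qed

lemma single_eigenvalue_radial_op:
  assumes "m2 \<le> m1"
  shows "single_eigenvalue (radial_op b d) (V_mod k \<omega> (m1, m2)) (poly (radial_poly b d (m1 + m2)) (c_val k (m1, m2)))"
proof -
  let ?c = "c_val k (m1, m2)" and ?g = "radial_poly b d (m1 + m2)" and ?V = "V_mod k \<omega> (m1, m2)"
  have D: "radial_op b d p = poly_act cas ?g p" if "p \<in> ?V" for p
    using that by (intro radial_op_poly_act) (simp add: V_mod_eq)
  have inv: "radial_op b d p \<in> ?V" if p: "p \<in> ?V" for p
  proof -
    obtain N where N: "poly_act cas ([:- ?c, 1:] ^ N) p = 0" and P: "p \<in> Pol (m1 + m2)"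
      using p by (auto simp: V_mod_eq)
    have "(cas ^^ i) p \<in> Pol (m1 + m2)" for i using P by (induction i) (auto intro: Pol_cas)
    then have "poly_act cas ?g p \<in> Pol (m1 + m2)" unfolding poly_act_def by (intro Pol_intros)
    moreover have "poly_act cas ([:- ?c, 1:] ^ N) (poly_act cas ?g p) = 0"
      by (subst poly_act_commute[OF lin_cas]) (simp add: N lin_zero[OF lin_poly_act[OF lin_cas]])
    ultimately show ?thesis unfolding D[OF p] by (auto simp: V_mod_eq)
  qed
  have ev: "c' = poly ?g ?c" if p: "p \<in> ?V" "p \<noteq> 0" "radial_op b d p = cscale c' p" for p c'
  proof (rule ccontr)
    assume "c' \<noteq> poly ?g ?c"
    then have "poly (?g - [:c':]) ?c \<noteq> 0" by simp
    moreover obtain N where N: "poly_act cas ([:- ?c, 1:] ^ N) p = 0"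
      using p by (auto simp: V_mod_eq)
    moreover have "poly_act cas (?g - [:c':]) p = 0"
      using p(3) by (simp add: D[OF p(1)] poly_act_diff poly_act_pCons[OF lin_cas] lin_zero[OF lin_cas])
    ultimately show False using gen_eigen_kill[OF lin_cas] p(2) by blast
  qed
  obtain p where p: "p \<in> ?V" "p \<noteq> 0" "cas p = cscale ?c p" using V_mod_eigenvector[OF assms] by blast
  then have "radial_op b d p = cscale (poly ?g ?c) p" by (simp add: D poly_act_eigen[OF lin_cas])
  then have "{c'. \<exists>p\<in>?V. p \<noteq> 0 \<and> radial_op b d p = cscale c' p} = {poly ?g ?c}"
    using p ev by blast
  then show ?thesis using inv by (auto simp: single_eigenvalue_def)
qed

text \<open>The weight \<open>(d - i, i)\<close> has this Casimir value. If it is singular, the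
  dagger involution replaces it by a quasiregular weight of the same degree and the same
  value.\<close>

lemma cas_node_in_spectrum:
  assumes "i \<le> d div 2"
  shows "\<exists>\<mu>\<in>reg_or_quasi k. fst \<mu> + snd \<mu> = d \<and> cas_node d i = c_val k \<mu>"
proof (cases "(d - i, i) \<in> reg_or_quasi k")
  case True
  have "of_nat (d - i) = (of_nat d - of_nat i :: complex)" using assms by (simp add: of_nat_diff)
  then have "cas_node d i = c_val k (d - i, i)" unfolding cas_node_def c_val_def prod.case by (simp only:) (simp add: algebra_simps)
  then show ?thesis using True assms by (intro bexI[of _ "(d - i, i)"]) auto
next
  case False
  then have *: "k + 2 \<le> d - 2 * i" "d - 2 * i \<le> 2 * k + 2"
    using assms by (auto simp: reg_or_quasi_def regular_def quasiregular_def partitions_def)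
  have "of_nat (d - i - k - 1) = (of_nat d - of_nat i - of_nat k - 1 :: complex)" using * by (simp add: of_nat_diff)
  then have "cas_node d i = c_val k (i + k + 1, d - i - k - 1)"
    unfolding cas_node_def c_val_def prod.case by (simp only:) (simp add: algebra_simps)
  moreover have "(i + k + 1, d - i - k - 1) \<in> reg_or_quasi k"
    using * by (auto simp: reg_or_quasi_def quasiregular_def partitions_def)
  ultimately show ?thesis using * by (intro bexI[of _ "(i + k + 1, d - i - k - 1)"]) auto
qed

lemma char_poly_kill:
  assumes "p \<in> Pol d"
  shows "poly_act cas (\<Prod>i<Suc (d div 2). [:cas_node d i, -1:]) p = 0"
proof -
  have "(Lap ^^ Suc (d div 2)) p = 0" by (rule Lap_pow_low[OF assms]) simp
  then show ?thesis
    using R2_Lap_pow[OF assms, of "Suc (d div 2)"] by (metis lin_zero[OF lin_R2_pow])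
qed

text \<open>\<open>Pol d\<close> is the sum of the modules \<open>V_mod\<close>: the product of all
  linear factors at the nodes annihilates it by \<open>char_poly_kill\<close>, and each node belongs
  to some module.\<close>

lemma kill_V_mods:
  assumes "lin F" "\<And>\<mu> p. \<mu> \<in> reg_or_quasi k \<Longrightarrow> fst \<mu> + snd \<mu> = d \<Longrightarrow> p \<in> V_mod k \<omega> \<mu> \<Longrightarrow> F p = 0" "p \<in> Pol d"
  shows "F p = 0"
proof -
  have eq: "(\<Prod>c\<leftarrow>map (cas_node d) [0..<n]. [:- c, 1:]) = smult ((-1) ^ n) (\<Prod>i<n. [:cas_node d i, -1:])" for n
  proof (induction n)
    case (Suc n)
    have "[:- cas_node d n, 1:] = smult (-1) [:cas_node d n, -1:]" by simp
    then show ?case using Suc by (simp only: upt_Suc_append le0 map_append list.map prod_list.append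
      prod_list.Cons prod_list.Nil prod.lessThan_Suc power_Suc mult_smult_left mult_smult_right smult_smult mult_1_right)
  qed simp
  let ?cs = "map (cas_node d) [0..<Suc (d div 2)]"
  have "poly_act cas (\<Prod>c\<leftarrow>?cs. [:- c, 1:]) p = 0"
    unfolding eq poly_act_smult char_poly_kill[OF assms(3)] by simp
  from gen_eigen_decomposition[OF lin_cas _ _ _ assms(3) this]
  obtain f where f: "\<And>c. c \<in> set ?cs \<Longrightarrow> f c \<in> Pol d \<and> (\<exists>n. poly_act cas ([:- c, 1:] ^ n) (f c) = 0)"
      "p = (\<Sum>c\<in>set ?cs. f c)"
    by (auto intro: Pol_intros Pol_cas)
  have "F (f c) = 0" if c: "c \<in> set ?cs" for c
  proof -
    obtain i where i: "i \<le> d div 2" "c = cas_node d i" using c by (auto simp del: upt_Suc simp: less_Suc_eq_le)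
    obtain \<mu> where \<mu>: "\<mu> \<in> reg_or_quasi k" "fst \<mu> + snd \<mu> = d" "c = c_val k \<mu>"
      using cas_node_in_spectrum[OF i(1)] i(2) by blast
    have "f c \<in> V_mod k \<omega> \<mu>" using f(1)[OF c] \<mu> by (simp add: V_mod_eq)
    then show ?thesis using assms(2) \<mu> by blast
  qed
  then show ?thesis by (subst f(2)) (simp add: lin_sum[OF assms(1)])
qed

text \<open>The difference of two candidates annihilates \<open>Pol d\<close> by
  \<open>kill_V_mods\<close>, and \<open>PolDiff_determined\<close> extends this to all
  degrees.\<close>

lemma capelli_eqI:
  assumes D: "D \<in> PD_inv \<omega>" "D \<in> PolDiff (fst l + snd l) (fst l + snd l)"
    and l: "\<And>p. p \<in> V_mod k \<omega> l \<Longrightarrow> D p = p"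
    and other: "\<And>\<mu> p. \<mu> \<in> reg_or_quasi k \<Longrightarrow> fst \<mu> + snd \<mu> = fst l + snd l \<Longrightarrow> \<mu> \<noteq> l \<Longrightarrow> p \<in> V_mod k \<omega> \<mu> \<Longrightarrow> D p = 0"
  shows "capelli k \<omega> l = D"
  unfolding capelli_def
proof (rule the_equality)
  show "D \<in> PD_inv \<omega> \<and> D \<in> PolDiff (fst l + snd l) (fst l + snd l) \<and> (\<forall>p\<in>V_mod k \<omega> l. D p = p) \<and>
    (\<forall>\<mu>\<in>reg_or_quasi k. fst \<mu> + snd \<mu> = fst l + snd l \<and> \<mu> \<noteq> l \<longrightarrow> (\<forall>p\<in>V_mod k \<omega> \<mu>. D p = 0))"
    using assms by blast
next
  fix D'
  assume D': "D' \<in> PD_inv \<omega> \<and> D' \<in> PolDiff (fst l + snd l) (fst l + snd l) \<and> (\<forall>p\<in>V_mod k \<omega> l. D' p = p) \<and>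
    (\<forall>\<mu>\<in>reg_or_quasi k. fst \<mu> + snd \<mu> = fst l + snd l \<and> \<mu> \<noteq> l \<longrightarrow> (\<forall>p\<in>V_mod k \<omega> \<mu>. D' p = 0))"
  have diff: "(\<lambda>p. D' p - D p) \<in> PolDiff (fst l + snd l) (fst l + snd l)"
    using D D' by (intro PolDiff_minus) auto
  have "D' p - D p = 0" if "p \<in> Pol (fst l + snd l)" for p
  proof (rule kill_V_mods[OF lin_PolDiff[OF diff] _ that])
    fix \<mu> p assume "\<mu> \<in> reg_or_quasi k" "fst \<mu> + snd \<mu> = fst l + snd l" "p \<in> V_mod k \<omega> \<mu>"
    then show "D' p - D p = 0" using D' l other by (cases "\<mu> = l") auto
  qed
  then have "D' p - D p = 0" for p by (rule PolDiff_determined[OF diff])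
  then show "D' = D" by (simp add: fun_eq_iff)
qed

end

section \<open>Hypergeometric identities\<close>

lemma ffact_0 [simp]: "ffact a 0 = 1"
  by (simp add: ffact_def)

lemma ffact_Suc: "ffact a (Suc n) = ffact a n * (a - of_nat n)"
  by (simp add: ffact_def)

lemma ffact_add: "ffact a (m + n) = ffact a m * ffact (a - of_nat m) n"
  by (induction n) (simp_all add: ffact_Suc algebra_simps)

lemma ffact_of_nat_eq_0: "p < n \<Longrightarrow> ffact (of_nat p :: 'c::comm_ring_1) n = 0"
  by (auto simp: ffact_def intro!: prod_zero bexI[of _ p])

lemma ffact_of_nat:
  assumes "n \<le> p"
  shows "ffact (of_nat p :: complex) n = fact p / fact (p - n)"
  using assms
proof (induction n)
  case (Suc n)
  then have "fact (p - n) = (of_nat p - of_nat n) * (fact (p - Suc n) :: complex)"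
    by (metis Suc_diff_Suc Suc_le_lessD fact_Suc of_nat_diff Suc_leD of_nat_fact of_nat_mult)
  moreover have "(of_nat p - of_nat n :: complex) \<noteq> 0" using Suc.prems by simp
  ultimately show ?case using Suc by (simp add: ffact_Suc)
qed simp

lemma ffact_Suc_left: "ffact (of_nat (Suc p) :: complex) n * (of_nat (Suc p) - of_nat n) = of_nat (Suc p) * ffact (of_nat p) n"
  by (induction n) (simp_all add: ffact_Suc algebra_simps)

lemma ffact_Suc_Suc: "ffact (of_nat (Suc p) :: complex) (Suc n) = of_nat (Suc p) * ffact (of_nat p) n"
  by (simp only: ffact_Suc ffact_Suc_left)

lemma fact_add_pochhammer: "fact (m + n) = fact m * pochhammer (of_nat m + 1 :: complex) n"
  by (induction n) (simp_all add: pochhammer_Suc algebra_simps)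

lemma pochhammer_nz: "(\<And>i. i < n \<Longrightarrow> c + of_nat i \<noteq> 0) \<Longrightarrow> pochhammer (c :: complex) n \<noteq> 0"
  by (induction n) (auto simp: pochhammer_Suc)

lemma of_nat_Suc_plus_nz: "(of_nat m + 1 + of_nat i :: complex) \<noteq> 0" "(of_nat m + 1 :: complex) \<noteq> 0"
  by (metis add.commute add.left_commute of_nat_Suc of_nat_add of_nat_neq_0, metis add.commute of_nat_Suc of_nat_neq_0)

lemma pochhammer_of_nat_nz: "pochhammer (of_nat m + 1 :: complex) n \<noteq> 0"
  by (intro pochhammer_nz of_nat_Suc_plus_nz)

text \<open>The cancellation in a quotient of consecutive hypergeometric terms, stated with atoms so
  that the large factors are not multiplied out.\<close>

lemma frac_step:
  fixes x y f h :: complex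
  assumes "x \<noteq> 0" "y \<noteq> 0" "f \<noteq> 0" "h \<noteq> 0"
  shows "(a * a') * (b * b') / ((x * f) * (h * y)) * (x * y) = a * b / (f * h) * (a' * b')"
  using assms by (simp add: divide_simps)

lemma frac_step':
  fixes x y z w f h P Q :: complex
  assumes "x \<noteq> 0" "y \<noteq> 0" "z \<noteq> 0" "w \<noteq> 0" "f \<noteq> 0" "h \<noteq> 0" "P \<noteq> 0" "Q \<noteq> 0"
  shows "((a * a') * (b * b')) * ((c * c') * (d * d')) / (((x * f) * (h * y)) * ((P * z) * (Q * w))) * (x * y * z * w) =
    (a * b) * (c * d) / ((f * h) * (P * Q)) * (a' * b' * c' * d')"
  using assms by (simp add: divide_simps)

text \<open>Each step \<open>p \<rightarrow> p + 1\<close> telescopes in \<open>n\<close>.\<close>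

lemma chu_vandermonde:
  fixes c :: complex
  assumes c: "\<And>i. c + of_nat i \<noteq> 0"
  shows "(\<Sum>n\<le>q. ffact (of_nat p) n * ffact (of_nat q) n / (fact n * pochhammer c n)) =
    pochhammer (c + of_nat p) q / pochhammer c q"
proof (induction p)
  case 0
  have "(\<Sum>n\<le>q. ffact (of_nat 0) n * ffact (of_nat q) n / (fact n * pochhammer c n)) =
      (\<Sum>n\<le>q. if n = 0 then 1 else 0)"
    using ffact_of_nat_eq_0[of 0, where 'c = complex] by (intro sum.cong refl) auto
  then show ?case using pochhammer_nz[of q c] c by simp
next
  case (Suc p)
  define u where "u n = ffact (of_nat (Suc p)) n * ffact (of_nat q) n / (fact n * pochhammer c n)" for n
  define W where "W n = u n * (of_nat n * (c + of_nat n - 1))" for n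
  have pc: "pochhammer c n \<noteq> 0" for n by (intro pochhammer_nz c)
  have W_Suc: "W (Suc n) = u n * ((of_nat (Suc p) - of_nat n) * (of_nat q - of_nat n))" for n
  proof -
    have "u (Suc n) * (of_nat (Suc n) * (c + of_nat n)) = u n * ((of_nat (Suc p) - of_nat n) * (of_nat q - of_nat n))"
      unfolding u_def ffact_Suc pochhammer_Suc fact_Suc of_nat_fact of_nat_mult
      by (rule frac_step) (use c[of n] pc[of n] in \<open>auto simp del: of_nat_Suc simp: of_nat_neq_0\<close>)
    then show ?thesis by (simp add: W_def algebra_simps)
  qed
  have F: "ffact (of_nat p) n * ffact (of_nat q) n / (fact n * pochhammer c n) =
      u n * (of_nat (Suc p) - of_nat n) / of_nat (Suc p)" for n
    using ffact_Suc_left[of p n] by (simp add: u_def field_simps del: of_nat_Suc)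
  have "(c + of_nat p) * (\<Sum>n\<le>q. u n) - (c + of_nat p + of_nat q) *
      (\<Sum>n\<le>q. ffact (of_nat p) n * ffact (of_nat q) n / (fact n * pochhammer c n)) =
      (\<Sum>n\<le>q. (c + of_nat p) * u n - (c + of_nat p + of_nat q) * (u n * (of_nat (Suc p) - of_nat n) / of_nat (Suc p)))"
    by (simp only: F sum_distrib_left sum_subtractf)
  also have "\<dots> = (\<Sum>n\<le>q. (W n - W (Suc n)) / of_nat (Suc p))"
  proof (intro sum.cong refl)
    fix n
    show "(c + of_nat p) * u n - (c + of_nat p + of_nat q) * (u n * (of_nat (Suc p) - of_nat n) / of_nat (Suc p)) =
        (W n - W (Suc n)) / of_nat (Suc p)"
      by (simp only: W_Suc) (simp add: W_def divide_simps del: of_nat_Suc, simp add: algebra_simps)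
  qed
  also have "\<dots> = (W 0 - W (Suc q)) / of_nat (Suc p)"
    by (simp only: sum_telescope flip: sum_divide_distrib)
  also have "\<dots> = 0" unfolding W_Suc by (simp add: W_def)
  finally have "(c + of_nat p) * (\<Sum>n\<le>q. u n) = (c + of_nat p + of_nat q) * (pochhammer (c + of_nat p) q / pochhammer c q)"
    by (simp add: Suc.IH)
  also have "\<dots> = (c + of_nat p) * (pochhammer (c + of_nat (Suc p)) q / pochhammer c q)"
    using pochhammer_Suc[of "c + of_nat p" q] pochhammer_rec[of "c + of_nat p" q] by (simp add: algebra_simps)
  finally show ?case using c[of p] by (simp only: u_def mult_cancel_left) blast
qed

lemma DERIV_pochhammer:
  assumes "\<And>i. c + of_nat i \<noteq> 0"
  shows "((\<lambda>c. pochhammer c n) has_field_derivative pochhammer c n * (\<Sum>i<n. 1 / (c + of_nat i))) (at (c :: complex))"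
proof (induction n)
  case (Suc n)
  show ?case
    unfolding pochhammer_Suc
    by (rule DERIV_cong, rule DERIV_mult[OF Suc]) (auto intro!: derivative_eq_intros simp: field_simps assms)
qed simp

lemma harm_add: "harm (m + n) = harm m + (\<Sum>i<n. 1 / (of_nat m + 1 + of_nat i :: complex))"
  by (induction n) (simp_all add: harm_Suc inverse_eq_divide add_ac)

text \<open>Differentiate \<open>chu_vandermonde\<close> in the parameter \<open>c\<close> at
  \<open>s + 1\<close>. Logarithmic derivatives of Pochhammer symbols are differences of harmonic
  numbers, and the common summand \<open>harm s\<close> cancels by \<open>chu_vandermonde\<close>
  itself.\<close>

lemma harm_vandermonde:
  "(\<Sum>n\<le>q. ffact (of_nat p) n * ffact (of_nat q) n / (fact n * pochhammer (of_nat s + 1) n) * harm (s + n)) =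
    pochhammer (of_nat s + 1 + of_nat p) q / pochhammer (of_nat s + 1) q *
    (harm (s + p) + harm (s + q) - harm (s + p + q) :: complex)"
proof -
  define T where "T c n = ffact (of_nat p) n * ffact (of_nat q) n / (fact n * pochhammer c n)" for c :: complex and n
  define R where "R c = pochhammer (c + of_nat p) q / pochhammer c q" for c :: complex
  define c0 :: complex where "c0 = of_nat s + 1"
  have nz: "c + of_nat i \<noteq> 0" if "Re c > 0" for c :: complex and i
    using that by (auto simp: complex_eq_iff)
  have c0: "Re c0 > 0" by (simp add: c0_def)
  note pnz = pochhammer_nz[OF nz]
  have eq: "(\<Sum>n\<le>q. T c n) = R c" if "Re c > 0" for c
    unfolding T_def R_def by (intro chu_vandermonde nz that)
  have dT: "((\<lambda>c. T c n) has_field_derivative - T c0 n * (\<Sum>i<n. 1 / (c0 + of_nat i))) (at c0)" for n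
    unfolding T_def
    by (rule DERIV_cong, rule DERIV_divide[OF DERIV_const DERIV_mult[OF DERIV_const DERIV_pochhammer]])
       (use nz[OF c0] pnz[OF c0] in \<open>auto simp: field_simps\<close>)
  have "((\<lambda>c. \<Sum>n\<le>q. T c n) has_field_derivative (\<Sum>n\<le>q. - T c0 n * (\<Sum>i<n. 1 / (c0 + of_nat i)))) (at c0)"
    by (intro DERIV_sum dT)
  moreover have "(R has_field_derivative R c0 * ((\<Sum>i<q. 1 / (c0 + of_nat p + of_nat i)) - (\<Sum>i<q. 1 / (c0 + of_nat i)))) (at c0)"
  proof -
    have nz': "c0 + of_nat p + of_nat i \<noteq> 0" for i
      using nz[OF c0, of "p + i"] by (simp add: add.assoc)
    have d: "((\<lambda>c. pochhammer (c + of_nat p) q) has_field_derivative pochhammer (c0 + of_nat p) q * (\<Sum>i<q. 1 / (c0 + of_nat p + of_nat i))) (at c0)"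
      using DERIV_shift[of "\<lambda>c. pochhammer c q" _ c0 "of_nat p"] DERIV_pochhammer[OF nz'] by blast
    show ?thesis
      unfolding R_def
      by (rule DERIV_cong, rule DERIV_divide[OF d DERIV_pochhammer])
         (use nz[OF c0] pnz[OF c0] in \<open>auto simp: field_simps\<close>)
  qed
  moreover have "eventually (\<lambda>c. (\<Sum>n\<le>q. T c n) = R c) (nhds c0)"
  proof -
    have "eventually (\<lambda>c. c \<in> {c. Re c > 0}) (nhds c0)"
      by (intro eventually_nhds_in_open open_halfspace_Re_gt) (use c0 in auto)
    then show ?thesis by (rule eventually_mono) (use eq in auto)
  qed
  ultimately have D: "(\<Sum>n\<le>q. - T c0 n * (\<Sum>i<n. 1 / (c0 + of_nat i))) =
      R c0 * ((\<Sum>i<q. 1 / (c0 + of_nat p + of_nat i)) - (\<Sum>i<q. 1 / (c0 + of_nat i)))"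
    using DERIV_cong_ev[OF refl, of "\<lambda>c. \<Sum>n\<le>q. T c n" R c0] DERIV_unique by blast
  have h: "(\<Sum>i<n. 1 / (c0 + of_nat i)) = harm (s + n) - harm s" for n
    by (simp add: harm_add c0_def)
  have hp: "(\<Sum>i<q. 1 / (c0 + of_nat p + of_nat i)) = harm (s + p + q) - harm (s + p)"
    using harm_add[of "s + p" q] by (simp add: c0_def add_ac)
  have "(\<Sum>n\<le>q. - T c0 n * (harm (s + n) - harm s)) =
      R c0 * (harm (s + p + q) - harm (s + p) - (harm (s + q) - harm s))"
    using D unfolding h hp .
  then have "(\<Sum>n\<le>q. T c0 n * harm (s + n)) - harm s * (\<Sum>n\<le>q. T c0 n) =
      R c0 * (harm (s + p) + harm (s + q) - harm (s + p + q)) - harm s * R c0"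
    by (simp add: right_diff_distrib sum_subtractf sum_distrib_left sum_negf mult_ac) (simp add: algebra_simps)
  then show ?thesis by (simp add: eq[OF c0]) (simp add: T_def R_def c0_def)
qed

text \<open>The WZ certificate of the well-poised sum \<open>dougall_sum\<close>, for the step \<open>i \<rightarrow> i + 1\<close>.\<close>

lemma dougall_certificate:
  fixes i j s t n :: complex
  shows "(i + 1) * (((s + t) + i + j + 1) * (s + i + 1)) * ((s + t) + 2 * n) -
      (s + i + j + 1) * (((s + t) + 2 * n) * (i + 1 - n) * ((s + t) + i + 1 + n)) =
    n * (s + n) * ((s + t) + i + 1 + n) * ((s + t) + j + n) - (t + n) * ((s + t) + n) * (i + 1 - n) * (j - n)"
  by algebra

text \<open>The terminating very-well-poised 5F4 sum at argument 1 with parameters a, t, -i, -j. For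
  the induction on \<open>i\<close>, a combination of the sums for \<open>i\<close> and
  \<open>i + 1\<close> is a telescoping sum of differences of \<open>W\<close>, which vanishes at
  both ends.\<close>

lemma dougall_sum:
  fixes s t i j :: nat
  defines "a \<equiv> of_nat s + of_nat t :: complex"
  assumes t: "t > 0"
  shows "(\<Sum>n\<le>j. pochhammer (of_nat t) n * pochhammer a n * (a + 2 * of_nat n) / (fact n * pochhammer (of_nat s + 1) n) *
      (ffact (of_nat i) n * ffact (of_nat j) n / (pochhammer (a + of_nat i + 1) n * pochhammer (a + of_nat j + 1) n))) =
    a * (pochhammer (a + 1) i * pochhammer (of_nat s + of_nat j + 1) i /
      (pochhammer (a + of_nat j + 1) i * pochhammer (of_nat s + 1) i))"
proof (induction i)
  case 0
  have "(\<Sum>n\<le>j. pochhammer (of_nat t) n * pochhammer a n * (a + 2 * of_nat n) / (fact n * pochhammer (of_nat s + 1) n) *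
      (ffact (of_nat 0) n * ffact (of_nat j) n / (pochhammer (a + of_nat 0 + 1) n * pochhammer (a + of_nat j + 1) n))) =
      (\<Sum>n\<le>j. if n = 0 then a else 0)"
    using ffact_of_nat_eq_0[of 0, where 'c = complex] by (intro sum.cong refl) auto
  then show ?case by simp
next
  case (Suc i)
  have nz: "a + of_nat m + 1 \<noteq> 0" "of_nat s + of_nat m + 1 \<noteq> (0::complex)" for m
    using of_nat_Suc_plus_nz(2)[of "s + t + m"] of_nat_Suc_plus_nz(2)[of "s + m"] by (auto simp: a_def add_ac)
  have pnz: "pochhammer (a + of_nat m + 1) n \<noteq> 0" "pochhammer (of_nat s + 1 :: complex) n \<noteq> 0" for m n
    using pochhammer_of_nat_nz[of "s + t + m" n] pochhammer_of_nat_nz[of s n] by (auto simp: a_def add_ac)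
  define A where "A n = pochhammer (of_nat t) n * pochhammer a n / (fact n * pochhammer (of_nat s + 1) n)" for n
  define u where "u n = A n * (ffact (of_nat (Suc i)) n * ffact (of_nat j) n / (pochhammer (a + of_nat i + 1) (Suc n) * pochhammer (a + of_nat j + 1) n))" for n
  define W where "W n = u n * (of_nat n * (of_nat s + of_nat n) * (a + of_nat i + 1 + of_nat n) * (a + of_nat j + of_nat n))" for n
  define F where "F i n = pochhammer (of_nat t) n * pochhammer a n * (a + 2 * of_nat n) / (fact n * pochhammer (of_nat s + 1) n) *
      (ffact (of_nat i) n * ffact (of_nat j) n / (pochhammer (a + of_nat i + 1) n * pochhammer (a + of_nat j + 1) n))" for i n
  have u_alt: "u n = (pochhammer (of_nat t) n * pochhammer a n) * (ffact (of_nat (Suc i)) n * ffact (of_nat j) n) /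
      ((fact n * pochhammer (of_nat s + 1) n) * (pochhammer (a + of_nat i + 1) (Suc n) * pochhammer (a + of_nat j + 1) n))" for n
    by (simp add: u_def A_def del: of_nat_Suc)
  have W_Suc: "W (Suc n) = u n * ((of_nat t + of_nat n) * (a + of_nat n) * (of_nat (Suc i) - of_nat n) * (of_nat j - of_nat n))" for n
  proof -
    define x1 x2 where x: "x1 = a + of_nat i + 1 + (1 + of_nat n)" "x2 = a + of_nat j + 1 + of_nat n"
    have x0: "x1 \<noteq> 0" "x2 \<noteq> 0" "(1 + of_nat n :: complex) \<noteq> 0" "(of_nat s + 1 + of_nat n :: complex) \<noteq> 0"
      using nz(1)[of "i + 1 + n"] nz(1)[of "j + n"] of_nat_Suc_plus_nz(2)[of n] nz(2)[of n] by (auto simp: x add_ac)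
    have "u (Suc n) * ((1 + of_nat n) * (of_nat s + 1 + of_nat n) * x1 * x2) =
        u n * ((of_nat t + of_nat n) * (a + of_nat n) * (of_nat (Suc i) - of_nat n) * (of_nat j - of_nat n))"
      unfolding u_alt fact_Suc of_nat_mult of_nat_fact ffact_Suc x
        pochhammer_Suc[of "of_nat t"] pochhammer_Suc[of a] pochhammer_Suc[of "of_nat s + 1"]
        pochhammer_Suc[of "a + of_nat i + 1" "Suc n"] pochhammer_Suc[of "a + of_nat j + 1"] of_nat_Suc[of n]
      by (rule frac_step'[of "1 + of_nat n"]) (use x0 pnz(1)[of i "Suc n"] pnz(1)[of j n] pnz(2)[of n] in \<open>simp_all add: x\<close>)
    then show ?thesis by (simp add: W_def x add_ac)
  qed
  have F1: "F (Suc i) n = u n * ((a + 2 * of_nat n) * (a + of_nat i + 1))" for n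
  proof -
    have "pochhammer (a + of_nat i + 1) (Suc n) = (a + of_nat i + 1) * pochhammer (a + of_nat (Suc i) + 1) n"
      by (simp add: pochhammer_rec add_ac)
    then show ?thesis
      using nz(1)[of i] by (simp add: F_def u_def A_def mult_ac del: of_nat_Suc)
  qed
  have F2: "F i n * of_nat (Suc i) = u n * ((a + 2 * of_nat n) * (of_nat (Suc i) - of_nat n) * (a + of_nat i + 1 + of_nat n))" for n
  proof -
    have nz': "a + of_nat i + 1 + of_nat n \<noteq> 0" using nz(1)[of "i + n"] by (simp add: add_ac)
    have "F i n * of_nat (Suc i) = A n * (a + 2 * of_nat n) * ((of_nat (Suc i) * ffact (of_nat i) n) * ffact (of_nat j) n /
        (pochhammer (a + of_nat i + 1) n * pochhammer (a + of_nat j + 1) n))"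
      by (simp add: F_def A_def del: of_nat_Suc)
    then show ?thesis
      unfolding ffact_Suc_left[symmetric] u_def pochhammer_Suc[of "a + of_nat i + 1"] using nz' by (simp del: of_nat_Suc)
  qed
  let ?L = "(a + of_nat i + of_nat j + 1) * (of_nat s + of_nat i + 1)" and ?R = "(of_nat s + of_nat i + of_nat j + 1) * (a + of_nat i + 1)"
  have "of_nat (Suc i) * (?L * (\<Sum>n\<le>j. F (Suc i) n) - ?R * (\<Sum>n\<le>j. F i n)) =
      (\<Sum>n\<le>j. of_nat (Suc i) * ?L * F (Suc i) n - ?R * (F i n * of_nat (Suc i)))"
    by (simp add: sum_distrib_left sum_distrib_right sum_subtractf right_diff_distrib mult_ac del: of_nat_Suc)
  also have "\<dots> = (\<Sum>n\<le>j. (a + of_nat i + 1) * (W n - W (Suc n)))"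
  proof (intro sum.cong refl)
    fix n
    have "of_nat (Suc i) * ?L * F (Suc i) n - ?R * (F i n * of_nat (Suc i)) = u n * (a + of_nat i + 1) *
        (of_nat (Suc i) * ?L * (a + 2 * of_nat n) -
         (of_nat s + of_nat i + of_nat j + 1) * ((a + 2 * of_nat n) * (of_nat (Suc i) - of_nat n) * (a + of_nat i + 1 + of_nat n)))"
      unfolding F1 F2 right_diff_distrib by (simp only: mult_ac)
    also have "of_nat (Suc i) = (of_nat i + 1 :: complex)" by simp
    also note dougall_certificate[where i = "of_nat i :: complex" and j = "of_nat j" and s = "of_nat s" and t = "of_nat t" and n = "of_nat n", folded a_def]
    finally show "of_nat (Suc i) * ?L * F (Suc i) n - ?R * (F i n * of_nat (Suc i)) = (a + of_nat i + 1) * (W n - W (Suc n))"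
      unfolding W_Suc unfolding W_def by (simp add: right_diff_distrib mult_ac add.commute[of 1])
  qed
  also have "\<dots> = (a + of_nat i + 1) * (W 0 - W (Suc j))"
    by (simp only: sum_telescope flip: sum_distrib_left)
  also have "\<dots> = 0" unfolding W_Suc by (simp add: W_def)
  finally have "?L * (\<Sum>n\<le>j. F (Suc i) n) = ?R * (\<Sum>n\<le>j. F i n)"
    by (simp del: of_nat_Suc)
  also have "(\<Sum>n\<le>j. F i n) = a * (pochhammer (a + 1) i * pochhammer (of_nat s + of_nat j + 1) i /
      (pochhammer (a + of_nat j + 1) i * pochhammer (of_nat s + 1) i))"
    unfolding F_def by (rule Suc.IH)
  also have "?R * \<dots> = ?L * (a * (pochhammer (a + 1) (Suc i) * pochhammer (of_nat s + of_nat j + 1) (Suc i) /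
      (pochhammer (a + of_nat j + 1) (Suc i) * pochhammer (of_nat s + 1) (Suc i))))"
  proof -
    define x1 x2 where x: "x1 = a + of_nat i + of_nat j + 1" "x2 = of_nat s + of_nat i + (1 :: complex)"
    have x0: "x1 \<noteq> 0" "x2 \<noteq> 0" using nz(1)[of "i + j"] nz(2)[of i] by (auto simp: x add_ac)
    have y: "a + of_nat j + 1 + of_nat i = x1" "of_nat s + 1 + of_nat i = x2" by (auto simp: x add_ac)
    show ?thesis
      unfolding pochhammer_Suc y x[symmetric] using x0 by (simp add: divide_simps) (simp add: algebra_simps)
  qed
  finally have "?L * (\<Sum>n\<le>j. F (Suc i) n) =
      ?L * (a * (pochhammer (a + 1) (Suc i) * pochhammer (of_nat s + of_nat j + 1) (Suc i) /
      (pochhammer (a + of_nat j + 1) (Suc i) * pochhammer (of_nat s + 1) (Suc i))))" .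
  moreover have "?L \<noteq> 0" using nz(1)[of "i + j"] nz(2)[of i] by (simp add: add_ac)
  ultimately have "(\<Sum>n\<le>j. F (Suc i) n) = a * (pochhammer (a + 1) (Suc i) * pochhammer (of_nat s + of_nat j + 1) (Suc i) /
      (pochhammer (a + of_nat j + 1) (Suc i) * pochhammer (of_nat s + 1) (Suc i)))"
    by (simp only: mult_cancel_left) blast
  then show ?case unfolding F_def .
qed

lemma telescoped_diff:
  fixes D p j :: complex
  assumes "(p + j) * D = j / p" "p \<noteq> 0" "p + j \<noteq> 0"
  shows "D = 1 / p - 1 / (p + j)"
proof -
  have "D = j / p / (p + j)" using assms(1,3) by (metis nonzero_mult_div_cancel_left)
  also have "\<dots> = 1 / p - 1 / (p + j)" using assms(2,3) by (simp add: divide_simps)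
  finally show ?thesis .
qed

text \<open>The limit of \<open>dougall_sum\<close> as t tends to 0, after subtracting the term with
  n = 0 and dividing by t (up to the constant \<open>s\<close>); the index is m = n - 1. Since
  \<open>t\<close> is a natural number there, the formula is proved afresh with a telescoping
  \<open>W\<close> of the same kind.\<close>

lemma dougall_sum_limit:
  fixes s i j :: nat
  shows "(\<Sum>m<j. (1 / (of_nat m + 1) + 1 / (of_nat s + of_nat m + 1)) *
      (ffact (of_nat i) (Suc m) * ffact (of_nat j) (Suc m) /
        (pochhammer (of_nat s + of_nat i + 1) (Suc m) * pochhammer (of_nat s + of_nat j + 1) (Suc m)))) =
    (harm (s + i) + harm (s + j) - harm (s + i + j) - harm s :: complex)"
proof (induction i)
  case 0
  show ?case by (simp add: ffact_of_nat_eq_0[of 0, where 'c = complex, simplified])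
next
  case (Suc i)
  have nz: "of_nat s + of_nat m + 1 \<noteq> (0::complex)" for m
    using of_nat_Suc_plus_nz(2)[of "s + m"] by (auto simp: add_ac)
  have pnz: "pochhammer (of_nat s + of_nat m + 1 :: complex) n \<noteq> 0" for m n
    using pochhammer_of_nat_nz[of "s + m" n] by (auto simp: add_ac)
  define F where "F i m = (1 / (of_nat m + 1) + 1 / (of_nat s + of_nat m + 1)) *
      (ffact (of_nat i) (Suc m) * ffact (of_nat j) (Suc m) /
        (pochhammer (of_nat s + of_nat i + 1) (Suc m) * pochhammer (of_nat s + of_nat j + 1) (Suc m)) :: complex)" for i m
  define v where "v m = ffact (of_nat i) m * ffact (of_nat j) (Suc m) /
        (pochhammer (of_nat s + of_nat i + 1) (Suc (Suc m)) * pochhammer (of_nat s + of_nat j + 1) (Suc m) :: complex)" for m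
  define W where "W m = v m * ((of_nat s + of_nat i + 2 + of_nat m) * (of_nat s + of_nat j + 1 + of_nat m))" for m
  have W_Suc: "W (Suc m) = v m * ((of_nat i - of_nat m) * (of_nat j - of_nat m - 1))" for m
  proof -
    define x1 x2 where x: "x1 = of_nat s + of_nat i + 2 + (1 + of_nat m :: complex)" "x2 = of_nat s + of_nat j + 1 + (1 + of_nat m :: complex)"
    have x0: "x1 \<noteq> 0" "x2 \<noteq> 0" using nz[of "i + 2 + m"] nz[of "j + 1 + m"] by (auto simp: x add_ac)
    have y: "of_nat s + of_nat i + 1 + of_nat (Suc (Suc m)) = x1" "of_nat s + of_nat j + 1 + of_nat (Suc m) = x2"
      by (auto simp: x)
    have "v (Suc m) * (x1 * x2) = v m * ((of_nat i - of_nat m) * (of_nat j - of_nat (Suc m)))"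
      unfolding v_def pochhammer_Suc[of _ "Suc (Suc m)"] pochhammer_Suc[of "of_nat s + of_nat j + 1" "Suc m"] ffact_Suc[of _ m] ffact_Suc[of _ "Suc m"] y
      using x0 by (simp add: divide_simps del: of_nat_Suc)
    then show ?thesis by (simp add: W_def x algebra_simps)
  qed
  have nz1: "(of_nat m + 1 :: complex) \<noteq> 0" for m by (rule of_nat_Suc_plus_nz)
  have F1: "F (Suc i) m = (1 / (of_nat m + 1) + 1 / (of_nat s + of_nat m + 1)) * v m * (of_nat (Suc i) * (of_nat s + of_nat i + 1))" for m
  proof -
    have "pochhammer (of_nat s + of_nat i + 1) (Suc (Suc m)) = (of_nat s + of_nat i + 1 :: complex) * pochhammer (of_nat s + of_nat (Suc i) + 1) (Suc m)"
      by (simp add: pochhammer_rec[of _ "Suc m"] add_ac)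
    then show ?thesis
      unfolding F_def v_def ffact_Suc_Suc[of i m] using nz[of i] by (simp del: of_nat_Suc)
  qed
  have F2: "F i m = (1 / (of_nat m + 1) + 1 / (of_nat s + of_nat m + 1)) * v m * ((of_nat i - of_nat m) * (of_nat s + of_nat i + 2 + of_nat m))" for m
  proof -
    have y: "of_nat s + of_nat i + 1 + of_nat (Suc m) = (of_nat s + of_nat i + 2 + of_nat m :: complex)" by simp
    have "(of_nat s + of_nat i + 2 + of_nat m :: complex) \<noteq> 0" using nz[of "i + 1 + m"] by (simp add: add_ac)
    then show ?thesis
      unfolding F_def v_def ffact_Suc[of "of_nat i" m] pochhammer_Suc[of "of_nat s + of_nat i + 1" "Suc m"] y by simp
  qed
  have "(of_nat s + of_nat i + 1 + of_nat j) * (F (Suc i) m - F i m) = W m - W (Suc m)" for m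
  proof -
    have "F (Suc i) m - F i m = (1 / (of_nat m + 1) + 1 / (of_nat s + of_nat m + 1)) * v m * ((of_nat m + 1) * (of_nat s + of_nat m + 1))"
      unfolding F1 F2 by (simp add: algebra_simps)
    also have "\<dots> = v m * (of_nat s + 2 * of_nat m + 2)"
      using nz1[of m] nz[of m] by (simp add: divide_simps)
    finally show ?thesis unfolding W_Suc unfolding W_def by (simp add: algebra_simps)
  qed
  then have "(of_nat s + of_nat i + 1 + of_nat j) * ((\<Sum>m<j. F (Suc i) m) - (\<Sum>m<j. F i m)) = (\<Sum>m<j. W m - W (Suc m))"
    by (simp add: sum_distrib_left sum_subtractf[symmetric])
  also have "\<dots> = W 0 - W j" by (rule sum_lessThan_telescope')
  also have "W j = 0"
    by (simp add: W_def v_def ffact_of_nat_eq_0)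
  also have "W 0 - 0 = of_nat j / (of_nat s + of_nat i + 1)"
  proof -
    define x1 x2 where x: "x1 = of_nat s + of_nat i + 2 + (0 :: complex)" "x2 = of_nat s + of_nat j + (1 :: complex)"
    have x0: "x1 \<noteq> 0" "x2 \<noteq> 0" using nz[of "i + 1"] nz[of j] by (auto simp: x add_ac)
    have y: "of_nat s + of_nat i + 1 + of_nat (Suc 0) = x1" "of_nat s + of_nat i + 2 = x1" by (auto simp: x)
    show ?thesis
      unfolding W_def v_def using x0 y nz[of i]
      by (simp add: pochhammer_Suc ffact_Suc y x(2)[symmetric])
  qed
  finally have "(of_nat s + of_nat i + 1 + of_nat j) * ((\<Sum>m<j. F (Suc i) m) - (\<Sum>m<j. F i m)) = of_nat j / (of_nat s + of_nat i + 1)" .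
  then have "(\<Sum>m<j. F (Suc i) m) - (\<Sum>m<j. F i m) = 1 / (of_nat s + of_nat i + 1) - 1 / (of_nat s + of_nat i + 1 + of_nat j)"
    by (rule telescoped_diff) (use nz[of i] nz[of "i + j"] in \<open>simp_all add: add_ac\<close>)
  moreover have "(\<Sum>m<j. F i m) = harm (s + i) + harm (s + j) - harm (s + i + j) - harm s"
    unfolding F_def by (rule Suc.IH)
  moreover have "harm (s + Suc i) = harm (s + i) + 1 / (of_nat s + of_nat i + 1 :: complex)"
    "harm (s + Suc i + j) = harm (s + i + j) + 1 / (of_nat s + of_nat i + 1 + of_nat j :: complex)"
    by (simp_all add: harm_Suc inverse_eq_divide add_ac)
  ultimately have "(\<Sum>m<j. F (Suc i) m) = harm (s + Suc i) + harm (s + j) - harm (s + Suc i + j) - harm s"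
    by (simp add: diff_eq_eq)
  then show ?case unfolding F_def .
qed

text \<open>The fraction is the Beta integral of x^m (1 - x)^u over [0, 1], so the sum is the
  integral of (1 - x)^(u + r). The recurrence \<open>rec\<close> splits off a factor 1 - x.\<close>

lemma beta_sum:
  "(\<Sum>m\<le>r. (-1) ^ m * of_nat (r choose m) * (fact m * fact u / fact (u + m + 1))) = (1 / (of_nat u + of_nat r + 1) :: complex)"
proof (induction r arbitrary: u)
  case 0
  show ?case using of_nat_Suc_plus_nz(2)[of u] by (simp add: divide_simps) (simp add: algebra_simps)
next
  case (Suc r)
  define f :: "nat \<Rightarrow> nat \<Rightarrow> complex" where "f u m = fact m * fact u / fact (u + m + 1)" for u m
  have rec: "f u (Suc m) = f u m - f (Suc u) m" for m
  proof -
    have "(2 + (of_nat u + of_nat m) :: complex) = of_nat (Suc (u + m + 1))" by simp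
    then have "(2 + (of_nat u + of_nat m) :: complex) \<noteq> 0" by (simp only: of_nat_neq_0 not_False_eq_True)
    then show ?thesis by (simp add: f_def divide_simps) (simp add: algebra_simps)
  qed
  have "(\<Sum>m\<le>Suc r. (-1) ^ m * of_nat (Suc r choose m) * f u m) =
      f u 0 + (\<Sum>m\<le>r. (-1) ^ Suc m * of_nat (Suc r choose Suc m) * f u (Suc m))"
    by (subst sum.atMost_Suc_shift) simp
  also have "(\<Sum>m\<le>r. (-1) ^ Suc m * of_nat (Suc r choose Suc m) * f u (Suc m)) =
      (\<Sum>m\<le>r. (-1) ^ Suc m * of_nat (r choose Suc m) * f u (Suc m)) + (\<Sum>m\<le>r. (-1) ^ Suc m * of_nat (r choose m) * f u (Suc m))"
    unfolding sum.distrib[symmetric] by (intro sum.cong refl) (simp add: algebra_simps)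
  also have "f u 0 + ((\<Sum>m\<le>r. (-1) ^ Suc m * of_nat (r choose Suc m) * f u (Suc m)) + (\<Sum>m\<le>r. (-1) ^ Suc m * of_nat (r choose m) * f u (Suc m))) =
      (\<Sum>m\<le>Suc r. (-1) ^ m * of_nat (r choose m) * f u m) + (\<Sum>m\<le>r. (-1) ^ Suc m * of_nat (r choose m) * f u (Suc m))"
    by (subst sum.atMost_Suc_shift) simp
  also have "\<dots> = (\<Sum>m\<le>r. (-1) ^ m * of_nat (r choose m) * f u m) - (\<Sum>m\<le>r. (-1) ^ m * of_nat (r choose m) * f u (Suc m))"
    by (simp add: sum_negf)
  also have "\<dots> = (\<Sum>m\<le>r. (-1) ^ m * of_nat (r choose m) * f (Suc u) m)"
    unfolding rec sum_subtractf[symmetric] by (intro sum.cong refl) (simp add: algebra_simps)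
  also have "\<dots> = 1 / (of_nat (Suc u) + of_nat r + 1)" unfolding f_def by (rule Suc.IH)
  finally show ?case by (simp add: f_def add_ac)
qed

text \<open>By Pascal's rule the increment from \<open>r\<close> to \<open>r + 1\<close> is minus a
  \<open>beta_sum\<close>.\<close>

lemma alternating_harm_sum:
  "(\<Sum>t<r. (-1) ^ Suc t * of_nat (r choose Suc t) * (fact t * fact u / fact (u + t + 1))) = (harm u - harm (u + r) :: complex)"
proof (induction r)
  case (Suc r)
  define f :: "nat \<Rightarrow> complex" where "f m = fact m * fact u / fact (u + m + 1)" for m
  have "(\<Sum>t<Suc r. (-1) ^ Suc t * of_nat (Suc r choose Suc t) * f t) =
      (\<Sum>t<Suc r. (-1) ^ Suc t * of_nat (r choose Suc t) * f t) - (\<Sum>t\<le>r. (-1) ^ t * of_nat (r choose t) * f t)"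
    unfolding lessThan_Suc_atMost sum_subtractf[symmetric] by (intro sum.cong refl) (simp add: algebra_simps)
  also have "\<dots> = (\<Sum>t<r. (-1) ^ Suc t * of_nat (r choose Suc t) * f t) - 1 / (of_nat u + of_nat r + 1)"
    unfolding f_def beta_sum by simp
  also have "\<dots> = harm u - harm (u + Suc r)"
    unfolding f_def Suc by (simp add: harm_Suc inverse_eq_divide add_ac)
  finally show ?case unfolding f_def .
qed simp

lemma dougall_factorial:
  fixes s t i j :: nat
  assumes "t > 0" "s > 0"
  shows "(\<Sum>n\<le>min i j. fact (t + n - 1) * fact (s - 1 + t + n) * (of_nat s + of_nat t + 2 * of_nat n) /
      (fact n * fact (s + n) * fact (i - n) * fact (j - n) * fact (s + t + n + i) * fact (s + t + n + j))) =
    (fact (t - 1) * fact (s + i + j) / (fact i * fact j * fact (s + i) * fact (s + j) * fact (s + t + i + j)) :: complex)"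
proof -
  define a :: complex where "a = of_nat s + of_nat t"
  define C :: complex where "C = fact (t - 1) * fact (s + t - 1) / (fact s * fact i * fact j * fact (s + t + i) * fact (s + t + j))"
  define F where "F n = pochhammer (of_nat t) n * pochhammer a n * (a + 2 * of_nat n) / (fact n * pochhammer (of_nat s + 1) n) *
      (ffact (of_nat i) n * ffact (of_nat j) n / (pochhammer (a + of_nat i + 1) n * pochhammer (a + of_nat j + 1) n))" for n
  have f1: "fact (t + n - 1) = fact (t - 1) * pochhammer (of_nat t :: complex) n" for n
    using fact_add_pochhammer[of "t - 1" n] assms(1) by (simp add: of_nat_diff)
  have f2: "fact (s - 1 + t + n) = fact (s + t - 1) * pochhammer a n" for n
    using fact_add_pochhammer[of "s + t - 1" n] assms by (simp add: of_nat_diff a_def)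
  have f3: "fact (s + n) = fact s * pochhammer (of_nat s + 1 :: complex) n" for n
    by (rule fact_add_pochhammer)
  have f4: "fact (s + t + n + m) = fact (s + t + m) * pochhammer (a + of_nat m + 1) n" for n m
    using fact_add_pochhammer[of "s + t + m" n] by (simp add: a_def add_ac)
  have f5: "(1 :: complex) / fact (m - n) = ffact (of_nat m) n / fact m" if "n \<le> m" for m n
    using ffact_of_nat[OF that] by simp
  have "(\<Sum>n\<le>min i j. fact (t + n - 1) * fact (s - 1 + t + n) * (of_nat s + of_nat t + 2 * of_nat n) /
      (fact n * fact (s + n) * fact (i - n) * fact (j - n) * fact (s + t + n + i) * fact (s + t + n + j))) =
      (\<Sum>n\<le>min i j. C * F n)"
  proof (intro sum.cong refl)
    fix n assume n: "n \<in> {..min i j}"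
    have "fact (t + n - 1) * fact (s - 1 + t + n) * (of_nat s + of_nat t + 2 * of_nat n) /
        (fact n * fact (s + n) * fact (i - n) * fact (j - n) * fact (s + t + n + i) * fact (s + t + n + j)) =
        fact (t + n - 1) * fact (s - 1 + t + n) * (a + 2 * of_nat n) /
        (fact n * fact (s + n) * fact (s + t + n + i) * fact (s + t + n + j)) * (1 / fact (i - n)) * (1 / fact (j - n))"
      by (simp add: a_def)
    also have "\<dots> = C * F n"
      using n unfolding f1 f2 f3 f4 f5[of n i, OF min.boundedE[of n i j]] by (simp add: f5 C_def F_def mult_ac)
    finally show "fact (t + n - 1) * fact (s - 1 + t + n) * (of_nat s + of_nat t + 2 * of_nat n) /
        (fact n * fact (s + n) * fact (i - n) * fact (j - n) * fact (s + t + n + i) * fact (s + t + n + j)) = C * F n" .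
  qed
  also have "\<dots> = (\<Sum>n\<le>j. C * F n)"
    by (rule sum.mono_neutral_left) (auto simp: F_def ffact_of_nat_eq_0)
  also have "\<dots> = C * (a * (pochhammer (a + 1) i * pochhammer (of_nat s + of_nat j + 1) i /
      (pochhammer (a + of_nat j + 1) i * pochhammer (of_nat s + 1) i)))"
    unfolding sum_distrib_left[symmetric] F_def a_def dougall_sum[OF assms(1)] ..
  also have "a * fact (s + t - 1) = fact (s + t)"
    using assms(1) by (cases t) (simp_all add: a_def)
  then have "C = fact (t - 1) * fact (s + t) / (fact s * fact i * fact j * fact (s + t + i) * fact (s + t + j)) / a"
    using assms by (simp add: C_def a_def field_simps flip: of_nat_add)
  also have "\<dots> * (a * (pochhammer (a + 1) i * pochhammer (of_nat s + of_nat j + 1) i /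
      (pochhammer (a + of_nat j + 1) i * pochhammer (of_nat s + 1) i))) =
      fact (t - 1) * fact (s + i + j) / (fact i * fact j * fact (s + i) * fact (s + j) * fact (s + t + i + j))"
  proof -
    have a0: "a \<noteq> 0" using assms by (simp add: a_def flip: of_nat_add)
    have e: "pochhammer (a + 1) i = fact (s + t + i) / fact (s + t)"
      "pochhammer (of_nat s + of_nat j + 1) i = (fact (s + i + j) / fact (s + j) :: complex)"
      "pochhammer (a + of_nat j + 1) i = fact (s + t + i + j) / fact (s + t + j)"
      "pochhammer (of_nat s + 1) i = (fact (s + i) / fact s :: complex)"
      using fact_add_pochhammer[of "s + t" i] fact_add_pochhammer[of "s + j" i] fact_add_pochhammer[of "s + t + j" i] fact_add_pochhammer[of s i]
      by (simp_all add: a_def add_ac)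
    show ?thesis unfolding e using a0 by (simp add: divide_simps)
  qed
  finally show ?thesis .
qed

lemma dougall_factorial_limit:
  fixes s i j :: nat
  assumes "s > 0"
  shows "(\<Sum>n=1..min i j. fact (n - 1) * fact (s - 1 + n) * (of_nat s + 2 * of_nat n) /
      (fact n * fact (s + n) * fact (i - n) * fact (j - n) * fact (s + n + i) * fact (s + n + j))) =
    ((harm (s + i) + harm (s + j) - harm (s + i + j) - harm s) / (fact i * fact j * fact (s + i) * fact (s + j)) :: complex)"
proof -
  define C :: complex where "C = 1 / (fact i * fact j * fact (s + i) * fact (s + j))"
  define F where "F m = (1 / (of_nat m + 1) + 1 / (of_nat s + of_nat m + 1)) *
      (ffact (of_nat i) (Suc m) * ffact (of_nat j) (Suc m) /
        (pochhammer (of_nat s + of_nat i + 1) (Suc m) * pochhammer (of_nat s + of_nat j + 1) (Suc m)) :: complex)" for m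
  have f4: "fact (s + n + m) = fact (s + m) * pochhammer (of_nat s + of_nat m + 1 :: complex) n" for n m
    using fact_add_pochhammer[of "s + m" n] by (simp add: add_ac)
  have f5: "(1 :: complex) / fact (m - n) = ffact (of_nat m) n / fact m" if "n \<le> m" for m n
    using ffact_of_nat[OF that] by simp
  have "(\<Sum>n=1..min i j. fact (n - 1) * fact (s - 1 + n) * (of_nat s + 2 * of_nat n) /
      (fact n * fact (s + n) * fact (i - n) * fact (j - n) * fact (s + n + i) * fact (s + n + j))) =
      (\<Sum>m<min i j. C * F m)"
  proof (rule sum.reindex_bij_witness[of _ Suc "\<lambda>n. n - 1"])
    fix n assume n: "n \<in> {1..min i j}"
    then obtain m where m: "n = Suc m" by (cases n) auto
    obtain s' where s': "s = Suc s'" using assms by (cases s) auto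
    have nz: "(of_nat m + 1 :: complex) \<noteq> 0" "(of_nat s + of_nat m + 1 :: complex) \<noteq> 0"
      using of_nat_Suc_plus_nz(2)[of m] of_nat_Suc_plus_nz(2)[of "s + m"] by (auto simp: add_ac)
    have "fact (n - 1) * fact (s - 1 + n) * (of_nat s + 2 * of_nat n) /
        (fact n * fact (s + n) * fact (i - n) * fact (j - n) * fact (s + n + i) * fact (s + n + j)) =
        (fact (n - 1) / fact n * (fact (s - 1 + n) / fact (s + n)) * (of_nat s + 2 * of_nat n)) / (fact (s + n + i) * fact (s + n + j)) * (1 / fact (i - n)) * (1 / fact (j - n) :: complex)"
      by simp
    also have "fact (n - 1) / fact n * (fact (s - 1 + n) / fact (s + n)) * (of_nat s + 2 * of_nat n) = 1 / (of_nat m + 1) + 1 / (of_nat s + of_nat m + 1 :: complex)"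
    proof -
      define p q where pq: "p = (of_nat m + 1 :: complex)" "q = (of_nat s + of_nat m + 1 :: complex)"
      have "fact n = p * fact m" "fact (s + n) = q * fact (s + m)" "of_nat s + 2 * of_nat n = p + q"
        "s - 1 + n = s + m" "n - 1 = m" by (simp_all add: m s' pq add_ac)
      then show ?thesis using nz unfolding pq[symmetric] by (simp add: divide_simps)
    qed
    also have "\<dots> / (fact (s + n + i) * fact (s + n + j)) * (1 / fact (i - n)) * (1 / fact (j - n)) = C * F (n - 1)"
      using n unfolding f4 by (simp add: f5 C_def F_def m mult_ac)
    finally show "C * F (n - 1) = fact (n - 1) * fact (s - 1 + n) * (of_nat s + 2 * of_nat n) /
        (fact n * fact (s + n) * fact (i - n) * fact (j - n) * fact (s + n + i) * fact (s + n + j))" by simp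
  qed auto
  also have "\<dots> = (\<Sum>m<j. C * F m)"
    by (rule sum.mono_neutral_left) (auto simp: F_def ffact_of_nat_eq_0)
  also have "\<dots> = C * (harm (s + i) + harm (s + j) - harm (s + i + j) - harm s)"
    unfolding sum_distrib_left[symmetric] F_def dougall_sum_limit ..
  finally show ?thesis by (simp add: C_def)
qed

text \<open>For fixed positive \<open>t\<close> the inner sum is \<open>dougall_factorial\<close>,
  for \<open>t = 0\<close> it is its limit; the outer sum over \<open>t\<close> is then
  \<open>alternating_harm_sum\<close>. The term with \<open>t = n = 0\<close>, where the factorial
  of t + n - 1 has a pole, is left out and corresponds to the separately defined
  \<open>M_coeff\<close> at \<open>(0, 0)\<close>.\<close>

lemma double_sum:
  fixes s i j r :: nat
  assumes "s > 0"
  shows "(\<Sum>t\<le>r. \<Sum>n\<le>min i j. if t = 0 \<and> n = 0 then 0 else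
      (-1) ^ t * fact (t + n - 1) * fact (s - 1 + t + n) * (of_nat s + of_nat t + 2 * of_nat n) /
      (fact n * fact t * fact (s + n) * fact (i - n) * fact (j - n) * fact (r - t) * fact (s + t + n + i) * fact (s + t + n + j))) =
    ((harm (s + i) + harm (s + j) - harm (s + i + j + r) - harm s) / (fact r * fact i * fact j * fact (s + i) * fact (s + j)) :: complex)"
proof -
  define f where "f t n = (if t = 0 \<and> n = 0 then 0 else
      (-1) ^ t * fact (t + n - 1) * fact (s - 1 + t + n) * (of_nat s + of_nat t + 2 * of_nat n) /
      (fact n * fact t * fact (s + n) * fact (i - n) * fact (j - n) * fact (r - t) * fact (s + t + n + i) * fact (s + t + n + j)) :: complex)" for t n :: nat
  define Z :: complex where "Z = fact r * fact i * fact j * fact (s + i) * fact (s + j)"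
  have "(\<Sum>n\<le>min i j. f 0 n) = (\<Sum>n=1..min i j. f 0 n)"
    by (rule sum.mono_neutral_right) (auto simp: f_def)
  also have "\<dots> = (\<Sum>n=1..min i j. 1 / fact r * (fact (n - 1) * fact (s - 1 + n) * (of_nat s + 2 * of_nat n) /
      (fact n * fact (s + n) * fact (i - n) * fact (j - n) * fact (s + n + i) * fact (s + n + j))))"
    by (intro sum.cong refl) (auto simp: f_def)
  also have "\<dots> = (harm (s + i) + harm (s + j) - harm (s + i + j) - harm s) / Z"
    unfolding sum_distrib_left[symmetric] dougall_factorial_limit[OF assms] by (simp add: Z_def)
  finally have t0: "(\<Sum>n\<le>min i j. f 0 n) = (harm (s + i) + harm (s + j) - harm (s + i + j) - harm s) / Z" .
  have t1: "(\<Sum>n\<le>min i j. f (Suc t) n) = (-1) ^ Suc t * of_nat (r choose Suc t) * (fact t * fact (s + i + j) / fact (s + i + j + t + 1)) / Z"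
    if "t < r" for t
  proof -
    have "(\<Sum>n\<le>min i j. f (Suc t) n) = (\<Sum>n\<le>min i j. (-1) ^ Suc t / (fact (Suc t) * fact (r - Suc t)) *
      (fact (Suc t + n - 1) * fact (s - 1 + Suc t + n) * (of_nat s + of_nat (Suc t) + 2 * of_nat n) /
      (fact n * fact (s + n) * fact (i - n) * fact (j - n) * fact (s + Suc t + n + i) * fact (s + Suc t + n + j))))"
      by (intro sum.cong refl) (simp add: f_def mult_ac del: fact_Suc of_nat_Suc add_Suc_right add_Suc)
    also have "\<dots> = (-1) ^ Suc t / (fact (Suc t) * fact (r - Suc t)) *
        (fact (Suc t - 1) * fact (s + i + j) / (fact i * fact j * fact (s + i) * fact (s + j) * fact (s + Suc t + i + j)))"
      unfolding sum_distrib_left[symmetric] by (subst dougall_factorial) (use assms in auto)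
    also have "\<dots> = (-1) ^ Suc t * (fact r / (fact (Suc t) * fact (r - Suc t))) * (fact t * fact (s + i + j) / fact (s + i + j + t + 1)) / Z"
    proof -
      have e: "s + Suc t + i + j = s + i + j + t + 1" by simp
      show ?thesis unfolding e by (simp add: Z_def del: fact_Suc)
    qed
    also have "fact r / (fact (Suc t) * fact (r - Suc t)) = (of_nat (r choose Suc t) :: complex)"
      using that by (simp add: binomial_fact del: fact_Suc)
    finally show ?thesis .
  qed
  have "(\<Sum>t\<le>r. \<Sum>n\<le>min i j. f t n) = (\<Sum>n\<le>min i j. f 0 n) + (\<Sum>t<r. \<Sum>n\<le>min i j. f (Suc t) n)"
    by (rule sum.atMost_shift)
  also have "(\<Sum>t<r. \<Sum>n\<le>min i j. f (Suc t) n) =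
      (\<Sum>t<r. (-1) ^ Suc t * of_nat (r choose Suc t) * (fact t * fact (s + i + j) / fact (s + i + j + t + 1)) / Z)"
    by (intro sum.cong refl t1) auto
  also have "\<dots> = (harm (s + i + j) - harm (s + i + j + r)) / Z"
    unfolding sum_divide_distrib[symmetric] alternating_harm_sum ..
  finally have "(\<Sum>t\<le>r. \<Sum>n\<le>min i j. f t n) = (harm (s + i) + harm (s + j) - harm (s + i + j + r) - harm s) / Z"
    unfolding t0 by (simp add: diff_divide_distrib add_divide_distrib)
  then show ?thesis unfolding f_def Z_def .
qed

text \<open>A quarter of the difference between the node \<open>j\<close> and the common value of
  the nodes \<open>e\<close> and \<open>l\<close>; see \<open>cas_node_diff\<close>.\<close>

definition node_diff :: "nat \<Rightarrow> nat \<Rightarrow> nat \<Rightarrow> complex" where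
  "node_diff e l j = (of_nat j - of_nat l) * (of_nat j - of_nat e)"

lemma node_diff_nz: "j \<noteq> e \<Longrightarrow> j \<noteq> l \<Longrightarrow> node_diff e l j \<noteq> 0"
  by (simp add: node_diff_def)

text \<open>The coefficients, in the Newton basis with nodes \<open>- node_diff e l j\<close>, of the polynomial that vanishes at
  all nodes except the double node \<open>0\<close> (for \<open>j = e, l\<close>), where it is \<open>1\<close> with derivative \<open>0\<close>.\<close>

definition newton_coef :: "nat \<Rightarrow> nat \<Rightarrow> nat \<Rightarrow> complex" where
  "newton_coef e l n = (if n < e then 0 else (\<Prod>j\<in>{..n} - {e, l}. 1 / node_diff e l j) *
     (if n < l then 1 else - (\<Sum>j\<in>{..n} - {e, l}. 1 / node_diff e l j)))"

lemma prod_node_ratio: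
  assumes "J \<subseteq> - {e, l}" "finite J"
  shows "(\<Prod>j\<in>J. 1 / node_diff e l j) * (\<Prod>j\<in>J. t + node_diff e l j) = (\<Prod>j\<in>J. 1 + t / node_diff e l j)"
  unfolding prod.distrib[symmetric]
proof (intro prod.cong refl)
  fix j assume "j \<in> J"
  then have "node_diff e l j \<noteq> 0" using assms by (intro node_diff_nz) auto
  then show "1 / node_diff e l j * (t + node_diff e l j) = 1 + t / node_diff e l j" by (simp add: add_divide_distrib)
qed

text \<open>The partial sums of the Newton series factor completely: as long as \<open>l\<close> is
  not reached, the term for a new node multiplies the sum so far by the linear factor of that
  node.\<close>

lemma newton_single:
  assumes "e \<le> n" "n < l"
  shows "(\<Sum>j\<le>n. newton_coef e l j * (\<Prod>i<j. t + node_diff e l i)) = (\<Prod>j\<in>{..n} - {e, l}. 1 + t / node_diff e l j)"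
  using assms
proof (induction n rule: dec_induct)
  case base
  have "{..e} - {e, l} = {..<e}" using assms by auto
  moreover have "(\<Sum>j\<le>e. newton_coef e l j * (\<Prod>i<j. t + node_diff e l i)) = (\<Sum>j\<le>e. if j = e then newton_coef e l e * (\<Prod>i<e. t + node_diff e l i) else 0)"
    by (intro sum.cong) (auto simp: newton_coef_def)
  ultimately show ?case
    using assms by (simp add: newton_coef_def) (intro prod_node_ratio, auto)
next
  case (step n)
  let ?J = "{..n} - {e, l}"
  have J: "{..Suc n} - {e, l} = insert (Suc n) ?J" "Suc n \<notin> ?J" using step by auto
  have "{..<Suc n} = insert e ?J" "e \<notin> ?J" using step by auto
  then have P: "(\<Prod>i<Suc n. t + node_diff e l i) = t * (\<Prod>j\<in>?J. t + node_diff e l j)"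
    by (simp add: node_diff_def[of e l e])
  have "newton_coef e l (Suc n) * (\<Prod>i<Suc n. t + node_diff e l i) = t / node_diff e l (Suc n) * ((\<Prod>j\<in>?J. 1 / node_diff e l j) * (\<Prod>j\<in>?J. t + node_diff e l j))"
    unfolding P newton_coef_def J using step J(2) by simp
  also have "\<dots> = t / node_diff e l (Suc n) * (\<Prod>j\<in>?J. 1 + t / node_diff e l j)"
    by (subst prod_node_ratio) auto
  finally show ?case
    using step J by (simp add: algebra_simps)
qed

text \<open>To first order in \<open>t\<close> the product is 1 plus \<open>t\<close> times the sum
  of the reciprocals. The additional factor cancels this linear term, so the value 1 at
  \<open>t = 0\<close> comes with derivative 0.\<close>

lemma newton_double:
  assumes "e < l" "l \<le> n"
  shows "(\<Sum>j\<le>n. newton_coef e l j * (\<Prod>i<j. t + node_diff e l i)) =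
    (\<Prod>j\<in>{..n} - {e, l}. 1 + t / node_diff e l j) * (1 - t * (\<Sum>j\<in>{..n} - {e, l}. 1 / node_diff e l j))"
  using assms(2)
proof (induction n rule: dec_induct)
  case base
  obtain m where m: "l = Suc m" "e \<le> m" using assms(1) by (cases l) auto
  let ?J = "{..m} - {e, l}"
  have J: "{..l} - {e, l} = ?J" using m by auto
  have "{..<l} = insert e ?J" "e \<notin> ?J" using m by auto
  then have P: "(\<Prod>i<l. t + node_diff e l i) = t * (\<Prod>j\<in>?J. t + node_diff e l j)"
    by (simp add: node_diff_def[of e l e])
  have "newton_coef e l l * (\<Prod>i<l. t + node_diff e l i) = - t * (\<Sum>j\<in>?J. 1 / node_diff e l j) * ((\<Prod>j\<in>?J. 1 / node_diff e l j) * (\<Prod>j\<in>?J. t + node_diff e l j))"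
    unfolding P newton_coef_def J using assms by simp
  also have "\<dots> = - t * (\<Sum>j\<in>?J. 1 / node_diff e l j) * (\<Prod>j\<in>?J. 1 + t / node_diff e l j)"
    by (subst prod_node_ratio) auto
  finally have "newton_coef e l l * (\<Prod>i<l. t + node_diff e l i) = - t * (\<Sum>j\<in>?J. 1 / node_diff e l j) * (\<Prod>j\<in>?J. 1 + t / node_diff e l j)" .
  moreover have "(\<Sum>j\<le>m. newton_coef e l j * (\<Prod>i<j. t + node_diff e l i)) = (\<Prod>j\<in>?J. 1 + t / node_diff e l j)"
    by (rule newton_single) (use m in auto)
  moreover have "(\<Sum>j\<le>l. newton_coef e l j * (\<Prod>i<j. t + node_diff e l i)) =
      (\<Sum>j\<le>m. newton_coef e l j * (\<Prod>i<j. t + node_diff e l i)) + newton_coef e l l * (\<Prod>i<l. t + node_diff e l i)"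
    unfolding m(1) by (rule sum.atMost_Suc)
  ultimately show ?case unfolding J by (simp add: algebra_simps)
next
  case (step n)
  let ?J = "{..n} - {e, l}"
  define Q S d where Q: "Q = (\<Prod>j\<in>?J. 1 + t / node_diff e l j)" and S: "S = (\<Sum>j\<in>?J. 1 / node_diff e l j)" and d: "d = 1 / node_diff e l (Suc n)"
  have J: "{..Suc n} - {e, l} = insert (Suc n) ?J" "Suc n \<notin> ?J" using step assms by auto
  have "{..<Suc n} = insert e (insert l ?J)" "e \<notin> ?J" "l \<notin> ?J" "e \<noteq> l" using step assms by auto
  then have P: "(\<Prod>i<Suc n. t + node_diff e l i) = t * (t * (\<Prod>j\<in>?J. t + node_diff e l j))"
    by (simp add: node_diff_def[of e l e] node_diff_def[of e l l])
  have sJ: "(\<Sum>j\<in>{..Suc n} - {e, l}. 1 / node_diff e l j) = S + d" using J by (simp add: S d)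
  have pJ: "(\<Prod>j\<in>{..Suc n} - {e, l}. 1 / node_diff e l j) = d * (\<Prod>j\<in>?J. 1 / node_diff e l j)" using J by (simp add: d)
  have qJ: "(\<Prod>j\<in>{..Suc n} - {e, l}. 1 + t / node_diff e l j) = (1 + t * d) * Q" using J by (simp add: Q d)
  have "newton_coef e l (Suc n) * (\<Prod>i<Suc n. t + node_diff e l i) = - (S + d) * d * t\<^sup>2 * ((\<Prod>j\<in>?J. 1 / node_diff e l j) * (\<Prod>j\<in>?J. t + node_diff e l j))"
    unfolding P newton_coef_def sJ pJ using step assms by (simp add: power2_eq_square algebra_simps)
  also have "\<dots> = - (S + d) * d * t\<^sup>2 * Q"
    by (subst prod_node_ratio) (auto simp: Q)
  finally have "(\<Sum>j\<le>Suc n. newton_coef e l j * (\<Prod>i<j. t + node_diff e l i)) = Q * (1 - t * S) + - (S + d) * d * t\<^sup>2 * Q"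
    using step.IH unfolding sum.atMost_Suc Q S by (simp only:)
  also have "\<dots> = (1 + t * d) * Q * (1 - t * (S + d))"
    by (simp add: power2_eq_square algebra_simps)
  finally show ?case unfolding sJ qJ .
qed

section \<open>Expansion of eigenvalues in products of falling factorials\<close>

lemma ffact_gbinomial: "ffact a n = fact n * (a gchoose n :: complex)"
  by (simp add: gbinomial_prod_rev ffact_def atLeast0LessThan)

definition triangle :: "nat \<Rightarrow> (nat \<times> nat) set" where
  "triangle d = {(i, j). i + j \<le> d}"

lemma finite_triangle [simp]: "finite (triangle d)"
  by (rule finite_subset[of _ "{..d} \<times> {..d}"]) (auto simp: triangle_def)

lemma gbinomial_trinomial:
  "(x + y + z) gchoose r = (\<Sum>(a, b)\<in>triangle r. (x gchoose a) * (y gchoose b) * (z gchoose (r - a - b)) :: complex)"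
proof -
  have "(x + y + z) gchoose r = (\<Sum>a\<le>r. (x gchoose a) * (\<Sum>b\<le>r - a. (y gchoose b) * (z gchoose (r - a - b))))"
  proof -
    have "(y + z) gchoose (r - a) = (\<Sum>b\<le>r - a. (y gchoose b) * (z gchoose (r - a - b)))" for a
      using gbinomial_Vandermonde[of y z "r - a"] by (simp only: atLeast0AtMost)
    then show ?thesis
      using gbinomial_Vandermonde[of x "y + z" r] by (simp only: atLeast0AtMost add.assoc)
  qed
  also have "\<dots> = (\<Sum>(a, b)\<in>(SIGMA a:{..r}. {..r - a}). (x gchoose a) * (y gchoose b) * (z gchoose (r - a - b)))"
    by (simp add: sum.Sigma sum_distrib_left mult.assoc)
  also have "(SIGMA a:{..r}. {..r - a}) = triangle r"
    by (auto simp: triangle_def)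
  finally show ?thesis .
qed

text \<open>Write \<open>x + y + K - 2 * j\<close> as \<open>(x - j) + (y - j) + K\<close> and apply
  the threefold Vandermonde convolution; \<open>ffact x j\<close> then combines with the falling
  factorial of \<open>x - j\<close>, and likewise for \<open>y\<close>.\<close>

lemma capelli_poly_expansion:
  fixes K x y :: complex
  shows "(\<Sum>j\<le>d div 2. b j * ffact x j * ffact y j * ffact (x + y + K - 2 * of_nat j) (d - 2 * j) / fact (d - 2 * j)) =
    (\<Sum>(A, B)\<in>triangle d. ((K gchoose (d - A - B)) * (\<Sum>j\<le>min A B. b j / (fact (A - j) * fact (B - j)))) * (ffact x A * ffact y B))"
proof -
  define g where "g A B j = (K gchoose (d - A - B)) * (b j / (fact (A - j) * fact (B - j))) * (ffact x A * ffact y B)" for A B j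
  have "b j * ffact x j * ffact y j * ffact (x + y + K - 2 * of_nat j) (d - 2 * j) / fact (d - 2 * j) =
      (\<Sum>(a, b)\<in>triangle (d - 2 * j). g (j + a) (j + b) j)" for j
  proof -
    have "x + y + K - 2 * of_nat j = (x - of_nat j) + (y - of_nat j) + K" by simp
    then have "b j * ffact x j * ffact y j * ffact (x + y + K - 2 * of_nat j) (d - 2 * j) / fact (d - 2 * j) =
        b j * ffact x j * ffact y j * (\<Sum>(a, b)\<in>triangle (d - 2 * j). ((x - of_nat j) gchoose a) * ((y - of_nat j) gchoose b) * (K gchoose (d - 2 * j - a - b)))"
      by (simp only: ffact_gbinomial[of "_ + K"] gbinomial_trinomial[symmetric]) simp
    also have "\<dots> = (\<Sum>(a, b)\<in>triangle (d - 2 * j). g (j + a) (j + b) j)"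
      unfolding sum_distrib_left
    proof (intro sum.cong refl, clarify)
      fix a b'
      have "d - 2 * j - a - b' = d - (j + a) - (j + b')" by simp
      then show "b j * ffact x j * ffact y j * (((x - of_nat j) gchoose a) * ((y - of_nat j) gchoose b') * (K gchoose (d - 2 * j - a - b'))) =
          g (j + a) (j + b') j"
        by (simp only: g_def ffact_add[of _ j] ffact_gbinomial[of "_ - _"]) simp
    qed
    finally show ?thesis .
  qed
  then have "(\<Sum>j\<le>d div 2. b j * ffact x j * ffact y j * ffact (x + y + K - 2 * of_nat j) (d - 2 * j) / fact (d - 2 * j)) =
      (\<Sum>(j, a, b)\<in>(SIGMA j:{..d div 2}. triangle (d - 2 * j)). g (j + a) (j + b) j)"
    by (simp add: sum.Sigma)
  also have "\<dots> = (\<Sum>(p, j)\<in>(SIGMA p:triangle d. {..min (fst p) (snd p)}). g (fst p) (snd p) j)"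
    by (rule sum.reindex_bij_witness[of _ "\<lambda>((A, B), j). (j, A - j, B - j)" "\<lambda>(j, a, b). ((j + a, j + b), j)"])
       (auto simp: triangle_def)
  also have "\<dots> = (\<Sum>p\<in>triangle d. \<Sum>j\<le>min (fst p) (snd p). g (fst p) (snd p) j)"
    by (simp add: sum.Sigma)
  also have "\<dots> = (\<Sum>(A, B)\<in>triangle d. ((K gchoose (d - A - B)) * (\<Sum>j\<le>min A B. b j / (fact (A - j) * fact (B - j)))) * (ffact x A * ffact y B))"
    by (intro sum.cong refl) (simp add: g_def case_prod_beta sum_distrib_left sum_distrib_right)
  finally show ?thesis .
qed

section \<open>Regular parts of the Knop--Sahi polynomials\<close>

lemma eval2_simps [simp]:
  "eval2 (f + g) x y = eval2 f x y + eval2 g x y"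
  "eval2 (f * g) x y = eval2 f x y * eval2 g x y"
  "eval2 (cmult2 c f) x y = c * eval2 f x y"
  "eval2 0 x y = 0"
  by (simp_all add: eval2_def cmult2_def)

lemma eval2_sum: "eval2 (sum f A) x y = (\<Sum>a\<in>A. eval2 (f a) x y)"
  by (induction A rule: infinite_finite_induct) auto

lemma eval2_ffact [simp]: "eval2 (ffact X_var n) x y = ffact x n" "eval2 (ffact Y_var n) x y = ffact y n"
proof -
  have "poly (X_var - of_nat i) [:y:] = [:- of_nat i, 1:]" "poly (Y_var - of_nat i) [:y:] = [:y - of_nat i:]" for i
    by (simp_all add: X_var_def Y_var_def of_nat_poly)
  then show "eval2 (ffact X_var n) x y = ffact x n" "eval2 (ffact Y_var n) x y = ffact y n"
    by (simp_all add: eval2_def ffact_def poly_prod)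
qed

lemma poly2_eqI:
  assumes "infinite B" "\<And>y. y \<in> B \<Longrightarrow> infinite {x. eval2 f x y = eval2 g x y}"
  shows "f = g"
proof -
  have row: "poly f [:y:] = poly g [:y:]" if "y \<in> B" for y
  proof (rule ccontr)
    assume "poly f [:y:] \<noteq> poly g [:y:]"
    then have "finite {x. poly (poly f [:y:] - poly g [:y:]) x = 0}" by (intro poly_roots_finite) simp
    then show False using assms(2)[OF that] by (simp add: eval2_def)
  qed
  have "f - g = 0"
  proof (rule ccontr)
    assume "f - g \<noteq> 0"
    then have "finite {p. poly (f - g) p = 0}" by (rule poly_roots_finite)
    moreover have "(\<lambda>y. [:y:]) ` B \<subseteq> {p. poly (f - g) p = 0}" using row by auto
    moreover have "infinite ((\<lambda>y. [:y:]) ` B)"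
      using assms(1) by (subst finite_image_iff) (auto simp: inj_on_def)
    ultimately show False using finite_subset by blast
  qed
  then show ?thesis by simp
qed

lemma coeff2_simps [simp]:
  "coeff2 (f + g) i j = coeff2 f i j + coeff2 g i j"
  "coeff2 (f - g) i j = coeff2 f i j - coeff2 g i j"
  "coeff2 (cmult2 c f) i j = c * coeff2 f i j"
  "coeff2 0 i j = 0"
  by (simp_all add: coeff2_def cmult2_def)

lemma coeff2_sum: "coeff2 (sum f A) i j = (\<Sum>a\<in>A. coeff2 (f a) i j)"
  by (induction A rule: infinite_finite_induct) auto

lemma poly2_coeff_eqI: "(\<And>i j. coeff2 f i j = coeff2 g i j) \<Longrightarrow> f = g"
  unfolding coeff2_def by (intro poly_eqI) (metis poly_eqI)

lemma coeff2_ffact_mult: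
  "coeff2 (ffact X_var a * ffact Y_var b) i j = coeff (ffact [:0, 1:] a) i * coeff (ffact [:0, 1:] b) j"
proof -
  have X: "ffact X_var a = [:ffact [:0, 1:] a:]" for a
    by (induction a) (simp_all add: ffact_Suc X_var_def of_nat_poly one_pCons)
  have Y: "coeff (ffact Y_var b) j = [:coeff (ffact [:0, 1:] b) j:]" for b j
  proof (induction b arbitrary: j)
    case 0
    show ?case by (cases j) (simp_all add: coeff_1 one_pCons)
  next
    case (Suc b)
    have *: "Y_var - of_nat b = [:[:- of_nat b:], 1:]" "[:0, 1:] - of_nat b = [:- of_nat b, 1 :: complex:]"
      by (simp_all add: Y_var_def of_nat_poly)
    show ?case
      unfolding ffact_Suc * by (cases j) (simp_all add: Suc.IH coeff_pCons algebra_simps)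
  qed
  show ?thesis unfolding coeff2_def X by (simp add: Y mult.commute)
qed

definition falling2 :: "nat \<Rightarrow> nat \<Rightarrow> poly2" where
  "falling2 a b = ffact X_var a * ffact Y_var b"

lemma coeff2_falling2_swap: "coeff2 (falling2 a b) i j = coeff2 (falling2 b a) j i"
  by (simp add: falling2_def coeff2_ffact_mult)

lemma coeffwise_lim_eq:
  assumes "finite I" "\<And>a. a \<in> I \<Longrightarrow> (c a \<longlongrightarrow> s a) (at z)" "\<And>\<kappa>. F \<kappa> = (\<Sum>a\<in>I. cmult2 (c a \<kappa>) (P a))"
  shows "coeffwise_lim z F = (\<Sum>a\<in>I. cmult2 (s a) (P a))"
proof -
  have lim: "((\<lambda>\<kappa>. coeff2 (F \<kappa>) i j) \<longlongrightarrow> coeff2 (\<Sum>a\<in>I. cmult2 (s a) (P a)) i j) (at z)" for i j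
    unfolding assms(3) coeff2_sum coeff2_simps by (intro tendsto_intros assms)
  show ?thesis
    unfolding coeffwise_lim_def
  proof (rule the_equality)
    fix f assume f: "\<forall>i j. ((\<lambda>\<kappa>. coeff2 (F \<kappa>) i j) \<longlongrightarrow> coeff2 f i j) (at z)"
    show "f = (\<Sum>a\<in>I. cmult2 (s a) (P a))"
      by (rule poly2_coeff_eqI) (use f lim tendsto_unique[OF trivial_limit_at] in blast)
  qed (use lim in blast)
qed

definition knop_sahi_coef :: "complex \<Rightarrow> nat \<Rightarrow> nat \<Rightarrow> nat \<Rightarrow> complex" where
  "knop_sahi_coef \<kappa> d i j = fact d * ffact (\<kappa> + 1) (d - i) * ffact (\<kappa> + 1) (d - j)
      / (fact i * fact j * fact (d - i - j) * ffact (\<kappa> + 1) d)"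

lemma knop_sahi_alt:
  "knop_sahi \<kappa> (l1, l2) = (\<Sum>(i, j)\<in>triangle (l1 - l2). cmult2 (knop_sahi_coef \<kappa> (l1 - l2) i j) (falling2 (l2 + i) (l2 + j)))"
  unfolding knop_sahi_def prod.case Let_def triangle_def knop_sahi_coef_def falling2_def ..

lemma in_triangle: "a \<in> triangle d \<longleftrightarrow> fst a + snd a \<le> d"
  by (cases a) (simp add: triangle_def)

lemma R_poly_eq:
  assumes "\<And>i j. i + j \<le> l1 - l2 \<Longrightarrow> ((\<lambda>\<kappa>. (\<kappa> - of_nat k) * knop_sahi_coef \<kappa> (l1 - l2) i j) \<longlongrightarrow> S i j) (at (of_nat k))"
    "\<And>i j. i + j \<le> l1 - l2 \<Longrightarrow> ((\<lambda>\<kappa>. knop_sahi_coef \<kappa> (l1 - l2) i j - S i j / (\<kappa> - of_nat k)) \<longlongrightarrow> r i j) (at (of_nat k))"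
  shows "R_poly k (l1, l2) = (\<Sum>(i, j)\<in>triangle (l1 - l2). cmult2 (r i j) (falling2 (l2 + i) (l2 + j)))"
proof -
  let ?I = "triangle (l1 - l2)" and ?P = "\<lambda>(i, j). falling2 (l2 + i) (l2 + j)"
  have cm: "cmult2 a (\<Sum>x\<in>A. cmult2 (f x) (g x)) = (\<Sum>x\<in>A. cmult2 (a * f x) (g x))" for a f g and A :: "(nat \<times> nat) set"
    by (rule poly2_coeff_eqI) (simp add: coeff2_sum sum_distrib_left mult.assoc)
  have S: "Sing_part k (l1, l2) = (\<Sum>a\<in>?I. cmult2 (S (fst a) (snd a)) (?P a))"
    unfolding Sing_part_def
    by (rule coeffwise_lim_eq[where c = "\<lambda>a \<kappa>. (\<kappa> - of_nat k) * knop_sahi_coef \<kappa> (l1 - l2) (fst a) (snd a)"])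
       (auto simp: assms(1) in_triangle knop_sahi_alt case_prod_unfold cm)
  have "R_poly k (l1, l2) = (\<Sum>a\<in>?I. cmult2 (r (fst a) (snd a)) (?P a))"
    unfolding R_poly_def S
  proof (rule coeffwise_lim_eq[where c = "\<lambda>a \<kappa>. knop_sahi_coef \<kappa> (l1 - l2) (fst a) (snd a) - S (fst a) (snd a) / (\<kappa> - of_nat k)"])
    fix \<kappa>
    show "knop_sahi \<kappa> (l1, l2) - cmult2 (1 / (\<kappa> - of_nat k)) (\<Sum>a\<in>?I. cmult2 (S (fst a) (snd a)) (?P a)) =
        (\<Sum>a\<in>?I. cmult2 (knop_sahi_coef \<kappa> (l1 - l2) (fst a) (snd a) - S (fst a) (snd a) / (\<kappa> - of_nat k)) (?P a))"
      by (rule poly2_coeff_eqI)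
         (simp add: knop_sahi_alt case_prod_unfold cm coeff2_sum left_diff_distrib sum_subtractf)
  qed (auto simp: assms(2) in_triangle)
  then show ?thesis by (simp add: case_prod_unfold)
qed

lemma isCont_ffact [continuous_intros]: "isCont f z \<Longrightarrow> isCont (\<lambda>\<kappa>. ffact (f \<kappa> :: complex) n) z"
  unfolding ffact_def by (intro continuous_intros)

lemma ffact_of_nat_nz: "n \<le> p \<Longrightarrow> ffact (of_nat p :: complex) n \<noteq> 0"
  by (simp add: ffact_of_nat)

text \<open>For \<open>l1 - l2 \<le> k\<close> the denominator does not vanish at
  \<open>\<kappa> = k\<close>, so the singular part is 0 and the regular part is the value.\<close>

lemma R_poly_regular:
  assumes "l1 - l2 \<le> k"
  shows "R_poly k (l1, l2) = (\<Sum>(i, j)\<in>triangle (l1 - l2). cmult2 (knop_sahi_coef (of_nat k) (l1 - l2) i j) (falling2 (l2 + i) (l2 + j)))"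
proof -
  have "ffact (of_nat k + 1 :: complex) (l1 - l2) \<noteq> 0"
    using ffact_of_nat_nz[of "l1 - l2" "k + 1"] assms by (simp add: add.commute)
  then have "isCont (\<lambda>\<kappa>. knop_sahi_coef \<kappa> (l1 - l2) i j) (of_nat k)" for i j
    unfolding knop_sahi_coef_def by (intro continuous_intros) auto
  then have lim: "((\<lambda>\<kappa>. knop_sahi_coef \<kappa> (l1 - l2) i j) \<longlongrightarrow> knop_sahi_coef (of_nat k) (l1 - l2) i j) (at (of_nat k))" for i j
    by (simp add: isCont_def)
  have "((\<lambda>\<kappa>. (\<kappa> - of_nat k) * knop_sahi_coef \<kappa> (l1 - l2) i j) \<longlongrightarrow> (of_nat k - of_nat k) * knop_sahi_coef (of_nat k) (l1 - l2) i j) (at (of_nat k))" for i j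
    by (intro tendsto_intros lim)
  then show ?thesis
    by (intro R_poly_eq[where S = "\<lambda>_ _. 0"]) (use lim in auto)
qed

lemma ffact_eq_pochhammer: "ffact (c + of_nat q - 1 :: complex) q = pochhammer c q"
proof (induction q arbitrary: c)
  case (Suc q)
  have "ffact (c + of_nat (Suc q) - 1) (Suc q) = ffact (c + 1 + of_nat q - 1) q * c"
    by (simp add: ffact_Suc algebra_simps)
  then show ?case using Suc.IH[of "c + 1"] by (simp add: pochhammer_rec mult.commute)
qed simp

lemma inverse_fact_ffact: "n \<le> p \<Longrightarrow> 1 / fact (p - n) = ffact (of_nat p) n / (fact p :: complex)"
  using ffact_of_nat[of n p] by simp

lemma chu_vandermonde_factorial:
  fixes c :: complex
  assumes "\<And>i. c + of_nat i \<noteq> 0"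
  shows "(\<Sum>n\<le>min p q. 1 / (fact (p - n) * fact (q - n) * (fact n * pochhammer c n))) =
    pochhammer (c + of_nat p) q / (fact p * fact q * pochhammer c q)"
proof -
  have "(\<Sum>n\<le>min p q. 1 / (fact (p - n) * fact (q - n) * (fact n * pochhammer c n))) =
      (\<Sum>n\<le>min p q. 1 / (fact p * fact q) * (ffact (of_nat p) n * ffact (of_nat q) n / (fact n * pochhammer c n)))"
  proof (intro sum.cong refl)
    fix n assume "n \<in> {..min p q}"
    then have n: "n \<le> p" "n \<le> q" by auto
    have "1 / (fact (p - n) * fact (q - n) * (fact n * pochhammer c n)) = 1 / fact (p - n) * (1 / fact (q - n)) / (fact n * pochhammer c n)"
      by simp
    also have "\<dots> = 1 / (fact p * fact q) * (ffact (of_nat p) n * ffact (of_nat q) n / (fact n * pochhammer c n))"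
      unfolding inverse_fact_ffact[OF n(1)] inverse_fact_ffact[OF n(2)] by simp
    finally show "1 / (fact (p - n) * fact (q - n) * (fact n * pochhammer c n)) =
        1 / (fact p * fact q) * (ffact (of_nat p) n * ffact (of_nat q) n / (fact n * pochhammer c n))" .
  qed
  also have "\<dots> = (\<Sum>n\<le>q. 1 / (fact p * fact q) * (ffact (of_nat p) n * ffact (of_nat q) n / (fact n * pochhammer c n)))"
    by (rule sum.mono_neutral_left) (auto simp: ffact_of_nat_eq_0)
  also have "\<dots> = 1 / (fact p * fact q) * (pochhammer (c + of_nat p) q / pochhammer c q)"
    by (simp only: chu_vandermonde[OF assms] flip: sum_distrib_left)
  finally show ?thesis by simp
qed

text \<open>This has the shape of the coefficients in \<open>capelli_poly_expansion\<close>, a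
  binomial coefficient times a sum over \<open>n\<close> with the weights 1 / ((p - n)! (q - n)!),
  so that the two can be compared term by term in \<open>n\<close>.\<close>

lemma knop_sahi_coef_vandermonde:
  assumes "\<And>i. \<kappa> + 2 - of_nat d + of_nat i \<noteq> 0" "ffact (\<kappa> + 1) d \<noteq> 0" "p + q \<le> d"
  shows "knop_sahi_coef \<kappa> d p q = fact d * (ffact (\<kappa> + 1) (d - p - q) / fact (d - p - q)) *
    (\<Sum>n\<le>min p q. 1 / (fact (p - n) * fact (q - n) * (fact n * pochhammer (\<kappa> + 2 - of_nat d) n)))"
proof -
  define c where "c = \<kappa> + 2 - of_nat d"
  have 1: "ffact (\<kappa> + 1) d = ffact (\<kappa> + 1) (d - q) * pochhammer c q"
  proof -
    have "\<kappa> + 1 - of_nat (d - q) = c + of_nat q - 1" using assms(3) by (simp add: c_def of_nat_diff)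
    then have "ffact (\<kappa> + 1) (d - q + q) = ffact (\<kappa> + 1) (d - q) * pochhammer c q"
      unfolding ffact_add by (simp only: ffact_eq_pochhammer)
    then show ?thesis using assms(3) by simp
  qed
  have 2: "ffact (\<kappa> + 1) (d - p) = ffact (\<kappa> + 1) (d - p - q) * pochhammer (c + of_nat p) q"
  proof -
    have "of_nat (d - p - q) = (of_nat d - of_nat p - of_nat q :: complex)" using assms(3) by (simp add: of_nat_diff)
    then have "\<kappa> + 1 - of_nat (d - p - q) = c + of_nat p + of_nat q - 1" by (simp add: c_def)
    then have "ffact (\<kappa> + 1) (d - p - q + q) = ffact (\<kappa> + 1) (d - p - q) * pochhammer (c + of_nat p) q"
      unfolding ffact_add by (simp only: ffact_eq_pochhammer)
    moreover have "d - p - q + q = d - p" using assms(3) by simp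
    ultimately show ?thesis by (simp only:)
  qed
  have nz: "ffact (\<kappa> + 1) (d - q) \<noteq> 0" "pochhammer c q \<noteq> 0" using assms(2) unfolding 1 by auto
  have "knop_sahi_coef \<kappa> d p q = fact d * (ffact (\<kappa> + 1) (d - p - q) / fact (d - p - q)) * (pochhammer (c + of_nat p) q / (fact p * fact q * pochhammer c q))"
    unfolding knop_sahi_coef_def 1 2 using nz by (simp add: divide_simps)
  then show ?thesis
    unfolding chu_vandermonde_factorial[OF assms(1)] c_def .
qed

text \<open>The Knop--Sahi coefficients are expanded by Chu--Vandermonde (\<open>knop_sahi_coef_vandermonde\<close>) into terms with
  denominators \<open>pochhammer (\<kappa> + 2 - d) n\<close>; for \<open>d = k + 1 + s\<close> these have a simple zero at
  \<open>\<kappa> = k\<close> exactly if \<open>n \<ge> s\<close>. The number \<open>pole_coef s n\<close> is what remains of \<open>1 / (fact n * pochhammer \<dots>)\<close>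
  at \<open>\<kappa> = k\<close> without the vanishing factor, and \<open>R_coef\<close> is the finite part of the whole coefficient.\<close>

definition pole_coef :: "nat \<Rightarrow> nat \<Rightarrow> complex" where
  "pole_coef s n = 1 / (fact n * (\<Prod>i\<in>{1..n} - {s}. of_nat i - of_nat s))"

definition R_coef :: "nat \<Rightarrow> nat \<Rightarrow> nat \<Rightarrow> nat \<Rightarrow> complex" where
  "R_coef k s p q = (let r = k + 1 + s - p - q; \<beta> = ffact (of_nat k + 1) r / fact r;
      \<beta>' = deriv (\<lambda>\<kappa>. ffact (\<kappa> + 1) r / fact r) (of_nat k) in
    fact (k + 1 + s) * (\<Sum>n\<le>min p q. (if n < s then \<beta> else \<beta>' - \<beta> * (\<Sum>i\<in>{1..n} - {s}. 1 / (of_nat i - of_nat s))) *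
      pole_coef s n / (fact (p - n) * fact (q - n))))"

lemma ffact_has_derivative:
  "((\<lambda>\<kappa>. ffact (\<kappa> + 1) r / fact r) has_field_derivative deriv (\<lambda>\<kappa>. ffact (\<kappa> + 1) r / fact r) z) (at (z :: complex))"
proof -
  have "(\<lambda>\<kappa> :: complex. ffact (\<kappa> + 1) r) field_differentiable at z"
    by (induction r) (auto simp: ffact_Suc intro!: derivative_intros)
  then have "(\<lambda>\<kappa> :: complex. ffact (\<kappa> + 1) r / fact r) field_differentiable at z"
    by (intro derivative_intros) auto
  then show ?thesis by (simp add: DERIV_deriv_iff_field_differentiable)
qed

lemma DERIV_prod_shift:
  fixes c :: "nat \<Rightarrow> complex"
  assumes "finite I" "\<And>i. i \<in> I \<Longrightarrow> c i \<noteq> 0"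
  shows "((\<lambda>\<kappa>. \<Prod>i\<in>I. c i + (\<kappa> - z)) has_field_derivative (\<Prod>i\<in>I. c i) * (\<Sum>i\<in>I. 1 / c i)) (at z)"
  using assms
proof (induction I rule: finite_induct)
  case (insert i I)
  have "((\<lambda>\<kappa>. (c i + (\<kappa> - z)) * (\<Prod>i\<in>I. c i + (\<kappa> - z))) has_field_derivative
      (1 * (\<Prod>i\<in>I. c i + (z - z)) + (\<Prod>i\<in>I. c i) * (\<Sum>i\<in>I. 1 / c i) * (c i + (z - z)))) (at z)"
    by (intro DERIV_mult insert.IH) (use insert.prems in \<open>auto intro!: derivative_eq_intros\<close>)
  moreover have "1 * (\<Prod>i\<in>I. c i + (z - z)) + (\<Prod>i\<in>I. c i) * (\<Sum>i\<in>I. 1 / c i) * (c i + (z - z)) = (\<Prod>i\<in>insert i I. c i) * (\<Sum>i\<in>insert i I. 1 / c i)"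
    using insert by (simp add: field_simps)
  ultimately show ?case using insert.hyps by simp
qed simp

text \<open>\<open>\<kappa> - k\<close> times a coefficient extends to a function \<open>U\<close>
  that is differentiable at \<open>k\<close>. The value of \<open>U\<close> at \<open>k\<close> is
  the singular part and its derivative there is the regular part.\<close>

lemma R_poly_singular:
  assumes "s \<ge> 1" "l1 - l2 = k + 1 + s" "s \<le> k + 1"
  shows "R_poly k (l1, l2) = (\<Sum>(p, q)\<in>triangle (l1 - l2). cmult2 (R_coef k s p q) (falling2 (l2 + p) (l2 + q)))"
proof -
  let ?k = "of_nat k :: complex" and ?d = "k + 1 + s"
  \<comment> \<open>For \<open>n \<ge> s\<close> the vanishing factor \<open>i = s\<close> of the
    Pochhammer symbol cancels against \<open>\<kappa> - k\<close>; for \<open>n < s\<close> there is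
    no such factor and \<open>\<kappa> - k\<close> stays in the numerator.\<close>
  define U where "U p q \<kappa> = fact ?d * (ffact (\<kappa> + 1) (?d - p - q) / fact (?d - p - q)) *
      (\<Sum>n\<le>min p q. (if n < s then \<kappa> - ?k else 1) / (fact (p - n) * fact (q - n) * (fact n * (\<Prod>i\<in>{1..n} - {s}. (of_nat i - of_nat s) + (\<kappa> - ?k)))))" for p q \<kappa>
  have near: "eventually (\<lambda>\<kappa>. (\<kappa> - ?k) * knop_sahi_coef \<kappa> ?d p q = U p q \<kappa>) (at ?k)" if pq: "p + q \<le> ?d" for p q
  proof -
    \<comment> \<open>All zeros of the linear factors in question lie at integers, so within
      distance 1 of \<open>k\<close> only \<open>k\<close> itself has to be excluded.\<close>
    have "eventually (\<lambda>\<kappa>. dist \<kappa> ?k < 1 \<and> \<kappa> \<noteq> ?k) (at ?k)"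
      unfolding eventually_at by (intro exI[of _ 1]) auto
    then show ?thesis
    proof (rule eventually_mono)
      fix \<kappa> assume \<kappa>: "dist \<kappa> ?k < 1 \<and> \<kappa> \<noteq> ?k"
      define \<epsilon> where "\<epsilon> = \<kappa> - ?k"
      have int: "\<epsilon> + of_int z \<noteq> 0" for z
      proof
        assume "\<epsilon> + of_int z = 0"
        then have e: "\<epsilon> = of_int (- z)" by (simp add: eq_neg_iff_add_eq_0)
        then have "norm \<epsilon> = \<bar>of_int z\<bar>" by (metis norm_of_int of_int_minus abs_minus_cancel of_int_abs)
        then have "of_int \<bar>z\<bar> < (1 :: real)" using \<kappa> by (simp add: \<epsilon>_def dist_norm)
        then have "z = 0" by simp
        then show False using e \<kappa> by (simp add: \<epsilon>_def)
      qed
      have c: "\<kappa> + 2 - of_nat ?d = 1 - of_nat s + \<epsilon>" by (simp add: \<epsilon>_def)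
      have 1: "\<kappa> + 2 - of_nat ?d + of_nat i \<noteq> 0" for i
        unfolding c using int[of "1 - int s + int i"] by (simp add: algebra_simps)
      have 2: "ffact (\<kappa> + 1) ?d \<noteq> 0"
      proof -
        have "\<kappa> + 1 - of_nat i \<noteq> 0" for i
          using int[of "int k + 1 - int i"] by (simp add: \<epsilon>_def algebra_simps)
        then show ?thesis by (simp only: ffact_def prod_zero_iff[OF finite_lessThan]) blast
      qed
      have poch: "pochhammer (\<kappa> + 2 - of_nat ?d) n = (\<Prod>i\<in>{1..n}. (of_nat i - of_nat s) + \<epsilon>)" for n
        unfolding c pochhammer_prod
        by (rule prod.reindex_bij_witness[of _ "\<lambda>i. i - 1" Suc]) (auto simp: of_nat_diff)
      have "\<epsilon> * (1 / (fact (p - n) * fact (q - n) * (fact n * pochhammer (\<kappa> + 2 - of_nat ?d) n))) =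
          (if n < s then \<kappa> - ?k else 1) / (fact (p - n) * fact (q - n) * (fact n * (\<Prod>i\<in>{1..n} - {s}. (of_nat i - of_nat s) + (\<kappa> - ?k))))" for n
      proof (cases "n < s")
        case True
        then have "{1..n} - {s} = {1..n}" by auto
        then show ?thesis using True unfolding poch \<epsilon>_def[symmetric] by simp
      next
        case False
        then have "(\<Prod>i\<in>{1..n}. (of_nat i - of_nat s) + \<epsilon>) = \<epsilon> * (\<Prod>i\<in>{1..n} - {s}. (of_nat i - of_nat s) + \<epsilon>)"
          using assms(1) by (subst prod.remove[of _ s]) auto
        moreover have "\<epsilon> \<noteq> 0" using int[of 0] by simp
        ultimately show ?thesis using False unfolding poch \<epsilon>_def[symmetric] by simp
      qed
      then have *: "\<epsilon> * (\<Sum>n\<le>min p q. 1 / (fact (p - n) * fact (q - n) * (fact n * pochhammer (\<kappa> + 2 - of_nat ?d) n))) =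
          (\<Sum>n\<le>min p q. (if n < s then \<kappa> - ?k else 1) / (fact (p - n) * fact (q - n) * (fact n * (\<Prod>i\<in>{1..n} - {s}. (of_nat i - of_nat s) + (\<kappa> - ?k)))))"
        unfolding sum_distrib_left by (intro sum.cong refl)
      show "(\<kappa> - ?k) * knop_sahi_coef \<kappa> ?d p q = U p q \<kappa>"
        unfolding knop_sahi_coef_vandermonde[OF 1 2 pq] U_def mult.left_commute[of "\<kappa> - ?k"] using *[unfolded \<epsilon>_def] by (simp only:)
    qed
  qed
  have dU: "(U p q has_field_derivative R_coef k s p q) (at ?k)" for p q
  proof -
    let ?r = "?d - p - q"
    let ?b = "\<lambda>\<kappa> :: complex. ffact (\<kappa> + 1) ?r / fact ?r"
    let ?v = "\<lambda>n \<kappa>. (if n < s then \<kappa> - ?k else 1) / (fact (p - n) * fact (q - n) * (fact n * (\<Prod>i\<in>{1..n} - {s}. (of_nat i - of_nat s) + (\<kappa> - ?k))))"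
    define v' where "v' n = (if n < s then 1 else - (\<Sum>i\<in>{1..n} - {s}. 1 / (of_nat i - of_nat s))) * pole_coef s n / (fact (p - n) * fact (q - n))" for n
    have prod_nz: "(\<Prod>i\<in>{1..n} - {s}. of_nat i - of_nat s :: complex) \<noteq> 0" for n
      by (simp add: prod_zero_iff)
    have dv: "(?v n has_field_derivative v' n) (at ?k)" for n
    proof -
      have dp: "((\<lambda>\<kappa>. fact (p - n) * fact (q - n) * (fact n * (\<Prod>i\<in>{1..n} - {s}. (of_nat i - of_nat s) + (\<kappa> - ?k)))) has_field_derivative
          fact (p - n) * fact (q - n) * (fact n * ((\<Prod>i\<in>{1..n} - {s}. of_nat i - of_nat s) * (\<Sum>i\<in>{1..n} - {s}. 1 / (of_nat i - of_nat s))))) (at ?k)"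
        by (intro DERIV_cmult DERIV_prod_shift) auto
      have dn: "((\<lambda>\<kappa>. if n < s then \<kappa> - ?k else 1) has_field_derivative (if n < s then 1 else 0)) (at ?k)"
        by (auto intro!: derivative_eq_intros)
      show ?thesis
        by (rule DERIV_cong, rule DERIV_divide[OF dn dp])
           (use prod_nz[of n] in \<open>auto simp: v'_def pole_coef_def divide_simps\<close>)
    qed
    have "(U p q has_field_derivative (fact ?d * deriv ?b ?k) * (\<Sum>n\<le>min p q. ?v n ?k) + (\<Sum>n\<le>min p q. v' n) * (fact ?d * ?b ?k)) (at ?k)"
      unfolding U_def by (intro DERIV_mult DERIV_cmult ffact_has_derivative DERIV_sum dv)
    also have "(fact ?d * deriv ?b ?k) * (\<Sum>n\<le>min p q. ?v n ?k) + (\<Sum>n\<le>min p q. v' n) * (fact ?d * ?b ?k) = R_coef k s p q"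
    proof -
      have "deriv ?b ?k * ?v n ?k + v' n * ?b ?k = (if n < s then ?b ?k else deriv ?b ?k - ?b ?k * (\<Sum>i\<in>{1..n} - {s}. 1 / (of_nat i - of_nat s))) *
          pole_coef s n / (fact (p - n) * fact (q - n))" for n
        by (simp add: v'_def pole_coef_def diff_divide_distrib left_diff_distrib mult_ac)
      then have "deriv ?b ?k * (\<Sum>n\<le>min p q. ?v n ?k) + (\<Sum>n\<le>min p q. v' n) * ?b ?k =
          (\<Sum>n\<le>min p q. (if n < s then ?b ?k else deriv ?b ?k - ?b ?k * (\<Sum>i\<in>{1..n} - {s}. 1 / (of_nat i - of_nat s))) *
          pole_coef s n / (fact (p - n) * fact (q - n)))"
        unfolding sum_distrib_left sum_distrib_right sum.distrib[symmetric] by (simp only:)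
      note eq = this
      have "F * b' * S1 + S2 * (F * b) = F * (b' * S1 + S2 * b)" for F b b' S1 S2 :: complex
        by (simp add: algebra_simps)
      then show ?thesis unfolding R_coef_def Let_def by (simp only: eq)
    qed
    finally show ?thesis .
  qed
  show ?thesis
  proof (rule R_poly_eq[where S = "\<lambda>p q. U p q ?k"], unfold assms(2))
    fix p q assume pq: "p + q \<le> ?d"
    have "(U p q \<longlongrightarrow> U p q ?k) (at ?k)" using DERIV_isCont[OF dU] by (simp add: isCont_def)
    then show "((\<lambda>\<kappa>. (\<kappa> - ?k) * knop_sahi_coef \<kappa> ?d p q) \<longlongrightarrow> U p q ?k) (at ?k)"
      by (rule Lim_transform_eventually) (use near[OF pq] in \<open>simp add: eq_commute\<close>)
    have "((\<lambda>\<kappa>. (U p q \<kappa> - U p q ?k) / (\<kappa> - ?k)) \<longlongrightarrow> R_coef k s p q) (at ?k)"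
      using dU by (simp add: has_field_derivative_iff)
    moreover have "eventually (\<lambda>\<kappa>. (U p q \<kappa> - U p q ?k) / (\<kappa> - ?k) = knop_sahi_coef \<kappa> ?d p q - U p q ?k / (\<kappa> - ?k)) (at ?k)"
    proof -
      have "eventually (\<lambda>\<kappa>. \<kappa> \<noteq> ?k) (at ?k)" by (simp add: eventually_at_filter)
      with near[OF pq] show ?thesis by eventually_elim (metis diff_divide_distrib eq_iff_diff_eq_0 nonzero_mult_div_cancel_left)
    qed
    ultimately show "((\<lambda>\<kappa>. knop_sahi_coef \<kappa> ?d p q - U p q ?k / (\<kappa> - ?k)) \<longlongrightarrow> R_coef k s p q) (at ?k)"
      by (rule Lim_transform_eventually)
  qed
qed

section \<open>Comparison of coefficients\<close>

lemma sum_inverse_descending: "(\<Sum>j<e. 1 / (of_nat (e + s) - of_nat j :: complex)) = harm (e + s) - harm s"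
proof (induction e)
  case (Suc e)
  have "(\<Sum>j<Suc e. 1 / (of_nat (Suc e + s) - of_nat j :: complex)) =
      1 / of_nat (Suc e + s) + (\<Sum>j<e. 1 / (of_nat (e + s) - of_nat j))"
    by (subst sum.lessThan_Suc_shift) simp
  then show ?case using Suc by (simp add: harm_Suc inverse_eq_divide)
qed simp

lemma deriv_ffact:
  assumes "r \<le> k + 1"
  shows "deriv (\<lambda>\<kappa>. ffact (\<kappa> + 1) r / fact r) (of_nat k :: complex) =
    ffact (of_nat k + 1) r / fact r * (harm (k + 1) - harm (k + 1 - r))"
proof -
  define c :: "nat \<Rightarrow> complex" where "c i = of_nat (k + 1) - of_nat i" for i
  have F: "ffact (\<kappa> + 1) r = (\<Prod>i<r. c i + (\<kappa> - of_nat k))" for \<kappa>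
    unfolding ffact_def by (intro prod.cong refl) (simp add: c_def)
  have "((\<lambda>\<kappa>. (\<Prod>i<r. c i + (\<kappa> - of_nat k)) / fact r) has_field_derivative
      ((\<Prod>i<r. c i) * (\<Sum>i<r. 1 / c i)) / fact r) (at (of_nat k))"
    by (intro DERIV_cdivide DERIV_prod_shift) (use assms in \<open>auto simp: c_def simp del: of_nat_add of_nat_Suc\<close>)
  moreover have "(\<Prod>i<r. c i) = ffact (of_nat k + 1) r"
    by (simp add: ffact_def c_def add.commute)
  moreover have "(\<Sum>i<r. 1 / c i) = harm (k + 1) - harm (k + 1 - r)"
    using sum_inverse_descending[of r "k + 1 - r"] assms by (simp add: c_def)
  ultimately show ?thesis unfolding F by (simp only: DERIV_imp_deriv times_divide_eq_left)
qed

lemma pole_coef_add: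
  assumes "s \<ge> 1"
  shows "pole_coef s (s + J) = (-1) ^ (s - 1) / (fact (s - 1) * fact (s + J) * fact J)"
proof -
  have "(\<Prod>i\<in>{1..s + J} - {s}. of_nat i - of_nat s :: complex) = (-1) ^ (s - 1) * fact (s - 1) * fact J"
  proof (induction J)
    case 0
    have "(\<Prod>i\<in>{1..s} - {s}. of_nat i - of_nat s :: complex) = (\<Prod>m\<in>{1..s - 1}. - of_nat m)"
      by (rule prod.reindex_bij_witness[of _ "\<lambda>m. s - m" "\<lambda>i. s - i"]) (auto simp: of_nat_diff)
    also have "\<dots> = (-1) ^ (s - 1) * fact (s - 1)"
      by (simp add: prod_uminus fact_prod)
    finally show ?case by simp
  next
    case (Suc J)
    have "{1..s + Suc J} - {s} = insert (s + Suc J) ({1..s + J} - {s})" using assms by auto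
    then show ?case using Suc by (simp add: mult_ac)
  qed
  moreover have "((-1) ^ (s - 1) :: complex) * (-1) ^ (s - 1) = 1" by (simp flip: power_add power_mult_distrib)
  ultimately show ?thesis by (simp add: pole_coef_def divide_simps)
qed

definition hres :: "nat \<Rightarrow> nat \<Rightarrow> complex" where
  "hres s n = (\<Sum>i\<in>{1..n} - {s}. 1 / (of_nat i - of_nat s))"

text \<open>Since \<open>node_diff e (e + s) (e + i)\<close> is \<open>i * (i - s)\<close>, the
  nodes from \<open>e\<close> on reproduce \<open>pole_coef\<close>. The nodes below
  \<open>e\<close> contribute only a constant factor and, by partial fractions, the harmonic numbers
  that do not depend on \<open>n\<close>.\<close>

lemma newton_coef_shift:
  assumes s: "s \<ge> 1"
  shows "newton_coef e (e + s) (e + n) = fact s / (fact e * fact (e + s)) *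
    (if n < s then pole_coef s n
     else - pole_coef s n * (harm e - harm (e + s) + harm s + hres s n - harm n + 1 / of_nat s))"
proof -
  let ?I = "{1..n} - {s}" and ?d = "node_diff e (e + s)"
  have d1: "?d j = (of_nat (e + s) - of_nat j) * (of_nat e - of_nat j)" for j
    by (simp add: node_diff_def algebra_simps)
  have d2: "?d (e + i) = of_nat i * (of_nat i - of_nat s)" for i
    by (simp add: node_diff_def algebra_simps)
  have J: "{..e + n} - {e, e + s} = {..<e} \<union> (\<lambda>i. e + i) ` ?I" "{..<e} \<inter> (\<lambda>i. e + i) ` ?I = {}"
    using s by (auto simp: image_iff) (metis atLeastAtMost_iff le_add_diff_inverse nat_add_left_cancel_le not_less_eq_eq
        One_nat_def Suc_leI diff_is_0_eq not_le_imp_less zero_less_iff_neq_zero add_0_right DiffI singletonD nat_le_linear)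
  have P: "(\<Prod>j<e. 1 / ?d j) = fact s / (fact e * fact (e + s))"
  proof -
    have "(\<Prod>j<e. ?d j) = ffact (of_nat (e + s)) e * ffact (of_nat e) e"
      by (simp add: d1 ffact_def prod.distrib)
    also have "\<dots> = fact (e + s) / fact s * fact e"
      using ffact_of_nat[of e "e + s"] ffact_of_nat[of e e] by simp
    finally show ?thesis by (simp add: prod_dividef)
  qed
  have S: "of_nat s * (\<Sum>j<e. 1 / ?d j) = harm e - harm (e + s) + harm s"
  proof -
    have "of_nat s * (1 / ?d j) = 1 / (of_nat (e + 0) - of_nat j) - 1 / (of_nat (e + s) - of_nat j)" if "j < e" for j
    proof -
      have "(of_nat (e + s) - of_nat j :: complex) \<noteq> 0" "(of_nat e - of_nat j :: complex) \<noteq> 0"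
        using that by (simp_all del: of_nat_add)
      then show ?thesis unfolding d1 by (simp add: divide_simps)
    qed
    then have "of_nat s * (\<Sum>j<e. 1 / ?d j) = (\<Sum>j<e. 1 / (of_nat (e + 0) - of_nat j) - 1 / (of_nat (e + s) - of_nat j))"
      unfolding sum_distrib_left by (intro sum.cong refl) auto
    also have "\<dots> = harm e - (harm (e + s) - harm s)"
      unfolding sum_subtractf sum_inverse_descending by (simp add: harm_def)
    finally show ?thesis by simp
  qed
  have prodJ: "(\<Prod>j\<in>{..e + n} - {e, e + s}. 1 / ?d j) = fact s / (fact e * fact (e + s)) * (\<Prod>i\<in>?I. 1 / (of_nat i * (of_nat i - of_nat s)))"
    unfolding J(1) by (subst prod.union_disjoint) (use J(2) in \<open>auto simp: P prod.reindex d2\<close>)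
  have sumJ: "(\<Sum>j\<in>{..e + n} - {e, e + s}. 1 / ?d j) = (\<Sum>j<e. 1 / ?d j) + (\<Sum>i\<in>?I. 1 / (of_nat i * (of_nat i - of_nat s)))"
    unfolding J(1) by (subst sum.union_disjoint) (use J(2) in \<open>auto simp: sum.reindex d2\<close>)
  have fact_n: "(fact n :: complex) = (\<Prod>i\<in>{1..n}. of_nat i)" by (simp add: fact_prod)
  show ?thesis
  proof (cases "n < s")
    case True
    then have I: "?I = {1..n}" by auto
    have "(\<Prod>i\<in>?I. 1 / (of_nat i * (of_nat i - of_nat s))) = pole_coef s n"
      unfolding pole_coef_def I fact_n by (simp add: prod_dividef prod.distrib)
    then show ?thesis using True by (simp add: newton_coef_def prodJ)
  next
    case False
    then have f: "(fact n :: complex) = of_nat s * (\<Prod>i\<in>?I. of_nat i)"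
      unfolding fact_n using s by (subst prod.remove[of _ s]) auto
    have s0: "(of_nat s :: complex) \<noteq> 0" using s by simp
    have "(\<Prod>i\<in>?I. 1 / (of_nat i * (of_nat i - of_nat s))) = of_nat s * pole_coef s n"
      unfolding pole_coef_def f using s0 by (simp add: prod_dividef prod.distrib)
    moreover have "of_nat s * (\<Sum>i\<in>?I. 1 / (of_nat i * (of_nat i - of_nat s))) = hres s n - harm n + 1 / of_nat s"
    proof -
      have "of_nat s * (1 / (of_nat i * (of_nat i - of_nat s))) = 1 / (of_nat i - of_nat s) - 1 / (of_nat i :: complex)" if "i \<in> ?I" for i
        using that by (simp add: divide_simps)
      then have "of_nat s * (\<Sum>i\<in>?I. 1 / (of_nat i * (of_nat i - of_nat s))) = hres s n - (\<Sum>i\<in>?I. 1 / of_nat i)"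
        unfolding sum_distrib_left hres_def sum_subtractf[symmetric] by (intro sum.cong refl) auto
      moreover have "harm n = 1 / of_nat s + (\<Sum>i\<in>?I. 1 / of_nat i :: complex)"
        unfolding harm_def inverse_eq_divide using False s by (subst sum.remove[of _ s]) auto
      ultimately show ?thesis by simp
    qed
    moreover have "p * x * - (u + v) = p * (- y * (A + h - b + c))"
      if "x = of_nat s * y" "of_nat s * v = h - b + c" "of_nat s * u = A" for p x y u v A h b c :: complex
    proof -
      have "p * x * - (u + v) = - (p * y) * (of_nat s * u + of_nat s * v)" unfolding that(1) by (simp add: algebra_simps)
      then show ?thesis unfolding that(2,3) by (simp add: algebra_simps)
    qed
    ultimately have "fact s / (fact e * fact (e + s)) * (\<Prod>i\<in>?I. 1 / (of_nat i * (of_nat i - of_nat s))) *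
        - ((\<Sum>j<e. 1 / ?d j) + (\<Sum>i\<in>?I. 1 / (of_nat i * (of_nat i - of_nat s)))) =
        fact s / (fact e * fact (e + s)) * (- pole_coef s n * (harm e - harm (e + s) + harm s + hres s n - harm n + 1 / of_nat s))"
      using S by blast
    moreover have "newton_coef e (e + s) (e + n) = fact s / (fact e * fact (e + s)) * (\<Prod>i\<in>?I. 1 / (of_nat i * (of_nat i - of_nat s))) *
        - ((\<Sum>j<e. 1 / ?d j) + (\<Sum>i\<in>?I. 1 / (of_nat i * (of_nat i - of_nat s))))"
      using False unfolding newton_coef_def prodJ sumJ by simp
    ultimately show ?thesis using False by (simp only: if_False)
  qed
qed

lemma vandermonde_factorial:
  "(\<Sum>n\<le>min i j. 1 / (fact (i - n) * fact (j - n) * fact n * fact (s + n))) =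
    (fact (s + i + j) / (fact i * fact j * fact (s + i) * fact (s + j)) :: complex)" (is ?V)
  "(\<Sum>n\<le>min i j. 1 / (fact (i - n) * fact (j - n) * fact n * fact (s + n)) * harm (s + n)) =
    (fact (s + i + j) / (fact i * fact j * fact (s + i) * fact (s + j)) * (harm (s + i) + harm (s + j) - harm (s + i + j)) :: complex)" (is ?H)
proof -
  define C :: complex where "C = 1 / (fact i * fact j * fact s)"
  define T :: "nat \<Rightarrow> complex" where "T n = ffact (of_nat i) n * ffact (of_nat j) n / (fact n * pochhammer (of_nat s + 1) n)" for n
  have t: "1 / (fact (i - n) * fact (j - n) * fact n * fact (s + n)) = C * T n" if "n \<le> min i j" for n
  proof -
    have "1 / (fact (i - n) * fact (j - n) * fact n * fact (s + n)) = 1 / fact (i - n) * (1 / fact (j - n)) / (fact n * fact (s + n) :: complex)"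
      by simp
    also have "\<dots> = C * T n"
      using that by (simp only: inverse_fact_ffact min.bounded_iff) (simp add: C_def T_def fact_add_pochhammer mult_ac)
    finally show ?thesis .
  qed
  have z: "T n = 0" if "n > i" for n using that by (simp add: T_def ffact_of_nat_eq_0)
  have R: "C * (pochhammer (of_nat s + 1 + of_nat i) j / pochhammer (of_nat s + 1) j) = fact (s + i + j) / (fact i * fact j * fact (s + i) * fact (s + j))"
    using fact_add_pochhammer[of "s + i" j] fact_add_pochhammer[of s j] by (simp add: C_def add_ac)
  have "(\<Sum>n\<le>min i j. 1 / (fact (i - n) * fact (j - n) * fact n * fact (s + n))) = (\<Sum>n\<le>min i j. C * T n)"
    by (intro sum.cong refl t) auto
  also have "\<dots> = (\<Sum>n\<le>j. C * T n)" by (rule sum.mono_neutral_left) (auto intro: z)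
  also have "\<dots> = C * (pochhammer (of_nat s + 1 + of_nat i) j / pochhammer (of_nat s + 1) j)"
    unfolding T_def sum_distrib_left[symmetric] by (simp only: chu_vandermonde[OF of_nat_Suc_plus_nz(1)])
  finally show ?V unfolding R .
  have "(\<Sum>n\<le>min i j. 1 / (fact (i - n) * fact (j - n) * fact n * fact (s + n)) * harm (s + n)) = (\<Sum>n\<le>min i j. C * (T n * harm (s + n)))"
    by (intro sum.cong refl) (simp add: t)
  also have "\<dots> = (\<Sum>n\<le>j. C * (T n * harm (s + n)))" by (rule sum.mono_neutral_left) (auto intro: z)
  also have "\<dots> = C * (pochhammer (of_nat s + 1 + of_nat i) j / pochhammer (of_nat s + 1) j) * (harm (s + i) + harm (s + j) - harm (s + i + j))"
    unfolding sum_distrib_left[symmetric] T_def harm_vandermonde by (simp only: mult.assoc)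
  finally show ?H unfolding R .
qed

lemma knop_sahi_coef_factorial:
  assumes "d + s = k + 1" "i + j \<le> d"
  shows "knop_sahi_coef (of_nat k) d i j = fact d * fact (k + 1) * fact s / (fact i * fact j * fact (d - i - j) * fact (s + i) * fact (s + j))"
proof -
  have f: "ffact (of_nat k + 1 :: complex) m = fact (k + 1) / fact (k + 1 - m)" if "m \<le> k + 1" for m
    using ffact_of_nat[OF that] by (simp add: add.commute)
  have "k + 1 - (d - i) = s + i" "k + 1 - (d - j) = s + j" "k + 1 - d = s" using assms by auto
  then show ?thesis unfolding knop_sahi_coef_def using assms by (simp add: f divide_simps del: fact_Suc)
qed

text \<open>With \<mu> written as \<open>(t + n, n)\<close> the product becomes, up to a factor
  independent of \<open>t\<close> and \<open>n\<close>, a summand of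
  \<open>double_sum\<close>.\<close>

lemma M_coeff_knop_sahi_coef:
  assumes "s \<ge> 1" "k + 1 = i + j + r + s" "t \<le> r" "n \<le> i" "n \<le> j" "t + n > 0"
  shows "M_coeff k (e + (k + 1), e + s) (t + n, n) * knop_sahi_coef (of_nat k) (i + j + r - (t + n) - n) (i - n) (j - n) =
    (-1) ^ (s - 1) * fact (k + 1) / fact (s - 1) *
    ((-1) ^ t * fact (t + n - 1) * fact (s - 1 + t + n) * (of_nat s + of_nat t + 2 * of_nat n) /
      (fact n * fact t * fact (s + n) * fact (i - n) * fact (j - n) * fact (r - t) * fact (s + t + n + i) * fact (s + t + n + j)))"
proof -
  define D where "D = i + j + r - (t + n) - n"
  have a: "e + s + k - (e + (k + 1)) = s - 1" "k - (s - 1) - (t + n) - n = D"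
    "s - 1 + n + 1 = s + n" "s - 1 + (t + n) = s - 1 + t + n" using assms by (auto simp: D_def)
  have kc: "knop_sahi_coef (of_nat k) D (i - n) (j - n) = fact D * fact (k + 1) * fact (s + t + 2 * n) /
      (fact (i - n) * fact (j - n) * fact (r - t) * fact (s + t + n + i) * fact (s + t + n + j))"
  proof -
    have "D - (i - n) - (j - n) = r - t" "s + t + 2 * n + (i - n) = s + t + n + i" "s + t + 2 * n + (j - n) = s + t + n + j"
      using assms by (auto simp: D_def)
    note e = this
    have "D + (s + t + 2 * n) = k + 1" "i - n + (j - n) \<le> D" using assms by (auto simp: D_def)
    from knop_sahi_coef_factorial[OF this] show ?thesis unfolding e .
  qed
  have f1: "(fact (s + t + 2 * n) :: complex) = (of_nat s + of_nat t + 2 * of_nat n) * fact (s - 1 + t + n + n)"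
  proof -
    obtain s' where s': "s = Suc s'" using assms(1) by (cases s) auto
    have eq: "s + t + 2 * n = Suc (s - 1 + t + n + n)" using s' by simp
    have "(of_nat (Suc (s - 1 + t + n + n)) :: complex) = of_nat s + of_nat t + 2 * of_nat n" using s' by simp
    then show ?thesis unfolding eq fact_Suc by (simp only: mult_ac)
  qed
  have f2: "(of_nat (t + n choose n) :: complex) = of_nat (t + n) * fact (t + n - 1) / (fact n * fact t)"
    using assms(6) by (simp add: binomial_fact fact_reduce[of "t + n"])
  have sg: "((-1) ^ (s - 1 + t + n + n) :: complex) = (-1) ^ (s - 1) * (-1) ^ t"
  proof -
    have "s - 1 + t + n + n = (s - 1) + t + 2 * n" by simp
    then show ?thesis by (simp only: power_add power_mult power2_minus) simp
  qed
  have M: "M_coeff k (e + (k + 1), e + s) (t + n, n) = (-1) ^ (s - 1) * (-1) ^ t * of_nat (t + n choose n) * fact (s - 1 + t + n)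
      / (fact D * fact (s - 1) * fact (s + n) * fact (s - 1 + t + n + n) * of_nat (t + n))"
  proof -
    have "t + n + n > 0" using assms(6) by simp
    then show ?thesis unfolding M_coeff_def prod.case Let_def a sg by (simp only: if_True a sg)
  qed
  have tn: "(of_nat (t + n) :: complex) \<noteq> 0" using assms(6) by (simp del: of_nat_add)
  show ?thesis
    unfolding D_def[symmetric] M kc f1 f2 using tn assms(6) by (auto simp: divide_simps simp del: of_nat_add fact_Suc)
qed

text \<open>The coefficient at \<open>(0, 0)\<close> is the only one in which \<open>e\<close>
  occurs: the sum in \<open>M_coeff\<close> runs from \<open>e + 1\<close> to \<open>e + s\<close>.
  It has to match the harmonic numbers that the nodes below \<open>e\<close> leave in
  \<open>newton_coef_shift\<close>.\<close>

lemma M_coeff_zero_knop_sahi_coef: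
  assumes "s \<ge> 1" "k + 1 = D + s" "i + j \<le> D"
  shows "M_coeff k (e + (k + 1), e + s) (0, 0) * knop_sahi_coef (of_nat k) D i j =
    (-1) ^ (s - 1) / fact (s - 1) * (fact (k + 1) / (fact i * fact j * fact (D - i - j) * fact (s + i) * fact (s + j))) *
    (harm (e + s) - harm e - 1 / of_nat s)"
proof -
  have a: "e + s + k - (e + (k + 1)) = s - 1" "k - (s - 1) = D" "s - 1 + 1 = s" "e + (k + 1) - k = e + 1" "e + (k + 1) + (s - 1) - k = e + s"
    using assms by auto
  have h: "(\<Sum>j = e + 1..e + s. of_nat s / of_nat j) = of_nat s * (harm (e + s) - harm e :: complex)"
  proof -
    have "(\<Sum>j = e + 1..e + s. 1 / of_nat j) = (\<Sum>i<s. 1 / (of_nat e + 1 + of_nat i :: complex))"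
      by (rule sum.reindex_bij_witness[of _ "\<lambda>i. e + 1 + i" "\<lambda>j. j - (e + 1)"]) (auto simp: of_nat_diff)
    then have "(\<Sum>j = e + 1..e + s. 1 / of_nat j) = (harm (e + s) - harm e :: complex)" by (simp add: harm_add)
    moreover have "(\<Sum>j = e + 1..e + s. of_nat s / of_nat j) = (of_nat s * (\<Sum>j = e + 1..e + s. 1 / of_nat j) :: complex)"
      unfolding sum_distrib_left by (intro sum.cong refl) simp
    ultimately show ?thesis by (simp only:)
  qed
  have M: "M_coeff k (e + (k + 1), e + s) (0, 0) = (-1) ^ s / (fact D * (fact s)\<^sup>2) * (1 - of_nat s * (harm (e + s) - harm e))"
    unfolding M_coeff_def prod.case Let_def a h by simp
  obtain s' where s': "s = Suc s'" using assms(1) by (cases s) auto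
  define P where "P = (fact (k + 1) / (fact i * fact j * fact (D - i - j) * fact (s + i) * fact (s + j)) :: complex)"
  have "knop_sahi_coef (of_nat k) D i j = fact D * fact s * P"
    using knop_sahi_coef_factorial[of D s k i j] assms by (simp add: P_def del: fact_Suc)
  then have "M_coeff k (e + (k + 1), e + s) (0, 0) * knop_sahi_coef (of_nat k) D i j = (-1) ^ s / fact s * P * (1 - of_nat s * (harm (e + s) - harm e))"
    unfolding M by (simp add: power2_eq_square)
  also have "(-1) ^ s / fact s = (- ((-1) ^ (s - 1) / fact (s - 1)) / of_nat s :: complex)"
    by (simp add: s' divide_simps)
  also have "\<dots> * P * (1 - of_nat s * (harm (e + s) - harm e)) = (-1) ^ (s - 1) / fact (s - 1) * P * (harm (e + s) - harm e - 1 / of_nat s)"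
    using assms(1) by (simp add: divide_simps) (simp add: algebra_simps)
  finally show ?thesis unfolding P_def .
qed

lemma sum_split_double_indicator:
  fixes f :: "nat \<Rightarrow> nat \<Rightarrow> complex"
  shows "(\<Sum>t\<le>r. \<Sum>n\<le>m. f t n) = f 0 0 + (\<Sum>t\<le>r. \<Sum>n\<le>m. if t = 0 \<and> n = 0 then 0 else f t n)"
proof -
  have "(\<Sum>t\<le>r. \<Sum>n\<le>m. f t n) = (\<Sum>t\<le>r. \<Sum>n\<le>m. (if t = 0 \<and> n = 0 then f 0 0 else 0) + (if t = 0 \<and> n = 0 then 0 else f t n))"
    by (intro sum.cong refl) auto
  also have "\<dots> = (\<Sum>t\<le>r. \<Sum>n\<le>m. if t = 0 \<and> n = 0 then f 0 0 else 0) + (\<Sum>t\<le>r. \<Sum>n\<le>m. if t = 0 \<and> n = 0 then 0 else f t n)"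
    by (simp add: sum.distrib)
  also have "(\<Sum>t\<le>r. \<Sum>n\<le>m. if t = 0 \<and> n = 0 then f 0 0 else 0) = (\<Sum>t\<le>r. if t = 0 then f 0 0 else 0)"
    by (intro sum.cong refl) auto
  also have "\<dots> = f 0 0" by simp
  finally show ?thesis .
qed

text \<open>The heart of the matter: harmonic numbers in the Newton coefficient (from the double node) and in
  the finite part (from the derivative of the binomial in \<open>\<kappa>\<close>) differ by sums that \<open>double_sum\<close>
  expresses through the numbers \<open>M_coeff\<close>.\<close>

lemma coefficient_identity:
  assumes s: "s \<ge> 1" and k: "k + 1 = i + j + r + s"
  defines "\<beta> \<equiv> ffact (of_nat k + 1) r / fact r :: complex"
  shows "\<beta> * (\<Sum>n\<le>min (s + i) (s + j). newton_coef e (e + s) (e + n) / (fact (s + i - n) * fact (s + j - n))) =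
    fact s / (fact e * fact (e + s)) * (1 / fact (k + 1 + s) * R_coef k s (s + i) (s + j) +
      (\<Sum>t\<le>r. \<Sum>n\<le>min i j. M_coeff k (e + (k + 1), e + s) (t + n, n) * knop_sahi_coef (of_nat k) (i + j + r - (t + n) - n) (i - n) (j - n)))"
proof -
  define P0 :: complex where "P0 = fact s / (fact e * fact (e + s))"
  define C :: complex where "C = harm (e + s) - harm e - harm s - 1 / of_nat s"
  define \<beta>' where "\<beta>' = deriv (\<lambda>\<kappa>. ffact (\<kappa> + 1) r / fact r) (of_nat k :: complex)"
  define \<sigma> :: complex where "\<sigma> = (-1) ^ (s - 1) / fact (s - 1)"
  define Y :: complex where "Y = fact (k + 1) / (fact i * fact j * fact r * fact (s + i) * fact (s + j))"
  define V :: complex where "V = fact (s + i + j) / (fact i * fact j * fact (s + i) * fact (s + j))"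
  let ?X = "\<lambda>n. fact (s + i - n) * fact (s + j - n) :: complex"
  have r: "k + 1 + s - (s + i) - (s + j) = r" using k by simp
  have b': "\<beta>' = \<beta> * (harm (k + 1) - harm (s + i + j))"
  proof -
    have "k + 1 - r = s + i + j" using k by simp
    then show ?thesis unfolding \<beta>'_def \<beta>_def using deriv_ffact[of r k] k by simp
  qed
  have bV: "\<beta> * V = Y"
  proof -
    have "ffact (of_nat k + 1) r = (fact (k + 1) / fact (s + i + j) :: complex)"
    proof -
      have "k + 1 - r = s + i + j" using k by simp
      moreover have "r \<le> k + 1" using k by simp
      ultimately show ?thesis using ffact_of_nat[of r "k + 1"] by (simp add: add.commute del: fact_Suc)
    qed
    then show ?thesis by (simp add: \<beta>_def V_def Y_def del: fact_Suc)
  qed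
  have R: "1 / fact (k + 1 + s) * R_coef k s (s + i) (s + j) =
      (\<Sum>n\<le>min (s + i) (s + j). (if n < s then \<beta> else \<beta>' - \<beta> * hres s n) * pole_coef s n / ?X n)"
    unfolding R_coef_def Let_def r \<beta>_def[symmetric] \<beta>'_def[symmetric] hres_def by (simp del: fact_Suc)
  \<comment> \<open>The terms with \<open>n < s\<close> agree on both sides. From
    \<open>n = s\<close> on, \<open>hres\<close> cancels, and \<open>harm n\<close>, the constant
    \<open>C\<close> and the derivative \<open>\<beta>'\<close> remain.\<close>
  have "\<beta> * (\<Sum>n\<le>min (s + i) (s + j). newton_coef e (e + s) (e + n) / ?X n) - P0 * (1 / fact (k + 1 + s) * R_coef k s (s + i) (s + j)) =
      (\<Sum>n\<le>min (s + i) (s + j). if n < s then 0 else P0 * (pole_coef s n * (\<beta> * (harm n + C) - \<beta>') / ?X n))"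
    unfolding R sum_distrib_left sum_subtractf[symmetric]
  proof (intro sum.cong refl)
    fix n
    have "\<beta> * (P0 * v / x) - P0 * (\<beta> * v / x) = 0" for v x by simp
    moreover have "\<beta> * (P0 * (- v * (harm e - harm (e + s) + harm s + h - harm n + 1 / of_nat s)) / x) - P0 * ((\<beta>' - \<beta> * h) * v / x) =
        P0 * (v * (\<beta> * (harm n + C) - \<beta>') / x)" for v x h
      by (simp add: C_def algebra_simps diff_divide_distrib add_divide_distrib)
    ultimately show "\<beta> * (newton_coef e (e + s) (e + n) / ?X n) - P0 * ((if n < s then \<beta> else \<beta>' - \<beta> * hres s n) * pole_coef s n / ?X n) =
        (if n < s then 0 else P0 * (pole_coef s n * (\<beta> * (harm n + C) - \<beta>') / ?X n))"
      unfolding newton_coef_shift[OF s] P0_def[symmetric] by (cases "n < s") (simp_all only: if_True if_False)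
  qed
  also have "\<dots> = (\<Sum>n\<in>{s..min (s + i) (s + j)}. P0 * (pole_coef s n * (\<beta> * (harm n + C) - \<beta>') / ?X n))"
    by (rule sum.mono_neutral_cong_right) auto
  also have "\<dots> = (\<Sum>J\<le>min i j. P0 * (pole_coef s (s + J) * (\<beta> * (harm (s + J) + C) - \<beta>') / (fact (i - J) * fact (j - J))))"
    by (rule sum.reindex_bij_witness[of _ "\<lambda>J. s + J" "\<lambda>n. n - s"]) (auto simp: add_ac)
  also have "\<dots> = (\<Sum>J\<le>min i j. P0 * \<sigma> * (\<beta> * (1 / (fact (i - J) * fact (j - J) * fact J * fact (s + J)) * harm (s + J)) +
      (\<beta> * C - \<beta>') * (1 / (fact (i - J) * fact (j - J) * fact J * fact (s + J)))))"
  proof (intro sum.cong refl)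
    fix J
    show "P0 * (pole_coef s (s + J) * (\<beta> * (harm (s + J) + C) - \<beta>') / (fact (i - J) * fact (j - J))) =
        P0 * \<sigma> * (\<beta> * (1 / (fact (i - J) * fact (j - J) * fact J * fact (s + J)) * harm (s + J)) +
        (\<beta> * C - \<beta>') * (1 / (fact (i - J) * fact (j - J) * fact J * fact (s + J))))"
      unfolding pole_coef_add[OF s] \<sigma>_def by (simp add: divide_simps) (simp add: algebra_simps)
  qed
  also have "\<dots> = P0 * \<sigma> * (\<beta> * (V * (harm (s + i) + harm (s + j) - harm (s + i + j))) + (\<beta> * C - \<beta>') * V)"
    unfolding sum_distrib_left[symmetric] sum.distrib vandermonde_factorial V_def ..
  also have "\<dots> = P0 * (\<sigma> * (\<beta> * V) * (harm (s + i) + harm (s + j) - harm (k + 1) + C))"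
    unfolding b' by (simp add: algebra_simps)
  also have "\<dots> = P0 * (\<sigma> * Y * (harm (s + i) + harm (s + j) - harm (k + 1) + C))"
    unfolding bV ..
  also have "\<sigma> * Y * (harm (s + i) + harm (s + j) - harm (k + 1) + C) =
      (\<Sum>t\<le>r. \<Sum>n\<le>min i j. M_coeff k (e + (k + 1), e + s) (t + n, n) * knop_sahi_coef (of_nat k) (i + j + r - (t + n) - n) (i - n) (j - n))"
  proof -
    define f where "f t n = M_coeff k (e + (k + 1), e + s) (t + n, n) * knop_sahi_coef (of_nat k) (i + j + r - (t + n) - n) (i - n) (j - n)" for t n
    have f0: "f 0 0 = \<sigma> * Y * (harm (e + s) - harm e - 1 / of_nat s)"
    proof -
      have le: "i + j \<le> i + j + r" and D: "i + j + r - i - j = r" by simp_all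
      show ?thesis using M_coeff_zero_knop_sahi_coef[OF s k le, of e] unfolding D by (simp add: f_def \<sigma>_def Y_def mult_ac del: fact_Suc)
    qed
    have "(\<Sum>t\<le>r. \<Sum>n\<le>min i j. if t = 0 \<and> n = 0 then 0 else f t n) =
        \<sigma> * fact (k + 1) * (\<Sum>t\<le>r. \<Sum>n\<le>min i j. if t = 0 \<and> n = 0 then 0 else
      (-1) ^ t * fact (t + n - 1) * fact (s - 1 + t + n) * (of_nat s + of_nat t + 2 * of_nat n) /
      (fact n * fact t * fact (s + n) * fact (i - n) * fact (j - n) * fact (r - t) * fact (s + t + n + i) * fact (s + t + n + j)))"
      unfolding sum_distrib_left
    proof (intro sum.cong refl)
      fix t n assume tn: "t \<in> {..r}" "n \<in> {..min i j}"
      show "(if t = 0 \<and> n = 0 then 0 else f t n) = \<sigma> * fact (k + 1) * (if t = 0 \<and> n = 0 then 0 else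
        (-1) ^ t * fact (t + n - 1) * fact (s - 1 + t + n) * (of_nat s + of_nat t + 2 * of_nat n) /
        (fact n * fact t * fact (s + n) * fact (i - n) * fact (j - n) * fact (r - t) * fact (s + t + n + i) * fact (s + t + n + j)))"
      proof (cases "t = 0 \<and> n = 0")
        case False
        have "f t n = (-1) ^ (s - 1) * fact (k + 1) / fact (s - 1) *
          ((-1) ^ t * fact (t + n - 1) * fact (s - 1 + t + n) * (of_nat s + of_nat t + 2 * of_nat n) /
          (fact n * fact t * fact (s + n) * fact (i - n) * fact (j - n) * fact (r - t) * fact (s + t + n + i) * fact (s + t + n + j)))"
          unfolding f_def by (rule M_coeff_knop_sahi_coef) (use s k tn False in auto)
        then show ?thesis unfolding if_not_P[OF False] \<sigma>_def by (simp only: times_divide_eq_left)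
      qed simp
    qed
    also have "\<dots> = \<sigma> * Y * (harm (s + i) + harm (s + j) - harm (k + 1) - harm s)"
    proof -
      have k': "s + i + j + r = k + 1" using k by simp
      have s': "0 < s" using s by simp
      show ?thesis unfolding double_sum[OF s'] k' by (simp add: Y_def mult_ac del: fact_Suc)
    qed
    finally have "(\<Sum>t\<le>r. \<Sum>n\<le>min i j. f t n) = \<sigma> * Y * (harm (e + s) - harm e - 1 / of_nat s) +
        \<sigma> * Y * (harm (s + i) + harm (s + j) - harm (k + 1) - harm s)"
      unfolding sum_split_double_indicator[of f] f0 by (rule arg_cong)
    then show ?thesis unfolding f_def C_def by (simp add: algebra_simps)
  qed
  finally show ?thesis unfolding P0_def[symmetric] by (simp add: algebra_simps)
qed

section \<open>The Capelli operators\<close>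

text \<open>An expansion modulo \<open>T * T\<close>. It will be used for
  \<open>T = shift_poly\<close>, whose square is the contribution of the double node.\<close>

lemma prod_one_plus_smult:
  fixes T :: "complex poly"
  assumes "finite J"
  shows "\<exists>u. (\<Prod>j\<in>J. 1 + smult (a j) T) = 1 + smult (\<Sum>j\<in>J. a j) T + T * T * u"
  using assms
proof (induction J rule: finite_induct)
  case (insert i J)
  then obtain u where u: "(\<Prod>j\<in>J. 1 + smult (a j) T) = 1 + smult (\<Sum>j\<in>J. a j) T + T * T * u" by blast
  have eq: "(1 + smult x T) * (1 + smult y T + T * T * u) = 1 + smult (x + y) T + T * T * (u + [:x * y:] + smult x (T * u))" for x y
    by (simp add: algebra_simps smult_add_left)
  show ?case unfolding prod.insert[OF insert.hyps] sum.insert[OF insert.hyps] u eq by blast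
qed (auto intro: exI[of _ 0])

lemma prod_const_poly: "finite A \<Longrightarrow> (\<Prod>i\<in>A. [:f i:]) = [:\<Prod>i\<in>A. f i:]"
  by (induction A rule: finite_induct) (auto simp: one_pCons mult_ac)

lemma c_val_eq_cases:
  assumes "m2 \<le> m1" "l2 \<le> l1" "m1 + m2 = l1 + l2" "c_val k (m1, m2) = c_val k (l1, l2)"
  shows "(m1, m2) = (l1, l2) \<or> (m1 - m2) + (l1 - l2) = 2 * k + 2"
proof -
  define a b where "a = m1 - m2" and "b = l1 - l2"
  have "(of_nat a - of_nat b :: complex) * (of_nat (a + b) - of_nat (2 * k + 2)) = 0"
    using assms by (simp add: c_val_def a_def b_def of_nat_diff algebra_simps)
  then have "of_nat a = (of_nat b :: complex) \<or> of_nat (a + b) = (of_nat (2 * k + 2) :: complex)"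
    by (simp only: mult_eq_0_iff right_minus_eq)
  then have "a = b \<or> a + b = 2 * k + 2" unfolding of_nat_eq_iff .
  then show ?thesis using assms by (auto simp: a_def b_def)
qed

context gosp_form
begin

text \<open>A quasiregular weight is parametrized by \<open>e = \<lambda>\<^sub>1 - k - 1\<close> and \<open>s = \<ell> + 1\<close>; its dagger partner has second
  entry \<open>e\<close>, so \<open>e\<close> and \<open>e + s\<close> are the two indices with the same Casimir eigenvalue.\<close>

context
  fixes e s :: nat
  assumes s: "1 \<le> s" "s \<le> k + 1"
begin

abbreviation (input) "wt \<equiv> (e + (k + 1), e + s)"
abbreviation (input) "deg \<equiv> e + (k + 1) + (e + s)"
abbreviation (input) "other_nodes \<equiv> {..deg div 2} - {e, e + s}"

lemma cas_node_diff: "cas_node deg i = c_val k wt + 4 * node_diff e (e + s) i"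
  by (simp add: cas_node_def c_val_def node_diff_def algebra_simps)

text \<open>The variable \<open>t\<close> of \<open>newton_double\<close> as a polynomial in the
  Casimir operator; its zero is the eigenvalue of the weight.\<close>

definition shift_poly :: "complex poly" where "shift_poly = [:c_val k wt / 4, - 1 / 4:]"

lemma node_shift_poly: "[:cas_node deg i, - 1:] = smult 4 (shift_poly + [:node_diff e (e + s) i:])"
  unfolding cas_node_diff by (simp add: shift_poly_def)

text \<open>Up to a constant, the annihilating polynomial of \<open>char_poly_kill\<close> with the
  double node removed, normalized to be 1 at that node.\<close>

definition cofactor :: "complex poly" where "cofactor = (\<Prod>j\<in>other_nodes. 1 + smult (1 / node_diff e (e + s) j) shift_poly)"

lemma radial_poly_newton_coef:
  "radial_poly (newton_coef e (e + s)) deg deg = cofactor * (1 - smult (\<Sum>j\<in>other_nodes. 1 / node_diff e (e + s) j) shift_poly)"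
proof (rule poly_eq_poly_eq_iff[THEN iffD1], rule ext)
  fix x
  have "newton_coef e (e + s) j / (4 ^ j * fact (deg - 2 * j)) * ffact (of_nat deg - 2 * of_nat j) (deg - 2 * j) *
      (\<Prod>i<j. poly [:cas_node deg i, - 1:] x) = newton_coef e (e + s) j * (\<Prod>i<j. poly shift_poly x + node_diff e (e + s) i)" if "j \<le> deg div 2" for j
  proof -
    have "2 * j \<le> deg" using that by simp
    then have "of_nat deg - 2 * of_nat j = (of_nat (deg - 2 * j) :: complex)" by (simp only: of_nat_diff of_nat_mult of_nat_numeral)
    then have "ffact (of_nat deg - 2 * of_nat j) (deg - 2 * j) = (fact (deg - 2 * j) :: complex)"
      using ffact_of_nat[of "deg - 2 * j" "deg - 2 * j"] by (simp only:) simp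
    moreover have "(\<Prod>i<j. poly [:cas_node deg i, - 1:] x) = 4 ^ j * (\<Prod>i<j. poly shift_poly x + node_diff e (e + s) i)"
    proof -
      have "poly [:cas_node deg i, - 1:] x = 4 * (poly shift_poly x + node_diff e (e + s) i)" for i unfolding node_shift_poly by simp
      then show ?thesis by (simp only: prod.distrib prod_constant card_lessThan)
    qed
    ultimately show ?thesis by (simp only:) simp
  qed
  then have "poly (radial_poly (newton_coef e (e + s)) deg deg) x = (\<Sum>j\<le>deg div 2. newton_coef e (e + s) j * (\<Prod>i<j. poly shift_poly x + node_diff e (e + s) i))"
    unfolding radial_poly_def poly_sum poly_smult poly_prod by (intro sum.cong refl) simp
  also have "\<dots> = poly (cofactor * (1 - smult (\<Sum>j\<in>other_nodes. 1 / node_diff e (e + s) j) shift_poly)) x"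
    using s by (subst newton_double) (simp_all add: cofactor_def poly_prod mult.commute)
  finally show "poly (radial_poly (newton_coef e (e + s)) deg deg) x = poly (cofactor * (1 - smult (\<Sum>j\<in>other_nodes. 1 / node_diff e (e + s) j) shift_poly)) x" .
qed

lemma poly_act_shift_square:
  assumes "p \<in> Pol deg"
  shows "poly_act cas (shift_poly * shift_poly * cofactor) p = 0"
proof -
  define D where "D = (\<Prod>j\<in>other_nodes. 4 * node_diff e (e + s) j)"
  have D0: "D \<noteq> 0" by (auto simp: D_def node_diff_nz)
  have "(\<Prod>i<Suc (deg div 2). [:cas_node deg i, -1:]) = (\<Prod>i\<in>{..deg div 2}. smult 4 (shift_poly + [:node_diff e (e + s) i:]))"
    unfolding node_shift_poly lessThan_Suc_atMost ..
  \<comment> \<open>Both nodes are in range, because \<open>s \<le> k + 1\<close> gives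
    \<open>2 * (e + s) \<le> deg\<close>.\<close>
  also have "{..deg div 2} = insert e (insert (e + s) other_nodes)" using s by auto
  also have "(\<Prod>i\<in>insert e (insert (e + s) other_nodes). smult 4 (shift_poly + [:node_diff e (e + s) i:])) =
      smult 16 (shift_poly * shift_poly) * (\<Prod>i\<in>other_nodes. smult 4 (shift_poly + [:node_diff e (e + s) i:]))"
  proof -
    have "node_diff e (e + s) e = 0" "node_diff e (e + s) (e + s) = 0" by (simp_all add: node_diff_def)
    then show ?thesis using s by (simp add: mult.assoc)
  qed
  also have "(\<Prod>i\<in>other_nodes. smult 4 (shift_poly + [:node_diff e (e + s) i:])) = (\<Prod>i\<in>other_nodes. [:4 * node_diff e (e + s) i:] * (1 + smult (1 / node_diff e (e + s) i) shift_poly))"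
    by (intro prod.cong refl) (auto simp: node_diff_nz smult_add_right)
  also have "\<dots> = smult D cofactor"
  proof -
    have "(\<Prod>i\<in>other_nodes. [:4 * node_diff e (e + s) i:]) = [:D:]" unfolding D_def by (rule prod_const_poly) simp
    then show ?thesis unfolding prod.distrib cofactor_def[symmetric] by simp
  qed
  finally have eq: "(\<Prod>i<Suc (deg div 2). [:cas_node deg i, -1:]) = smult (16 * D) (shift_poly * shift_poly * cofactor)"
    by (simp only: mult_smult_left mult_smult_right smult_smult mult.commute[of D])
  show ?thesis using char_poly_kill[OF assms] D0 unfolding eq poly_act_smult by simp
qed

text \<open>The radial polynomial is 1 modulo \<open>shift_poly * shift_poly\<close> and divisible
  by \<open>cofactor\<close>, while the product of these two annihilates degree \<open>deg\<close>.
  On the module of the weight \<open>cofactor\<close> is invertible, which leaves the identity; on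
  every other module \<open>shift_poly\<close> is invertible, which leaves 0. Both invertibility
  arguments are \<open>gen_eigen_kill\<close>.\<close>

lemma capelli_eq_radial_op: "capelli k \<omega> wt = radial_op (newton_coef e (e + s)) deg"
proof -
  define S where "S = (\<Sum>j\<in>other_nodes. 1 / node_diff e (e + s) j)"
  have D: "radial_op (newton_coef e (e + s)) deg p = poly_act cas (cofactor * (1 - smult S shift_poly)) p" if "p \<in> Pol deg" for p
    unfolding radial_op_poly_act[OF that] radial_poly_newton_coef S_def ..
  have "finite other_nodes" by simp
  from prod_one_plus_smult[OF this, of "\<lambda>j. 1 / node_diff e (e + s) j" shift_poly]
  obtain u where u: "cofactor = 1 + smult S shift_poly + shift_poly * shift_poly * u" unfolding cofactor_def S_def by blast
  have "(1 + smult S shift_poly + shift_poly * shift_poly * u) * (1 - smult S shift_poly) = 1 + shift_poly * shift_poly * (u * (1 - smult S shift_poly) - [:S * S:])"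
    by (simp add: algebra_simps)
  then obtain v where v: "cofactor * (1 - smult S shift_poly) = 1 + shift_poly * shift_poly * v" unfolding u by blast
  show ?thesis
  proof (rule capelli_eqI)
    fix p assume "p \<in> V_mod k \<omega> wt"
    then obtain N where p: "p \<in> Pol deg" and N: "poly_act cas ([:- c_val k wt, 1:] ^ N) p = 0"
      by (auto simp: V_mod_eq)
    define w where "w = poly_act cas (shift_poly * shift_poly * v) p"
    have N': "poly_act cas ([:- c_val k wt, 1:] ^ N) w = 0"
      unfolding w_def poly_act_commute[OF lin_cas, of _ "shift_poly * shift_poly * v"] N lin_zero[OF lin_poly_act[OF lin_cas]] ..
    have "poly_act cas cofactor w = poly_act cas (v * (shift_poly * shift_poly * cofactor)) p"
      unfolding w_def poly_act_mult[OF lin_cas, symmetric] by (simp only: mult_ac)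
    also have "\<dots> = 0" unfolding poly_act_mult[OF lin_cas, of v] poly_act_shift_square[OF p] lin_zero[OF lin_poly_act[OF lin_cas]] ..
    finally have "poly_act cas cofactor w = 0" .
    note N' this
    moreover have "poly cofactor (c_val k wt) \<noteq> 0" by (simp add: cofactor_def poly_prod shift_poly_def)
    ultimately have "w = 0" by (rule gen_eigen_kill[OF lin_cas])
    then show "radial_op (newton_coef e (e + s)) deg p = p" unfolding D[OF p] v poly_act_add w_def by simp
  next
    fix \<mu> p assume \<mu>: "\<mu> \<in> reg_or_quasi k" "fst \<mu> + snd \<mu> = fst wt + snd wt" "\<mu> \<noteq> wt" and "p \<in> V_mod k \<omega> \<mu>"
    then obtain N where p: "p \<in> Pol deg" and N: "poly_act cas ([:- c_val k \<mu>, 1:] ^ N) p = 0"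
      by (auto simp: V_mod_eq)
    define w where "w = poly_act cas cofactor p"
    obtain m1 m2 where m: "\<mu> = (m1, m2)" by fastforce
    have c: "c_val k \<mu> \<noteq> c_val k wt"
    proof
      assume "c_val k \<mu> = c_val k wt"
      \<comment> \<open>Then \<open>m1 - m2 = k + 1 + s\<close> lies between \<open>k + 2\<close>
        and \<open>2 * k + 2\<close>, so \<mu> would be singular.\<close>
      then have "(m1 - m2) + (e + (k + 1) - (e + s)) = 2 * k + 2"
        using c_val_eq_cases[of m2 m1 "e + s" "e + (k + 1)" k] \<mu> s
        by (auto simp: m reg_or_quasi_def regular_def quasiregular_def partitions_def)
      then show False using \<mu> s
        by (auto simp: m reg_or_quasi_def regular_def quasiregular_def partitions_def)
    qed
    have "poly_act cas ([:- c_val k \<mu>, 1:] ^ N) w = 0"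
      unfolding w_def poly_act_commute[OF lin_cas, of _ cofactor] N lin_zero[OF lin_poly_act[OF lin_cas]] ..
    moreover have "poly_act cas (shift_poly * shift_poly) w = 0" unfolding w_def poly_act_mult[OF lin_cas, symmetric] by (rule poly_act_shift_square[OF p])
    moreover have "poly shift_poly (c_val k \<mu>) \<noteq> 0" using c by (simp add: shift_poly_def)
    then have "poly (shift_poly * shift_poly) (c_val k \<mu>) \<noteq> 0" by simp
    ultimately have "w = 0" by (rule gen_eigen_kill[OF lin_cas])
    then show "radial_op (newton_coef e (e + s)) deg p = 0"
      unfolding D[OF p] poly_act_mult[OF lin_cas] poly_act_commute[OF lin_cas, of cofactor] w_def by (simp only: lin_zero[OF lin_poly_act[OF lin_cas]])
  qed (auto simp: radial_op_inv radial_op_PolDiff)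
qed

end

end

text \<open>Uniqueness is a density argument: for every \<open>m2\<close> all
  \<open>m1 \<ge> m2 + 2 * k + 3\<close> give regular weights, so two candidates agree at infinitely
  many points on infinitely many lines.\<close>

lemma eigenvalue_poly_eqI:
  assumes "symmetric2 f"
    and f: "\<And>m1 m2. (m1, m2) \<in> reg_or_quasi k \<Longrightarrow>
      single_eigenvalue D (V_mod k \<omega> (m1, m2)) (eval2 f (of_nat m1 - of_nat k - 1) (of_nat m2))"
  shows "eigenvalue_poly k \<omega> D = f"
  unfolding eigenvalue_poly_def
proof (rule the_equality)
  show "symmetric2 f \<and> (\<forall>(m1, m2)\<in>reg_or_quasi k.
      single_eigenvalue D (V_mod k \<omega> (m1, m2)) (eval2 f (of_nat m1 - of_nat k - 1) (of_nat m2)))"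
    using assms by auto
next
  fix g assume g: "symmetric2 g \<and> (\<forall>(m1, m2)\<in>reg_or_quasi k.
      single_eigenvalue D (V_mod k \<omega> (m1, m2)) (eval2 g (of_nat m1 - of_nat k - 1) (of_nat m2)))"
  have eq: "eval2 g (of_nat m1 - of_nat k - 1) (of_nat m2) = eval2 f (of_nat m1 - of_nat k - 1) (of_nat m2)"
    if "(m1, m2) \<in> reg_or_quasi k" for m1 m2
    using f[OF that] g that unfolding single_eigenvalue_def by fastforce
  show "g = f"
  proof (rule poly2_eqI)
    show "infinite (range (of_nat :: nat \<Rightarrow> complex))" by (intro range_inj_infinite inj_of_nat)
  next
    fix y :: complex assume "y \<in> range of_nat"
    then obtain m2 where y: "y = of_nat m2" by blast
    have "(\<lambda>m1. of_nat m1 - of_nat k - 1) ` {m2 + 2 * k + 3..} \<subseteq> {x. eval2 g x y = eval2 f x y}"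
      by (auto simp: y reg_or_quasi_def regular_def partitions_def intro!: eq)
    moreover have "infinite ((\<lambda>m1. of_nat m1 - of_nat k - 1 :: complex) ` {m2 + 2 * k + 3..})"
      by (subst finite_image_iff) (auto simp: inj_on_def infinite_Ici)
    ultimately show "infinite {x. eval2 g x y = eval2 f x y}" using finite_subset by blast
  qed
qed

section \<open>Assembling the coefficient identities\<close>

lemma sum_triangle_shift:
  fixes g :: "nat \<Rightarrow> nat \<Rightarrow> complex"
  assumes "2 * m + D \<le> d"
  shows "(\<Sum>(p, q)\<in>triangle D. c p q * g (m + p) (m + q)) =
    (\<Sum>(A, B)\<in>triangle d. (if m \<le> A \<and> m \<le> B \<and> A + B \<le> 2 * m + D then c (A - m) (B - m) else 0) * g A B)"
proof -
  let ?S = "{(A, B). m \<le> A \<and> m \<le> B \<and> A + B \<le> 2 * m + D}"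
  have "(\<Sum>(p, q)\<in>triangle D. c p q * g (m + p) (m + q)) = (\<Sum>(A, B)\<in>?S. c (A - m) (B - m) * g A B)"
    by (rule sum.reindex_bij_witness[of _ "\<lambda>(A, B). (A - m, B - m)" "\<lambda>(p, q). (m + p, m + q)"])
       (auto simp: triangle_def)
  also have "\<dots> = (\<Sum>(A, B)\<in>triangle d. (if m \<le> A \<and> m \<le> B \<and> A + B \<le> 2 * m + D then c (A - m) (B - m) else 0) * g A B)"
    using assms by (intro sum.mono_neutral_cong_left finite_triangle) (auto simp: triangle_def split: if_splits)
  finally show ?thesis .
qed

lemma sum_newton_coef_shift:
  assumes "e \<le> A" "e \<le> B"
  shows "(\<Sum>j\<le>min A B. newton_coef e l j / (fact (A - j) * fact (B - j))) =
    (\<Sum>n\<le>min (A - e) (B - e). newton_coef e l (e + n) / (fact (A - e - n) * fact (B - e - n)))"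
proof -
  have "(\<Sum>j\<le>min A B. newton_coef e l j / (fact (A - j) * fact (B - j))) = (\<Sum>j\<in>{e..min A B}. newton_coef e l j / (fact (A - j) * fact (B - j)))"
    by (rule sum.mono_neutral_right) (auto simp: newton_coef_def)
  also have "\<dots> = (\<Sum>n\<le>min (A - e) (B - e). newton_coef e l (e + n) / (fact (A - e - n) * fact (B - e - n)))"
    using assms by (intro sum.reindex_bij_witness[of _ "\<lambda>n. e + n" "\<lambda>j. j - e"]) auto
  finally show ?thesis .
qed

lemma finite_partitions_upto [simp]: "finite (partitions_upto d)"
  by (rule finite_subset[OF _ finite_triangle[of d]]) (auto simp: partitions_upto_def triangle_def)

text \<open>The substitution \<open>(t + n, n)\<close> for \<mu>. Those \<mu> that it does not reach
  are exactly the ones for which the support condition fails.\<close>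

lemma M_sum_reindex:
  assumes D: "D = i + j + r"
  shows "(\<Sum>\<mu>\<in>partitions_upto D. M \<mu> *
      (case \<mu> of (m1, m2) \<Rightarrow> if l + m2 \<le> l + i \<and> l + m2 \<le> l + j \<and> (l + i) + (l + j) \<le> 2 * (l + m2) + (D - m1 - m2)
         then f (D - m1 - m2) (l + i - (l + m2)) (l + j - (l + m2)) else 0)) =
    (\<Sum>t\<le>r. \<Sum>n\<le>min i j. M (t + n, n) * f (i + j + r - (t + n) - n) (i - n) (j - n) :: complex)"
proof -
  have "(\<Sum>t\<le>r. \<Sum>n\<le>min i j. M (t + n, n) * f (i + j + r - (t + n) - n) (i - n) (j - n)) =
      (\<Sum>(t, n)\<in>{..r} \<times> {..min i j}. M (t + n, n) * f (i + j + r - (t + n) - n) (i - n) (j - n))"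
    by (rule sum.cartesian_product)
  also have "\<dots> = (\<Sum>\<mu>\<in>{(m1, m2). m2 \<le> m1 \<and> m1 - m2 \<le> r \<and> m2 \<le> min i j}. M \<mu> * (case \<mu> of (m1, m2) \<Rightarrow> f (D - m1 - m2) (i - m2) (j - m2)))"
    by (rule sum.reindex_bij_witness[of _ "\<lambda>(m1, m2). (m1 - m2, m2)" "\<lambda>(t, n). (t + n, n)"]) (auto simp: D)
  also have "\<dots> = (\<Sum>\<mu>\<in>partitions_upto D. M \<mu> *
      (case \<mu> of (m1, m2) \<Rightarrow> if l + m2 \<le> l + i \<and> l + m2 \<le> l + j \<and> (l + i) + (l + j) \<le> 2 * (l + m2) + (D - m1 - m2)
         then f (D - m1 - m2) (l + i - (l + m2)) (l + j - (l + m2)) else 0))"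
    by (rule sum.mono_neutral_cong_left[OF finite_partitions_upto]) (auto simp: partitions_upto_def partitions_def D split: if_splits)
  finally show ?thesis by (rule sym)
qed

text \<open>If \<open>A\<close> or \<open>B\<close> is below \<open>e\<close>, all terms vanish. If
  both reach \<open>e\<close> but not both reach \<open>e + s\<close>, only indices
  \<open>n < s\<close> occur, where Newton coefficients and \<open>R_coef\<close> agree up to the
  common factor, and the sum over \<mu> is empty of contributions. The remaining range is
  \<open>coefficient_identity\<close>.\<close>

lemma coefficient_identity_triangle:
  assumes s: "1 \<le> s" "s \<le> k + 1" and AB: "A + B \<le> e + (k + 1) + (e + s)"
  shows "((of_nat k + 1) gchoose (e + (k + 1) + (e + s) - A - B)) * (\<Sum>j\<le>min A B. newton_coef e (e + s) j / (fact (A - j) * fact (B - j))) =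
    fact s / (fact e * fact (e + s)) *
     (1 / fact (k + 1 + s) * (if e \<le> A \<and> e \<le> B \<and> A + B \<le> 2 * e + (k + 1 + s) then R_coef k s (A - e) (B - e) else 0) +
      (\<Sum>\<mu>\<in>partitions_upto (k + 1 - s). M_coeff k (e + (k + 1), e + s) \<mu> *
        (case \<mu> of (m1, m2) \<Rightarrow> if e + s + m2 \<le> A \<and> e + s + m2 \<le> B \<and> A + B \<le> 2 * (e + s + m2) + (k + 1 - s - m1 - m2)
           then knop_sahi_coef (of_nat k) (k + 1 - s - m1 - m2) (A - (e + s + m2)) (B - (e + s + m2)) else 0)))"
    (is "?\<beta> * ?N = ?P * (?R + ?M)")
proof -
  define r where "r = e + (k + 1) + (e + s) - A - B"
  have \<beta>: "?\<beta> = ffact (of_nat k + 1) r / fact r" unfolding ffact_gbinomial r_def by simp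
  have c: "A + B \<le> 2 * e + (k + 1 + s)" using AB by simp
  have M0: "?M = 0" if "\<not> (e + s \<le> A \<and> e + s \<le> B)"
    by (rule sum.neutral) (use that in auto)
  consider "\<not> (e \<le> A \<and> e \<le> B)" | "e \<le> A" "e \<le> B" "\<not> (e + s \<le> A \<and> e + s \<le> B)" | "e + s \<le> A" "e + s \<le> B" by linarith
  then show ?thesis
  proof cases
    case 1
    then have "?N = 0" by (intro sum.neutral) (auto simp: newton_coef_def)
    moreover have "?M = 0" using 1 by (intro M0) auto
    moreover have "(if e \<le> A \<and> e \<le> B \<and> A + B \<le> 2 * e + (k + 1 + s) then R_coef k s (A - e) (B - e) else 0) = 0"
      using 1 by auto
    ultimately show ?thesis by (simp only: mult_zero_right add_0_left)
  next
    case 2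
    have r: "k + 1 + s - (A - e) - (B - e) = r" using 2 AB by (simp add: r_def)
    have n: "n < s" if "n \<le> min (A - e) (B - e)" for n using 2 that by auto
    have "?\<beta> * ?N = (\<Sum>n\<le>min (A - e) (B - e). ?\<beta> * (newton_coef e (e + s) (e + n) / (fact (A - e - n) * fact (B - e - n))))"
      unfolding sum_newton_coef_shift[OF 2(1,2)] sum_distrib_left ..
    also have "\<dots> = (\<Sum>n\<le>min (A - e) (B - e). ?P * ((if n < s then ?\<beta> else deriv (\<lambda>\<kappa>. ffact (\<kappa> + 1) r / fact r) (of_nat k) -
        ?\<beta> * (\<Sum>i\<in>{1..n} - {s}. 1 / (of_nat i - of_nat s))) * pole_coef s n / (fact (A - e - n) * fact (B - e - n))))"
      by (intro sum.cong refl) (simp add: newton_coef_shift[OF s(1)] n)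
    also have "\<dots> = ?P * (1 / fact (k + 1 + s) * R_coef k s (A - e) (B - e))"
      unfolding R_coef_def Let_def r \<beta> sum_distrib_left[symmetric] by (simp del: fact_Suc)
    finally show ?thesis using 2 c M0 by simp
  next
    case 3
    define i j where "i = A - (e + s)" and "j = B - (e + s)"
    have A: "A = e + s + i" and B: "B = e + s + j" using 3 by (auto simp: i_def j_def)
    have k: "k + 1 = i + j + r + s" using AB s by (simp add: r_def A B)
    have D: "k + 1 - s = i + j + r" using k by simp
    have ae: "A - e = s + i" "B - e = s + j" by (auto simp: A B)
    have eAB: "e \<le> A" "e \<le> B" using 3 by auto
    have "?\<beta> * ?N = ?P * (1 / fact (k + 1 + s) * R_coef k s (s + i) (s + j) +
      (\<Sum>t\<le>r. \<Sum>n\<le>min i j. M_coeff k (e + (k + 1), e + s) (t + n, n) * knop_sahi_coef (of_nat k) (i + j + r - (t + n) - n) (i - n) (j - n)))"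
      unfolding \<beta> sum_newton_coef_shift[OF eAB] ae by (rule coefficient_identity[OF s(1) k])
    also have "(\<Sum>t\<le>r. \<Sum>n\<le>min i j. M_coeff k (e + (k + 1), e + s) (t + n, n) * knop_sahi_coef (of_nat k) (i + j + r - (t + n) - n) (i - n) (j - n)) = ?M"
      unfolding A B by (rule M_sum_reindex[OF D, symmetric])
    also have "1 / fact (k + 1 + s) * R_coef k s (s + i) (s + j) = ?R"
      using eAB c by (simp only: ae if_True simp_thms)
    finally show ?thesis .
  qed
qed

definition capelli_coeff :: "nat \<Rightarrow> nat \<Rightarrow> nat \<Rightarrow> nat \<Rightarrow> nat \<Rightarrow> complex" where
  "capelli_coeff k e s A B = ((of_nat k + 1) gchoose (e + (k + 1) + (e + s) - A - B)) *
     (\<Sum>j\<le>min A B. newton_coef e (e + s) j / (fact (A - j) * fact (B - j)))"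

definition capelli_poly :: "nat \<Rightarrow> nat \<Rightarrow> nat \<Rightarrow> poly2" where
  "capelli_poly k e s = (\<Sum>(A, B)\<in>triangle (e + (k + 1) + (e + s)). cmult2 (capelli_coeff k e s A B) (falling2 A B))"

lemma eval2_falling_sum:
  "eval2 (\<Sum>(i, j)\<in>S. cmult2 (c i j) (falling2 (f i) (g j))) x y = (\<Sum>(i, j)\<in>S. c i j * (ffact x (f i) * ffact y (g j)))"
  by (simp add: eval2_sum case_prod_unfold falling2_def)

lemma symmetric2_capelli_poly: "symmetric2 (capelli_poly k e s)"
proof -
  let ?d = "e + (k + 1) + (e + s)"
  have c: "capelli_coeff k e s A B = capelli_coeff k e s B A" for A B
  proof -
    have "?d - A - B = ?d - B - A" by simp
    then show ?thesis unfolding capelli_coeff_def by (simp only: min.commute[of A B] mult.commute[of "fact (A - _)"])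
  qed
  have "(\<Sum>(A, B)\<in>triangle ?d. capelli_coeff k e s A B * coeff2 (falling2 A B) i j) =
      (\<Sum>(A, B)\<in>triangle ?d. capelli_coeff k e s A B * coeff2 (falling2 A B) j i)" for i j
  proof (rule sum.reindex_bij_witness[of _ prod.swap prod.swap])
    fix a assume "a \<in> triangle ?d"
    obtain A B where a: "a = (A, B)" by fastforce
    show "(case prod.swap a of (A, B) \<Rightarrow> capelli_coeff k e s A B * coeff2 (falling2 A B) j i) =
        (case a of (A, B) \<Rightarrow> capelli_coeff k e s A B * coeff2 (falling2 A B) i j)"
      unfolding a prod.swap_def fst_conv snd_conv prod.case c[of B A] coeff2_falling2_swap[of B A] ..
  qed (auto simp: triangle_def)
  then show ?thesis unfolding symmetric2_def capelli_poly_def by (simp add: coeff2_sum case_prod_unfold)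
qed

context gosp_form
begin

lemma eigenvalue_poly_capelli:
  assumes s: "1 \<le> s" "s \<le> k + 1"
  shows "eigenvalue_poly k \<omega> (capelli k \<omega> (e + (k + 1), e + s)) = capelli_poly k e s"
  unfolding capelli_eq_radial_op[OF s]
proof (rule eigenvalue_poly_eqI[OF symmetric2_capelli_poly])
  fix m1 m2 assume "(m1, m2) \<in> reg_or_quasi k"
  then have m: "m2 \<le> m1" by (auto simp: reg_or_quasi_def regular_def quasiregular_def partitions_def)
  let ?d = "e + (k + 1) + (e + s)" and ?x = "of_nat m1 - of_nat k - 1 :: complex" and ?y = "of_nat m2 :: complex"
  have K: "of_nat m1 + of_nat m2 = ?x + ?y + (of_nat k + 1)" by simp
  have "poly (radial_poly (newton_coef e (e + s)) ?d (m1 + m2)) (c_val k (m1, m2)) = eval2 (capelli_poly k e s) ?x ?y"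
    unfolding poly_radial_poly[OF m] K capelli_poly_expansion capelli_poly_def eval2_falling_sum capelli_coeff_def ..
  then show "single_eigenvalue (radial_op (newton_coef e (e + s)) ?d) (V_mod k \<omega> (m1, m2)) (eval2 (capelli_poly k e s) ?x ?y)"
    using single_eigenvalue_radial_op[OF m, of "newton_coef e (e + s)" ?d] by (simp only:)
qed

end

text \<open>All polynomials involved are expanded over the same triangle of products of falling
  factorials, where \<open>coefficient_identity_triangle\<close> applies to each
  coefficient.\<close>

lemma capelli_poly_eq_R_poly:
  assumes s: "1 \<le> s" "s \<le> k + 1"
  shows "capelli_poly k e s = cmult2 (fact s / (fact e * fact (e + s)))
    (cmult2 (1 / fact (k + 1 + s)) (R_poly k (e + s + k + 1, e)) +
     (\<Sum>\<mu>\<in>partitions_upto (k + 1 - s). cmult2 (M_coeff k (e + (k + 1), e + s) \<mu>) (R_poly k (nu (e + (k + 1), e + s) \<mu>))))"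
proof (rule poly2_eqI[OF infinite_UNIV_char_0])
  fix y :: complex
  define D where "D = k + 1 - s"
  define d where "d = e + (k + 1) + (e + s)"
  let ?M = "M_coeff k (e + (k + 1), e + s)"
  let ?cR = "\<lambda>A B. if e \<le> A \<and> e \<le> B \<and> A + B \<le> 2 * e + (k + 1 + s) then R_coef k s (A - e) (B - e) else 0"
  let ?cM = "\<lambda>\<mu> A B. case \<mu> of (m1, m2) \<Rightarrow> if e + s + m2 \<le> A \<and> e + s + m2 \<le> B \<and> A + B \<le> 2 * (e + s + m2) + (D - m1 - m2)
           then knop_sahi_coef (of_nat k) (D - m1 - m2) (A - (e + s + m2)) (B - (e + s + m2)) else 0"
  have "eval2 (capelli_poly k e s) x y = eval2 (cmult2 (fact s / (fact e * fact (e + s)))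
    (cmult2 (1 / fact (k + 1 + s)) (R_poly k (e + s + k + 1, e)) +
     (\<Sum>\<mu>\<in>partitions_upto (k + 1 - s). cmult2 (?M \<mu>) (R_poly k (nu (e + (k + 1), e + s) \<mu>))))) x y" for x
  proof -
    let ?g = "\<lambda>A B. ffact x A * ffact y B"
    let ?P = "fact s / (fact e * fact (e + s)) :: complex"
    have R: "eval2 (R_poly k (e + s + k + 1, e)) x y = (\<Sum>(A, B)\<in>triangle d. ?cR A B * ?g A B)"
    proof -
      have diff: "e + s + k + 1 - e = k + 1 + s" and le: "2 * e + (k + 1 + s) \<le> d" by (simp_all add: d_def)
      show ?thesis
        unfolding R_poly_singular[OF s(1) diff s(2)] eval2_falling_sum diff by (rule sum_triangle_shift[OF le])
    qed
    have M: "eval2 (R_poly k (nu (e + (k + 1), e + s) \<mu>)) x y = (\<Sum>(A, B)\<in>triangle d. ?cM \<mu> A B * ?g A B)"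
      if "\<mu> \<in> partitions_upto D" for \<mu>
    proof -
      obtain m1 m2 where \<mu>: "\<mu> = (m1, m2)" by fastforce
      have m: "m2 \<le> m1" "m1 + m2 \<le> D" using that by (auto simp: \<mu> partitions_upto_def partitions_def)
      \<comment> \<open>These weights have difference at most \<open>k\<close>, so their polynomials
        have no pole and \<open>R_poly_regular\<close> applies; the pole occurs only at the dagger
        weight.\<close>
      have diff: "e + (k + 1) - m1 - (e + s + m2) = D - m1 - m2" and le: "2 * (e + s + m2) + (D - m1 - m2) \<le> d"
        and lek: "D - m1 - m2 \<le> k"
        using m s by (auto simp: d_def D_def)
      show ?thesis
        unfolding \<mu> nu_def prod.case R_poly_regular[OF lek[folded diff]] eval2_falling_sum diff
        by (rule sum_triangle_shift[OF le])
    qed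
    have "eval2 (capelli_poly k e s) x y = (\<Sum>(A, B)\<in>triangle d. capelli_coeff k e s A B * ?g A B)"
      unfolding capelli_poly_def eval2_falling_sum d_def ..
    also have "\<dots> = (\<Sum>(A, B)\<in>triangle d. ?P * (1 / fact (k + 1 + s) * (?cR A B * ?g A B) +
        (\<Sum>\<mu>\<in>partitions_upto D. ?M \<mu> * (?cM \<mu> A B * ?g A B))))"
    proof (intro sum.cong refl, clarify)
      fix A B assume "(A, B) \<in> triangle d"
      then have AB: "A + B \<le> e + (k + 1) + (e + s)" by (simp add: triangle_def d_def)
      have "P * (f * r + S) * g = P * (f * (r * g) + S * g)" for P f r S g :: complex by (simp add: algebra_simps)
      then show "capelli_coeff k e s A B * ?g A B = ?P * (1 / fact (k + 1 + s) * (?cR A B * ?g A B) +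
          (\<Sum>\<mu>\<in>partitions_upto D. ?M \<mu> * (?cM \<mu> A B * ?g A B)))"
        unfolding capelli_coeff_def coefficient_identity_triangle[OF s AB] D_def mult.assoc[symmetric, of "?M _"]
          sum_distrib_right[symmetric] .
    qed
    also have "\<dots> = ?P * (1 / fact (k + 1 + s) * (\<Sum>(A, B)\<in>triangle d. ?cR A B * ?g A B) +
        (\<Sum>\<mu>\<in>partitions_upto D. ?M \<mu> * (\<Sum>(A, B)\<in>triangle d. ?cM \<mu> A B * ?g A B)))"
      unfolding case_prod_unfold sum_distrib_left[symmetric] sum.distrib sum.swap[of _ "partitions_upto D"] ..
    also have "\<dots> = eval2 (cmult2 ?P (cmult2 (1 / fact (k + 1 + s)) (R_poly k (e + s + k + 1, e)) +
        (\<Sum>\<mu>\<in>partitions_upto D. cmult2 (?M \<mu>) (R_poly k (nu (e + (k + 1), e + s) \<mu>))))) x y"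
      unfolding eval2_simps eval2_sum R[symmetric] by (simp only: M cong: sum.cong)
    finally show ?thesis unfolding D_def .
  qed
  then show "infinite {x. eval2 (capelli_poly k e s) x y = eval2 (cmult2 (fact s / (fact e * fact (e + s)))
    (cmult2 (1 / fact (k + 1 + s)) (R_poly k (e + s + k + 1, e)) +
     (\<Sum>\<mu>\<in>partitions_upto (k + 1 - s). cmult2 (?M \<mu>) (R_poly k (nu (e + (k + 1), e + s) \<mu>))))) x y}"
    by (simp only: UNIV_def[symmetric] simp_thms infinite_UNIV_char_0)
qed

theorem theoremD:
  fixes \<omega> :: "complex ^ ('a::finite + 'b::{finite,linorder}) \<Rightarrow> complex ^ ('a + 'b) \<Rightarrow> complex"
    and m n k l1 l2 L :: nat
  assumes "CARD('a) = 2 * m" and "CARD('b) = 2 * n"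
    and "0 < m" and "0 < n" and "m \<le> n" and "k = n - m"
    and "even_form \<omega>" and "supersymmetric_form \<omega>" and "nondegenerate_form \<omega>"
    and "quasiregular k (l1, l2)"
    and "L = l2 + k - l1"
  shows "eigenvalue_poly k \<omega> (capelli k \<omega> (l1, l2)) =
    cmult2 (fact (L + 1) / (fact (l1 - k - 1) * fact (l1 + L - k)))
      (cmult2 (1 / fact (2 * k + 2 + l2 - l1)) (R_poly k (dagger k (l1, l2)))
       + (\<Sum>\<mu>\<in>partitions_upto (k - L).
            cmult2 (M_coeff k (l1, l2) \<mu>) (R_poly k (nu (l1, l2) \<mu>))))"
proof -
  interpret osp_form \<omega> by unfold_locales (use assms(7-9) in auto)
  interpret gosp_form \<omega> k
  proof
    show "CARD('a) \<ge> 2" using assms(1,3) by simp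
    show "sdim = - 2 * of_nat k" using assms(1,2,5,6) by (simp add: sdim_eq of_nat_diff)
  qed
  define e s where "e = l1 - k - 1" and "s = L + 1"
  have l: "l2 \<le> l1" "k + 1 \<le> l1" "l1 - l2 \<le> k" using assms(10) by (auto simp: quasiregular_def partitions_def)
  have l1: "l1 = e + (k + 1)" and l2: "l2 = e + s" and s: "1 \<le> s" "s \<le> k + 1"
    using l by (auto simp: e_def s_def assms(11))
  have ar: "L + 1 = s" "e + (k + 1) - k - 1 = e" "e + (k + 1) + L - k = e + s" "2 * k + 2 + (e + s) - (e + (k + 1)) = k + 1 + s"
    "k - L = k + 1 - s"
    by (auto simp: s_def)
  have dagger: "dagger k (e + (k + 1), e + s) = (e + s + k + 1, e)" by (simp add: dagger_def)
  show ?thesis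
    unfolding l1 l2 ar dagger eigenvalue_poly_capelli[OF s] by (rule capelli_poly_eq_R_poly[OF s])
qed

end
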